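(* Let $X=(X_t)_{t\ge 0}$ be an $\mathbb F$-adapted right-continuous process of finite variation with canonical representation $$X_t=F(t)\mathbf 1_{\{t<\gamma\}}+L\,\mathbf 1_{\{t\ge\gamma\}},$$ where $F$ is the $\mathcal H$-measurable pre-jump process and $L$ is an $\mathcal F_\infty$-measurable random variable, and assume $\mathsf E[|L|]<\infty$ and $\mathsf E[\sup_{t\in[0,t_G)}|F(t)|]<\infty$ (so that $X$ is a special semimartingale). Put $H(t)=\mathsf E[L\mid\mathcal H,\gamma=t]$. Then the unique predictable compensator $A$ of $X$ is given by $A_t=C(t\wedge\gamma)$, where the $\mathcal H$-measurable function $C(t)$ is computed as follows. (i) For all $t<t_G$, $$C(t)=\int_{(0,t]}\frac{d\left[F(s)\overline G_{\mathcal H}(s)\right]+H(s)\,dG_{\mathcal H}(s)}{\overline G_{\mathcal H}(s-)} .$$ (ii) If moreover $\mathsf P(\gamma=t_G)>0$, then $C(t_G)=C(t_G-)+\Delta C(t_G)$ with $$\Delta C(t_G)=H(t_G)-F(t_G-).$$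
   Context: $(\Omega,\mathcal F,\mathsf P)$ is a probability space, $\mathcal H\subset\mathcal F$ a sub-$\sigma$-algebra (initial information), and $\gamma$ a random time with values in $[0,\infty]$ such that $\mathsf P(\gamma>0)=1$. $G_{\mathcal H}(t)=\mathsf P(\gamma\le t\mid\mathcal H)$ is the regular conditional distribution function of $\gamma$ given $\mathcal H$, $\overline G_{\mathcal H}(t)=\mathsf P(\gamma>t\mid\mathcal H)=1-G_{\mathcal H}(t)$, and $t_G=\sup\{t\in\mathbb R_+:\mathsf P(\gamma\le t)<1\}$. Single jump filtration with initial information $\mathbb F=(\mathcal F_t)_{t\ge0}$: for $t<\infty$, a set $A\in\mathcal F$ belongs to $\mathcal F_t$ iff there is $C\in\mathcal H$ with $A\cap\{t<\gamma\}=C\cap\{t<\gamma\}$; $\mathcal F_\infty$ is the limit $\sigma$-algebra, generated by all the $\mathcal F_t$, $t<\infty$ (its trace on $\{\gamma=\infty\}$ coincides with the trace of $\mathcal H$). The filtration is augmented with all $\mathsf P$-null sets of $\mathcal F$ (and satisfies the usual conditions). "Finite variation" means paths of finite variation on compact intervals. The predictable compensator of a special semimartingale $X$ is the unique predictable process of finite variation $A$ with $A_0=0$ such that $X-A$ is a local martingale. "$\mathcal H$-measurable process/function" of $(t,\omega)$ means that for each $t$ its value at $t$ is $\mathcal H$-measurable (jointly, $\mathcal B(\mathbb R_+)\otimes\mathcal H$-measurable). $H(t)=\mathsf E[L\mid\mathcal H,\gamma=t]$ denotes the version of $\mathsf E[L\mid\mathcal H\vee\sigma(\gamma)]$ written as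 a function of $(\omega,t)$, $\mathcal H$-measurable in $\omega$, evaluated at $\gamma=t$. Integrals are pathwise Lebesgue–Stieltjes integrals.
   Formalization: In (i) C(t) equals the integral a.s. for all t < t_G at which it exists, and existence is claimed only for t ≤ γ; in (ii) the formula is claimed a.s. when C(t_G−) and F(t_G−) exist, and they are claimed to exist only on {γ = t_G} with t_G < ∞. *)

theory Defs
  imports "HOL-Probability.Probability"
begin

definition finite_variation_on :: "(real \<Rightarrow> real) \<Rightarrow> real \<Rightarrow> real \<Rightarrow> bool" where
  "finite_variation_on g a b \<longleftrightarrow>
     (\<exists>B. \<forall>(p :: nat \<Rightarrow> real) n. mono_on {..n} p \<longrightarrow> p ` {..n} \<subseteq> {a..b} \<longrightarrow>
        (\<Sum>i<n. \<bar>g (p (Suc i)) - g (p i)\<bar>) \<le> B)"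

text \<open>
  \<open>has_LS_integral f g a b I\<close>: the Lebesgue--Stieltjes integral of \<open>f\<close> with respect to \<open>g\<close> over
  the half-open interval \<open>(a,b]\<close> exists and equals \<open>I\<close>. On \<open>[a,b]\<close> the integrator is a difference
  of two nondecreasing right-continuous functions, i.e. it is right-continuous and of finite
  variation; the value \<open>I\<close> does not depend on the chosen decomposition.
\<close>

definition has_LS_integral ::
    "(real \<Rightarrow> real) \<Rightarrow> (real \<Rightarrow> real) \<Rightarrow> real \<Rightarrow> real \<Rightarrow> real \<Rightarrow> bool" where
  "has_LS_integral f g a b I \<longleftrightarrow>
     (\<exists>g1 g2. mono g1 \<and> mono g2 \<and>
        (\<forall>x. continuous (at_right x) g1) \<and> (\<forall>x. continuous (at_right x) g2) \<and>
        (\<forall>x\<in>{a..b}. g x = g1 x - g2 x) \<and>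
        set_integrable (interval_measure g1) {a<..b} f \<and>
        set_integrable (interval_measure g2) {a<..b} f \<and>
        I = (LINT x:{a<..b}|interval_measure g1. f x) - (LINT x:{a<..b}|interval_measure g2. f x))"

text \<open>
  A filtration is a family \<open>Ft\<close> of \<open>\<sigma>\<close>-algebras indexed by \<open>[0,\<infinity>]\<close> (type \<open>ennreal\<close>), so that
  library stopping times may take the value \<open>\<infinity>\<close>. A process is a map \<open>X :: real \<Rightarrow> 'a \<Rightarrow> real\<close> of
  which only the values \<open>X t\<close> with \<open>t \<ge> 0\<close> matter. Path properties are required almost surely.
\<close>

definition adapted_process :: "(ennreal \<Rightarrow> 'a measure) \<Rightarrow> (real \<Rightarrow> 'a \<Rightarrow> real) \<Rightarrow> bool" where
  "adapted_process Ft X \<longleftrightarrow> (\<forall>t\<ge>0. X t \<in> borel_measurable (Ft (ennreal t)))"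

definition rc_finite_variation :: "'a measure \<Rightarrow> (real \<Rightarrow> 'a \<Rightarrow> real) \<Rightarrow> bool" where
  "rc_finite_variation M X \<longleftrightarrow>
     (AE \<omega> in M. (\<forall>t\<ge>0. continuous (at_right t) (\<lambda>s. X s \<omega>)) \<and>
                  (\<forall>b\<ge>0. finite_variation_on (\<lambda>s. X s \<omega>) 0 b))"

definition cadlag :: "'a measure \<Rightarrow> (real \<Rightarrow> 'a \<Rightarrow> real) \<Rightarrow> bool" where
  "cadlag M X \<longleftrightarrow>
     (AE \<omega> in M. (\<forall>t\<ge>0. continuous (at_right t) (\<lambda>s. X s \<omega>)) \<and>
                  (\<forall>t>0. \<exists>l. ((\<lambda>s. X s \<omega>) \<longlongrightarrow> l) (at_left t)))"

definition predictable_sigma :: "(ennreal \<Rightarrow> 'a measure) \<Rightarrow> (real \<times> 'a) measure" where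
  "predictable_sigma Ft =
     sigma ({0..} \<times> space (Ft 0))
       ({{0} \<times> B |B. B \<in> sets (Ft 0)} \<union>
        {{s<..t} \<times> B |s t B. 0 \<le> s \<and> s \<le> t \<and> B \<in> sets (Ft (ennreal s))})"

definition predictable_process :: "(ennreal \<Rightarrow> 'a measure) \<Rightarrow> (real \<Rightarrow> 'a \<Rightarrow> real) \<Rightarrow> bool" where
  "predictable_process Ft X \<longleftrightarrow> (\<lambda>(t, \<omega>). X t \<omega>) \<in> borel_measurable (predictable_sigma Ft)"

definition stopped_process ::
    "('a \<Rightarrow> ennreal) \<Rightarrow> (real \<Rightarrow> 'a \<Rightarrow> real) \<Rightarrow> real \<Rightarrow> 'a \<Rightarrow> real" where
  "stopped_process T X t \<omega> = X (enn2real (min (ennreal t) (T \<omega>))) \<omega>"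

definition martingale_process ::
    "'a measure \<Rightarrow> (ennreal \<Rightarrow> 'a measure) \<Rightarrow> (real \<Rightarrow> 'a \<Rightarrow> real) \<Rightarrow> bool" where
  "martingale_process M Ft N \<longleftrightarrow>
     adapted_process Ft N \<and> (\<forall>t\<ge>0. integrable M (N t)) \<and>
     (\<forall>s t. 0 \<le> s \<longrightarrow> s \<le> t \<longrightarrow>
        (AE \<omega> in M. real_cond_exp M (Ft (ennreal s)) (N t) \<omega> = N s \<omega>))"

definition local_martingale ::
    "'a measure \<Rightarrow> (ennreal \<Rightarrow> 'a measure) \<Rightarrow> (real \<Rightarrow> 'a \<Rightarrow> real) \<Rightarrow> bool" where
  "local_martingale M Ft N \<longleftrightarrow>
     adapted_process Ft N \<and> cadlag M N \<and>
     (\<exists>T :: nat \<Rightarrow> 'a \<Rightarrow> ennreal.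
        (\<forall>n. stopping_time Ft (T n)) \<and>
        (AE \<omega> in M. incseq (\<lambda>n. T n \<omega>) \<and> (\<lambda>n. T n \<omega>) \<longlonglongrightarrow> \<infinity>) \<and>
        (\<forall>n. martingale_process M Ft (stopped_process (T n) N)))"

definition is_predictable_compensator ::
    "'a measure \<Rightarrow> (ennreal \<Rightarrow> 'a measure) \<Rightarrow> (real \<Rightarrow> 'a \<Rightarrow> real) \<Rightarrow> (real \<Rightarrow> 'a \<Rightarrow> real) \<Rightarrow> bool" where
  "is_predictable_compensator M Ft X A \<longleftrightarrow>
     predictable_process Ft A \<and> rc_finite_variation M A \<and> (AE \<omega> in M. A 0 \<omega> = 0) \<and>
     local_martingale M Ft (\<lambda>t \<omega>. X t \<omega> - A t \<omega>)"

text \<open>Throughout, \<open>Hs\<close> is the initial \<open>\<sigma>\<close>-algebra and \<open>\<gamma>\<close> the random time.\<close>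

definition single_jump_sets ::
    "'a measure \<Rightarrow> 'a measure \<Rightarrow> ('a \<Rightarrow> ennreal) \<Rightarrow> ennreal \<Rightarrow> 'a set set" where
  "single_jump_sets M Hs \<gamma> t =
     {A \<in> sets M. \<exists>C\<in>sets Hs. A \<inter> {\<omega> \<in> space M. t < \<gamma> \<omega>} = C \<inter> {\<omega> \<in> space M. t < \<gamma> \<omega>}}"

definition single_jump_filtration ::
    "'a measure \<Rightarrow> 'a measure \<Rightarrow> ('a \<Rightarrow> ennreal) \<Rightarrow> ennreal \<Rightarrow> 'a measure" where
  "single_jump_filtration M Hs \<gamma> t =
     sigma (space M)
       (if t = \<infinity> then (\<Union>s\<in>{..<\<infinity>}. single_jump_sets M Hs \<gamma> s) \<union> null_sets M
        else single_jump_sets M Hs \<gamma> t \<union> null_sets M)"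

definition join_time :: "'a measure \<Rightarrow> 'a measure \<Rightarrow> ('a \<Rightarrow> ennreal) \<Rightarrow> 'a measure" where
  "join_time M Hs \<gamma> = sigma (space M) (sets Hs \<union> sets (vimage_algebra (space M) \<gamma> borel))"

definition t_G :: "'a measure \<Rightarrow> ('a \<Rightarrow> ennreal) \<Rightarrow> ennreal" where
  "t_G M \<gamma> =
     (SUP t\<in>{t::real. 0 \<le> t \<and> measure M {\<omega> \<in> space M. \<gamma> \<omega> \<le> ennreal t} < 1}. ennreal t)"

definition regular_cond_df ::
    "'a measure \<Rightarrow> 'a measure \<Rightarrow> ('a \<Rightarrow> ennreal) \<Rightarrow> (real \<Rightarrow> 'a \<Rightarrow> real) \<Rightarrow> bool" where
  "regular_cond_df M Hs \<gamma> G \<longleftrightarrow>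
     (\<forall>\<omega>\<in>space M. mono_on {0..} (\<lambda>t. G t \<omega>) \<and>
        (\<forall>t\<ge>0. continuous (at_right t) (\<lambda>s. G s \<omega>) \<and> 0 \<le> G t \<omega> \<and> G t \<omega> \<le> 1)) \<and>
     (\<forall>t\<ge>0. G t \<in> borel_measurable Hs \<and>
        (AE \<omega> in M. G t \<omega> =
           real_cond_exp M Hs (indicator {\<omega> \<in> space M. \<gamma> \<omega> \<le> ennreal t}) \<omega>))"

text \<open>
  \<open>H\<close> is defined on \<open>[0,\<infinity>]\<close>, because \<open>\<gamma>\<close> may be infinite.
\<close>

definition is_cond_exp_given_time ::
    "'a measure \<Rightarrow> 'a measure \<Rightarrow> ('a \<Rightarrow> ennreal) \<Rightarrow> ('a \<Rightarrow> real) \<Rightarrow> (ennreal \<Rightarrow> 'a \<Rightarrow> real) \<Rightarrow> bool" where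
  "is_cond_exp_given_time M Hs \<gamma> L H \<longleftrightarrow>
     (\<lambda>(t, \<omega>). H t \<omega>) \<in> borel_measurable (borel \<Otimes>\<^sub>M Hs) \<and>
     (AE \<omega> in M. H (\<gamma> \<omega>) \<omega> = real_cond_exp M (join_time M Hs \<gamma>) L \<omega>)"

definition left_survival :: "(real \<Rightarrow> 'a \<Rightarrow> real) \<Rightarrow> real \<Rightarrow> 'a \<Rightarrow> real" where
  "left_survival G s \<omega> = Lim (at_left s) (\<lambda>u. 1 - G u \<omega>)"

text \<open>
  \<open>has_compensator_integral G F H \<omega> t c\<close>: for the given \<open>\<omega>\<close>, the integral over \<open>(0,t]\<close> of
  \<open>(d[F(s)(1 - G(s))] + H(s) dG(s)) / (1 - G(s-))\<close> exists and equals \<open>c\<close>.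
  It need not exist for \<open>t\<close> beyond the point where \<open>1 - G(s-)\<close> reaches \<open>0\<close>, a point that depends
  on \<open>\<omega>\<close> and that may be strictly smaller than \<open>t_G\<close>.
\<close>

definition has_compensator_integral ::
    "(real \<Rightarrow> 'a \<Rightarrow> real) \<Rightarrow> (real \<Rightarrow> 'a \<Rightarrow> real) \<Rightarrow> (ennreal \<Rightarrow> 'a \<Rightarrow> real) \<Rightarrow>
     'a \<Rightarrow> real \<Rightarrow> real \<Rightarrow> bool" where
  "has_compensator_integral G F H \<omega> t c \<longleftrightarrow>
     (\<exists>I J.
        has_LS_integral (\<lambda>s. 1 / left_survival G s \<omega>) (\<lambda>s. F s \<omega> * (1 - G s \<omega>)) 0 t I \<and>
        has_LS_integral (\<lambda>s. H (ennreal s) \<omega> / left_survival G s \<omega>) (\<lambda>s. G s \<omega>) 0 t J \<and>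
        c = I + J)"

end

theory Submission
  imports Defs
begin

text \<open>
  Conditionally on \<open>Hs\<close> the time \<open>\<gamma>\<close> has the law \<open>\<kappa>\<close> with distribution function \<open>G\<close>. Integration by
  parts turns the integral in (i) into \<open>F(t) - F(0) + \<integral>\<^bsub>(0,t]\<^esub> (H - F) / W d\<kappa>\<close> with \<open>W = \<kappa>[s, \<infinity>]\<close>; in this
  form it is measurable in \<open>\<omega>\<close>, and (ii) is its jump at an atom of full remaining mass, where the
  value of \<open>F\<close> is immaterial and replaced by \<open>0\<close>. Thus \<open>X - A\<close> is \<open>F(0)\<close> plus a jump of size
  \<open>L - F(\<gamma>)\<close> at \<open>\<gamma>\<close> minus \<open>\<integral>\<^bsub>(0, t \<and> \<gamma>]\<^esub> (H - F) / W d\<kappa>\<close>. As \<open>E (\<integral> h / W 1{v \<le> \<gamma>} d\<kappa>) = E h(\<gamma>)\<close> for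
  \<open>Hs\<close>-measurable \<open>h\<close>, this is a true martingale.

  For uniqueness, a predictable process agrees up to \<open>\<gamma>\<close> with a \<open>borel \<Otimes> Hs\<close>-measurable function \<open>e\<close>,
  and a martingale is constant after \<open>\<gamma>\<close>. So the stopped difference of two compensators satisfies
  \<open>\<integral>\<^bsub>[0,t]\<^esub> e d\<kappa> + e(t) \<kappa>(t, \<infinity>] = 0\<close>, an equation whose only solution is \<open>e = 0\<close>.
\<close>

section \<open>Functions of finite variation\<close>

text \<open>Almost every path is controlled only up to \<open>\<gamma> \<omega>\<close>:
  \<open>F\<close> equals the regular process \<open>X\<close> strictly before
  \<open>\<gamma>\<close>, and \<open>(H - F) / W\<close> is known to be integrable against
  \<open>\<kappa>\<close> only up to it. Yet \<open>C\<close> has to be one jointly measurable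
  function that matches the pathwise integral at every \<open>t\<close> below \<open>t_G\<close> at
  which that integral happens to exist, also after \<open>1 - G\<close> has reached
  \<open>0\<close>, where division by zero makes the integrands vanish. Hence \<open>C\<close> is
  built from \<open>\<kappa>\<close> and compared separately with every value that the integral may
  take. The value of \<open>F\<close> at \<open>\<gamma>\<close> itself enters the jump of
  \<open>X - A\<close>, but the regularity of \<open>F\<close> is inherited from \<open>X\<close>
  and stops short of it. The remedy is a second, conditionally independent draw from
  \<open>\<kappa>\<close>: if mass survives beyond \<open>\<gamma>\<close>, a property that holds
  strictly before the jump also holds at it. Uniqueness meets the same gap and closes it in the same
  way. \<open>\<kappa>\<close> is realised as the image of the uniform law under a quantile
  function, so that disintegration and measurability in \<open>\<omega>\<close> reduce to Fubini on
  one fixed product space.\<close>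

lemma emeasure_add_on_Ioc:
  fixes A B D :: "real measure"
  assumes sets: "sets A = sets borel" "sets B = sets borel" "sets D = sets borel"
    and fin: "emeasure B {l<..r} \<noteq> \<infinity>" "emeasure D {l<..r} \<noteq> \<infinity>"
    and eq: "\<And>a b. l \<le> a \<Longrightarrow> a \<le> b \<Longrightarrow> b \<le> r \<Longrightarrow>
               emeasure A {a<..b} = emeasure B {a<..b} + emeasure D {a<..b}"
    and S: "S \<in> sets borel"
  shows "emeasure A (S \<inter> {l<..r}) = emeasure B (S \<inter> {l<..r}) + emeasure D (S \<inter> {l<..r})"
proof (cases "l \<le> r")
  case False
  then show ?thesis by simp
next
  case lr: True
  note [measurable_cong] = sets
  let ?E = "range (\<lambda>(a::real, b). {a<..b})"
  have "Int_stable ?E"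
    by (auto simp: Int_stable_def image_iff)
  moreover have "?E \<subseteq> Pow UNIV" by simp
  moreover have "S \<in> sigma_sets UNIV ?E"
    using S by (simp add: borel_sigma_sets_Ioc)
  ultimately show ?thesis
  proof (induction rule: sigma_sets_induct_disjoint)
    case (basic X)
    then obtain a b where X: "X = {a<..b}" by auto
    have Xeq: "X \<inter> {l<..r} = {max a l<..min b r}" by (auto simp: X)
    show ?case
    proof (cases "max a l \<le> min b r")
      case True
      then show ?thesis unfolding Xeq by (intro eq) auto
    next
      case False
      then have "{max a l<..min b r} = {}" by auto
      then show ?thesis unfolding Xeq by (metis emeasure_empty add_0)
    qed
  next
    case empty
    then show ?case by simp
  next
    case (compl X)
    have X: "X \<in> sets borel" using compl by (simp add: borel_sigma_sets_Ioc)
    have un: "{l<..r} = (X \<inter> {l<..r}) \<union> ((UNIV - X) \<inter> {l<..r})" by auto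
    have split: "emeasure N {l<..r} = emeasure N (X \<inter> {l<..r}) + emeasure N ((UNIV - X) \<inter> {l<..r})"
      if "sets N = sets borel" for N :: "real measure"
    proof -
      note [measurable_cong] = that
      show ?thesis
        by (subst un, subst plus_emeasure[symmetric]) (use X that in auto)
    qed
    have whole: "emeasure A {l<..r} = emeasure B {l<..r} + emeasure D {l<..r}"
      using eq[of l r] lr by simp
    \<comment> \<open>Complements are reached by subtraction, so the masses of \<open>B\<close> and
      \<open>D\<close> must be finite; this is why the identity is localised to
      \<open>{l<..r}\<close>.\<close>
    have fB: "emeasure B (X \<inter> {l<..r}) \<noteq> \<infinity>" "emeasure D (X \<inter> {l<..r}) \<noteq> \<infinity>"
      using fin split[OF sets(2)] split[OF sets(3)] by auto
    then obtain x y where xy: "emeasure B (X \<inter> {l<..r}) = ennreal x" "emeasure D (X \<inter> {l<..r}) = ennreal y" "0 \<le> x" "0 \<le> y"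
      by (metis ennreal_cases infinity_ennreal_def)
    have "(emeasure B (X \<inter> {l<..r}) + emeasure D (X \<inter> {l<..r})) + emeasure A ((UNIV - X) \<inter> {l<..r})
        = (emeasure B (X \<inter> {l<..r}) + emeasure D (X \<inter> {l<..r})) +
          (emeasure B ((UNIV - X) \<inter> {l<..r}) + emeasure D ((UNIV - X) \<inter> {l<..r}))"
      using whole split[OF sets(1)] split[OF sets(2)] split[OF sets(3)] compl(2)
      by (simp add: ac_simps)
    then show ?case
      by (simp add: xy ennreal_add_left_cancel flip: ennreal_plus)
  next
    case (union X)
    have X: "X i \<in> sets borel" for i using union by (auto simp: borel_sigma_sets_Ioc)
    have d: "disjoint_family (\<lambda>i. X i \<inter> {l<..r})"
      using union(1) by (auto simp: disjoint_family_on_def)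
    have s: "emeasure N ((\<Union>i. X i) \<inter> {l<..r}) = (\<Sum>i. emeasure N (X i \<inter> {l<..r}))"
      if "sets N = sets borel" for N :: "real measure"
    proof -
      have "(\<Union>i. X i) \<inter> {l<..r} = (\<Union>i. X i \<inter> {l<..r})" by auto
      then show ?thesis using X that d by (simp add: suminf_emeasure image_subset_iff)
    qed
    show ?case
      by (simp only: s[OF sets(1)] s[OF sets(2)] s[OF sets(3)] union(3) suminf_add[OF summableI summableI])
  qed
qed

text \<open>Stated as \<open>A = B + D\<close> and not as a difference, so that it stays within
  nonnegative measures. With \<open>p = a + q\<close> it compares two decompositions of one
  integrator; with \<open>D\<close> the null measure it is equality of integrals on
  \<open>{l<..r}\<close>.\<close>

lemma nn_integral_add_on_Ioc:
  fixes A B D :: "real measure" and f :: "real \<Rightarrow> ennreal"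
  assumes sets: "sets A = sets borel" "sets B = sets borel" "sets D = sets borel"
    and fin: "emeasure B {l<..r} \<noteq> \<infinity>" "emeasure D {l<..r} \<noteq> \<infinity>"
    and eq: "\<And>a b. l \<le> a \<Longrightarrow> a \<le> b \<Longrightarrow> b \<le> r \<Longrightarrow>
               emeasure A {a<..b} = emeasure B {a<..b} + emeasure D {a<..b}"
    and f: "f \<in> borel_measurable borel"
  shows "(\<integral>\<^sup>+x\<in>{l<..r}. f x \<partial>A) = (\<integral>\<^sup>+x\<in>{l<..r}. f x \<partial>B) + (\<integral>\<^sup>+x\<in>{l<..r}. f x \<partial>D)"
proof -
  note [measurable_cong] = sets
  show ?thesis
    using f
  proof (induction rule: borel_measurable_induct)
    case (cong f g)
    then show ?case by simp
  next
    case (set S)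
    have "indicator S x * indicator {l<..r} x = (indicator (S \<inter> {l<..r}) x :: ennreal)" for x
      by (auto simp: indicator_def)
    moreover have "S \<inter> {l<..r} \<in> sets borel" using set by auto
    ultimately show ?case
      using emeasure_add_on_Ioc[OF sets fin eq set] sets by simp
  next
    case (mult u c)
    then have [measurable]: "u \<in> borel_measurable borel" by simp
    show ?case using mult(4)
      by (simp add: mult.assoc nn_integral_cmult distrib_left)
  next
    case (add u v)
    then have [measurable]: "u \<in> borel_measurable borel" "v \<in> borel_measurable borel" by simp_all
    have "(\<integral>\<^sup>+x\<in>{l<..r}. (v x + u x) \<partial>N) = (\<integral>\<^sup>+x\<in>{l<..r}. v x \<partial>N) + (\<integral>\<^sup>+x\<in>{l<..r}. u x \<partial>N)"
      if "sets N = sets borel" for N :: "real measure"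
    proof -
      note [measurable_cong] = that
      show ?thesis unfolding distrib_right by (rule nn_integral_add) measurable
    qed
    then show ?case using add sets
      by (simp only: ac_simps)
  next
    case (seq U)
    have [measurable]: "U i \<in> borel_measurable borel" for i using seq by simp
    have inc: "incseq (\<lambda>i x. U i x * indicator {l<..r} x)"
      using seq(3) by (auto simp: incseq_def le_fun_def intro!: mult_right_mono)
    have s: "(\<integral>\<^sup>+x. (SUP i. U i) x * indicator {l<..r} x \<partial>N) = (SUP i. \<integral>\<^sup>+x. U i x * indicator {l<..r} x \<partial>N)"
      if "sets N = sets borel" for N :: "real measure"
    proof -
      note [measurable_cong] = that
      have "(SUP i. U i) x * indicator {l<..r} x = (SUP i. U i x * indicator {l<..r} x)" for x
        by (subst SUP_mult_right_ennreal[symmetric]) (simp add: SUP_apply image_image)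
      then show ?thesis
        using inc by (simp add: nn_integral_monotone_convergence_SUP)
    qed
    have inc': "incseq (\<lambda>i. \<integral>\<^sup>+x. U i x * indicator {l<..r} x \<partial>N)" for N
      using inc by (auto simp: incseq_def le_fun_def intro!: nn_integral_mono)
    show ?case
      unfolding s[OF sets(1)] s[OF sets(2)] s[OF sets(3)]
      using seq.IH ennreal_SUP_add[OF inc' inc', of B D] by simp
  qed
qed

lemma nn_integral_eq_on_Ioc:
  fixes A B :: "real measure" and f :: "real \<Rightarrow> ennreal"
  assumes sets: "sets A = sets borel" "sets B = sets borel"
    and fin: "emeasure B {l<..r} \<noteq> \<infinity>"
    and eq: "\<And>a b. l \<le> a \<Longrightarrow> a \<le> b \<Longrightarrow> b \<le> r \<Longrightarrow> emeasure A {a<..b} = emeasure B {a<..b}"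
    and f: "f \<in> borel_measurable borel"
  shows "(\<integral>\<^sup>+x\<in>{l<..r}. f x \<partial>A) = (\<integral>\<^sup>+x\<in>{l<..r}. f x \<partial>B)"
  using nn_integral_add_on_Ioc[OF sets, of "null_measure borel" l r f] fin eq f
  by (simp add: nn_integral_null_measure)

section \<open>Jordan decomposition into right-continuous monotone parts\<close>

lemma mono_right_limit:
  fixes p :: "real \<Rightarrow> real"
  assumes "mono p"
  defines "q \<equiv> \<lambda>x. Inf (p ` {x<..})"
  shows "mono q" "\<And>x. continuous (at_right x) q" "\<And>x. (p \<longlongrightarrow> q x) (at_right x)"
proof -
  have bdd: "bdd_below (p ` {x<..})" for x
    using assms(1) by (auto simp: bdd_below_def mono_def intro!: exI[of _ "p x"])
  show m: "mono q"
    unfolding q_def mono_def by (auto intro!: cInf_superset_mono bdd image_mono)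
  show "(p \<longlongrightarrow> q x) (at_right x)" for x
    using Lim_right_bound[of UNIV x p "p x"] assms(1) by (auto simp: q_def mono_def)
  show "continuous (at_right x) q" for x
  proof (subst continuous_at_right_real_increasing)
    show "\<And>x y. x \<le> y \<Longrightarrow> q x \<le> q y" using m by (auto simp: mono_def)
    show "\<forall>e>0. \<exists>d>0. q (x + d) - q x < e"
    proof (intro allI impI)
      fix e :: real assume "e > 0"
      then have "\<exists>y\<in>p ` {x<..}. y < q x + e"
        by (subst cInf_less_iff[symmetric]) (auto simp: q_def bdd)
      then obtain y where y: "x < y" "p y < q x + e" by auto
      have "q ((x + y)/2) \<le> p y"
        unfolding q_def using y by (intro cInf_lower bdd) auto
      with y show "\<exists>d>0. q (x + d) - q x < e"
        by (intro exI[of _ "(y - x)/2"]) (auto simp: field_simps)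
    qed
  qed
qed

definition variation_sums :: "(real \<Rightarrow> real) \<Rightarrow> real \<Rightarrow> real set" where
  "variation_sums f x = {(\<Sum>i<n. \<bar>f (p (Suc i)) - f (p i)\<bar>) |(p :: nat \<Rightarrow> real) n.
      mono_on {..n} p \<and> p ` {..n} \<subseteq> {0..x}}"

text \<open>Jordan decomposition: \<open>f = V - (V - f)\<close> with \<open>V\<close> the total
  variation on \<open>[0, x]\<close>. The single inequality
  \<open>V x + \<bar>f y - f x\<bar> \<le> V y\<close> makes both parts nondecreasing.\<close>

lemma finite_variation_on_mono_decomp:
  assumes fv: "finite_variation_on f 0 b"
  shows "\<exists>p q. mono_on {0..b} p \<and> mono_on {0..b} q \<and> (\<forall>x\<in>{0..b}. f x = p x - q x)"
proof -
  define V where "V x = Sup (variation_sums f x)" for x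
  obtain B where B: "\<And>(p :: nat \<Rightarrow> real) n. mono_on {..n} p \<Longrightarrow> p ` {..n} \<subseteq> {0..b} \<Longrightarrow>
        (\<Sum>i<n. \<bar>f (p (Suc i)) - f (p i)\<bar>) \<le> B"
    using fv unfolding finite_variation_on_def by blast
  have bdd: "bdd_above (variation_sums f x)" if "x \<le> b" for x
  proof (intro bdd_aboveI[of _ B])
    fix v assume "v \<in> variation_sums f x"
    then obtain p :: "nat \<Rightarrow> real" and n where p: "mono_on {..n} p" "p ` {..n} \<subseteq> {0..x}"
      and v: "v = (\<Sum>i<n. \<bar>f (p (Suc i)) - f (p i)\<bar>)"
      unfolding variation_sums_def by blast
    have "{0..x} \<subseteq> {0..b}" using that by auto
    with p(2) have "p ` {..n} \<subseteq> {0..b}" by (rule subset_trans)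
    then show "v \<le> B" unfolding v by (rule B[OF p(1)])
  qed
  have key: "V x + \<bar>f y - f x\<bar> \<le> V y" if xy: "0 \<le> x" "x \<le> y" "y \<le> b" for x y
  proof -
    have ne: "variation_sums f x \<noteq> {}"
      using xy unfolding variation_sums_def
      by (auto intro!: exI[of _ "\<lambda>_. 0"] exI[of _ "0::nat"] simp: mono_on_def)
    have "V x \<le> V y - \<bar>f y - f x\<bar>"
      unfolding V_def[of x]
    proof (rule cSup_least[OF ne])
      fix v assume "v \<in> variation_sums f x"
      then obtain p :: "nat \<Rightarrow> real" and n where p: "mono_on {..n} p" "p ` {..n} \<subseteq> {0..x}"
        and v: "v = (\<Sum>i<n. \<bar>f (p (Suc i)) - f (p i)\<bar>)"
        unfolding variation_sums_def by blast
      \<comment> \<open>A partition of \<open>[0, x]\<close> is prolonged by both \<open>x\<close>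
        and \<open>y\<close>; without \<open>x\<close> the increment from \<open>x\<close> to
        \<open>y\<close> would be missing when the partition stops before \<open>x\<close>.\<close>
      define p' where "p' i = (if i \<le> n then p i else if i = Suc n then x else y)" for i
      have "mono_on {..Suc (Suc n)} p'"
      proof (rule mono_onI)
        fix r s assume "r \<in> {..Suc (Suc n)}" "s \<in> {..Suc (Suc n)}" "r \<le> s"
        then show "p' r \<le> p' s"
          using p xy unfolding p'_def mono_on_def image_subset_iff
          by (auto split: if_splits) (meson atLeastAtMost_iff atMost_iff order_trans)+
      qed
      moreover have "p' ` {..Suc (Suc n)} \<subseteq> {0..y}"
        using p(2) xy unfolding p'_def image_subset_iff by (auto intro: order_trans)
      ultimately have "(\<Sum>i<Suc (Suc n). \<bar>f (p' (Suc i)) - f (p' i)\<bar>) \<in> variation_sums f y"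
        unfolding variation_sums_def by blast
      then have "(\<Sum>i<Suc (Suc n). \<bar>f (p' (Suc i)) - f (p' i)\<bar>) \<le> V y"
        unfolding V_def by (intro cSup_upper bdd xy)
      moreover have "(\<Sum>i<n. \<bar>f (p' (Suc i)) - f (p' i)\<bar>) = v"
        unfolding v by (intro sum.cong) (auto simp: p'_def)
      ultimately have "v + \<bar>f x - f (p n)\<bar> + \<bar>f y - f x\<bar> \<le> V y"
        by (simp add: p'_def)
      then show "v \<le> V y - \<bar>f y - f x\<bar>" by linarith
    qed
    then show ?thesis by simp
  qed
  show ?thesis
  proof (rule exI[of _ V], rule exI[of _ "\<lambda>x. V x - f x"], intro conjI)
    show "mono_on {0..b} V"
      by (rule mono_onI) (use key in \<open>auto, smt (verit)\<close>)
    show "mono_on {0..b} (\<lambda>x. V x - f x)"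
      by (rule mono_onI) (use key in \<open>auto, smt (verit)\<close>)
  qed simp
qed

text \<open>The Jordan parts need not be right-continuous. Passing to their right limits keeps the
  difference equal to \<open>f\<close> wherever \<open>f\<close> is right-continuous, and clamping
  the argument to \<open>[0, b]\<close> extends them to the line. Clamping also settles the endpoint
  \<open>b\<close>, where right-continuity is not assumed: to the right of \<open>b\<close> the
  clamped parts are constant.\<close>

lemma finite_variation_on_rc_decomp:
  assumes fv: "finite_variation_on f 0 b" and b: "0 \<le> b"
    and rc: "\<And>x. 0 \<le> x \<Longrightarrow> x < b \<Longrightarrow> continuous (at_right x) f"
  obtains p q where "mono p" "mono q" "\<And>x. continuous (at_right x) p" "\<And>x. continuous (at_right x) q"
    "\<And>x. x \<in> {0..b} \<Longrightarrow> f x = p x - q x"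
proof -
  obtain P Q where PQ: "mono_on {0..b} P" "mono_on {0..b} Q" "\<And>x. x \<in> {0..b} \<Longrightarrow> f x = P x - Q x"
    using finite_variation_on_mono_decomp[OF fv] by blast
  define cl where "cl x = max 0 (min b x)" for x :: real
  have cl: "cl x \<in> {0..b}" "mono cl" "x \<in> {0..b} \<Longrightarrow> cl x = x" for x
    using b by (auto simp: cl_def mono_def)
  have mP: "mono (P \<circ> cl)" "mono (Q \<circ> cl)"
    using PQ(1,2) cl(1,2) by (auto simp: mono_on_def mono_def)
  define p where "p x = Inf ((P \<circ> cl) ` {x<..})" for x
  define q where "q x = Inf ((Q \<circ> cl) ` {x<..})" for x
  note p = mono_right_limit[OF mP(1), folded p_def]
  note q = mono_right_limit[OF mP(2), folded q_def]
  show ?thesis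
  proof (rule that[of p q])
    fix x assume x: "x \<in> {0..b}"
    have lim: "((\<lambda>y. (P \<circ> cl) y - (Q \<circ> cl) y) \<longlongrightarrow> p x - q x) (at_right x)"
      by (intro tendsto_diff p q)
    show "f x = p x - q x"
    proof (cases "x < b")
      case True
      have "(f \<longlongrightarrow> f x) (at_right x)"
        using rc[of x] x True by (auto simp: continuous_within)
      moreover have "eventually (\<lambda>y. y \<in> {x<..<b}) (at_right x)"
        using True by (rule eventually_at_right_real)
      then have "eventually (\<lambda>y. f y = (P \<circ> cl) y - (Q \<circ> cl) y) (at_right x)"
        by eventually_elim (use x PQ(3) cl(3) in auto)
      ultimately have "((\<lambda>y. (P \<circ> cl) y - (Q \<circ> cl) y) \<longlongrightarrow> f x) (at_right x)"
        using tendsto_cong by fast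
      then show ?thesis
        using lim tendsto_unique by (metis trivial_limit_at_right_real)
    next
      case False
      with x have xb: "x = b" by simp
      have "p x = P b" "q x = Q b"
        using b unfolding p_def q_def xb by (auto simp: cl_def image_constant_conv)
      then show ?thesis using PQ(3)[of b] b xb by simp
    qed
  qed (use p q in auto)
qed

lemma finite_variation_on_mono:
  assumes "mono_on {a..b} f"
  shows "finite_variation_on f a b"
  unfolding finite_variation_on_def
proof (intro exI[of _ "f b - f a"] allI impI)
  fix p :: "nat \<Rightarrow> real" and n
  assume p: "mono_on {..n} p" "p ` {..n} \<subseteq> {a..b}"
  then have p': "p i \<in> {a..b}" if "i \<le> n" for i using that by auto
  have "(\<Sum>i<n. \<bar>f (p (Suc i)) - f (p i)\<bar>) = (\<Sum>i<n. f (p (Suc i)) - f (p i))"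
  proof (intro sum.cong refl)
    fix i assume "i \<in> {..<n}"
    then have "f (p i) \<le> f (p (Suc i))"
      using p(1) p'[of i] p'[of "Suc i"] by (intro mono_onD[OF assms]) (auto simp: mono_on_def)
    then show "\<bar>f (p (Suc i)) - f (p i)\<bar> = f (p (Suc i)) - f (p i)" by simp
  qed
  also have "\<dots> = f (p n) - f (p 0)" by (rule sum_lessThan_telescope)
  also have "\<dots> \<le> f b - f a"
    using p'[of n] p'[of 0] by (intro diff_mono mono_onD[OF assms]) auto
  finally show "(\<Sum>i<n. \<bar>f (p (Suc i)) - f (p i)\<bar>) \<le> f b - f a" .
qed

lemma finite_variation_on_diff:
  assumes "finite_variation_on f a b" "finite_variation_on g a b"
  shows "finite_variation_on (\<lambda>x. f x - g x) a b"
proof -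
  obtain B where B: "\<And>(p :: nat \<Rightarrow> real) n. mono_on {..n} p \<Longrightarrow> p ` {..n} \<subseteq> {a..b} \<Longrightarrow>
        (\<Sum>i<n. \<bar>f (p (Suc i)) - f (p i)\<bar>) \<le> B"
    using assms(1) unfolding finite_variation_on_def by blast
  obtain C where C: "\<And>(p :: nat \<Rightarrow> real) n. mono_on {..n} p \<Longrightarrow> p ` {..n} \<subseteq> {a..b} \<Longrightarrow>
        (\<Sum>i<n. \<bar>g (p (Suc i)) - g (p i)\<bar>) \<le> C"
    using assms(2) unfolding finite_variation_on_def by blast
  show ?thesis
    unfolding finite_variation_on_def
  proof (intro exI[of _ "B + C"] allI impI)
    fix p :: "nat \<Rightarrow> real" and n
    assume p: "mono_on {..n} p" "p ` {..n} \<subseteq> {a..b}"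
    have "(\<Sum>i<n. \<bar>f (p (Suc i)) - g (p (Suc i)) - (f (p i) - g (p i))\<bar>)
        \<le> (\<Sum>i<n. \<bar>f (p (Suc i)) - f (p i)\<bar> + \<bar>g (p (Suc i)) - g (p i)\<bar>)"
      by (intro sum_mono) linarith
    also have "\<dots> \<le> B + C"
      using B[OF p] C[OF p] by (simp add: sum.distrib)
    finally show "(\<Sum>i<n. \<bar>f (p (Suc i)) - g (p (Suc i)) - (f (p i) - g (p i))\<bar>) \<le> B + C" .
  qed
qed

lemma finite_variation_on_cong:
  assumes "\<And>x. x \<in> {a..b} \<Longrightarrow> f x = g x"
  shows "finite_variation_on f a b \<longleftrightarrow> finite_variation_on g a b"
proof -
  have *: "(\<Sum>i<n. \<bar>f (p (Suc i)) - f (p i)\<bar>) = (\<Sum>i<n. \<bar>g (p (Suc i)) - g (p i)\<bar>)"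
    if "p ` {..n} \<subseteq> {a..b}" for p :: "nat \<Rightarrow> real" and n
    using that by (intro sum.cong refl) (auto simp: image_subset_iff assms)
  show ?thesis
    unfolding finite_variation_on_def by (intro ex_cong1 all_cong1 imp_cong refl) (simp add: *)
qed

lemma finite_variation_on_bounded:
  assumes "finite_variation_on f 0 b"
  obtains B where "\<And>x. x \<in> {0..b} \<Longrightarrow> \<bar>f x\<bar> \<le> B"
proof -
  obtain P Q where PQ: "mono_on {0..b} P" "mono_on {0..b} Q" "\<And>x. x \<in> {0..b} \<Longrightarrow> f x = P x - Q x"
    using finite_variation_on_mono_decomp[OF assms] by blast
  show ?thesis
  proof (rule that[of "\<bar>P 0\<bar> + \<bar>P b\<bar> + \<bar>Q 0\<bar> + \<bar>Q b\<bar>"])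
    fix x assume x: "x \<in> {0..b}"
    then have "P 0 \<le> P x" "P x \<le> P b" "Q 0 \<le> Q x" "Q x \<le> Q b"
      using PQ(1,2) by (auto simp: mono_on_def)
    then show "\<bar>f x\<bar> \<le> \<bar>P 0\<bar> + \<bar>P b\<bar> + \<bar>Q 0\<bar> + \<bar>Q b\<bar>"
      unfolding PQ(3)[OF x] by linarith
  qed
qed

lemma mono_left_limit:
  fixes f :: "real \<Rightarrow> real"
  assumes "mono_on {a..b} f" "a < x" "x \<le> b"
  shows "(f \<longlongrightarrow> Sup (f ` {a<..<x})) (at_left x)"
proof -
  have "(f \<longlongrightarrow> Sup (f ` ({..<x} \<inter> {a<..<x}))) (at x within ({..<x} \<inter> {a<..<x}))"
    using assms by (intro Lim_left_bound[of "{a<..<x}" x f "f b"]) (auto simp: mono_on_def)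
  moreover have "{..<x} \<inter> {a<..<x} = {a<..<x}" by auto
  moreover have "at x within {a<..<x} = at_left x"
    using assms(2) by (intro at_within_nhd[of _ "{a<..}"]) auto
  ultimately show ?thesis by simp
qed

lemma finite_variation_on_left_limit:
  assumes "finite_variation_on f 0 b" "0 < x" "x \<le> b"
  shows "\<exists>l. (f \<longlongrightarrow> l) (at_left x)"
proof -
  obtain P Q where PQ: "mono_on {0..b} P" "mono_on {0..b} Q" "\<And>x. x \<in> {0..b} \<Longrightarrow> f x = P x - Q x"
    using finite_variation_on_mono_decomp[OF assms(1)] by blast
  have "eventually (\<lambda>y. y \<in> {0<..<x}) (at_left x)"
    using assms(2) by (rule eventually_at_left_real)
  then have "eventually (\<lambda>y. P y - Q y = f y) (at_left x)"
    by eventually_elim (use PQ(3) assms(3) in auto)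
  from tendsto_cong[OF this]
    tendsto_diff[OF mono_left_limit[OF PQ(1) assms(2,3)] mono_left_limit[OF PQ(2) assms(2,3)]]
  show ?thesis by blast
qed

section \<open>Pathwise Lebesgue--Stieltjes calculus\<close>

lemma mono_tendsto_at_left_Lim:
  fixes a :: "real \<Rightarrow> real"
  assumes "mono a"
  shows "(a \<longlongrightarrow> Lim (at_left x) a) (at_left x)"
proof -
  have "(a \<longlongrightarrow> Sup (a ` {x - 1<..<x})) (at_left x)"
    by (rule mono_left_limit[of "x - 1" x]) (use assms in \<open>auto simp: mono_def mono_on_def\<close>)
  then show ?thesis by (metis tendsto_Lim trivial_limit_at_left_real)
qed

lemma filterlim_minus_inverse_at_left:
  "filterlim (\<lambda>n. x - inverse (real (Suc n))) (at_left x) sequentially"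
  unfolding filterlim_at
  using LIMSEQ_inverse_real_of_nat_add_minus[of x] by (auto simp: eventually_sequentially)

lemma emeasure_interval_measure_Ioo:
  assumes a: "mono a" "\<And>x. continuous (at_right x) a" and "l < x"
  shows "emeasure (interval_measure a) {l<..<x} = ennreal (Lim (at_left x) a - a l)"
proof -
  define u where "u n = x - inverse (real (Suc n))" for n
  have "(\<Union>n. {l<..u n}) = {l<..<x}"
  proof (intro equalityI subsetI)
    fix y assume y: "y \<in> {l<..<x}"
    then obtain n where "inverse (real (Suc n)) < x - y"
      using reals_Archimedean[of "x - y"] by auto
    with y show "y \<in> (\<Union>n. {l<..u n})" by (auto simp: u_def intro!: exI[of _ n])
  qed (auto simp: u_def intro: le_less_trans)
  moreover have "incseq (\<lambda>n. {l<..u n})"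
  proof (rule incseq_SucI)
    have "u n \<le> u (Suc n)" for n
      unfolding u_def by (intro diff_left_mono le_imp_inverse_le) auto
    then have "x \<le> u n \<Longrightarrow> x \<le> u (Suc n)" for n x by (rule order_trans[rotated])
    then show "{l<..u n} \<subseteq> {l<..u (Suc n)}" for n by auto
  qed
  ultimately have "(\<lambda>n. emeasure (interval_measure a) {l<..u n}) \<longlonglongrightarrow> emeasure (interval_measure a) {l<..<x}"
    using Lim_emeasure_incseq[of "\<lambda>n. {l<..u n}" "interval_measure a"] by (simp add: image_subset_iff)
  moreover have "(\<lambda>n. ennreal (a (u n) - a l)) \<longlonglongrightarrow> ennreal (Lim (at_left x) a - a l)"
    unfolding u_def
    by (intro tendsto_intros filterlim_compose[OF mono_tendsto_at_left_Lim filterlim_minus_inverse_at_left] a)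
  moreover have "emeasure (interval_measure a) {l<..u n} = ennreal (a (u n) - a l)" for n
    using a monoD[OF a(1), of "u n" l]
    by (subst emeasure_interval_measure_Ioc_eq) (auto simp: mono_def ennreal_neg)
  ultimately show ?thesis
    by (simp add: LIMSEQ_unique)
qed

text \<open>Integration by parts as Fubini on the square over \<open>(l, r]\<close>, cut along the
  diagonal. The diagonal itself goes to one side only, so one integrand carries a left limit and the
  other does not.\<close>

lemma interval_measure_product:
  assumes a: "mono a" "\<And>x. continuous (at_right x) a"
    and b: "mono b" "\<And>x. continuous (at_right x) b"
    and lr: "l \<le> r"
  shows "(\<integral>\<^sup>+x\<in>{l<..r}. ennreal (Lim (at_left x) a - a l) \<partial>interval_measure b) +
         (\<integral>\<^sup>+y\<in>{l<..r}. ennreal (b y - b l) \<partial>interval_measure a) =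
         ennreal ((a r - a l) * (b r - b l))"
proof -
  define A where "A = interval_measure a"
  define B where "B = interval_measure b"
  have [measurable_cong]: "sets A = sets borel" "sets B = sets borel" by (simp_all add: A_def B_def)
  interpret A: sigma_finite_measure A
    unfolding A_def using a by (intro sigma_finite_interval_measure) (auto simp: mono_def)
  interpret B: sigma_finite_measure B
    unfolding B_def using b by (intro sigma_finite_interval_measure) (auto simp: mono_def)
  interpret AB: pair_sigma_finite B A ..
  \<comment> \<open>\<open>f\<close> is the open part \<open>y < x\<close> and \<open>g\<close> the
    closed part \<open>x \<le> y\<close>; together they are the indicator of the square.\<close>
  define f where "f x y = (if l < x \<and> x \<le> r \<and> l < y \<and> y < x then 1 else 0 :: ennreal)" for x y
  define g where "g x y = (if l < y \<and> y \<le> r \<and> l < x \<and> x \<le> y then 1 else 0 :: ennreal)" for x y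
  have [measurable]: "case_prod f \<in> borel_measurable (B \<Otimes>\<^sub>M A)" "case_prod g \<in> borel_measurable (B \<Otimes>\<^sub>M A)"
    unfolding f_def g_def by measurable
  have sf: "(\<integral>\<^sup>+y. f x y \<partial>A) = ennreal (Lim (at_left x) a - a l) * indicator {l<..r} x" for x
  proof (cases "l < x \<and> x \<le> r")
    case True
    then have "f x = indicator {l<..<x}" by (auto simp: f_def indicator_def)
    then show ?thesis using True emeasure_interval_measure_Ioo[OF a, of l x] by (simp add: A_def)
  next
    case False
    then show ?thesis by (auto simp: f_def)
  qed
  have sg: "(\<integral>\<^sup>+x. g x y \<partial>B) = ennreal (b y - b l) * indicator {l<..r} y" for y
  proof (cases "l < y \<and> y \<le> r")
    case True
    then have "(\<lambda>x. g x y) = indicator {l<..y}" by (auto simp: g_def indicator_def)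
    then show ?thesis using True emeasure_interval_measure_Ioc[of l y b] b by (simp add: B_def mono_def)
  next
    case False
    then show ?thesis by (auto simp: g_def)
  qed
  have "(\<integral>\<^sup>+x. (\<integral>\<^sup>+y. f x y \<partial>A) \<partial>B) + (\<integral>\<^sup>+y. (\<integral>\<^sup>+x. g x y \<partial>B) \<partial>A) =
        (\<integral>\<^sup>+x. (\<integral>\<^sup>+y. f x y \<partial>A) \<partial>B) + (\<integral>\<^sup>+x. (\<integral>\<^sup>+y. g x y \<partial>A) \<partial>B)"
    by (subst AB.Fubini') simp_all
  also have "\<dots> = (\<integral>\<^sup>+x. (\<integral>\<^sup>+y. f x y \<partial>A) + (\<integral>\<^sup>+y. g x y \<partial>A) \<partial>B)"
    by (rule nn_integral_add[symmetric]) measurable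
  also have "\<dots> = (\<integral>\<^sup>+x. (\<integral>\<^sup>+y. f x y + g x y \<partial>A) \<partial>B)"
    by (intro nn_integral_cong nn_integral_add[symmetric]) (unfold f_def g_def, measurable)
  also have "\<dots> = (\<integral>\<^sup>+x. (\<integral>\<^sup>+y. indicator {l<..r} x * indicator {l<..r} y \<partial>A) \<partial>B)"
    by (intro nn_integral_cong) (auto simp: f_def g_def indicator_def)
  also have "\<dots> = emeasure A {l<..r} * emeasure B {l<..r}"
    by (simp add: nn_integral_cmult nn_integral_multc mult.commute)
  also have "\<dots> = ennreal ((a r - a l) * (b r - b l))"
    using a b lr monoD[OF a(1) lr] monoD[OF b(1) lr]
    by (simp add: A_def B_def emeasure_interval_measure_Ioc mono_def ennreal_mult)
  finally show ?thesis unfolding sf sg unfolding A_def B_def .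
qed

lemma mono_Lim_at_left_le:
  assumes "mono (a :: real \<Rightarrow> real)"
  shows "Lim (at_left x) a \<le> a x" "y < x \<Longrightarrow> a y \<le> Lim (at_left x) a"
proof -
  have "eventually (\<lambda>z. z \<in> {x - 1<..<x}) (at_left x)" by (rule eventually_at_left_real) simp
  then show "Lim (at_left x) a \<le> a x"
    by (intro tendsto_upperbound[OF mono_tendsto_at_left_Lim[OF assms]])
       (auto elim!: eventually_mono intro: monoD[OF assms])
  assume "y < x"
  then have "eventually (\<lambda>z. z \<in> {y<..<x}) (at_left x)" by (rule eventually_at_left_real)
  then show "a y \<le> Lim (at_left x) a"
    by (intro tendsto_lowerbound[OF mono_tendsto_at_left_Lim[OF assms]])
       (auto elim!: eventually_mono intro: monoD[OF assms])
qed

lemma mono_Lim_at_left: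
  assumes "mono (a :: real \<Rightarrow> real)"
  shows "mono (\<lambda>x. Lim (at_left x) a)"
  by (rule monoI) (metis assms mono_Lim_at_left_le order_le_less order_trans)

text \<open>The measure of \<open>1 / (1 - a)\<close>, read off the vanishing differential of \<open>(1 - a) * (1 / (1 - a))\<close>.\<close>

lemma nn_integral_interval_measure_inverse:
  fixes a :: "real \<Rightarrow> real" and f :: "real \<Rightarrow> ennreal"
  assumes a: "mono a" "\<And>x. continuous (at_right x) a" and c: "\<And>x. a x \<le> c" "c < 1"
    and f: "f \<in> borel_measurable borel"
  defines "h \<equiv> \<lambda>x. 1 / (1 - a x)"
  shows "mono h" "\<And>x. continuous (at_right x) h"
    and "Lim (at_left x) h = 1 / (1 - Lim (at_left x) a)"
    and "(\<integral>\<^sup>+x\<in>{l<..r}. f x \<partial>interval_measure h) =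
         (\<integral>\<^sup>+x\<in>{l<..r}. f x * ennreal (1 / ((1 - a x) * (1 - Lim (at_left x) a))) \<partial>interval_measure a)"
proof -
  have pos: "1 - a x > 0" for x using c(1)[of x] c(2) by linarith
  have lim_le: "Lim (at_left x) a \<le> c" for x
    using mono_Lim_at_left_le(1)[OF a(1), of x] c(1)[of x] by linarith
  then have posl: "1 - Lim (at_left x) a > 0" for x using c(2) by (smt (verit))
  show h: "mono h"
    unfolding h_def using pos by (auto simp: mono_def intro!: divide_left_mono monoD[OF a(1)])
  show hc: "continuous (at_right x) h" for x
    unfolding h_def using pos[of x] by (intro continuous_intros a) auto
  show "Lim (at_left x) h = 1 / (1 - Lim (at_left x) a)"
  proof -
    have "(h \<longlongrightarrow> 1 / (1 - Lim (at_left x) a)) (at_left x)"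
      unfolding h_def using posl[of x] by (intro tendsto_intros mono_tendsto_at_left_Lim a) auto
    then show ?thesis by (metis tendsto_Lim trivial_limit_at_left_real)
  qed
  define la where "la x = Lim (at_left x) a" for x
  have [measurable]: "la \<in> borel_measurable borel" "a \<in> borel_measurable borel"
    "h \<in> borel_measurable borel" "f \<in> borel_measurable borel"
    unfolding la_def using a h f mono_Lim_at_left by (auto intro: borel_measurable_mono)
  have hpos: "h x > 0" for x unfolding h_def using pos[of x] by simp
  \<comment> \<open>\<open>P\<close> stands for \<open>(1 - a(x-)) dh\<close> and \<open>R\<close>
    for \<open>h da\<close>. The product rule for \<open>(1 - a) h = 1\<close> says that they
    coincide, and it suffices to check intervals.\<close>
  define P where "P = density (interval_measure h) (\<lambda>x. ennreal (1 - la x))"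
  define R where "R = density (interval_measure a) (\<lambda>x. ennreal (h x))"
  have setsPR: "sets P = sets borel" "sets R = sets borel" by (simp_all add: P_def R_def)
  have eq: "emeasure P {l<..r} = emeasure R {l<..r}" and fin: "emeasure R {l<..r} \<noteq> \<infinity>" if lr: "l \<le> r" for l r
  proof -
    have al: "a l \<le> a r" "h l \<le> h r" using a h lr by (auto dest: monoD)
    have eh: "emeasure (interval_measure h) {l<..r} = ennreal (h r - h l)"
      using h hc lr by (subst emeasure_interval_measure_Ioc) (auto simp: mono_def)
    have ea: "emeasure (interval_measure a) {l<..r} = ennreal (a r - a l)"
      using a lr by (subst emeasure_interval_measure_Ioc) (auto simp: mono_def)
    define I1 where "I1 = (\<integral>\<^sup>+x\<in>{l<..r}. ennreal (la x - a l) \<partial>interval_measure h)"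
    define I2 where "I2 = (\<integral>\<^sup>+y\<in>{l<..r}. ennreal (h y - h l) \<partial>interval_measure a)"
    have s: "I1 + I2 = ennreal ((a r - a l) * (h r - h l))"
      unfolding I1_def I2_def la_def by (rule interval_measure_product[OF a h hc lr])
    have EP: "emeasure P {l<..r} = (\<integral>\<^sup>+x\<in>{l<..r}. ennreal (1 - la x) \<partial>interval_measure h)"
      unfolding P_def by (subst emeasure_density) auto
    have ER: "emeasure R {l<..r} = (\<integral>\<^sup>+x\<in>{l<..r}. ennreal (h x) \<partial>interval_measure a)"
      unfolding R_def by (subst emeasure_density) auto
    have 1: "emeasure P {l<..r} + I1 = ennreal ((1 - a l) * (h r - h l))"
    proof -
      have "emeasure P {l<..r} + I1 = (\<integral>\<^sup>+x\<in>{l<..r}. ennreal (1 - la x) + ennreal (la x - a l) \<partial>interval_measure h)"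
        unfolding EP I1_def distrib_right by (rule nn_integral_add[symmetric]) measurable
      also have "\<dots> = (\<integral>\<^sup>+x\<in>{l<..r}. ennreal (1 - a l) \<partial>interval_measure h)"
        using posl mono_Lim_at_left_le(2)[OF a(1)]
        by (intro nn_integral_cong) (auto simp: la_def indicator_def less_imp_le simp flip: ennreal_plus)
      finally show ?thesis
        using pos[of l] al by (simp add: nn_integral_cmult eh ennreal_mult less_imp_le)
    qed
    have 2: "emeasure R {l<..r} = I2 + ennreal (h l * (a r - a l))"
    proof -
      have "emeasure R {l<..r} = (\<integral>\<^sup>+x\<in>{l<..r}. ennreal (h x - h l) + ennreal (h l) \<partial>interval_measure a)"
        unfolding ER using hpos monoD[OF h]
        by (intro nn_integral_cong) (auto simp: indicator_def less_imp_le simp flip: ennreal_plus)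
      also have "\<dots> = I2 + (\<integral>\<^sup>+x\<in>{l<..r}. ennreal (h l) \<partial>interval_measure a)"
        unfolding I2_def distrib_right by (rule nn_integral_add) measurable
      finally show ?thesis
        using hpos[of l] al by (simp add: nn_integral_cmult ea ennreal_mult less_imp_le)
    qed
    obtain i1 i2 where i: "I1 = ennreal i1" "I2 = ennreal i2" "0 \<le> i1" "0 \<le> i2"
      using s by (metis ennreal_add_eq_top ennreal_cases ennreal_neq_top)
    have s': "i1 + i2 = (a r - a l) * (h r - h l)"
      using s al i by (simp flip: ennreal_plus)
    obtain p where p: "emeasure P {l<..r} = ennreal p" "0 \<le> p"
      using 1 by (metis ennreal_add_eq_top ennreal_cases ennreal_neq_top)
    have "p + i1 = (1 - a l) * (h r - h l)"
      using 1 al pos[of l] p i by (simp flip: ennreal_plus)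
    \<comment> \<open>The left-hand side is \<open>(1 - a r) * (h r - h l)\<close>; it is rewritten
      with \<open>(1 - a) h = 1\<close> at both ends.\<close>
    moreover have "(1 - a l) * (h r - h l) - (a r - a l) * (h r - h l) = h l * (a r - a l)"
    proof -
      have "(1 - a r) * h r = 1" "(1 - a l) * h l = 1"
        using pos[of r] pos[of l] by (auto simp: h_def)
      then show ?thesis by algebra
    qed
    ultimately have "p = i2 + h l * (a r - a l)" using s' by linarith
    then show "emeasure P {l<..r} = emeasure R {l<..r}" "emeasure R {l<..r} \<noteq> \<infinity>"
      using 2 p i al hpos[of l] by (simp_all add: less_imp_le flip: ennreal_plus)
  qed
  have finR: "emeasure R {l<..r} \<noteq> \<infinity>" using fin[of l r] by (cases "l \<le> r") simp_all
  have "(\<integral>\<^sup>+x\<in>{l<..r}. f x \<partial>interval_measure h) =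
        (\<integral>\<^sup>+x. ennreal (1 - la x) * (f x * ennreal (1 / (1 - la x)) * indicator {l<..r} x) \<partial>interval_measure h)"
  proof (intro nn_integral_cong)
    fix x
    have "ennreal (1 - la x) * ennreal (1 / (1 - la x)) = 1"
      using posl[of x] by (simp add: la_def flip: ennreal_mult)
    then show "f x * indicator {l<..r} x = ennreal (1 - la x) * (f x * ennreal (1 / (1 - la x)) * indicator {l<..r} x)"
      by (metis mult.assoc mult.commute mult_1)
  qed
  also have "\<dots> = (\<integral>\<^sup>+x\<in>{l<..r}. f x * ennreal (1 / (1 - la x)) \<partial>P)"
    unfolding P_def by (subst nn_integral_density) (auto simp: ac_simps)
  also have "\<dots> = (\<integral>\<^sup>+x\<in>{l<..r}. f x * ennreal (1 / (1 - la x)) \<partial>R)"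
    by (rule nn_integral_eq_on_Ioc[OF setsPR finR]) (auto intro: eq)
  also have "\<dots> = (\<integral>\<^sup>+x. ennreal (h x) * (f x * ennreal (1 / (1 - la x)) * indicator {l<..r} x) \<partial>interval_measure a)"
    unfolding R_def by (subst nn_integral_density) (auto simp: ac_simps)
  also have "\<dots> = (\<integral>\<^sup>+x\<in>{l<..r}. f x * ennreal (1 / ((1 - a x) * (1 - Lim (at_left x) a))) \<partial>interval_measure a)"
  proof (intro nn_integral_cong)
    fix x
    have "ennreal (h x) * ennreal (1 / (1 - la x)) = ennreal (1 / ((1 - a x) * (1 - Lim (at_left x) a)))"
      using posl[of x] pos[of x] by (simp add: la_def h_def flip: ennreal_mult)
    then show "ennreal (h x) * (f x * ennreal (1 / (1 - la x)) * indicator {l<..r} x) =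
      f x * ennreal (1 / ((1 - a x) * (1 - Lim (at_left x) a))) * indicator {l<..r} x"
      by (metis mult.assoc mult.commute)
  qed
  finally show "(\<integral>\<^sup>+x\<in>{l<..r}. f x \<partial>interval_measure h) =
         (\<integral>\<^sup>+x\<in>{l<..r}. f x * ennreal (1 / ((1 - a x) * (1 - Lim (at_left x) a))) \<partial>interval_measure a)" .
qed


section \<open>Integrators given by decompositions: uniqueness, truncation, limits\<close>

lemma has_set_integral_nn_integral:
  fixes f :: "'a \<Rightarrow> real"
  assumes "S \<in> sets M" "f \<in> borel_measurable M" "\<And>x. x \<in> S \<Longrightarrow> 0 \<le> f x"
    and "(\<integral>\<^sup>+x\<in>S. ennreal (f x) \<partial>M) = ennreal v" "0 \<le> v"
  shows "set_integrable M S f" "(LINT x:S|M. f x) = v"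
proof -
  have "has_bochner_integral M (\<lambda>x. indicator S x *\<^sub>R f x) v"
  proof (rule has_bochner_integral_nn_integral)
    have "ennreal (indicator S x *\<^sub>R f x) = ennreal (f x) * indicator S x" for x
      by (simp add: indicator_def)
    then show "(\<integral>\<^sup>+x. ennreal (indicator S x *\<^sub>R f x) \<partial>M) = ennreal v"
      using assms(4) by simp
  qed (use assms in \<open>auto simp: indicator_def\<close>)
  then show "set_integrable M S f" "(LINT x:S|M. f x) = v"
    unfolding set_integrable_def set_lebesgue_integral_def
    by (auto simp: has_bochner_integral_iff)
qed

text \<open>Freezes a nondecreasing function from \<open>t\<close> on. With the left limit at
  \<open>t\<close> as level it removes a jump there, so that \<open>1 - a\<close> stays positive
  even if the function jumps to \<open>1\<close> at \<open>t\<close>; with a larger level it creates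
  a jump of prescribed size.\<close>

lemma mono_rc_splice:
  fixes a :: "real \<Rightarrow> real"
  assumes a: "mono a" "\<And>x. continuous (at_right x) a" and d: "\<And>x. x < t \<Longrightarrow> a x \<le> d"
  shows "mono (\<lambda>s. if s < t then a s else d)" (is "mono ?b")
    and "continuous (at_right x) (\<lambda>s. if s < t then a s else d)"
proof -
  show "mono ?b"
    using d monoD[OF a(1)] by (auto simp: mono_def)
  show "continuous (at_right x) ?b"
  proof (cases "x < t")
    case True
    have "(a \<longlongrightarrow> a x) (at_right x)" using a by (simp add: continuous_within)
    moreover have "eventually (\<lambda>y. y \<in> {x<..<t}) (at_right x)"
      using True by (rule eventually_at_right_real)
    then have "eventually (\<lambda>y. a y = ?b y) (at_right x)"
      by eventually_elim auto
    ultimately have "(?b \<longlongrightarrow> a x) (at_right x)" by (rule Lim_transform_eventually)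
    then show ?thesis using True by (simp add: continuous_within)
  next
    case False
    have "((\<lambda>_. d) \<longlongrightarrow> d) (at_right x)" by simp
    moreover have "eventually (\<lambda>y. y \<in> {x<..<x + 1}) (at_right x)"
      by (rule eventually_at_right_real) simp
    then have "eventually (\<lambda>y. d = ?b y) (at_right x)"
      by eventually_elim (use False in auto)
    ultimately have "(?b \<longlongrightarrow> d) (at_right x)" by (rule Lim_transform_eventually)
    then show ?thesis using False by (simp add: continuous_within)
  qed
qed

text \<open>If \<open>a = p - q\<close>, then \<open>p = a + q\<close> as measures on
  \<open>{l<..r}\<close>, because the identity holds on intervals. Hence an integral defined through
  any decomposition of a nondecreasing integrator is the integral against its own measure. Positive
  part, negative part and norm are treated separately, since the identity is one of nonnegative
  integrals.\<close>

lemma LS_integral_unique: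
  fixes a p q f :: "real \<Rightarrow> real"
  assumes a: "mono a" "\<And>x. continuous (at_right x) a"
    and p: "mono p" "\<And>x. continuous (at_right x) p"
    and q: "mono q" "\<And>x. continuous (at_right x) q"
    and eq: "\<And>x. x \<in> {l..r} \<Longrightarrow> a x = p x - q x"
    and f: "set_integrable (interval_measure p) {l<..r} f" "set_integrable (interval_measure q) {l<..r} f"
  shows "set_integrable (interval_measure a) {l<..r} f"
    and "(LINT x:{l<..r}|interval_measure a. f x) =
         (LINT x:{l<..r}|interval_measure p. f x) - (LINT x:{l<..r}|interval_measure q. f x)"
proof -
  define F where "F x = indicator {l<..r} x *\<^sub>R f x" for x
  have iF: "integrable (interval_measure p) F" "integrable (interval_measure q) F"
    using f by (simp_all add: set_integrable_def F_def[abs_def])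
  then have Fm [measurable]: "F \<in> borel_measurable borel"
    by (auto dest!: borel_measurable_integrable)
  have fin: "emeasure (interval_measure b) {l<..r} \<noteq> \<infinity>"
    if "mono b" "\<And>x. continuous (at_right x) b" for b
    using that by (subst emeasure_interval_measure_Ioc_eq) (auto simp: mono_def)
  have add: "(\<integral>\<^sup>+x. ennreal (h x) \<partial>interval_measure p) =
      (\<integral>\<^sup>+x. ennreal (h x) \<partial>interval_measure a) + (\<integral>\<^sup>+x. ennreal (h x) \<partial>interval_measure q)"
    if h: "h \<in> borel_measurable borel" "\<And>x. x \<notin> {l<..r} \<Longrightarrow> h x = 0" for h
  proof -
    have "ennreal (h x) = ennreal (h x) * indicator {l<..r} x" for x
      using h(2)[of x] by (auto simp: indicator_def)
    moreover have "(\<integral>\<^sup>+x\<in>{l<..r}. ennreal (h x) \<partial>interval_measure p) =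
      (\<integral>\<^sup>+x\<in>{l<..r}. ennreal (h x) \<partial>interval_measure a) + (\<integral>\<^sup>+x\<in>{l<..r}. ennreal (h x) \<partial>interval_measure q)"
    proof (rule nn_integral_add_on_Ioc)
      fix x y assume xy: "l \<le> x" "x \<le> y" "y \<le> r"
      have "emeasure (interval_measure b) {x<..y} = ennreal (b y - b x)"
        if "mono b" "\<And>x. continuous (at_right x) b" for b
        using that xy by (intro emeasure_interval_measure_Ioc) (auto simp: mono_def)
      moreover have "p y - p x = (a y - a x) + (q y - q x)" using eq[of x] eq[of y] xy by simp
      ultimately show "emeasure (interval_measure p) {x<..y} =
          emeasure (interval_measure a) {x<..y} + emeasure (interval_measure q) {x<..y}"
        using a p q monoD[OF a(1) xy(2)] monoD[OF q(1) xy(2)] by (simp flip: ennreal_plus)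
    qed (use fin a q h in auto)
    ultimately show ?thesis by presburger
  qed
  have F0: "F x = 0" if "x \<notin> {l<..r}" for x using that by (simp add: F_def)
  have parts: "(\<integral>\<^sup>+x. ennreal (F x) \<partial>interval_measure p) =
      (\<integral>\<^sup>+x. ennreal (F x) \<partial>interval_measure a) + (\<integral>\<^sup>+x. ennreal (F x) \<partial>interval_measure q)"
    "(\<integral>\<^sup>+x. ennreal (- F x) \<partial>interval_measure p) =
      (\<integral>\<^sup>+x. ennreal (- F x) \<partial>interval_measure a) + (\<integral>\<^sup>+x. ennreal (- F x) \<partial>interval_measure q)"
    "(\<integral>\<^sup>+x. ennreal (norm (F x)) \<partial>interval_measure p) =
      (\<integral>\<^sup>+x. ennreal (norm (F x)) \<partial>interval_measure a) + (\<integral>\<^sup>+x. ennreal (norm (F x)) \<partial>interval_measure q)"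
    using F0 by (auto intro!: add)
  have ia: "integrable (interval_measure a) F"
    using iF(1) parts(3) by (auto simp: integrable_iff_bounded)
  then show "set_integrable (interval_measure a) {l<..r} f"
    by (simp add: set_integrable_def F_def[abs_def])
  have fin': "(\<integral>\<^sup>+x. ennreal (F x) \<partial>N) < \<infinity>" "(\<integral>\<^sup>+x. ennreal (- F x) \<partial>N) < \<infinity>" if "integrable N F" for N
    using that by (auto simp: real_integrable_def less_top)
  have "integral\<^sup>L (interval_measure p) F = integral\<^sup>L (interval_measure a) F + integral\<^sup>L (interval_measure q) F"
    using fin'[OF ia] fin'[OF iF(2)]
    by (simp add: real_lebesgue_integral_def[OF ia] real_lebesgue_integral_def[OF iF(1)]
        real_lebesgue_integral_def[OF iF(2)] parts enn2real_plus)
  then show "(LINT x:{l<..r}|interval_measure a. f x) =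
         (LINT x:{l<..r}|interval_measure p. f x) - (LINT x:{l<..r}|interval_measure q. f x)"
    unfolding set_lebesgue_integral_def F_def[symmetric] by simp
qed

text \<open>Meant for times past the point where \<open>1 - G(s-)\<close> vanishes: the integrands
  are quotients by \<open>0\<close> there and hence \<open>0\<close>, so a longer interval
  contributes nothing.\<close>

lemma has_LS_integral_cut:
  assumes I: "has_LS_integral f \<phi> 0 t I" and s: "s \<le> t" "\<And>x. s < x \<Longrightarrow> x \<le> t \<Longrightarrow> f x = 0"
  shows "has_LS_integral f \<phi> 0 s I"
proof -
  have ind: "indicator {0<..t} x *\<^sub>R f x = indicator {0<..s} x *\<^sub>R f x" for x
    using s by (auto simp: indicator_def)
  obtain p q where pq: "mono p" "mono q" "\<forall>x. continuous (at_right x) p" "\<forall>x. continuous (at_right x) q"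
    "\<forall>x\<in>{0..t}. \<phi> x = p x - q x"
    "set_integrable (interval_measure p) {0<..t} f" "set_integrable (interval_measure q) {0<..t} f"
    "I = (LINT x:{0<..t}|interval_measure p. f x) - (LINT x:{0<..t}|interval_measure q. f x)"
    using I unfolding has_LS_integral_def by blast
  show ?thesis
    using pq s(1) unfolding has_LS_integral_def set_integrable_def set_lebesgue_integral_def ind
    by (intro exI[of _ p] exI[of _ q]) auto
qed

text \<open>Here the integrand vanishes at \<open>\<tau>\<close> as well, so the integral over
  \<open>(0, t]\<close> only sees \<open>(0, \<tau>)\<close>, and dominated convergence along
  \<open>s\<close> recovers it from intervals that stop before \<open>\<tau>\<close>.\<close>

lemma has_LS_integral_lim:
  assumes I: "has_LS_integral f \<phi> 0 t I" and z: "\<And>x. \<tau> \<le> x \<Longrightarrow> x \<le> t \<Longrightarrow> f x = 0"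
    and s: "\<And>n. s n < \<tau>" "s \<longlonglongrightarrow> \<tau>" "\<tau> \<le> t"
  shows "\<exists>J. (\<forall>n. has_LS_integral f \<phi> 0 (s n) (J n)) \<and> J \<longlonglongrightarrow> I"
proof -
  obtain p q where pq: "mono p" "mono q" "\<forall>x. continuous (at_right x) p" "\<forall>x. continuous (at_right x) q"
    "\<forall>x\<in>{0..t}. \<phi> x = p x - q x"
    "set_integrable (interval_measure p) {0<..t} f" "set_integrable (interval_measure q) {0<..t} f"
    "I = (LINT x:{0<..t}|interval_measure p. f x) - (LINT x:{0<..t}|interval_measure q. f x)"
    using I unfolding has_LS_integral_def by blast
  have st: "s n \<le> t" for n using s(1)[of n] s(3) by linarith
  have sub: "set_integrable (interval_measure b) {0<..s n} f"
    if "set_integrable (interval_measure b) {0<..t} f" for b n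
    by (rule set_integrable_subset[OF that]) (use st[of n] in auto)
  have lim: "(\<lambda>n. LINT x:{0<..s n}|interval_measure b. f x) \<longlonglongrightarrow> (LINT x:{0<..t}|interval_measure b. f x)"
    if "set_integrable (interval_measure b) {0<..t} f" for b
    unfolding set_lebesgue_integral_def
  proof (rule integral_dominated_convergence[where w = "\<lambda>x. norm (indicator {0<..t} x *\<^sub>R f x)"])
    show "(\<lambda>x. indicator {0<..t} x *\<^sub>R f x) \<in> borel_measurable (interval_measure b)"
      using that unfolding set_integrable_def by (rule borel_measurable_integrable)
    show "(\<lambda>x. indicator {0<..s n} x *\<^sub>R f x) \<in> borel_measurable (interval_measure b)" for n
      using sub[OF that] unfolding set_integrable_def by (rule borel_measurable_integrable)
    show "integrable (interval_measure b) (\<lambda>x. norm (indicator {0<..t} x *\<^sub>R f x))"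
      using that unfolding set_integrable_def by (rule integrable_norm)
    show "AE x in interval_measure b. (\<lambda>n. indicator {0<..s n} x *\<^sub>R f x) \<longlonglongrightarrow> indicator {0<..t} x *\<^sub>R f x"
    proof (rule AE_I2)
      fix x
      have "eventually (\<lambda>n. indicator {0<..s n} x *\<^sub>R f x = indicator {0<..t} x *\<^sub>R f x) sequentially"
      proof (cases "x < \<tau>")
        case True
        then have "eventually (\<lambda>n. x < s n) sequentially"
          using order_tendstoD(1)[OF s(2)] by blast
        then show ?thesis
          by eventually_elim (use True s(3) in \<open>auto simp: indicator_def\<close>)
      next
        case False
        then have "indicator {0<..s n} x *\<^sub>R f x = indicator {0<..t} x *\<^sub>R f x" for n
          using s(1)[of n] z[of x] by (auto simp: indicator_def)
        then show ?thesis by simp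
      qed
      then show "(\<lambda>n. indicator {0<..s n} x *\<^sub>R f x) \<longlonglongrightarrow> indicator {0<..t} x *\<^sub>R f x"
        by (rule tendsto_eventually)
    qed
    show "AE x in interval_measure b. norm (indicator {0<..s n} x *\<^sub>R f x) \<le> norm (indicator {0<..t} x *\<^sub>R f x)" for n
      using st[of n] by (intro AE_I2) (auto simp: indicator_def)
  qed
  show ?thesis
  proof (intro exI conjI allI)
    show "has_LS_integral f \<phi> 0 (s n)
      ((LINT x:{0<..s n}|interval_measure p. f x) - (LINT x:{0<..s n}|interval_measure q. f x))" for n
      unfolding has_LS_integral_def
      using pq sub[OF pq(6)] sub[OF pq(7)] st[of n] by (intro exI[of _ p] exI[of _ q]) auto
    show "(\<lambda>n. (LINT x:{0<..s n}|interval_measure p. f x) - (LINT x:{0<..s n}|interval_measure q. f x)) \<longlonglongrightarrow> I"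
      unfolding pq(8) by (intro tendsto_diff lim pq)
  qed
qed

section \<open>The compensator integral along one distribution function\<close>

locale df_path =
  fixes g :: "real \<Rightarrow> real"
  assumes g_mono: "mono_on {0..} g" and g_rc: "\<And>t. 0 \<le> t \<Longrightarrow> continuous (at_right t) g"
    and g_0: "g 0 = 0" and g_le_1: "\<And>t. 0 \<le> t \<Longrightarrow> g t \<le> 1"
begin

text \<open>The extension by the constant \<open>g 0\<close> to the negative axis gives an
  integrator on the whole line that puts no mass on \<open>(-\<infinity>, 0]\<close>.\<close>

definition g0 :: "real \<Rightarrow> real" where "g0 s = g (max 0 s)"
definition K :: "real measure" where "K = interval_measure g0"
definition w :: "real \<Rightarrow> real" where "w s = 1 - Lim (at_left s) g0"

lemma sets_K [simp, measurable_cong]: "sets K = sets borel" and space_K [simp]: "space K = UNIV"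
  by (simp_all add: K_def)

lemma mono_g0: "mono g0"
  using g_mono by (auto simp: mono_on_def mono_def g0_def)

lemma g0_le_1: "g0 s \<le> 1" and g0_nonneg: "0 \<le> g0 s"
  using g_le_1[of "max 0 s"] mono_onD[OF g_mono, of 0 "max 0 s"] g_0 by (auto simp: g0_def)

lemma g0_rc: "continuous (at_right x) g0"
proof (cases "x < 0")
  case True
  have "((\<lambda>_. g 0) \<longlongrightarrow> g 0) (at_right x)" by simp
  moreover have "eventually (\<lambda>y. y \<in> {x<..<0}) (at_right x)"
    using True by (rule eventually_at_right_real)
  then have "eventually (\<lambda>y. g 0 = g0 y) (at_right x)"
    by eventually_elim (auto simp: g0_def)
  ultimately have "(g0 \<longlongrightarrow> g 0) (at_right x)" by (rule Lim_transform_eventually)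
  then show ?thesis using True by (simp add: continuous_within g0_def)
next
  case False
  then have "(g \<longlongrightarrow> g x) (at_right x)"
    using g_rc[of x] by (simp add: continuous_within)
  moreover have "eventually (\<lambda>y. y \<in> {x<..<x + 1}) (at_right x)"
    by (rule eventually_at_right_real) simp
  then have "eventually (\<lambda>y. g y = g0 y) (at_right x)"
    by eventually_elim (use False in \<open>auto simp: g0_def\<close>)
  ultimately have "(g0 \<longlongrightarrow> g x) (at_right x)" by (rule Lim_transform_eventually)
  then show ?thesis using False by (simp add: continuous_within g0_def)
qed

lemma w_eq_Lim: "0 < s \<Longrightarrow> Lim (at_left s) (\<lambda>u. 1 - g u) = w s"
proof -
  assume s: "0 < s"
  have "((\<lambda>u. 1 - g0 u) \<longlongrightarrow> w s) (at_left s)"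
    unfolding w_def by (intro tendsto_intros mono_tendsto_at_left_Lim mono_g0)
  moreover have "eventually (\<lambda>y. y \<in> {0<..<s}) (at_left s)" using s by (rule eventually_at_left_real)
  then have "eventually (\<lambda>u. 1 - g0 u = 1 - g u) (at_left s)"
    by eventually_elim (auto simp: g0_def)
  ultimately have "((\<lambda>u. 1 - g u) \<longlongrightarrow> w s) (at_left s)" by (rule Lim_transform_eventually)
  then show ?thesis by (intro tendsto_Lim) auto
qed

lemma w_antimono: "s \<le> t \<Longrightarrow> w t \<le> w s"
  using mono_Lim_at_left[OF mono_g0] by (auto simp: w_def mono_def)

lemma w_ge: "1 - g0 s \<le> w s"
  using mono_Lim_at_left_le(1)[OF mono_g0, of s] by (simp add: w_def)

lemma w_le: "s < t \<Longrightarrow> w t \<le> 1 - g0 s"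
  using mono_Lim_at_left_le(2)[OF mono_g0, of s t] by (simp add: w_def)

lemma w_nonneg: "0 \<le> w s"
  using w_ge[of s] g0_le_1[of s] by linarith

lemma w_measurable [measurable]: "w \<in> borel_measurable borel"
proof -
  have [measurable]: "(\<lambda>s. Lim (at_left s) g0) \<in> borel_measurable borel"
    by (rule borel_measurable_mono[OF mono_Lim_at_left[OF mono_g0]])
  show ?thesis unfolding w_def[abs_def] by measurable
qed

lemma g0_measurable [measurable]: "g0 \<in> borel_measurable borel"
  using mono_g0 by (rule borel_measurable_mono)

lemma emeasure_K_Ioc: "a \<le> b \<Longrightarrow> emeasure K {a<..b} = ennreal (g0 b - g0 a)"
  unfolding K_def using mono_g0 g0_rc by (intro emeasure_interval_measure_Ioc) (auto simp: mono_def)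

lemma emeasure_K_Ioo: "a < b \<Longrightarrow> emeasure K {a<..<b} = ennreal (1 - w b - g0 a)"
  unfolding K_def w_def using mono_g0 g0_rc by (simp add: emeasure_interval_measure_Ioo)

lemma finite_measure_K: "finite_measure K"
proof
  have "emeasure K (\<Union>n::nat. {- real n<..real n}) \<le> 1"
  proof -
    have "(\<lambda>n. emeasure K {- real n<..real n}) \<longlonglongrightarrow> emeasure K (\<Union>n::nat. {- real n<..real n})"
      by (intro Lim_emeasure_incseq) (auto simp: incseq_def)
    moreover have "emeasure K {- real n<..real n} \<le> 1" for n
      using g0_le_1[of "real n"] g0_nonneg[of "- real n"] by (simp add: emeasure_K_Ioc)
    ultimately show ?thesis by (intro LIMSEQ_le_const2) auto
  qed
  moreover have "(\<Union>n::nat. {- real n<..real n}) = UNIV"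
  proof (intro equalityI subsetI)
    fix x :: real
    obtain n :: nat where "\<bar>x\<bar> < real n" using reals_Archimedean2 by blast
    then show "x \<in> (\<Union>n::nat. {- real n<..real n})" by (intro UN_I[of n]) auto
  qed auto
  ultimately have "emeasure K (space K) \<le> 1" by simp
  then show "emeasure K (space K) \<noteq> \<infinity>" by (auto simp: top_unique)
qed

text \<open>Integration by parts of \<open>p\<close> against \<open>1 / (1 - g)\<close>, whose
  measure is \<open>dg / ((1 - g) (1 - g-))\<close>. The jump of \<open>1 / (1 - g)\<close> at
  \<open>t\<close> has to be kept out, since \<open>g t = 1\<close> is allowed; therefore the
  integral against \<open>K\<close> runs over the open interval and the boundary term has the
  denominator \<open>w t\<close>.\<close>

lemma LS_integral_mono:
  assumes t: "0 < t" "0 < w t" and p: "mono p" "\<And>x. continuous (at_right x) p"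
  shows "set_integrable (interval_measure p) {0<..t} (\<lambda>s. 1 / w s)"
    and "set_integrable K {0<..<t} (\<lambda>s. p s / ((1 - g s) * w s))"
    and "(LINT s:{0<..t}|interval_measure p. 1 / w s) =
         p t / w t - p 0 - (LINT s:{0<..<t}|K. p s / ((1 - g s) * w s))"
proof -
  \<comment> \<open>\<open>g0\<close> before \<open>t\<close>, continued by its left limit
    \<open>1 - w t\<close>: there is no jump at \<open>t\<close>, and \<open>1 - a\<close> is at
    least \<open>w t > 0\<close> throughout.\<close>
  define a where "a s = (if s < t then g0 s else 1 - w t)" for s
  define c where "c = 1 - w t"
  define h where "h x = 1 / (1 - a x)" for x
  define \<rho> where "\<rho> s = 1 / ((1 - g0 s) * w s)" for s
  have c1: "c < 1" using t by (simp add: c_def)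
  have ac: "a x \<le> c" for x using w_le[of x t] unfolding a_def c_def by (cases "x < t") simp_all
  have d: "x < t \<Longrightarrow> g0 x \<le> 1 - w t" for x using w_le[of x t] by linarith
  have am: "mono a" and arc: "continuous (at_right x) a" for x
    using mono_rc_splice[OF mono_g0 g0_rc d] by (simp_all add: a_def[abs_def])
  have Lim_a: "Lim (at_left s) a = 1 - w s" if "s \<le> t" for s
  proof -
    have "(g0 \<longlongrightarrow> 1 - w s) (at_left s)"
      using mono_tendsto_at_left_Lim[OF mono_g0, of s] by (simp add: w_def)
    moreover have "eventually (\<lambda>y. y \<in> {s - 1<..<s}) (at_left s)"
      by (rule eventually_at_left_real) simp
    then have "eventually (\<lambda>y. g0 y = a y) (at_left s)"
      by eventually_elim (use that in \<open>auto simp: a_def\<close>)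
    ultimately have "(a \<longlongrightarrow> 1 - w s) (at_left s)" by (rule Lim_transform_eventually)
    then show ?thesis by (intro tendsto_Lim) auto
  qed
  note inv = nn_integral_interval_measure_inverse[OF am arc ac c1, folded h_def]
  have Lim_h: "Lim (at_left s) h = 1 / w s" if "s \<le> t" for s
    using inv(3)[of "\<lambda>_. 0" s] Lim_a[OF that] by simp
  have hm: "mono h" "\<And>x. continuous (at_right x) h"
    using inv(1,2)[of "\<lambda>_. 0"] by auto
  have h0: "h 0 = 1" and ht: "h t = 1 / w t"
    using t by (simp_all add: h_def a_def g0_def g_0)
  have wpos: "0 < w s" if "s \<le> t" for s using w_antimono[OF that] t by linarith
  have gpos: "0 < 1 - g0 s" if "s < t" for s using w_le[OF that] t by linarith
  have \<rho>pos: "0 < \<rho> s" if "s < t" for s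
    using wpos[of s] gpos[of s] that by (simp add: \<rho>_def)
  have [measurable]: "a \<in> borel_measurable borel" "h \<in> borel_measurable borel"
     "p \<in> borel_measurable borel"
    using am hm p by (auto intro: borel_measurable_mono)
  have [measurable]: "\<rho> \<in> borel_measurable borel"
    unfolding \<rho>_def by measurable
  have dh: "(\<integral>\<^sup>+s\<in>{0<..t}. f s \<partial>interval_measure h) = (\<integral>\<^sup>+s\<in>{0<..<t}. f s * ennreal (\<rho> s) \<partial>K)"
    if f [measurable]: "f \<in> borel_measurable borel" for f :: "real \<Rightarrow> ennreal"
  proof -
    define B where "B = density K (indicator {..<t})"
    have setsB [measurable_cong]: "sets B = sets borel" by (simp add: B_def)
    have B: "emeasure B S = emeasure K (S \<inter> {..<t})" if "S \<in> sets borel" for S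
      unfolding B_def using that by (subst emeasure_density) (auto simp: Int_commute nn_integral_indicator simp flip: indicator_inter_arith)
    have eq: "emeasure (interval_measure a) {x<..y} = emeasure B {x<..y}"
      if xy: "0 \<le> x" "x \<le> y" "y \<le> t" for x y
    proof (cases "x = y")
      case True
      then show ?thesis by simp
    next
      case False
      have ea: "emeasure (interval_measure a) {x<..y} = ennreal (a y - a x)"
        using am arc xy by (intro emeasure_interval_measure_Ioc) (auto simp: mono_def)
      show ?thesis
      proof (cases "y < t")
        case True
        then have "{x<..y} \<inter> {..<t} = {x<..y}" by auto
        then show ?thesis using True xy unfolding ea by (simp add: B emeasure_K_Ioc a_def)
      next
        case yt: False
        then have "{x<..y} \<inter> {..<t} = {x<..<y}" using xy by auto
        then show ?thesis using yt xy False unfolding ea by (simp add: B emeasure_K_Ioo a_def)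
      qed
    qed
    have fin: "emeasure B {0<..t} \<noteq> \<infinity>"
      using finite_measure.emeasure_finite[OF finite_measure_K] by (simp add: B)
    have "(\<integral>\<^sup>+s\<in>{0<..t}. f s \<partial>interval_measure h) =
      (\<integral>\<^sup>+x\<in>{0<..t}. f x * ennreal (1 / ((1 - a x) * (1 - Lim (at_left x) a))) \<partial>interval_measure a)"
      by (rule inv(4)) measurable
    also have "\<dots> = (\<integral>\<^sup>+x\<in>{0<..t}. f x * ennreal (1 / ((1 - a x) * w x)) \<partial>interval_measure a)"
      by (intro nn_integral_cong) (auto simp: indicator_def Lim_a)
    also have "\<dots> = (\<integral>\<^sup>+x\<in>{0<..t}. f x * ennreal (1 / ((1 - a x) * w x)) \<partial>B)"
      by (rule nn_integral_eq_on_Ioc[OF _ setsB fin eq]) auto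
    also have "\<dots> = (\<integral>\<^sup>+s\<in>{0<..<t}. f s * ennreal (\<rho> s) \<partial>K)"
      unfolding B_def
      by (subst nn_integral_density) (auto intro!: nn_integral_cong simp: indicator_def a_def \<rho>_def)
    finally show ?thesis .
  qed
  have pt: "p 0 \<le> p t" using p t by (auto simp: mono_def)
  have hpt: "1 \<le> 1 / w t" using monoD[OF hm(1), of 0 t] t by (simp add: h0 ht)
  have "(\<integral>\<^sup>+s\<in>{0<..<t}. ennreal (\<rho> s) \<partial>K) = (\<integral>\<^sup>+s\<in>{0<..t}. 1 \<partial>interval_measure h)"
    using dh[of "\<lambda>_. 1"] by simp
  also have "\<dots> = ennreal (1 / w t - 1)"
    using hm t by (simp add: emeasure_interval_measure_Ioc mono_def h0 ht)
  finally have \<rho>1: "(\<integral>\<^sup>+s\<in>{0<..<t}. ennreal (\<rho> s) \<partial>K) = ennreal (1 / w t - 1)" .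
  note \<rho>_int = has_set_integral_nn_integral[OF _ _ _ \<rho>1]
  have \<rho>i: "set_integrable K {0<..<t} \<rho>" "(LINT s:{0<..<t}|K. \<rho> s) = 1 / w t - 1"
    by (rule \<rho>_int; use hpt \<rho>pos in \<open>auto intro: less_imp_le\<close>)+
  \<comment> \<open>Both integrands are shifted by the initial values \<open>h 0 = 1\<close> and
    \<open>p 0\<close> to make them nonnegative; the product formula then lives in
    \<open>ennreal\<close>, and the shifts are undone at the end with the total masses of
    \<open>h\<close> and \<open>p\<close>.\<close>
  define I1 where "I1 = (\<integral>\<^sup>+s\<in>{0<..t}. ennreal (1 / w s - 1) \<partial>interval_measure p)"
  define I2 where "I2 = (\<integral>\<^sup>+s\<in>{0<..<t}. ennreal ((p s - p 0) * \<rho> s) \<partial>K)"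
  have "I1 = (\<integral>\<^sup>+s\<in>{0<..t}. ennreal (Lim (at_left s) h - h 0) \<partial>interval_measure p)"
    unfolding I1_def by (intro nn_integral_cong) (auto simp: indicator_def Lim_h h0)
  moreover have "I2 = (\<integral>\<^sup>+s\<in>{0<..t}. ennreal (p s - p 0) \<partial>interval_measure h)"
    unfolding I2_def
    by (subst dh) (auto intro!: nn_integral_cong simp: indicator_def ennreal_mult'' less_imp_le \<rho>pos)
  ultimately have s: "I1 + I2 = ennreal ((1 / w t - 1) * (p t - p 0))"
    using interval_measure_product[OF hm p, of 0 t] t by (simp add: h0 ht)
  obtain i1 i2 where i: "I1 = ennreal i1" "I2 = ennreal i2" "0 \<le> i1" "0 \<le> i2"
    using s by (metis ennreal_add_eq_top ennreal_cases ennreal_neq_top)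
  have s': "i1 + i2 = (1 / w t - 1) * (p t - p 0)"
    using s pt hpt i by (simp flip: ennreal_plus)
  have w1: "1 / w s \<ge> 1" if "0 < s" "s \<le> t" for s
    using w_le[of 0 s] that wpos[of s] by (simp add: g0_def g_0)
  have i1': "set_integrable (interval_measure p) {0<..t} (\<lambda>s. 1 / w s - 1)"
    "(LINT s:{0<..t}|interval_measure p. 1 / w s - 1) = i1"
    by (rule has_set_integral_nn_integral[OF _ _ _ i(1)[unfolded I1_def]]; use i w1 in auto)+
  have i2': "set_integrable K {0<..<t} (\<lambda>s. (p s - p 0) * \<rho> s)"
    "(LINT s:{0<..<t}|K. (p s - p 0) * \<rho> s) = i2"
    by (rule has_set_integral_nn_integral[OF _ _ _ i(2)[unfolded I2_def]];
        use i \<rho>pos monoD[OF p(1), of 0] in \<open>auto intro!: mult_nonneg_nonneg simp: less_imp_le\<close>)+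
  have ep: "emeasure (interval_measure p) {0<..t} = ennreal (p t - p 0)"
    using p t by (intro emeasure_interval_measure_Ioc) (auto simp: mono_def)
  have one: "set_integrable (interval_measure p) {0<..t} (\<lambda>s. 1 :: real)"
    "(LINT s:{0<..t}|interval_measure p. 1 :: real) = p t - p 0"
    using has_set_integral_nn_integral[where f = "\<lambda>_. 1 :: real" and S = "{0<..t}" and M = "interval_measure p"
        and v = "p t - p 0"] pt ep by simp_all
  show int1: "set_integrable (interval_measure p) {0<..t} (\<lambda>s. 1 / w s)"
    using set_integral_add(1)[OF i1'(1) one(1)] by simp
  have val1: "(LINT s:{0<..t}|interval_measure p. 1 / w s) = i1 + (p t - p 0)"
    using set_integral_add(2)[OF i1'(1) one(1)] i1'(2) one(2) by simp
  have p\<rho>: "set_integrable K {0<..<t} (\<lambda>s. p 0 * \<rho> s)"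
    using \<rho>i(1) by simp
  have r: "p s / ((1 - g s) * w s) = (p s - p 0) * \<rho> s + p 0 * \<rho> s" if "s \<in> {0<..<t}" for s
    using that by (simp add: \<rho>_def g0_def diff_divide_distrib algebra_simps)
  show "set_integrable K {0<..<t} (\<lambda>s. p s / ((1 - g s) * w s))"
    using set_integral_add(1)[OF i2'(1) p\<rho>] r
    by (subst set_integrable_cong[OF refl refl r]) auto
  have "(LINT s:{0<..<t}|K. p s / ((1 - g s) * w s)) = i2 + p 0 * (1 / w t - 1)"
  proof -
    have "(LINT s:{0<..<t}|K. p s / ((1 - g s) * w s)) = (LINT s:{0<..<t}|K. (p s - p 0) * \<rho> s + p 0 * \<rho> s)"
      by (intro set_lebesgue_integral_cong) (auto simp: r)
    then show ?thesis using set_integral_add(2)[OF i2'(1) p\<rho>] i2'(2) \<rho>i(2) by simp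
  qed
  then show "(LINT s:{0<..t}|interval_measure p. 1 / w s) =
         p t / w t - p 0 - (LINT s:{0<..<t}|K. p s / ((1 - g s) * w s))"
    using val1 s' by (simp add: algebra_simps diff_divide_distrib)
qed


text \<open>Where \<open>g s = 1\<close> the product \<open>F (1 - g)\<close> forgets
  \<open>F s\<close>; replacing it by \<open>0\<close> leaves the product unchanged.\<close>

definition Fz :: "(real \<Rightarrow> real) \<Rightarrow> real \<Rightarrow> real" where
  "Fz F s = (if g s < 1 then F s else 0)"

text \<open>The formulas for \<open>p\<close> and \<open>q\<close> are subtracted, which turns
  \<open>p - q\<close> back into \<open>F (1 - g)\<close> and cancels the factor
  \<open>1 - g\<close>. It remains to close the interval at \<open>t\<close>: the atom
  \<open>K {t}\<close> has mass \<open>w t - (1 - g t)\<close>, and this converts the boundary term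
  \<open>F t (1 - g t) / w t\<close> into \<open>Fz F t\<close> minus the contribution of
  \<open>t\<close> to the integral.\<close>

lemma LS_value:
  assumes t: "0 < t" "0 < w t"
    and p: "mono p" "\<And>x. continuous (at_right x) p"
    and q: "mono q" "\<And>x. continuous (at_right x) q"
    and eq: "\<And>x. x \<in> {0..t} \<Longrightarrow> F x * (1 - g x) = p x - q x"
  shows "set_integrable K {0<..t} (\<lambda>s. Fz F s / w s)"
    and "(LINT s:{0<..t}|interval_measure p. 1 / w s) - (LINT s:{0<..t}|interval_measure q. 1 / w s) =
         Fz F t - F 0 - (LINT s:{0<..t}|K. Fz F s / w s)"
proof -
  interpret finite_measure K by (rule finite_measure_K)
  note P = LS_integral_mono[OF t p] and Q = LS_integral_mono[OF t q]
  have g1: "g s < 1" if "s \<in> {0<..<t}" for s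
    using w_le[of s t] that t by (auto simp: g0_def)
  have r: "Fz F s / w s = p s / ((1 - g s) * w s) - q s / ((1 - g s) * w s)" if "s \<in> {0<..<t}" for s
  proof -
    have "p s / ((1 - g s) * w s) - q s / ((1 - g s) * w s) = (F s * (1 - g s)) / ((1 - g s) * w s)"
      using that eq[of s] by (simp add: diff_divide_distrib)
    then show ?thesis using g1[OF that] by (simp add: Fz_def)
  qed
  have i1: "set_integrable K {0<..<t} (\<lambda>s. Fz F s / w s)"
    using set_integral_diff(1)[OF P(2) Q(2)] r
    by (subst set_integrable_cong[OF refl refl r]) auto
  have v1: "(LINT s:{0<..<t}|K. Fz F s / w s) =
      (LINT s:{0<..<t}|K. p s / ((1 - g s) * w s)) - (LINT s:{0<..<t}|K. q s / ((1 - g s) * w s))"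
    unfolding set_integral_diff(2)[OF P(2) Q(2), symmetric]
    by (intro set_lebesgue_integral_cong) (auto simp: r)
  have sing: "indicator {t} s *\<^sub>R (Fz F s / w s) = indicator {t} s *\<^sub>R (Fz F t / w t)" for s
    by (auto simp: indicator_def)
  have i2: "set_integrable K {t} (\<lambda>s. Fz F s / w s)"
    unfolding set_integrable_def sing
    by (intro integrable_scaleR_left integrable_real_indicator) (auto simp: top.not_eq_extremum[symmetric])
  have v2: "(LINT s:{t}|K. Fz F s / w s) = measure K {t} * (Fz F t / w t)"
    unfolding set_lebesgue_integral_def sing by simp
  have U: "{0<..t} = {0<..<t} \<union> {t}" using t by auto
  show "set_integrable K {0<..t} (\<lambda>s. Fz F s / w s)"
    unfolding U by (intro set_integrable_Un i1 i2) auto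
  have vU: "(LINT s:{0<..t}|K. Fz F s / w s) = (LINT s:{0<..<t}|K. Fz F s / w s) + measure K {t} * (Fz F t / w t)"
    unfolding U v2[symmetric] by (intro set_integral_Un i1 i2) auto
  have mt: "measure K {t} = w t - (1 - g t)"
  proof -
    have "measure K {0<..t} = measure K {0<..<t} + measure K {t}"
      unfolding U by (rule finite_measure_Union) auto
    moreover have "measure K {0<..t} = g t"
      using emeasure_K_Ioc[of 0 t] g0_nonneg[of t] t by (simp add: measure_def g0_def g_0)
    moreover have "measure K {0<..<t} = 1 - w t"
      using emeasure_K_Ioo[of 0 t] w_le[of 0 t] t by (simp add: measure_def g0_def g_0)
    ultimately show ?thesis by simp
  qed
  have e: "p t / w t - q t / w t = Fz F t - measure K {t} * (Fz F t / w t)"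
  proof -
    have "p t / w t - q t / w t = F t * (1 - g t) / w t"
      using eq[of t] t by (simp add: diff_divide_distrib)
    also have "\<dots> = Fz F t * (1 - g t) / w t"
      using g_le_1[of t] t by (auto simp: Fz_def)
    also have "\<dots> = Fz F t - measure K {t} * (Fz F t / w t)"
      using t by (simp add: mt field_simps)
    finally show ?thesis .
  qed
  show "(LINT s:{0<..t}|interval_measure p. 1 / w s) - (LINT s:{0<..t}|interval_measure q. 1 / w s) =
         Fz F t - F 0 - (LINT s:{0<..t}|K. Fz F s / w s)"
    unfolding P(3) Q(3) vU v1 using e eq[of 0] t by (simp add: g_0)
qed

definition ct :: "(real \<Rightarrow> real) \<Rightarrow> (real \<Rightarrow> real) \<Rightarrow> real \<Rightarrow> real" where
  "ct F h t = Fz F t - F 0 + (LINT s:{0<..t}|K. (h s - Fz F s) / w s)"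

context
  fixes G F :: "real \<Rightarrow> 'a \<Rightarrow> real" and H :: "ennreal \<Rightarrow> 'a \<Rightarrow> real" and \<omega> :: 'a
  assumes G: "\<And>s. G s \<omega> = g s"
begin

lemma left_survival_eq: "0 < s \<Longrightarrow> left_survival G s \<omega> = w s"
  using w_eq_Lim by (simp add: left_survival_def G)

text \<open>Whichever decompositions witness the two Lebesgue--Stieltjes integrals,
  \<open>LS_value\<close> and \<open>LS_integral_unique\<close> lead to the same closed form.
  Positivity of \<open>w t\<close> keeps all denominators on \<open>(0, t]\<close> positive.\<close>

lemma has_compensator_integral_value:
  assumes t: "0 \<le> t" "0 < w t" and c: "has_compensator_integral G F H \<omega> t c"
  shows "c = ct (\<lambda>s. F s \<omega>) (\<lambda>s. H (ennreal s) \<omega>) t"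
proof (cases "t = 0")
  case True
  have "c = 0" using c unfolding has_compensator_integral_def has_LS_integral_def True
    by (auto simp: set_lebesgue_integral_def)
  then show ?thesis using True by (simp add: ct_def Fz_def g_0 set_lebesgue_integral_def)
next
  case False
  with t have t: "0 < t" "0 < w t" by auto
  have ls: "set_integrable N {0<..t} (\<lambda>s. f s / left_survival G s \<omega>) \<longleftrightarrow> set_integrable N {0<..t} (\<lambda>s. f s / w s)"
    "(LINT s:{0<..t}|N. f s / left_survival G s \<omega>) = (LINT s:{0<..t}|N. f s / w s)"
    if "sets N = sets borel" for N and f :: "real \<Rightarrow> real"
  proof -
    show "set_integrable N {0<..t} (\<lambda>s. f s / left_survival G s \<omega>) \<longleftrightarrow> set_integrable N {0<..t} (\<lambda>s. f s / w s)"
      by (rule set_integrable_cong) (auto simp: left_survival_eq)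
    show "(LINT s:{0<..t}|N. f s / left_survival G s \<omega>) = (LINT s:{0<..t}|N. f s / w s)"
      by (rule set_lebesgue_integral_cong) (auto simp: left_survival_eq that)
  qed
  obtain I J where c_eq: "c = I + J"
    and I: "has_LS_integral (\<lambda>s. 1 / left_survival G s \<omega>) (\<lambda>s. F s \<omega> * (1 - G s \<omega>)) 0 t I"
    and J: "has_LS_integral (\<lambda>s. H (ennreal s) \<omega> / left_survival G s \<omega>) (\<lambda>s. G s \<omega>) 0 t J"
    using c unfolding has_compensator_integral_def by blast
  obtain p q where pq: "mono p" "mono q" "\<And>x. continuous (at_right x) p" "\<And>x. continuous (at_right x) q"
    "\<And>x. x \<in> {0..t} \<Longrightarrow> F x \<omega> * (1 - g x) = p x - q x"
    "I = (LINT s:{0<..t}|interval_measure p. 1 / w s) - (LINT s:{0<..t}|interval_measure q. 1 / w s)"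
    using I unfolding has_LS_integral_def by (auto simp: ls G)
  note V = LS_value[OF t pq(1,3,2,4), of "\<lambda>s. F s \<omega>", OF pq(5)]
  obtain p' q' where pq': "mono p'" "mono q'" "\<And>x. continuous (at_right x) p'" "\<And>x. continuous (at_right x) q'"
    "\<And>x. x \<in> {0..t} \<Longrightarrow> g x = p' x - q' x"
    "set_integrable (interval_measure p') {0<..t} (\<lambda>s. H (ennreal s) \<omega> / w s)"
    "set_integrable (interval_measure q') {0<..t} (\<lambda>s. H (ennreal s) \<omega> / w s)"
    "J = (LINT s:{0<..t}|interval_measure p'. H (ennreal s) \<omega> / w s) -
         (LINT s:{0<..t}|interval_measure q'. H (ennreal s) \<omega> / w s)"
    using J unfolding has_LS_integral_def by (auto simp: ls G)
  have geq: "x \<in> {0..t} \<Longrightarrow> g0 x = p' x - q' x" for x using pq'(5)[of x] by (simp add: g0_def)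
  note U = LS_integral_unique[OF mono_g0 g0_rc pq'(1,3,2,4) geq pq'(6,7), folded K_def]
  show ?thesis
    unfolding ct_def c_eq diff_divide_distrib
    using pq(6) V pq'(8) U by (simp add: set_integral_diff)
qed

lemma has_compensator_integral_exists:
  assumes t: "0 \<le> t" "0 < w t"
    and p: "mono p" "\<And>x. continuous (at_right x) p"
    and q: "mono q" "\<And>x. continuous (at_right x) q"
    and eq: "\<And>x. x \<in> {0..t} \<Longrightarrow> F x \<omega> * (1 - g x) = p x - q x"
    and H: "set_integrable K {0<..t} (\<lambda>s. H (ennreal s) \<omega> / w s)"
  shows "\<exists>c. has_compensator_integral G F H \<omega> t c"
proof -
  have ls: "set_integrable N {0<..t} (\<lambda>s. f s / left_survival G s \<omega>) \<longleftrightarrow> set_integrable N {0<..t} (\<lambda>s. f s / w s)"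
    if "sets N = sets borel" for N and f :: "real \<Rightarrow> real"
    by (rule set_integrable_cong) (auto simp: left_survival_eq)
  have "\<exists>I. has_LS_integral (\<lambda>s. 1 / left_survival G s \<omega>) (\<lambda>s. F s \<omega> * (1 - G s \<omega>)) 0 t I"
  proof (cases "t = 0")
    case True
    then show ?thesis
      using p q eq unfolding has_LS_integral_def G
      by (intro exI[of _ 0] exI[of _ p] exI[of _ q]) (auto simp: set_integrable_def set_lebesgue_integral_def)
  next
    case False
    with t have t: "0 < t" "0 < w t" by auto
    show ?thesis
      using p q eq LS_integral_mono(1)[OF t p] LS_integral_mono(1)[OF t q]
      unfolding has_LS_integral_def G
      by (intro exI[of _ "(LINT s:{0<..t}|interval_measure p. 1 / left_survival G s \<omega>) -
          (LINT s:{0<..t}|interval_measure q. 1 / left_survival G s \<omega>)"] exI[of _ p] exI[of _ q]) (auto simp: ls)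
  qed
  moreover have "\<exists>J. has_LS_integral (\<lambda>s. H (ennreal s) \<omega> / left_survival G s \<omega>) (\<lambda>s. G s \<omega>) 0 t J"
    unfolding has_LS_integral_def G
  \<comment> \<open>\<open>G\<close> is its own decomposition, with subtrahend \<open>0\<close>; the
    interval measure of a constant gives no mass to \<open>(0, t]\<close>, so integrability against
    it needs only measurability.\<close>
  proof (rule exI, rule exI[of _ g0], rule exI[of _ "\<lambda>_. 0"], intro conjI)
    have z: "emeasure (interval_measure (\<lambda>_::real. 0::real)) {0<..t} = 0"
      using t by (subst emeasure_interval_measure_Ioc) auto
    have "AE x in interval_measure (\<lambda>_::real. 0::real). x \<notin> {0<..t}"
      by (rule AE_not_in) (use z in \<open>auto simp: null_sets_def\<close>)
    then have ae: "AE x in interval_measure (\<lambda>_::real. 0::real). indicator {0<..t} x *\<^sub>R (H (ennreal x) \<omega> / w x) = 0"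
      by eventually_elim auto
    have m: "(\<lambda>x. indicator {0<..t} x *\<^sub>R (H (ennreal x) \<omega> / w x)) \<in> borel_measurable borel"
      using borel_measurable_integrable[OF H[unfolded set_integrable_def]] by simp
    show "set_integrable (interval_measure (\<lambda>_::real. 0::real)) {0<..t} (\<lambda>s. H (ennreal s) \<omega> / left_survival G s \<omega>)"
      unfolding ls[OF sets_interval_measure] unfolding set_integrable_def
      using m by (subst integrable_cong_AE[OF _ _ ae]) auto
    show "set_integrable (interval_measure g0) {0<..t} (\<lambda>s. H (ennreal s) \<omega> / left_survival G s \<omega>)"
      unfolding ls[OF sets_interval_measure] using H by (simp add: K_def)
  qed (use mono_g0 g0_rc in \<open>auto simp: mono_def g0_def\<close>)
  ultimately show ?thesis unfolding has_compensator_integral_def by blast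
qed

lemma has_compensator_integral_cut:
  assumes c: "has_compensator_integral G F H \<omega> t c" and s: "0 \<le> s" "s \<le> t" "\<And>x. s < x \<Longrightarrow> x \<le> t \<Longrightarrow> w x = 0"
  shows "has_compensator_integral G F H \<omega> s c"
proof -
  have "left_survival G x \<omega> = 0" if "s < x" "x \<le> t" for x
    using s(1) s(3)[OF that] that by (simp add: left_survival_eq)
  then have z: "1 / left_survival G x \<omega> = 0" "H (ennreal x) \<omega> / left_survival G x \<omega> = 0"
    if "s < x" "x \<le> t" for x
    using that by simp_all
  obtain I J where c_eq: "c = I + J"
    and I: "has_LS_integral (\<lambda>s. 1 / left_survival G s \<omega>) (\<lambda>s. F s \<omega> * (1 - G s \<omega>)) 0 t I"
    and J: "has_LS_integral (\<lambda>s. H (ennreal s) \<omega> / left_survival G s \<omega>) (\<lambda>s. G s \<omega>) 0 t J"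
    using c unfolding has_compensator_integral_def by blast
  show ?thesis
    unfolding has_compensator_integral_def
    using has_LS_integral_cut[OF I s(2) z(1)] has_LS_integral_cut[OF J s(2) z(2)] c_eq by blast
qed

lemma has_compensator_integral_lim:
  assumes c: "has_compensator_integral G F H \<omega> t c" and z: "\<And>x. \<tau> \<le> x \<Longrightarrow> x \<le> t \<Longrightarrow> w x = 0"
    and s: "\<And>n. 0 \<le> s n" "\<And>n. s n < \<tau>" "s \<longlonglongrightarrow> \<tau>" "\<tau> \<le> t"
  shows "\<exists>cs. (\<forall>n. has_compensator_integral G F H \<omega> (s n) (cs n)) \<and> cs \<longlonglongrightarrow> c"
proof -
  have \<tau>: "0 < \<tau>" using s(1)[of 0] s(2)[of 0] by linarith
  obtain I J where c_eq: "c = I + J"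
    and I: "has_LS_integral (\<lambda>s. 1 / left_survival G s \<omega>) (\<lambda>s. F s \<omega> * (1 - G s \<omega>)) 0 t I"
    and J: "has_LS_integral (\<lambda>s. H (ennreal s) \<omega> / left_survival G s \<omega>) (\<lambda>s. G s \<omega>) 0 t J"
    using c unfolding has_compensator_integral_def by blast
  have z': "\<And>x. \<tau> \<le> x \<Longrightarrow> x \<le> t \<Longrightarrow> left_survival G x \<omega> = 0"
    using z \<tau> by (simp add: left_survival_eq)
  obtain Is where Is: "\<And>n. has_LS_integral (\<lambda>s. 1 / left_survival G s \<omega>) (\<lambda>s. F s \<omega> * (1 - G s \<omega>)) 0 (s n) (Is n)"
    "Is \<longlonglongrightarrow> I"
    using has_LS_integral_lim[OF I _ s(2,3,4)] z' by auto
  obtain Js where Js: "\<And>n. has_LS_integral (\<lambda>s. H (ennreal s) \<omega> / left_survival G s \<omega>) (\<lambda>s. G s \<omega>) 0 (s n) (Js n)"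
    "Js \<longlonglongrightarrow> J"
    using has_LS_integral_lim[OF J _ s(2,3,4)] z' by auto
  show ?thesis
    unfolding has_compensator_integral_def c_eq
    using Is Js by (intro exI[of _ "\<lambda>n. Is n + Js n"]) (auto intro!: tendsto_add)
qed

text \<open>With \<open>X = y1 - y2\<close> on \<open>[0, t)\<close> and both parts nonnegative and
  nondecreasing, \<open>F (1 - g) = (y1 + y2 g) - (y2 + y1 g)\<close> is a difference of
  nondecreasing functions. At \<open>t\<close> nothing ties \<open>F\<close> to \<open>X\<close>, as
  \<open>t\<close> may be the jump time, so the value there is attached by a final jump.\<close>

lemma survival_product_decomp:
  assumes t: "0 < t" and X: "finite_variation_on X 0 t" "\<And>s. 0 \<le> s \<Longrightarrow> s < t \<Longrightarrow> continuous (at_right s) X"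
    and FX: "\<And>s. 0 \<le> s \<Longrightarrow> s < t \<Longrightarrow> F s \<omega> = X s"
  obtains p q where "mono p" "\<And>x. continuous (at_right x) p" "mono q" "\<And>x. continuous (at_right x) q"
    "\<And>x. x \<in> {0..t} \<Longrightarrow> F x \<omega> * (1 - g x) = p x - q x"
proof -
  obtain x1 x2 where x: "mono x1" "mono x2" "\<And>x. continuous (at_right x) x1" "\<And>x. continuous (at_right x) x2"
    "\<And>s. s \<in> {0..t} \<Longrightarrow> X s = x1 s - x2 s"
    using finite_variation_on_rc_decomp[OF X(1) less_imp_le[OF t] X(2)] by blast
  \<comment> \<open>A common shift by \<open>b\<close> makes both parts nonnegative from time
    \<open>0\<close> on and cancels in the difference.\<close>
  define b where "b = \<bar>x1 0\<bar> + \<bar>x2 0\<bar>"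
  define y1 where "y1 s = (if s < 0 then 0 else x1 s + b)" for s
  define y2 where "y2 s = (if s < 0 then 0 else x2 s + b)" for s
  have y: "mono y \<and> (\<forall>x. continuous (at_right x) y) \<and> (\<forall>s. 0 \<le> y s)"
    if "mono x" "\<And>s. continuous (at_right s) x" "\<And>s. y s = (if s < 0 then 0 else x s + b)" "\<bar>x 0\<bar> \<le> b" for x y :: "real \<Rightarrow> real"
  proof (intro conjI allI)
    have nn: "0 \<le> x s + b" if "0 \<le> s" for s
      using monoD[OF \<open>mono x\<close> that] \<open>\<bar>x 0\<bar> \<le> b\<close> by linarith
    show "0 \<le> y s" for s using nn[of s] by (cases "s < 0") (simp_all add: that(3))
    show "mono y"
      using nn monoD[OF that(1)] by (auto simp: mono_def that(3))
    fix s
    show "continuous (at_right s) y"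
    proof (cases "s < 0")
      case True
      have "((\<lambda>_. 0) \<longlongrightarrow> 0) (at_right s)" by simp
      moreover have "eventually (\<lambda>y. y \<in> {s<..<0}) (at_right s)"
        using True by (rule eventually_at_right_real)
      then have "eventually (\<lambda>u. 0 = y u) (at_right s)"
        by eventually_elim (auto simp: that(3))
      ultimately have "(y \<longlongrightarrow> 0) (at_right s)" by (rule Lim_transform_eventually)
      then show ?thesis using True by (simp add: continuous_within that(3))
    next
      case False
      have "(x \<longlongrightarrow> x s) (at_right s)" using that(2)[of s] by (simp add: continuous_within)
      then have "((\<lambda>s. x s + b) \<longlongrightarrow> x s + b) (at_right s)" by (intro tendsto_intros)
      moreover have "eventually (\<lambda>y. y \<in> {s<..<s + 1}) (at_right s)"
        by (rule eventually_at_right_real) simp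
      then have "eventually (\<lambda>u. x u + b = y u) (at_right s)"
        by eventually_elim (use False in \<open>auto simp: that(3)\<close>)
      ultimately have "(y \<longlongrightarrow> x s + b) (at_right s)" by (rule Lim_transform_eventually)
      then show ?thesis using False by (simp add: continuous_within that(3))
    qed
  qed
  have y1: "mono y1" "\<And>x. continuous (at_right x) y1" "\<And>s. 0 \<le> y1 s"
    using y[of x1 y1] x by (auto simp: y1_def b_def)
  have y2: "mono y2" "\<And>x. continuous (at_right x) y2" "\<And>s. 0 \<le> y2 s"
    using y[of x2 y2] x by (auto simp: y2_def b_def)
  define v where "v = F t \<omega> * (1 - g t)"
  \<comment> \<open>\<open>c\<close> dominates both functions before \<open>t\<close>, so adding the
    positive or the negative part of \<open>v\<close> to it yields upward jumps only, and the
    difference at \<open>t\<close> is \<open>v\<close>.\<close>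
  define c where "c = y1 t + y2 t"
  define p where "p s = (if s < t then y1 s + y2 s * g0 s else c + max 0 v)" for s
  define q where "q s = (if s < t then y2 s + y1 s * g0 s else c + max 0 (- v))" for s
  have le: "u s * g0 s \<le> u t" if "mono u" "\<And>s. 0 \<le> u s" "s < t" for u :: "real \<Rightarrow> real" and s
    using mult_left_le[OF g0_le_1[of s] that(2)[of s]] monoD[OF that(1), of s t] that(3) by linarith
  have mp: "mono (\<lambda>s. u s + v s * g0 s)" "continuous (at_right x) (\<lambda>s. u s + v s * g0 s)"
    if "mono u" "mono v" "\<And>s. 0 \<le> v s" "\<And>x. continuous (at_right x) u" "\<And>x. continuous (at_right x) v" for u v :: "real \<Rightarrow> real" and x
    using that mono_g0 g0_rc g0_nonneg
    by (auto simp: mono_def intro!: add_mono mult_mono continuous_add continuous_mult)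
  have dp: "y1 s + y2 s * g0 s \<le> c + max 0 v" and dq: "y2 s + y1 s * g0 s \<le> c + max 0 (- v)"
    if "s < t" for s
    using le[OF y2(1,3) that] le[OF y1(1,3) that] monoD[OF y1(1), of s t] monoD[OF y2(1), of s t] that
    by (auto simp: c_def)
  have pp: "mono p" "continuous (at_right x) p" for x
    unfolding p_def
    by (rule mono_rc_splice[OF mp(1)[OF y1(1) y2(1,3) y1(2) y2(2)] mp(2)[OF y1(1) y2(1,3) y1(2) y2(2)] dp]; assumption)+
  have qq: "mono q" "continuous (at_right x) q" for x
    unfolding q_def
    by (rule mono_rc_splice[OF mp(1)[OF y2(1) y1(1,3) y2(2) y1(2)] mp(2)[OF y2(1) y1(1,3) y2(2) y1(2)] dq]; assumption)+
  show ?thesis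
  proof (rule that[OF pp qq])
    fix s assume s: "s \<in> {0..t}"
    show "F s \<omega> * (1 - g s) = p s - q s"
    proof (cases "s < t")
      case True
      then have *: "F s \<omega> = y1 s - y2 s" using s FX[of s] x(5)[of s] by (simp add: y1_def y2_def)
      show ?thesis unfolding * using True s by (simp add: p_def q_def g0_def algebra_simps)
    next
      case False
      with s have "s = t" by auto
      then show ?thesis by (simp add: p_def q_def v_def max_def)
    qed
  qed
qed

end

end

section \<open>The single jump filtration\<close>

locale single_jump = prob_space M for M :: "'a measure" +
  fixes Hs :: "'a measure" and \<gamma> :: "'a \<Rightarrow> ennreal"
  assumes sub: "subalgebra M Hs" and \<gamma>_measurable [measurable]: "\<gamma> \<in> borel_measurable M"
    and \<gamma>_pos: "AE \<omega> in M. 0 < \<gamma> \<omega>"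
begin

abbreviation Fi :: "ennreal \<Rightarrow> 'a measure" where "Fi \<equiv> single_jump_filtration M Hs \<gamma>"

lemma space_Hs [simp]: "space Hs = space M" and sets_Hs: "sets Hs \<subseteq> sets M"
  using sub by (auto simp: subalgebra_def)

lemma single_jump_sets_Un_subset: "(single_jump_sets M Hs \<gamma> t \<union> null_sets M) \<subseteq> Pow (space M)"
  by (auto simp: single_jump_sets_def null_sets_def dest: sets.sets_into_space)

lemma space_Fi [simp]: "space (Fi t) = space M"
  unfolding single_jump_filtration_def
  by (subst space_measure_of) (auto simp: single_jump_sets_def null_sets_def dest: sets.sets_into_space)

lemma sets_Fi: "t < \<infinity> \<Longrightarrow> sets (Fi t) = sigma_sets (space M) (single_jump_sets M Hs \<gamma> t \<union> null_sets M)"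
  unfolding single_jump_filtration_def
  using single_jump_sets_Un_subset[of t] by (auto simp: sets_measure_of)

lemma sets_Fi_subset: "sets (Fi t) \<subseteq> sets M"
  unfolding single_jump_filtration_def
  by (subst sets_measure_of)
     (auto simp: single_jump_sets_def null_sets_def dest: sets.sets_into_space intro!: sets.sigma_sets_subset)

lemma subalgebra_Fi: "subalgebra M (Fi t)"
  using sets_Fi_subset by (simp add: subalgebra_def)

lemma Fi_I:
  assumes "t < \<infinity>" "A \<in> sets M" "C \<in> sets Hs"
    and "\<And>\<omega>. \<omega> \<in> space M \<Longrightarrow> t < \<gamma> \<omega> \<Longrightarrow> \<omega> \<in> A \<longleftrightarrow> \<omega> \<in> C"
  shows "A \<in> sets (Fi t)"
  unfolding sets_Fi[OF assms(1)]
  using assms by (intro sigma_sets.Basic UnI1) (auto simp: single_jump_sets_def)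

lemma Fi_after: "t < \<infinity> \<Longrightarrow> A \<in> sets M \<Longrightarrow> (\<And>\<omega>. \<omega> \<in> A \<Longrightarrow> \<gamma> \<omega> \<le> t) \<Longrightarrow> A \<in> sets (Fi t)"
  by (rule Fi_I[where C = "{}"]) (auto simp: not_less[symmetric])

lemma Hs_Fi: "t < \<infinity> \<Longrightarrow> C \<in> sets Hs \<Longrightarrow> C \<in> sets (Fi t)"
  using sets_Hs by (intro Fi_I[where C = C]) auto

lemma \<gamma>_Fi: "t < \<infinity> \<Longrightarrow> {\<omega> \<in> space M. t < \<gamma> \<omega>} \<in> sets (Fi t)"
  by (rule Fi_I[where C = "space Hs"]) (auto simp del: space_Hs, auto)

text \<open>Before the jump the filtration knows nothing beyond \<open>Hs\<close>. On generators
  this is the definition; the null sets turn it into an almost sure statement, which is stable under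
  complements and countable unions.\<close>

lemma Fi_trace:
  assumes "t < \<infinity>" "A \<in> sets (Fi t)"
  shows "\<exists>C\<in>sets Hs. AE \<omega> in M. t < \<gamma> \<omega> \<longrightarrow> (\<omega> \<in> A \<longleftrightarrow> \<omega> \<in> C)"
  using assms(2) unfolding sets_Fi[OF assms(1)]
proof (induction rule: sigma_sets.induct)
  case (Basic A)
  then show ?case
  proof
    assume "A \<in> single_jump_sets M Hs \<gamma> t"
    then obtain C where "C \<in> sets Hs"
      "A \<inter> {\<omega> \<in> space M. t < \<gamma> \<omega>} = C \<inter> {\<omega> \<in> space M. t < \<gamma> \<omega>}"
      unfolding single_jump_sets_def by blast
    then show ?thesis by (intro bexI[of _ C] AE_I2) auto
  next
    assume "A \<in> null_sets M"
    then have "AE \<omega> in M. \<omega> \<notin> A" by (rule AE_not_in)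
    then show ?thesis by (intro bexI[of _ "{}"]) auto
  qed
next
  case Empty
  then show ?case by (intro bexI[of _ "{}"]) auto
next
  case (Compl A)
  then obtain C where C: "C \<in> sets Hs" "AE \<omega> in M. t < \<gamma> \<omega> \<longrightarrow> (\<omega> \<in> A \<longleftrightarrow> \<omega> \<in> C)" by blast
  from C(1) have "space Hs - C \<in> sets Hs" by (rule sets.compl_sets)
  moreover have "AE \<omega> in M. t < \<gamma> \<omega> \<longrightarrow> (\<omega> \<in> space M - A \<longleftrightarrow> \<omega> \<in> space Hs - C)"
    using C(2) by eventually_elim auto
  ultimately show ?case by blast
next
  case (Union A)
  then obtain C where C: "\<And>i. C i \<in> sets Hs" "\<And>i. AE \<omega> in M. t < \<gamma> \<omega> \<longrightarrow> (\<omega> \<in> A i \<longleftrightarrow> \<omega> \<in> C i)"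
    by metis
  have "AE \<omega> in M. \<forall>i::nat. t < \<gamma> \<omega> \<longrightarrow> (\<omega> \<in> A i \<longleftrightarrow> \<omega> \<in> C i)"
    unfolding AE_all_countable by (intro allI C(2))
  then have "AE \<omega> in M. t < \<gamma> \<omega> \<longrightarrow> (\<omega> \<in> (\<Union>i. A i) \<longleftrightarrow> \<omega> \<in> (\<Union>i. C i))"
    by eventually_elim auto
  then show ?case using C(1) by (intro bexI[of _ "\<Union>i. C i"]) auto
qed

section \<open>Predictable sets, stopping, and traces up to the jump\<close>

abbreviation Pred :: "(real \<times> 'a) measure" where "Pred \<equiv> predictable_sigma Fi"

lemma Pred_generators:
  "{{0} \<times> B |B. B \<in> sets (Fi 0)} \<union> {{s<..t} \<times> B |s t B. 0 \<le> s \<and> s \<le> t \<and> B \<in> sets (Fi (ennreal s))}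
     \<subseteq> Pow ({0::real..} \<times> space (Fi 0))"
  using sets.sets_into_space by fastforce

lemma space_Pred [simp]: "space Pred = {0..} \<times> space M"
  unfolding predictable_sigma_def using Pred_generators by (simp add: space_measure_of)

lemma sets_Pred: "sets Pred = sigma_sets ({0..} \<times> space M)
   ({{0} \<times> B |B. B \<in> sets (Fi 0)} \<union> {{s<..t} \<times> B |s t B. 0 \<le> s \<and> s \<le> t \<and> B \<in> sets (Fi (ennreal s))})"
  unfolding predictable_sigma_def using Pred_generators by (simp add: sets_measure_of)

lemma Pred_zero: "B \<in> sets (Fi 0) \<Longrightarrow> {0} \<times> B \<in> sets Pred"
  unfolding sets_Pred by (intro sigma_sets.Basic) auto

lemma Pred_Ioc: "0 \<le> s \<Longrightarrow> B \<in> sets (Fi (ennreal s)) \<Longrightarrow> {s<..t} \<times> B \<in> sets Pred"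
proof (cases "s \<le> t")
  case True
  assume "0 \<le> s" "B \<in> sets (Fi (ennreal s))"
  with True show ?thesis unfolding sets_Pred by (intro sigma_sets.Basic) auto
qed auto

lemma Pred_Ioi: 
  assumes "0 \<le> s" "B \<in> sets (Fi (ennreal s))"
  shows "{s<..} \<times> B \<in> sets Pred"
proof -
  have "{s<..} \<times> B = (\<Union>n::nat. {s<..real n} \<times> B)"
    using real_arch_simple by fastforce
  then show ?thesis using Pred_Ioc[OF assms] by auto
qed

lemma Pred_snd: "snd \<in> measurable Pred Hs"
proof (rule measurableI)
  fix C assume C: "C \<in> sets Hs"
  then have "C \<in> sets (Fi 0)" "C \<subseteq> space M"
    using Hs_Fi[of 0 C] sets.sets_into_space by fastforce+
  then have "{0} \<times> C \<union> {0<..} \<times> C \<in> sets Pred"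
    using Pred_zero Pred_Ioi[of 0 C] by auto
  moreover have "snd -` C \<inter> space Pred = {0} \<times> C \<union> {0<..} \<times> C"
    using \<open>C \<subseteq> space M\<close> by auto
  ultimately show "snd -` C \<inter> space Pred \<in> sets Pred" by simp
qed auto

text \<open>The level sets are the half-infinite rectangles over \<open>{a<..}\<close> and
  \<open>{a < T}\<close>, which are predictable. Only the events \<open>{s < T}\<close> matter, so
  the lemma serves \<open>\<gamma>\<close> and stopping times alike.\<close>

lemma Pred_min:
  assumes T: "\<And>s. 0 \<le> s \<Longrightarrow> {\<omega> \<in> space M. ennreal s < T \<omega>} \<in> sets (Fi (ennreal s))"
  shows "(\<lambda>x. min (ennreal (fst x)) (T (snd x))) \<in> borel_measurable Pred"
proof (rule borel_measurableI_greater)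
  fix y :: ennreal
  show "{x \<in> space Pred. y < min (ennreal (fst x)) (T (snd x))} \<in> sets Pred"
  proof (cases y)
    case (real a)
    then have "{x \<in> space Pred. y < min (ennreal (fst x)) (T (snd x))} =
        {a<..} \<times> {\<omega> \<in> space M. ennreal a < T \<omega>}"
      by (auto simp: ennreal_less_iff)
    then show ?thesis using Pred_Ioi[OF _ T] real by simp
  next
    case top
    then have e: "{x \<in> space Pred. y < min (ennreal (fst x)) (T (snd x))} = {}"
      by (auto simp: not_less)
    show ?thesis unfolding e by simp
  qed
qed

lemma stopping_time_greater:
  assumes "stopping_time Fi T"
  shows "{\<omega> \<in> space M. t < T \<omega>} \<in> sets (Fi t)"
proof -
  have "Measurable.pred (Fi t) (\<lambda>\<omega>. T \<omega> \<le> t)"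
    using assms by (simp add: stopping_time_def)
  then have "Measurable.pred (Fi t) (\<lambda>\<omega>. \<not> T \<omega> \<le> t)" by measurable
  then have "{\<omega> \<in> space (Fi t). \<not> T \<omega> \<le> t} \<in> sets (Fi t)" by measurable
  then show ?thesis by (simp add: not_le)
qed

text \<open>Stopping is composition with \<open>\<phi>\<close>, so everything rests on
  \<open>\<phi>\<close> being measurable from the predictable \<open>\<sigma>\<close>-algebra to
  itself. For a generator \<open>{s<..t} \<times> B\<close> the stopped time exceeds
  \<open>s\<close> iff \<open>s < u\<close> and \<open>s < T\<close>, and the latter event is known
  at \<open>s\<close>.\<close>

lemma predictable_process_stopped:
  assumes D: "predictable_process Fi D" and T: "stopping_time Fi T"
  shows "predictable_process Fi (stopped_process T D)"
proof -
  define \<phi> where "\<phi> x = (enn2real (min (ennreal (fst x)) (T (snd x))), snd x)" for x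
  have min_m [measurable]: "(\<lambda>x. min (ennreal (fst x)) (T (snd x))) \<in> borel_measurable Pred"
    by (rule Pred_min) (rule stopping_time_greater[OF T])
  have "\<phi> \<in> measurable Pred Pred"
  proof -
    have "\<phi> \<in> measurable Pred (sigma ({0..} \<times> space M) ({{0} \<times> B |B. B \<in> sets (Fi 0)} \<union>
        {{s<..t} \<times> B |s t B. 0 \<le> s \<and> s \<le> t \<and> B \<in> sets (Fi (ennreal s))}))"
    proof (rule measurable_measure_of)
      show "{{0} \<times> B |B. B \<in> sets (Fi 0)} \<union>
        {{s<..t} \<times> B |s t B. 0 \<le> s \<and> s \<le> t \<and> B \<in> sets (Fi (ennreal s))} \<subseteq> Pow ({0::real..} \<times> space M)"
        using Pred_generators by simp
      show "\<phi> \<in> space Pred \<rightarrow> {0..} \<times> space M" by (auto simp: \<phi>_def)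
      fix Y assume "Y \<in> {{0} \<times> B |B. B \<in> sets (Fi 0)} \<union>
        {{s<..t} \<times> B |s t B. 0 \<le> s \<and> s \<le> t \<and> B \<in> sets (Fi (ennreal s))}"
      then consider B where "Y = {0} \<times> B" "B \<in> sets (Fi 0)"
        | s t B where "Y = {s<..t} \<times> B" "0 \<le> s" "s \<le> t" "B \<in> sets (Fi (ennreal s))" by blast
      then show "\<phi> -` Y \<inter> space Pred \<in> sets Pred"
      proof cases
        case 1
        have T0: "{\<omega> \<in> space M. T \<omega> \<le> 0} \<in> sets (Fi 0)"
          using T[unfolded stopping_time_def, rule_format, of 0] by (simp add: pred_def)
        have "\<phi> -` Y \<inter> space Pred = {0} \<times> B \<union> {0<..} \<times> (B \<inter> {\<omega> \<in> space M. T \<omega> \<le> 0})"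
          using 1 sets.sets_into_space[OF 1(2)]
          by (auto simp: \<phi>_def enn2real_eq_0_iff min_def split: if_splits)
        then show ?thesis using Pred_zero[OF 1(2)] Pred_Ioi[of 0 "B \<inter> {\<omega> \<in> space M. T \<omega> \<le> 0}"] T0 1 by auto
      next
        case 2
        have m: "enn2real (min (ennreal u) (T \<omega>)) \<in> {s<..t} \<longleftrightarrow>
            s < u \<and> ennreal s < T \<omega> \<and> min (ennreal u) (T \<omega>) \<le> ennreal t" if "0 \<le> u" for u \<omega>
        proof -
          have lt: "min (ennreal u) (T \<omega>) < top" by (simp add: min_less_iff_disj)
          then obtain r where r: "min (ennreal u) (T \<omega>) = ennreal r" "0 \<le> r"
            by (metis ennreal_cases less_irrefl)
          have "s < r \<longleftrightarrow> ennreal s < min (ennreal u) (T \<omega>)" using r 2 by (simp add: ennreal_less_iff)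
          also have "\<dots> \<longleftrightarrow> s < u \<and> ennreal s < T \<omega>" using 2 by (simp add: ennreal_less_iff)
          finally show ?thesis using r 2 by (auto simp: ennreal_le_iff)
        qed
        have "\<phi> -` Y \<inter> space Pred = ({s<..} \<times> (B \<inter> {\<omega> \<in> space M. ennreal s < T \<omega>})) \<inter>
            {x \<in> space Pred. min (ennreal (fst x)) (T (snd x)) \<le> ennreal t}"
          using 2 sets.sets_into_space[OF 2(4)]
          by (auto simp: \<phi>_def m simp del: greaterThanAtMost_iff)
        moreover have "{s<..} \<times> (B \<inter> {\<omega> \<in> space M. ennreal s < T \<omega>}) \<in> sets Pred"
          using 2 stopping_time_greater[OF T] by (intro Pred_Ioi) auto
        moreover have "{x \<in> space Pred. min (ennreal (fst x)) (T (snd x)) \<le> ennreal t} \<in> sets Pred"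
          by measurable
        ultimately show ?thesis by (simp only: sets.Int)
      qed
    qed
    then show "\<phi> \<in> measurable Pred Pred"
      by (simp add: predictable_sigma_def)
  qed
  then have "(\<lambda>x. (case x of (t, \<omega>) \<Rightarrow> D t \<omega>)) \<circ> \<phi> \<in> borel_measurable Pred"
    using D unfolding predictable_process_def by (rule measurable_comp)
  then show ?thesis
    unfolding predictable_process_def by (simp add: \<phi>_def stopped_process_def comp_def case_prod_beta')
qed

text \<open>In a generator \<open>{s<..t} \<times> B\<close> only times \<open>u > s\<close> count,
  and \<open>u \<le> \<gamma>\<close> then forces \<open>s < \<gamma>\<close>, where
  \<open>B\<close> agrees with a set of \<open>Hs\<close>. Because the interval is left-open this
  works up to and including \<open>\<gamma>\<close>; for the generator \<open>{0} \<times> B\<close>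
  it works because \<open>\<gamma> > 0\<close>.\<close>

lemma predictable_trace_set:
  assumes "S \<in> sets Pred"
  shows "\<exists>S'\<in>sets (borel \<Otimes>\<^sub>M Hs). AE \<omega> in M. \<forall>t\<ge>0. ennreal t \<le> \<gamma> \<omega> \<longrightarrow> ((t, \<omega>) \<in> S \<longleftrightarrow> (t, \<omega>) \<in> S')"
  using assms unfolding sets_Pred
proof (induction rule: sigma_sets.induct)
  case (Basic A)
  then consider B where "A = {0} \<times> B" "B \<in> sets (Fi 0)"
    | s t B where "A = {s<..t} \<times> B" "0 \<le> s" "s \<le> t" "B \<in> sets (Fi (ennreal s))" by blast
  then show ?case
  proof cases
    case 1
    then obtain C where C: "C \<in> sets Hs" "AE \<omega> in M. 0 < \<gamma> \<omega> \<longrightarrow> (\<omega> \<in> B \<longleftrightarrow> \<omega> \<in> C)"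
      using Fi_trace[of 0 B] by auto
    show ?thesis
      using C(1)
    proof (intro bexI[of _ "{0} \<times> C"])
      show "AE \<omega> in M. \<forall>t\<ge>0. ennreal t \<le> \<gamma> \<omega> \<longrightarrow> ((t, \<omega>) \<in> A \<longleftrightarrow> (t, \<omega>) \<in> {0} \<times> C)"
        using C(2) \<gamma>_pos by eventually_elim (auto simp: 1)
    qed auto
  next
    case 2
    then obtain C where C: "C \<in> sets Hs" "AE \<omega> in M. ennreal s < \<gamma> \<omega> \<longrightarrow> (\<omega> \<in> B \<longleftrightarrow> \<omega> \<in> C)"
      using Fi_trace[of "ennreal s" B] by auto
    show ?thesis
      using C(1)
    proof (intro bexI[of _ "{s<..t} \<times> C"])
      show "AE \<omega> in M. \<forall>u\<ge>0. ennreal u \<le> \<gamma> \<omega> \<longrightarrow> ((u, \<omega>) \<in> A \<longleftrightarrow> (u, \<omega>) \<in> {s<..t} \<times> C)"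
        using C(2)
      proof eventually_elim
        case (elim \<omega>)
        have "ennreal s < \<gamma> \<omega>" if "s < u" "ennreal u \<le> \<gamma> \<omega>" for u
          using that 2 by (meson ennreal_lessI le_less_trans less_le_trans)
        then show ?case using elim by (auto simp: 2)
      qed
    qed auto
  qed
next
  case Empty
  then show ?case by (intro bexI[of _ "{}"]) auto
next
  case (Compl A)
  then obtain S' where S': "S' \<in> sets (borel \<Otimes>\<^sub>M Hs)"
    "AE \<omega> in M. \<forall>t\<ge>0. ennreal t \<le> \<gamma> \<omega> \<longrightarrow> ((t, \<omega>) \<in> A \<longleftrightarrow> (t, \<omega>) \<in> S')" by blast
  have "AE \<omega> in M. \<forall>t\<ge>0. ennreal t \<le> \<gamma> \<omega> \<longrightarrow> ((t, \<omega>) \<in> {0..} \<times> space M - A \<longleftrightarrow> (t, \<omega>) \<in> space (borel \<Otimes>\<^sub>M Hs) - S')"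
    using S'(2) AE_space by eventually_elim (auto simp: space_pair_measure)
  then show ?case using S'(1) by (intro bexI[of _ "space (borel \<Otimes>\<^sub>M Hs) - S'"]) auto
next
  case (Union A)
  then have "\<forall>i. \<exists>S'. S' \<in> sets (borel \<Otimes>\<^sub>M Hs) \<and>
    (AE \<omega> in M. \<forall>t\<ge>0. ennreal t \<le> \<gamma> \<omega> \<longrightarrow> ((t, \<omega>) \<in> A i \<longleftrightarrow> (t, \<omega>) \<in> S'))"
    by blast
  from choice[OF this] obtain S' where S': "\<And>i::nat. S' i \<in> sets (borel \<Otimes>\<^sub>M Hs)"
    "\<And>i. AE \<omega> in M. \<forall>t\<ge>0. ennreal t \<le> \<gamma> \<omega> \<longrightarrow> ((t, \<omega>) \<in> A i \<longleftrightarrow> (t, \<omega>) \<in> S' i)"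
    by blast
  have "AE \<omega> in M. \<forall>i. \<forall>t\<ge>0. ennreal t \<le> \<gamma> \<omega> \<longrightarrow> ((t, \<omega>) \<in> A i \<longleftrightarrow> (t, \<omega>) \<in> S' i)"
    unfolding AE_all_countable by (intro allI S'(2))
  then have "AE \<omega> in M. \<forall>t\<ge>0. ennreal t \<le> \<gamma> \<omega> \<longrightarrow> ((t, \<omega>) \<in> (\<Union>i. A i) \<longleftrightarrow> (t, \<omega>) \<in> (\<Union>i. S' i))"
    by eventually_elim auto
  then show ?case using S'(1) by (intro bexI[of _ "\<Union>i. S' i"]) auto
qed

lemma predictable_trace:
  assumes X: "predictable_process Fi X"
  shows "\<exists>p\<in>borel_measurable (borel \<Otimes>\<^sub>M Hs). AE \<omega> in M. \<forall>t\<ge>0. ennreal t \<le> \<gamma> \<omega> \<longrightarrow> X t \<omega> = p (t, \<omega>)"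
proof -
  have Xm [measurable]: "(\<lambda>(t, \<omega>). X t \<omega>) \<in> borel_measurable Pred"
    using X by (simp add: predictable_process_def)
  have "{x \<in> space Pred. (case x of (t, \<omega>) \<Rightarrow> X t \<omega>) \<le> real_of_rat q} \<in> sets Pred" for q
    by measurable
  from predictable_trace_set[OF this]
  have "\<forall>q. \<exists>S. S \<in> sets (borel \<Otimes>\<^sub>M Hs) \<and> (AE \<omega> in M. \<forall>t\<ge>0. ennreal t \<le> \<gamma> \<omega> \<longrightarrow>
       ((t, \<omega>) \<in> {x \<in> space Pred. (case x of (t, \<omega>) \<Rightarrow> X t \<omega>) \<le> real_of_rat q} \<longleftrightarrow> (t, \<omega>) \<in> S))"
    by blast
  from choice[OF this] obtain S where S: "\<And>q. S q \<in> sets (borel \<Otimes>\<^sub>M Hs)"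
    "\<And>q. AE \<omega> in M. \<forall>t\<ge>0. ennreal t \<le> \<gamma> \<omega> \<longrightarrow>
       ((t, \<omega>) \<in> {x \<in> space Pred. (case x of (t, \<omega>) \<Rightarrow> X t \<omega>) \<le> real_of_rat q} \<longleftrightarrow> (t, \<omega>) \<in> S q)"
    by blast
  \<comment> \<open>\<open>p\<close> is rebuilt from the traces of the rational level sets of
    \<open>X\<close>. There are countably many of them, so one null set serves all times
    \<open>t\<close>.\<close>
  define p where "p x = real_of_ereal (INF q. if x \<in> S q then ereal (real_of_rat q) else \<infinity>)" for x
  have [measurable]: "S q \<in> sets (borel \<Otimes>\<^sub>M Hs)" for q by (rule S)
  have pm: "p \<in> borel_measurable (borel \<Otimes>\<^sub>M Hs)"
    unfolding p_def by measurable
  have "AE \<omega> in M. \<forall>q. \<forall>t\<ge>0. ennreal t \<le> \<gamma> \<omega> \<longrightarrow>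
       ((t, \<omega>) \<in> {x \<in> space Pred. (case x of (t, \<omega>) \<Rightarrow> X t \<omega>) \<le> real_of_rat q} \<longleftrightarrow> (t, \<omega>) \<in> S q)"
    using S(2) by (simp only: AE_all_countable) blast
  with AE_space have "AE \<omega> in M. \<forall>t\<ge>0. ennreal t \<le> \<gamma> \<omega> \<longrightarrow> X t \<omega> = p (t, \<omega>)"
  proof eventually_elim
    case (elim \<omega>)
    show ?case
    proof (intro allI impI)
      fix t :: real assume t: "0 \<le> t" "ennreal t \<le> \<gamma> \<omega>"
      then have iff: "(t, \<omega>) \<in> S q \<longleftrightarrow> X t \<omega> \<le> real_of_rat q" for q
        using elim by auto
      have "(INF q. if (t, \<omega>) \<in> S q then ereal (real_of_rat q) else \<infinity>) = ereal (X t \<omega>)"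
      proof (rule antisym)
        show "ereal (X t \<omega>) \<le> (INF q. if (t, \<omega>) \<in> S q then ereal (real_of_rat q) else \<infinity>)"
          by (intro INF_greatest) (auto simp: iff)
        show "(INF q. if (t, \<omega>) \<in> S q then ereal (real_of_rat q) else \<infinity>) \<le> ereal (X t \<omega>)"
        proof (rule ereal_le_epsilon2)
          fix e :: real assume "0 < e"
          then obtain q where q: "X t \<omega> < real_of_rat q" "real_of_rat q < X t \<omega> + e"
            using of_rat_dense[of "X t \<omega>" "X t \<omega> + e"] by auto
          have "(INF q. if (t, \<omega>) \<in> S q then ereal (real_of_rat q) else \<infinity>) \<le> ereal (real_of_rat q)"
            using q by (intro INF_lower2[of q]) (auto simp: iff)
          also have "\<dots> \<le> ereal (X t \<omega>) + ereal e" using q by simp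
          finally show "(INF q. if (t, \<omega>) \<in> S q then ereal (real_of_rat q) else \<infinity>) \<le> ereal (X t \<omega>) + ereal e" .
        qed
      qed
      then show "X t \<omega> = p (t, \<omega>)" by (simp add: p_def)
    qed
  qed
  with pm show ?thesis by blast
qed

end

section \<open>The conditional law of the jump time\<close>

text \<open>The points without mass from them onwards form an up-set. Its infimum either belongs to
  it or is approached by a sequence in it, so the up-set lies in one null tail or in a countable
  union of null tails.\<close>

lemma AE_survival_pos:
  fixes N :: "ennreal measure"
  assumes [measurable_cong]: "sets N = sets borel"
  shows "AE v in N. emeasure N {v..} \<noteq> 0"
proof -
  define Z where "Z = {v. emeasure N {v..} = 0}"
  have up: "u \<in> Z" if "v \<in> Z" "v \<le> u" for u v
  proof -
    have "emeasure N {u..} \<le> emeasure N {v..}" using that by (intro emeasure_mono) auto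
    then show ?thesis using that by (simp add: Z_def)
  qed
  have "\<exists>X\<in>null_sets N. Z \<subseteq> X"
  proof (cases "Z = {}")
    case True
    then show ?thesis by (intro bexI[of _ "{}"]) auto
  next
    case False
    obtain u where u: "\<And>n. u n \<in> Z" "u \<longlonglongrightarrow> Inf Z"
      using Inf_as_limit[OF False] by blast
    have null: "{v..} \<in> null_sets N" if "v \<in> Z" for v
      using that by (auto simp: Z_def null_sets_def)
    have "(\<Union>n. {u n..}) \<in> null_sets N" using u by (intro null_sets_UN null) auto
    show ?thesis
    proof (cases "Inf Z \<in> Z")
      case True
      then show ?thesis by (intro bexI[OF _ null[OF True]]) (auto intro: Inf_lower)
    next
      case False
      have "Z \<subseteq> (\<Union>n. {u n..})"
      proof
        fix v assume "v \<in> Z"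
        then have "Inf Z < v" using False Inf_lower[of v Z] by (metis le_less)
        then have "eventually (\<lambda>n. u n < v) sequentially" by (rule order_tendstoD(2)[OF u(2)])
        then show "v \<in> (\<Union>n. {u n..})" by (auto simp: eventually_sequentially intro: less_imp_le)
      qed
      then show ?thesis using \<open>(\<Union>n. {u n..}) \<in> null_sets N\<close> by blast
    qed
  qed
  then obtain X where "X \<in> null_sets N" "Z \<subseteq> X" by blast
  then show ?thesis by (intro AE_I'[of X]) (auto simp: Z_def)
qed

section \<open>Quantile construction of the conditional law and disintegration\<close>

definition unif01 :: "real measure" where "unif01 = uniform_measure lborel {0<..<1}"

lemma sets_unif01 [simp, measurable_cong]: "sets unif01 = sets borel" and space_unif01 [simp]: "space unif01 = UNIV"
  by (simp_all add: unif01_def)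

interpretation unif01: prob_space unif01
  unfolding unif01_def by (rule prob_space_uniform_measure) auto

lemma emeasure_unif01_atMost: "0 \<le> c \<Longrightarrow> c \<le> 1 \<Longrightarrow> emeasure unif01 {..c} = ennreal c"
proof -
  assume c: "0 \<le> c" "c \<le> 1"
  have "emeasure unif01 {..c} = emeasure lborel ({0<..<1} \<inter> {..c})"
    unfolding unif01_def by (subst emeasure_uniform_measure) (auto simp: divide_ennreal_def)
  also have "\<dots> = ennreal c"
  proof (cases "c = 1")
    case True
    then have "{0<..<1} \<inter> {..c} = {0<..<1}" by auto
    then show ?thesis using True by simp
  next
    case False
    then have "{0<..<1} \<inter> {..c} = {0<..c}" using c by auto
    then show ?thesis using c by simp
  qed
  finally show ?thesis .
qed

lemma sets_ennreal_atMost: "sets (borel :: ennreal measure) = sigma_sets UNIV (range atMost)"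
proof -
  have "sigma_sets UNIV (range greaterThan) = sigma_sets UNIV (range (atMost :: ennreal \<Rightarrow> _))"
  proof (rule sigma_sets_eqI)
    fix A :: "ennreal set" assume "A \<in> range greaterThan"
    then obtain x where "A = {x<..}" by auto
    then have "A = UNIV - {..x}" by auto
    then show "A \<in> sigma_sets UNIV (range atMost)" by (auto intro: sigma_sets.Compl sigma_sets.Basic)
  next
    fix A :: "ennreal set" assume "A \<in> range atMost"
    then obtain x where "A = {..x}" by auto
    then have "A = UNIV - {x<..}" by auto
    then show "A \<in> sigma_sets UNIV (range greaterThan)" by (auto intro: sigma_sets.Compl sigma_sets.Basic)
  qed
  then show ?thesis by (simp add: borel_Ioi)
qed

locale single_jump_df = single_jump +
  fixes G :: "real \<Rightarrow> 'a \<Rightarrow> real"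
  assumes G: "regular_cond_df M Hs \<gamma> G"
begin

lemma G_mono: "\<omega> \<in> space M \<Longrightarrow> mono_on {0..} (\<lambda>t. G t \<omega>)"
  and G_rc: "\<omega> \<in> space M \<Longrightarrow> 0 \<le> t \<Longrightarrow> continuous (at_right t) (\<lambda>s. G s \<omega>)"
  and G_bounds: "\<omega> \<in> space M \<Longrightarrow> 0 \<le> t \<Longrightarrow> 0 \<le> G t \<omega>" "\<omega> \<in> space M \<Longrightarrow> 0 \<le> t \<Longrightarrow> G t \<omega> \<le> 1"
  and G_measurable: "0 \<le> t \<Longrightarrow> G t \<in> borel_measurable Hs"
  and G_cond: "0 \<le> t \<Longrightarrow> AE \<omega> in M. G t \<omega> = real_cond_exp M Hs (indicator {\<omega> \<in> space M. \<gamma> \<omega> \<le> ennreal t}) \<omega>"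
  using G unfolding regular_cond_df_def by auto

text \<open>The quantile function of \<open>G\<close>, with values in
  \<open>[0, \<infinity>]\<close>: a level that \<open>G\<close> never reaches is sent to
  \<open>\<infinity>\<close>, which puts the remaining mass there. The restriction to rational times
  makes the infimum countable and hence measurable in both arguments.\<close>

definition Q :: "'a \<Rightarrow> real \<Rightarrow> ennreal" where
  "Q \<omega> u = (INF q\<in>\<rat> \<inter> {0..}. if u \<le> G q \<omega> then ennreal q else \<infinity>)"

text \<open>The Galois relation between \<open>G\<close> and its quantile function; it is what gives
  \<open>{..t}\<close> the mass \<open>G t\<close> under the image of the uniform law.
  Right-continuity is used in the direction from \<open>Q\<close> to \<open>G\<close>.\<close>

lemma Q_le_iff:
  assumes \<omega>: "\<omega> \<in> space M" and t: "0 \<le> t"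
  shows "Q \<omega> u \<le> ennreal t \<longleftrightarrow> u \<le> G t \<omega>"
proof
  assume u: "u \<le> G t \<omega>"
  show "Q \<omega> u \<le> ennreal t"
  proof (rule ennreal_le_epsilon)
    fix e :: real assume e: "0 < e"
    then obtain q where q: "q \<in> \<rat>" "t < q" "q < t + e" using Rats_dense_in_real[of t "t + e"] by auto
    then have "G t \<omega> \<le> G q \<omega>" using G_mono[OF \<omega>] t by (auto simp: mono_on_def)
    then have "Q \<omega> u \<le> ennreal q"
      unfolding Q_def using q t u by (intro INF_lower2[of q]) auto
    also have "ennreal q \<le> ennreal t + ennreal e" using q t e by (simp flip: ennreal_plus)
    finally show "Q \<omega> u \<le> ennreal t + ennreal e" .
  qed
next
  assume Q: "Q \<omega> u \<le> ennreal t"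
  have "u \<le> G s \<omega>" if "t < s" for s
  proof -
    have "Q \<omega> u < ennreal s" using Q that t by (meson ennreal_lessI le_less_trans less_le_trans)
    then obtain q where q: "q \<in> \<rat> \<inter> {0..}" "(if u \<le> G q \<omega> then ennreal q else \<infinity>) < ennreal s"
      unfolding Q_def INF_less_iff by blast
    then have "u \<le> G q \<omega>" "q < s" by (auto simp: ennreal_less_iff split: if_splits)
    moreover have "G q \<omega> \<le> G s \<omega>" using G_mono[OF \<omega>] q calculation by (auto simp: mono_on_def)
    ultimately show ?thesis by linarith
  qed
  moreover have "eventually (\<lambda>s. s \<in> {t<..<t+1}) (at_right t)" by (rule eventually_at_right_real) simp
  ultimately have "eventually (\<lambda>s. u \<le> G s \<omega>) (at_right t)" by (auto elim: eventually_mono)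
  then show "u \<le> G t \<omega>"
    using G_rc[OF \<omega> t] unfolding continuous_within
    by (intro tendsto_lowerbound[where F = "at_right t"]) auto
qed

lemma Q_measurable [measurable]: "(\<lambda>(\<omega>, u). Q \<omega> u) \<in> borel_measurable (Hs \<Otimes>\<^sub>M borel)"
proof -
  have "(\<lambda>x. INF q\<in>\<rat> \<inter> {0..}. if snd x \<le> G q (fst x) then ennreal q else \<infinity>) \<in> borel_measurable (Hs \<Otimes>\<^sub>M borel)"
  proof (rule borel_measurable_INF)
    show "countable (\<rat> \<inter> {0::real..})" by (intro countable_Int1 countable_rat)
    fix q :: real assume "q \<in> \<rat> \<inter> {0..}"
    then have [measurable]: "G q \<in> borel_measurable Hs" by (auto intro: G_measurable)
    show "(\<lambda>x. if snd x \<le> G q (fst x) then ennreal q else \<infinity>) \<in> borel_measurable (Hs \<Otimes>\<^sub>M borel)"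
      by measurable
  qed
  then show ?thesis by (simp add: Q_def case_prod_beta')
qed

text \<open>As the image of one fixed law, \<open>\<kappa> \<omega>\<close> reduces its integrals to
  integrals over \<open>unif01\<close>; measurability in \<open>\<omega>\<close> and exchange of
  integrals are then those of the product \<open>M \<Otimes>\<^sub>M unif01\<close>.\<close>

definition \<kappa> :: "'a \<Rightarrow> ennreal measure" where "\<kappa> \<omega> = distr unif01 borel (Q \<omega>)"

lemma sets_\<kappa> [simp, measurable_cong]: "sets (\<kappa> \<omega>) = sets borel" and space_\<kappa> [simp]: "space (\<kappa> \<omega>) = UNIV"
  by (simp_all add: \<kappa>_def)

lemma Q_section [measurable]: "\<omega> \<in> space M \<Longrightarrow> Q \<omega> \<in> borel_measurable borel"
  using measurable_Pair2[OF Q_measurable, of \<omega>] by simp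

lemma prob_space_\<kappa>: "\<omega> \<in> space M \<Longrightarrow> prob_space (\<kappa> \<omega>)"
  unfolding \<kappa>_def by (rule unif01.prob_space_distr) simp

lemma \<kappa>_measurable [measurable]: "\<kappa> \<in> measurable Hs (subprob_algebra borel)"
  unfolding \<kappa>_def
proof (rule measurable_distr2)
  have "Hs \<Otimes>\<^sub>M unif01 = Hs \<Otimes>\<^sub>M unif01" ..
  show "case_prod Q \<in> borel_measurable (Hs \<Otimes>\<^sub>M borel)" by (rule Q_measurable)
  show "(\<lambda>_. unif01) \<in> Hs \<rightarrow>\<^sub>M subprob_algebra borel"
    using unif01.subprob_space_axioms by (intro measurable_const) (simp add: space_subprob_algebra)
qed

lemma emeasure_\<kappa>_atMost:
  assumes "\<omega> \<in> space M" "0 \<le> t"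
  shows "emeasure (\<kappa> \<omega>) {..ennreal t} = ennreal (G t \<omega>)"
proof -
  have "emeasure (\<kappa> \<omega>) {..ennreal t} = emeasure unif01 {..G t \<omega>}"
    unfolding \<kappa>_def using assms by (subst emeasure_distr) (auto intro!: arg_cong[where f = "emeasure unif01"] simp: Q_le_iff)
  then show ?thesis using assms G_bounds by (simp add: emeasure_unif01_atMost)
qed

lemma nn_integral_\<kappa>:
  assumes "\<omega> \<in> space M" "f \<in> borel_measurable borel"
  shows "(\<integral>\<^sup>+v. f v \<partial>\<kappa> \<omega>) = (\<integral>\<^sup>+u. f (Q \<omega> u) \<partial>unif01)"
  unfolding \<kappa>_def using assms by (intro nn_integral_distr) auto

lemma Hs_id [measurable]: "(\<lambda>\<omega>. \<omega>) \<in> measurable M Hs"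
  using sets_Hs by (intro measurableI) (auto dest: sets.sets_into_space)

text \<open>Both laws are tested on \<open>{..x} \<times> C\<close> with \<open>C\<close> in
  \<open>Hs\<close>; such sets generate, because the second coordinate carries only
  \<open>Hs\<close>. For finite \<open>x\<close> the masses agree because \<open>G\<close> is a
  version of the conditional probability of \<open>\<gamma> \<le> x\<close>; for
  \<open>x = \<infinity>\<close> both equal the mass of \<open>C\<close>.\<close>

lemma disintegration_distr:
  "distr M (borel \<Otimes>\<^sub>M Hs) (\<lambda>\<omega>. (\<gamma> \<omega>, \<omega>)) =
   distr (M \<Otimes>\<^sub>M unif01) (borel \<Otimes>\<^sub>M Hs) (\<lambda>(\<omega>, u). (Q \<omega> u, \<omega>))" (is "?A = ?B")
proof -
  interpret c: finite_measure_subalgebra M Hs by unfold_locales (rule sub)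
  interpret MU: pair_prob_space M unif01 ..
  define E where "E = {a \<times> b |a b. a \<in> range (atMost :: ennreal \<Rightarrow> _) \<and> b \<in> sets Hs}"
  have [measurable]: "fst \<in> measurable (M \<Otimes>\<^sub>M unif01) Hs"
    using measurable_compose[OF measurable_fst Hs_id] by simp
  have Qm [measurable]: "(\<lambda>x. Q (fst x) (snd x)) \<in> borel_measurable (M \<Otimes>\<^sub>M unif01)"
  proof -
    have "(\<lambda>x. (fst x, snd x)) \<in> measurable (M \<Otimes>\<^sub>M unif01) (Hs \<Otimes>\<^sub>M borel)" by measurable
    from measurable_compose[OF this Q_measurable] show ?thesis by simp
  qed
  have m1 [measurable]: "(\<lambda>\<omega>. (\<gamma> \<omega>, \<omega>)) \<in> measurable M (borel \<Otimes>\<^sub>M Hs)" by measurable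
  have m2 [measurable]: "(\<lambda>(\<omega>, u). (Q \<omega> u, \<omega>)) \<in> measurable (M \<Otimes>\<^sub>M unif01) (borel \<Otimes>\<^sub>M Hs)"
    unfolding case_prod_beta' by measurable
  have gen: "sets (borel \<Otimes>\<^sub>M Hs) = sigma_sets (UNIV \<times> space M) E"
  proof -
    have "sets (borel \<Otimes>\<^sub>M Hs) = sets (sigma (space borel \<times> space Hs) E)"
      unfolding E_def
      by (rule sets_pair_eq[where Ca = "{{..top}}" and Cb = "{space Hs}"])
         (use sets.sets_into_space[of _ Hs] in \<open>auto simp: sets_ennreal_atMost sets.sigma_sets_eq[of Hs, unfolded space_Hs] sets.top[of Hs, unfolded space_Hs]\<close>)
    moreover have "E \<subseteq> Pow (UNIV \<times> space Hs)" unfolding E_def using sets.sets_into_space by fastforce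
    ultimately show ?thesis by simp
  qed
  show ?thesis
  proof (rule measure_eqI_generator_eq[where E = E and \<Omega> = "UNIV \<times> space M" and A = "\<lambda>_. UNIV \<times> space M"])
    show "Int_stable E"
      unfolding E_def
    proof (rule Int_stableI, safe)
      fix x y :: ennreal and b d assume bd: "b \<in> sets Hs" "d \<in> sets Hs"
      have "{..x} \<times> b \<inter> {..y} \<times> d = {..min x y} \<times> (b \<inter> d)" by auto
      then show "\<exists>a' b'. {..x} \<times> b \<inter> {..y} \<times> d = a' \<times> b' \<and> a' \<in> range atMost \<and> b' \<in> sets Hs"
        using bd by blast
    qed
    show "E \<subseteq> Pow (UNIV \<times> space M)"
      unfolding E_def using sets.sets_into_space[of _ Hs] by fastforce
    show "sets ?A = sigma_sets (UNIV \<times> space M) E" "sets ?B = sigma_sets (UNIV \<times> space M) E"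
      using gen by simp_all
    have "UNIV \<times> space M = {..top::ennreal} \<times> space Hs" by auto
    then show "range (\<lambda>_::nat. UNIV \<times> space M) \<subseteq> E"
      unfolding E_def by (auto intro!: exI[of _ "{..top::ennreal}"] exI[of _ "space M"]) (metis sets.top space_Hs)
    show "(\<Union>i::nat. UNIV \<times> space M) = UNIV \<times> space M" by simp
    interpret A: prob_space ?A by (rule prob_space_distr[OF m1])
    show "emeasure ?A (UNIV \<times> space M) \<noteq> \<infinity>" for i :: nat
      using A.emeasure_finite by simp
    fix X assume "X \<in> E"
    then obtain x C where X: "X = {..x} \<times> C" and C: "C \<in> sets Hs" unfolding E_def by blast
    have CM: "C \<in> sets M" "C \<subseteq> space M" using C sets_Hs sets.sets_into_space[of C M] by auto
    have XS: "X \<in> sets (borel \<Otimes>\<^sub>M Hs)" unfolding X using C by auto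
    have eA: "emeasure ?A X = emeasure M (C \<inter> {\<omega> \<in> space M. \<gamma> \<omega> \<le> x})"
      using CM by (subst emeasure_distr[OF m1 XS]) (auto simp: X intro!: arg_cong[where f = "emeasure M"])
    have "(\<lambda>(\<omega>, u). (Q \<omega> u, \<omega>)) -` X \<inter> space (M \<Otimes>\<^sub>M unif01) \<in> sets (M \<Otimes>\<^sub>M unif01)"
      using measurable_sets[OF m2 XS] .
    then have eB: "emeasure ?B X = (\<integral>\<^sup>+\<omega>. emeasure unif01 (Pair \<omega> -` ((\<lambda>(\<omega>, u). (Q \<omega> u, \<omega>)) -` X \<inter> space (M \<Otimes>\<^sub>M unif01))) \<partial>M)"
      by (subst emeasure_distr[OF m2 XS]) (rule unif01.emeasure_pair_measure_alt)
    show "emeasure ?A X = emeasure ?B X"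
    proof (cases x)
      case top
      have "emeasure ?B X = (\<integral>\<^sup>+\<omega>. indicator C \<omega> \<partial>M)"
        unfolding eB
      proof (intro nn_integral_cong)
        fix \<omega> assume "\<omega> \<in> space M"
        then have "Pair \<omega> -` ((\<lambda>(\<omega>, u). (Q \<omega> u, \<omega>)) -` X \<inter> space (M \<Otimes>\<^sub>M unif01)) = (if \<omega> \<in> C then UNIV else {})"
          by (auto simp: X top space_pair_measure)
        then show "emeasure unif01 (Pair \<omega> -` ((\<lambda>(\<omega>, u). (Q \<omega> u, \<omega>)) -` X \<inter> space (M \<Otimes>\<^sub>M unif01))) = indicator C \<omega>"
          using unif01.emeasure_space_1 by simp
      qed
      also have "\<dots> = emeasure ?A X"
        unfolding eA using CM by (simp add: top Int_absorb2)
      finally show ?thesis by simp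
    next
      case (real t)
      have Gm [measurable]: "G t \<in> borel_measurable M"
        using measurable_from_subalg[OF sub G_measurable[OF real(1)]] .
      have "emeasure ?B X = (\<integral>\<^sup>+\<omega>. ennreal (indicator C \<omega> * G t \<omega>) \<partial>M)"
        unfolding eB
      proof (intro nn_integral_cong)
        fix \<omega> assume \<omega>: "\<omega> \<in> space M"
        then have "Pair \<omega> -` ((\<lambda>(\<omega>, u). (Q \<omega> u, \<omega>)) -` X \<inter> space (M \<Otimes>\<^sub>M unif01)) = (if \<omega> \<in> C then {..G t \<omega>} else {})"
          by (auto simp: X real space_pair_measure Q_le_iff)
        then show "emeasure unif01 (Pair \<omega> -` ((\<lambda>(\<omega>, u). (Q \<omega> u, \<omega>)) -` X \<inter> space (M \<Otimes>\<^sub>M unif01))) = ennreal (indicator C \<omega> * G t \<omega>)"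
          using emeasure_unif01_atMost[of "G t \<omega>"] G_bounds[OF \<omega> real(1)] by simp
      qed
      also have "\<dots> = ennreal (\<integral>\<omega>. indicator C \<omega> * G t \<omega> \<partial>M)"
      proof (rule nn_integral_eq_integral)
        show "integrable M (\<lambda>\<omega>. indicator C \<omega> * G t \<omega>)"
          using CM G_bounds real(1) by (intro integrable_const_bound[of _ 1]) (auto intro!: AE_I2 simp: indicator_def abs_of_nonneg)
      qed (use G_bounds real(1) in \<open>auto intro!: AE_I2 mult_nonneg_nonneg\<close>)
      also have "(\<integral>\<omega>. indicator C \<omega> * G t \<omega> \<partial>M) = (\<integral>\<omega>\<in>C. real_cond_exp M Hs (indicator {\<omega> \<in> space M. \<gamma> \<omega> \<le> ennreal t}) \<omega> \<partial>M)"
        unfolding set_lebesgue_integral_def using G_cond[OF real(1)] CM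
        by (intro integral_cong_AE) auto
      also have "\<dots> = (\<integral>\<omega>\<in>C. indicator {\<omega> \<in> space M. \<gamma> \<omega> \<le> ennreal t} \<omega> \<partial>M)"
        by (rule c.real_cond_exp_intA[symmetric]) (use C in \<open>auto intro!: integrable_real_indicator simp: less_top[symmetric]\<close>)
      also have "\<dots> = measure M (C \<inter> {\<omega> \<in> space M. \<gamma> \<omega> \<le> ennreal t})"
        unfolding set_lebesgue_integral_def using CM
        by (simp add: indicator_inter_arith[symmetric])
      finally show ?thesis unfolding eA by (simp add: real emeasure_eq_measure)
    qed
  qed
qed

lemma Hs_imp_M: "f \<in> measurable Hs N \<Longrightarrow> f \<in> measurable M N"
  by (rule measurable_compose[OF Hs_id])

lemma \<gamma>_pair_measurable [measurable]: "(\<lambda>\<omega>. (\<gamma> \<omega>, \<omega>)) \<in> measurable M (borel \<Otimes>\<^sub>M Hs)"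
  by measurable

lemma nn_integral_\<kappa>_measurable:
  assumes "(\<lambda>(x, v). f x v) \<in> borel_measurable (N \<Otimes>\<^sub>M borel)" "k \<in> measurable N Hs"
  shows "(\<lambda>x. \<integral>\<^sup>+v. f x v \<partial>\<kappa> (k x)) \<in> borel_measurable N"
  using nn_integral_measurable_subprob_algebra2[OF assms(1) measurable_compose[OF assms(2) \<kappa>_measurable]] by simp

lemma disintegration:
  assumes f: "(\<lambda>(v, \<omega>). f v \<omega>) \<in> borel_measurable (borel \<Otimes>\<^sub>M Hs)"
  shows "(\<integral>\<^sup>+\<omega>. f (\<gamma> \<omega>) \<omega> \<partial>M) = (\<integral>\<^sup>+\<omega>. (\<integral>\<^sup>+v. f v \<omega> \<partial>\<kappa> \<omega>) \<partial>M)"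
proof -
  interpret MU: pair_prob_space M unif01 ..
  have [measurable]: "fst \<in> measurable (M \<Otimes>\<^sub>M unif01) Hs"
    using measurable_compose[OF measurable_fst Hs_id] by simp
  have Qm [measurable]: "(\<lambda>x. Q (fst x) (snd x)) \<in> borel_measurable (M \<Otimes>\<^sub>M unif01)"
  proof -
    have "(\<lambda>x. (fst x, snd x)) \<in> measurable (M \<Otimes>\<^sub>M unif01) (Hs \<Otimes>\<^sub>M borel)" by measurable
    from measurable_compose[OF this Q_measurable] show ?thesis by simp
  qed
  have m2: "(\<lambda>(\<omega>, u). (Q \<omega> u, \<omega>)) \<in> measurable (M \<Otimes>\<^sub>M unif01) (borel \<Otimes>\<^sub>M Hs)"
    unfolding case_prod_beta' by measurable
  have "(\<integral>\<^sup>+\<omega>. f (\<gamma> \<omega>) \<omega> \<partial>M) = (\<integral>\<^sup>+x. (case x of (v, \<omega>) \<Rightarrow> f v \<omega>) \<partial>distr M (borel \<Otimes>\<^sub>M Hs) (\<lambda>\<omega>. (\<gamma> \<omega>, \<omega>)))"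
    using f by (subst nn_integral_distr) simp_all
  also have "\<dots> = (\<integral>\<^sup>+x. (case x of (\<omega>, u) \<Rightarrow> f (Q \<omega> u) \<omega>) \<partial>(M \<Otimes>\<^sub>M unif01))"
    unfolding disintegration_distr using f m2 by (subst nn_integral_distr) (auto simp: case_prod_beta')
  also have "\<dots> = (\<integral>\<^sup>+\<omega>. (\<integral>\<^sup>+u. f (Q \<omega> u) \<omega> \<partial>unif01) \<partial>M)"
  proof -
    have "(\<lambda>(\<omega>, u). f (Q \<omega> u) \<omega>) \<in> borel_measurable (M \<Otimes>\<^sub>M unif01)"
      using measurable_compose[OF m2 f] by (simp add: case_prod_beta')
    from unif01.nn_integral_fst[OF this] show ?thesis by simp
  qed
  also have "\<dots> = (\<integral>\<^sup>+\<omega>. (\<integral>\<^sup>+v. f v \<omega> \<partial>\<kappa> \<omega>) \<partial>M)"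
  proof (rule nn_integral_cong)
    fix \<omega> assume \<omega>: "\<omega> \<in> space M"
    then have "(\<lambda>v. f v \<omega>) \<in> borel_measurable borel"
      using measurable_Pair1[OF f, of \<omega>] by simp
    from nn_integral_\<kappa>[OF \<omega> this] show "(\<integral>\<^sup>+u. f (Q \<omega> u) \<omega> \<partial>unif01) = (\<integral>\<^sup>+v. f v \<omega> \<partial>\<kappa> \<omega>)" by simp
  qed
  finally show ?thesis .
qed


section \<open>Conditional survival and the compensation identity\<close>

definition W :: "ennreal \<Rightarrow> 'a \<Rightarrow> real" where "W v \<omega> = measure (\<kappa> \<omega>) {v..}"

lemma emeasure_\<kappa>_measurable:
  assumes "Measurable.pred (N \<Otimes>\<^sub>M borel) (\<lambda>(x, v). P x v)" "k \<in> measurable N Hs"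
  shows "(\<lambda>x. emeasure (\<kappa> (k x)) {v. P x v}) \<in> borel_measurable N"
proof -
  have P [measurable]: "Measurable.pred (N \<Otimes>\<^sub>M borel) (\<lambda>x. P (fst x) (snd x))"
    using assms(1) by (simp add: case_prod_beta')
  have "(\<lambda>x. \<integral>\<^sup>+v. (if P x v then 1 else 0) \<partial>\<kappa> (k x)) \<in> borel_measurable N"
    by (rule nn_integral_\<kappa>_measurable[OF _ assms(2)]) (simp add: case_prod_beta')
  moreover have "(\<integral>\<^sup>+v. (if P x v then 1 else 0) \<partial>\<kappa> (k x)) = emeasure (\<kappa> (k x)) {v. P x v}" if "x \<in> space N" for x
  proof -
    have "(\<lambda>v. P x v) \<in> measurable borel (count_space UNIV)"
      using measurable_compose[OF measurable_Pair1'[OF that] assms(1)] by simp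
    then have "{v. P x v} \<in> sets (\<kappa> (k x))" by (simp add: pred_def)
    moreover have "(\<lambda>v. if P x v then 1 else 0 :: ennreal) = indicator {v. P x v}" by (auto simp: indicator_def)
    ultimately show ?thesis by simp
  qed
  ultimately show ?thesis by (simp cong: measurable_cong)
qed

lemma W_measurable [measurable]: "(\<lambda>(v, \<omega>). W v \<omega>) \<in> borel_measurable (borel \<Otimes>\<^sub>M Hs)"
proof -
  have "(\<lambda>x. emeasure (\<kappa> (snd x)) {y. fst x \<le> y}) \<in> borel_measurable (borel \<Otimes>\<^sub>M Hs)"
    by (rule emeasure_\<kappa>_measurable) (auto simp: case_prod_beta')
  then have "(\<lambda>x. enn2real (emeasure (\<kappa> (snd x)) {y. fst x \<le> y})) \<in> borel_measurable (borel \<Otimes>\<^sub>M Hs)"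
    by measurable
  then show ?thesis by (simp add: W_def measure_def case_prod_beta' atLeast_def)
qed

lemma \<kappa>_section: "(\<lambda>(v, \<omega>). f v \<omega>) \<in> measurable (borel \<Otimes>\<^sub>M Hs) N \<Longrightarrow> \<omega> \<in> space M \<Longrightarrow> (\<lambda>v. f v \<omega>) \<in> measurable borel N"
  using measurable_Pair1[of "\<lambda>(v, \<omega>). f v \<omega>" borel Hs N \<omega>] by simp

lemma graph_measurable:
  "(\<lambda>(v, \<omega>). f v \<omega>) \<in> measurable (borel \<Otimes>\<^sub>M Hs) N \<Longrightarrow> (\<lambda>\<omega>. f (\<gamma> \<omega>) \<omega>) \<in> measurable M N"
  using measurable_compose[OF \<gamma>_pair_measurable, of "\<lambda>(v, \<omega>). f v \<omega>" N] by simp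

lemma emeasure_\<kappa>_atLeast: "\<omega> \<in> space M \<Longrightarrow> emeasure (\<kappa> \<omega>) {v..} = ennreal (W v \<omega>)"
proof -
  assume "\<omega> \<in> space M"
  then interpret k: prob_space "\<kappa> \<omega>" by (rule prob_space_\<kappa>)
  show ?thesis by (simp add: W_def k.emeasure_eq_measure)
qed

lemma W_nonneg: "0 \<le> W v \<omega>" by (simp add: W_def)

lemma AE_\<kappa>_W_pos: "\<omega> \<in> space M \<Longrightarrow> AE v in \<kappa> \<omega>. 0 < W v \<omega>"
  using AE_survival_pos[of "\<kappa> \<omega>"] W_nonneg by (auto simp: emeasure_\<kappa>_atLeast elim!: eventually_mono intro: less_le[THEN iffD2])

lemma AE_disintegration:
  assumes P: "Measurable.pred (borel \<Otimes>\<^sub>M Hs) (\<lambda>(v, \<omega>). P v \<omega>)"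
  shows "(AE \<omega> in M. P (\<gamma> \<omega>) \<omega>) \<longleftrightarrow> (AE \<omega> in M. AE v in \<kappa> \<omega>. P v \<omega>)"
proof -
  define f where "f v \<omega> = (if P v \<omega> then 0 else 1 :: ennreal)" for v \<omega>
  have [measurable]: "Measurable.pred (borel \<Otimes>\<^sub>M Hs) (\<lambda>x. P (fst x) (snd x))"
    using P by (simp add: case_prod_beta')
  have f: "(\<lambda>(v, \<omega>). f v \<omega>) \<in> borel_measurable (borel \<Otimes>\<^sub>M Hs)"
    unfolding f_def case_prod_beta' by measurable
  have f': "(\<lambda>(\<omega>, v). f v \<omega>) \<in> borel_measurable (Hs \<Otimes>\<^sub>M borel)"
    using measurable_compose[OF measurable_pair_swap' f] by (simp add: case_prod_beta')
  have m: "(\<lambda>\<omega>. \<integral>\<^sup>+v. f v \<omega> \<partial>\<kappa> \<omega>) \<in> borel_measurable M"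
    by (rule Hs_imp_M) (rule nn_integral_\<kappa>_measurable[OF f' measurable_ident_sets[OF refl], simplified])
  have "(AE \<omega> in M. P (\<gamma> \<omega>) \<omega>) \<longleftrightarrow> (AE \<omega> in M. f (\<gamma> \<omega>) \<omega> = 0)"
    by (intro AE_cong) (simp add: f_def)
  also have "\<dots> \<longleftrightarrow> (\<integral>\<^sup>+\<omega>. f (\<gamma> \<omega>) \<omega> \<partial>M) = 0"
    by (rule nn_integral_0_iff_AE[symmetric]) (rule graph_measurable[OF f])
  also have "\<dots> \<longleftrightarrow> (AE \<omega> in M. (\<integral>\<^sup>+v. f v \<omega> \<partial>\<kappa> \<omega>) = 0)"
    unfolding disintegration[OF f] by (rule nn_integral_0_iff_AE[OF m])
  also have "\<dots> \<longleftrightarrow> (AE \<omega> in M. AE v in \<kappa> \<omega>. P v \<omega>)"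
  proof (intro AE_cong)
    fix \<omega> assume \<omega>: "\<omega> \<in> space M"
    have "(\<integral>\<^sup>+v. f v \<omega> \<partial>\<kappa> \<omega>) = 0 \<longleftrightarrow> (AE v in \<kappa> \<omega>. f v \<omega> = 0)"
      using \<kappa>_section[OF f \<omega>] by (intro nn_integral_0_iff_AE) simp
    then show "(\<integral>\<^sup>+v. f v \<omega> \<partial>\<kappa> \<omega>) = 0 \<longleftrightarrow> (AE v in \<kappa> \<omega>. P v \<omega>)" by (simp add: f_def)
  qed
  finally show ?thesis .
qed

lemma AE_W_\<gamma>_pos: "AE \<omega> in M. 0 < W (\<gamma> \<omega>) \<omega>"
proof -
  have "Measurable.pred (borel \<Otimes>\<^sub>M Hs) (\<lambda>(v, \<omega>). 0 < W v \<omega>)"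
    using W_measurable unfolding case_prod_beta' by measurable
  from AE_disintegration[OF this] show ?thesis using AE_\<kappa>_W_pos by auto
qed

text \<open>Given \<open>Hs\<close>, an independent copy of \<open>\<gamma>\<close> lies strictly before \<open>\<gamma>\<close> with positive probability
  unless nothing survives it; this transfers path properties on \<open>[0, \<gamma>)\<close> to the time \<open>\<gamma>\<close> itself.\<close>

lemma AE_independent_copy:
  assumes P: "Measurable.pred (borel \<Otimes>\<^sub>M Hs) (\<lambda>(v, \<omega>). P v \<omega>)"
    and before: "AE \<omega> in M. \<forall>v<\<gamma> \<omega>. P v \<omega>"
  shows "AE \<omega> in M. P (\<gamma> \<omega>) \<omega> \<or> emeasure (\<kappa> \<omega>) {\<gamma> \<omega><..} = 0"
proof -
  define f where "f v \<omega> = (if P v \<omega> then 0 else 1 :: ennreal)" for v \<omega>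
  have [measurable]: "Measurable.pred (borel \<Otimes>\<^sub>M Hs) (\<lambda>x. P (fst x) (snd x))"
    using P by (simp add: case_prod_beta')
  have f: "(\<lambda>(v, \<omega>). f v \<omega>) \<in> borel_measurable (borel \<Otimes>\<^sub>M Hs)"
    unfolding f_def case_prod_beta' by measurable
  have fm [measurable]: "(\<lambda>x. f (fst x) (snd x)) \<in> borel_measurable (borel \<Otimes>\<^sub>M Hs)"
    using f by (simp add: case_prod_beta')
  \<comment> \<open>The mass of those points strictly before \<open>y\<close> at which
    \<open>P\<close> fails; by \<open>before\<close> it vanishes at
    \<open>y = \<gamma>\<close>.\<close>
  define \<Psi> where "\<Psi> y \<omega> = (\<integral>\<^sup>+v. f v \<omega> * (if v < y then 1 else 0) \<partial>\<kappa> \<omega>)" for y \<omega>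
  define S where "S v \<omega> = emeasure (\<kappa> \<omega>) {v<..}" for v \<omega>
  have S: "(\<lambda>(v, \<omega>). S v \<omega>) \<in> borel_measurable (borel \<Otimes>\<^sub>M Hs)"
  proof -
    have "(\<lambda>x. emeasure (\<kappa> (snd x)) {y. fst x < y}) \<in> borel_measurable (borel \<Otimes>\<^sub>M Hs)"
      by (rule emeasure_\<kappa>_measurable) (auto simp: case_prod_beta')
    then show ?thesis by (simp add: S_def case_prod_beta' greaterThan_def)
  qed
  have [measurable]: "(\<lambda>x. S (fst x) (snd x)) \<in> borel_measurable (borel \<Otimes>\<^sub>M Hs)"
    using S by (simp add: case_prod_beta')
  have \<Psi>: "(\<lambda>(y, \<omega>). \<Psi> y \<omega>) \<in> borel_measurable (borel \<Otimes>\<^sub>M Hs)"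
  proof -
    have [measurable]: "(\<lambda>x. f (snd x) (snd (fst x))) \<in> borel_measurable ((borel \<Otimes>\<^sub>M Hs) \<Otimes>\<^sub>M borel)"
      using measurable_compose[of "\<lambda>x. (snd x, snd (fst x))" "(borel \<Otimes>\<^sub>M Hs) \<Otimes>\<^sub>M borel" "borel \<Otimes>\<^sub>M Hs", OF _ fm] by simp
    show ?thesis
      unfolding \<Psi>_def case_prod_beta'
      by (rule nn_integral_\<kappa>_measurable) (auto simp: case_prod_beta')
  qed
  have "AE \<omega> in M. \<Psi> (\<gamma> \<omega>) \<omega> = 0"
    using before
  proof eventually_elim
    case (elim \<omega>)
    then have "(\<lambda>v. f v \<omega> * (if v < \<gamma> \<omega> then 1 else 0)) = (\<lambda>_. 0)" by (auto simp: f_def)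
    then show ?case unfolding \<Psi>_def by (simp only: nn_integral_const) simp
  qed
  then have "(\<integral>\<^sup>+\<omega>. \<Psi> (\<gamma> \<omega>) \<omega> \<partial>M) = 0"
    by (subst nn_integral_0_iff_AE) (use graph_measurable[OF \<Psi>] in auto)
  then have "(\<integral>\<^sup>+\<omega>. (\<integral>\<^sup>+y. \<Psi> y \<omega> \<partial>\<kappa> \<omega>) \<partial>M) = 0"
    unfolding disintegration[OF \<Psi>] .
  \<comment> \<open>Exchanging the two copies lets the point of failure be integrated last and
    leaves as its weight \<open>S v\<close>, the mass strictly after it.\<close>
  also have "(\<integral>\<^sup>+\<omega>. (\<integral>\<^sup>+y. \<Psi> y \<omega> \<partial>\<kappa> \<omega>) \<partial>M) = (\<integral>\<^sup>+\<omega>. (\<integral>\<^sup>+v. f v \<omega> * S v \<omega> \<partial>\<kappa> \<omega>) \<partial>M)"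
  proof (rule nn_integral_cong)
    fix \<omega> assume \<omega>: "\<omega> \<in> space M"
    interpret k: prob_space "\<kappa> \<omega>" by (rule prob_space_\<kappa>[OF \<omega>])
    interpret kk: pair_prob_space "\<kappa> \<omega>" "\<kappa> \<omega>" ..
    have [measurable]: "(\<lambda>v. f v \<omega>) \<in> borel_measurable borel" using \<kappa>_section[OF f \<omega>] .
    have "(\<integral>\<^sup>+y. \<Psi> y \<omega> \<partial>\<kappa> \<omega>) = (\<integral>\<^sup>+v. (\<integral>\<^sup>+y. f v \<omega> * (if v < y then 1 else 0) \<partial>\<kappa> \<omega>) \<partial>\<kappa> \<omega>)"
      unfolding \<Psi>_def by (rule kk.Fubini') measurable
    also have "\<dots> = (\<integral>\<^sup>+v. f v \<omega> * S v \<omega> \<partial>\<kappa> \<omega>)"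
    proof (intro nn_integral_cong)
      fix v :: ennreal
      have "(\<integral>\<^sup>+y. (if v < y then 1 else 0) \<partial>\<kappa> \<omega>) = (\<integral>\<^sup>+y. indicator {v<..} y \<partial>\<kappa> \<omega>)"
        by (intro nn_integral_cong) (simp add: indicator_def)
      also have "\<dots> = emeasure (\<kappa> \<omega>) {v<..}" by simp
      finally have "(\<integral>\<^sup>+y. (if v < y then 1 else 0) \<partial>\<kappa> \<omega>) = emeasure (\<kappa> \<omega>) {v<..}" .
      then show "(\<integral>\<^sup>+y. f v \<omega> * (if v < y then 1 else 0) \<partial>\<kappa> \<omega>) = f v \<omega> * S v \<omega>"
        by (simp add: nn_integral_cmult S_def)
    qed
    finally show "(\<integral>\<^sup>+y. \<Psi> y \<omega> \<partial>\<kappa> \<omega>) = (\<integral>\<^sup>+v. f v \<omega> * S v \<omega> \<partial>\<kappa> \<omega>)" .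
  qed
  also have "\<dots> = (\<integral>\<^sup>+\<omega>. f (\<gamma> \<omega>) \<omega> * S (\<gamma> \<omega>) \<omega> \<partial>M)"
    by (rule disintegration[symmetric]) (unfold case_prod_beta', measurable)
  finally have "AE \<omega> in M. f (\<gamma> \<omega>) \<omega> * S (\<gamma> \<omega>) \<omega> = 0"
    by (subst (asm) nn_integral_0_iff_AE) (use graph_measurable[OF f] graph_measurable[OF S] in auto)
  then show ?thesis
    by eventually_elim (auto simp: f_def S_def split: if_splits)
qed

text \<open>Integrating over the jump time first produces the factor \<open>W v\<close>, which
  cancels the denominator; it is positive for \<open>\<kappa>\<close>-almost every
  \<open>v\<close>.\<close>

lemma nn_integral_compensation:
  assumes h: "(\<lambda>(v, \<omega>). h v \<omega>) \<in> borel_measurable (borel \<Otimes>\<^sub>M Hs)" and nonneg: "\<And>v \<omega>. 0 \<le> h v \<omega>"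
  defines "I \<equiv> \<lambda>y \<omega>. \<integral>\<^sup>+v. ennreal (h v \<omega> / W v \<omega>) * (if v \<le> y then 1 else 0) \<partial>\<kappa> \<omega>"
  shows "(\<lambda>(y, \<omega>). I y \<omega>) \<in> borel_measurable (borel \<Otimes>\<^sub>M Hs)"
    and "(\<integral>\<^sup>+\<omega>. I (\<gamma> \<omega>) \<omega> \<partial>M) = (\<integral>\<^sup>+\<omega>. ennreal (h (\<gamma> \<omega>) \<omega>) \<partial>M)"
proof -
  have [measurable]: "(\<lambda>x. h (fst x) (snd x)) \<in> borel_measurable (borel \<Otimes>\<^sub>M Hs)"
    "(\<lambda>x. W (fst x) (snd x)) \<in> borel_measurable (borel \<Otimes>\<^sub>M Hs)"
    using h W_measurable by (simp_all add: case_prod_beta')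
  define f where "f v \<omega> = ennreal (h v \<omega> / W v \<omega>)" for v \<omega>
  have fm [measurable]: "(\<lambda>x. f (fst x) (snd x)) \<in> borel_measurable (borel \<Otimes>\<^sub>M Hs)"
    unfolding f_def by measurable
  have f: "(\<lambda>(v, \<omega>). f v \<omega>) \<in> borel_measurable (borel \<Otimes>\<^sub>M Hs)"
    using fm by (simp add: case_prod_beta')
  show I: "(\<lambda>(y, \<omega>). I y \<omega>) \<in> borel_measurable (borel \<Otimes>\<^sub>M Hs)"
  proof -
    have [measurable]: "(\<lambda>x. f (snd x) (snd (fst x))) \<in> borel_measurable ((borel \<Otimes>\<^sub>M Hs) \<Otimes>\<^sub>M borel)"
      using measurable_compose[of "\<lambda>x. (snd x, snd (fst x))" "(borel \<Otimes>\<^sub>M Hs) \<Otimes>\<^sub>M borel" "borel \<Otimes>\<^sub>M Hs", OF _ fm] by simp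
    show ?thesis
      unfolding I_def case_prod_beta' f_def[symmetric]
      by (rule nn_integral_\<kappa>_measurable) (auto simp: case_prod_beta')
  qed
  have "(\<integral>\<^sup>+\<omega>. I (\<gamma> \<omega>) \<omega> \<partial>M) = (\<integral>\<^sup>+\<omega>. (\<integral>\<^sup>+y. I y \<omega> \<partial>\<kappa> \<omega>) \<partial>M)"
    by (rule disintegration[OF I])
  also have "\<dots> = (\<integral>\<^sup>+\<omega>. (\<integral>\<^sup>+v. ennreal (h v \<omega>) \<partial>\<kappa> \<omega>) \<partial>M)"
  proof (rule nn_integral_cong)
    fix \<omega> assume \<omega>: "\<omega> \<in> space M"
    interpret k: prob_space "\<kappa> \<omega>" by (rule prob_space_\<kappa>[OF \<omega>])
    interpret kk: pair_prob_space "\<kappa> \<omega>" "\<kappa> \<omega>" ..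
    have [measurable]: "(\<lambda>v. f v \<omega>) \<in> borel_measurable borel" using \<kappa>_section[OF f \<omega>] .
    have "(\<integral>\<^sup>+y. I y \<omega> \<partial>\<kappa> \<omega>) = (\<integral>\<^sup>+v. (\<integral>\<^sup>+y. f v \<omega> * (if v \<le> y then 1 else 0) \<partial>\<kappa> \<omega>) \<partial>\<kappa> \<omega>)"
      unfolding I_def f_def[symmetric] by (rule kk.Fubini') measurable
    also have "\<dots> = (\<integral>\<^sup>+v. f v \<omega> * ennreal (W v \<omega>) \<partial>\<kappa> \<omega>)"
    proof (intro nn_integral_cong)
      fix v :: ennreal
      have "(\<integral>\<^sup>+y. (if v \<le> y then 1 else 0) \<partial>\<kappa> \<omega>) = (\<integral>\<^sup>+y. indicator {v..} y \<partial>\<kappa> \<omega>)"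
        by (intro nn_integral_cong) (simp add: indicator_def)
      also have "\<dots> = emeasure (\<kappa> \<omega>) {v..}" by simp
      finally have "(\<integral>\<^sup>+y. (if v \<le> y then 1 else 0) \<partial>\<kappa> \<omega>) = emeasure (\<kappa> \<omega>) {v..}" .
      then show "(\<integral>\<^sup>+y. f v \<omega> * (if v \<le> y then 1 else 0) \<partial>\<kappa> \<omega>) = f v \<omega> * ennreal (W v \<omega>)"
        using emeasure_\<kappa>_atLeast[OF \<omega>] by (simp add: nn_integral_cmult)
    qed
    also have "\<dots> = (\<integral>\<^sup>+v. ennreal (h v \<omega>) \<partial>\<kappa> \<omega>)"
      using AE_\<kappa>_W_pos[OF \<omega>] nonneg
      by (intro nn_integral_cong_AE) (auto elim!: eventually_mono simp: f_def simp flip: ennreal_mult)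
    finally show "(\<integral>\<^sup>+y. I y \<omega> \<partial>\<kappa> \<omega>) = (\<integral>\<^sup>+v. ennreal (h v \<omega>) \<partial>\<kappa> \<omega>)" .
  qed
  also have "\<dots> = (\<integral>\<^sup>+\<omega>. ennreal (h (\<gamma> \<omega>) \<omega>) \<partial>M)"
    by (rule disintegration[symmetric]) (unfold case_prod_beta', measurable)
  finally show "(\<integral>\<^sup>+\<omega>. I (\<gamma> \<omega>) \<omega> \<partial>M) = (\<integral>\<^sup>+\<omega>. ennreal (h (\<gamma> \<omega>) \<omega>) \<partial>M)" .
qed

lemma compensation:
  assumes h: "(\<lambda>(v, \<omega>). h v \<omega>) \<in> borel_measurable (borel \<Otimes>\<^sub>M Hs)"
    and int: "integrable M (\<lambda>\<omega>. h (\<gamma> \<omega>) \<omega>)"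
  defines "J \<equiv> \<lambda>\<omega> v. h v \<omega> / W v \<omega> * (if v \<le> \<gamma> \<omega> then 1 else 0)"
  shows "AE \<omega> in M. integrable (\<kappa> \<omega>) (J \<omega>)"
    and "integrable M (\<lambda>\<omega>. \<integral>v. J \<omega> v \<partial>\<kappa> \<omega>)"
    and "integrable M (\<lambda>\<omega>. \<integral>v. \<bar>J \<omega> v\<bar> \<partial>\<kappa> \<omega>)"
    and "(\<integral>\<omega>. (\<integral>v. J \<omega> v \<partial>\<kappa> \<omega>) \<partial>M) = (\<integral>\<omega>. h (\<gamma> \<omega>) \<omega> \<partial>M)"
proof -
  have hm [measurable]: "(\<lambda>x. h (fst x) (snd x)) \<in> borel_measurable (borel \<Otimes>\<^sub>M Hs)"
    using h by (simp add: case_prod_beta')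
  define I where "I k \<omega> = (\<integral>\<^sup>+v. ennreal (k v \<omega> / W v \<omega>) * (if v \<le> \<gamma> \<omega> then 1 else 0) \<partial>\<kappa> \<omega>)"
    for k :: "ennreal \<Rightarrow> 'a \<Rightarrow> real" and \<omega>
  define hp hn ha where "hp v \<omega> = max 0 (h v \<omega>)" and "hn v \<omega> = max 0 (- h v \<omega>)" and "ha v \<omega> = \<bar>h v \<omega>\<bar>" for v \<omega>
  have km: "(\<lambda>(v, \<omega>). hp v \<omega>) \<in> borel_measurable (borel \<Otimes>\<^sub>M Hs)"
    "(\<lambda>(v, \<omega>). hn v \<omega>) \<in> borel_measurable (borel \<Otimes>\<^sub>M Hs)"
    "(\<lambda>(v, \<omega>). ha v \<omega>) \<in> borel_measurable (borel \<Otimes>\<^sub>M Hs)"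
    unfolding hp_def hn_def ha_def case_prod_beta' by measurable
  have Im: "I k \<in> borel_measurable M" and Ie: "(\<integral>\<^sup>+\<omega>. I k \<omega> \<partial>M) = (\<integral>\<^sup>+\<omega>. ennreal (k (\<gamma> \<omega>) \<omega>) \<partial>M)"
    if "(\<lambda>(v, \<omega>). k v \<omega>) \<in> borel_measurable (borel \<Otimes>\<^sub>M Hs)" "\<And>v \<omega>. 0 \<le> k v \<omega>" for k
    using graph_measurable[OF nn_integral_compensation(1)[OF that]] nn_integral_compensation(2)[OF that]
    unfolding I_def by auto
  have ipos: "0 \<le> hp v \<omega>" "0 \<le> hn v \<omega>" "0 \<le> ha v \<omega>" for v \<omega> by (auto simp: hp_def hn_def ha_def)
  note [measurable] = Im[OF km(1) ipos(1)] Im[OF km(2) ipos(2)] Im[OF km(3) ipos(3)]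
  have int': "integrable M (\<lambda>\<omega>. hp (\<gamma> \<omega>) \<omega>)" "integrable M (\<lambda>\<omega>. hn (\<gamma> \<omega>) \<omega>)" "integrable M (\<lambda>\<omega>. ha (\<gamma> \<omega>) \<omega>)"
    unfolding hp_def hn_def ha_def using int by auto
  have fin: "(\<integral>\<^sup>+\<omega>. I hp \<omega> \<partial>M) = ennreal (\<integral>\<omega>. hp (\<gamma> \<omega>) \<omega> \<partial>M)" "(\<integral>\<^sup>+\<omega>. I hn \<omega> \<partial>M) = ennreal (\<integral>\<omega>. hn (\<gamma> \<omega>) \<omega> \<partial>M)"
    "(\<integral>\<^sup>+\<omega>. I ha \<omega> \<partial>M) = ennreal (\<integral>\<omega>. ha (\<gamma> \<omega>) \<omega> \<partial>M)"
    using Ie[OF km(1) ipos(1)] Ie[OF km(2) ipos(2)] Ie[OF km(3) ipos(3)] int' ipos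
    by (simp_all add: nn_integral_eq_integral)
  have ae: "AE \<omega> in M. I hp \<omega> \<noteq> \<infinity>" "AE \<omega> in M. I hn \<omega> \<noteq> \<infinity>" "AE \<omega> in M. I ha \<omega> \<noteq> \<infinity>"
    by (rule nn_integral_noteq_infinite; simp add: fin)+
  have en: "has_bochner_integral M (\<lambda>\<omega>. enn2real (I k \<omega>)) x"
    if [measurable]: "I k \<in> borel_measurable M" and "AE \<omega> in M. I k \<omega> \<noteq> \<infinity>" "(\<integral>\<^sup>+\<omega>. I k \<omega> \<partial>M) = ennreal x" "0 \<le> x" for k x
  proof (rule has_bochner_integral_nn_integral)
    have "(\<integral>\<^sup>+\<omega>. ennreal (enn2real (I k \<omega>)) \<partial>M) = (\<integral>\<^sup>+\<omega>. I k \<omega> \<partial>M)"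
    proof (intro nn_integral_cong_AE)
      show "AE \<omega> in M. ennreal (enn2real (I k \<omega>)) = I k \<omega>"
        using that(2) by eventually_elim (simp add: ennreal_enn2real_if)
    qed
    then show "(\<integral>\<^sup>+\<omega>. ennreal (enn2real (I k \<omega>)) \<partial>M) = ennreal x" using that by simp
  qed (use that in auto)
  have Jm: "J \<omega> \<in> borel_measurable borel" if "\<omega> \<in> space M" for \<omega>
  proof -
    have "(\<lambda>v. if v \<le> y then 1 else 0 :: real) \<in> borel_measurable borel" for y :: ennreal
      by measurable
    then have "(\<lambda>v. h v \<omega> / W v \<omega> * (if v \<le> y then 1 else 0)) \<in> borel_measurable borel" for y
      by (intro borel_measurable_times borel_measurable_divide \<kappa>_section[OF h that] \<kappa>_section[OF W_measurable that])
    then show ?thesis unfolding J_def .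
  qed
  have Jn: "(\<integral>\<^sup>+v. ennreal (J \<omega> v) \<partial>\<kappa> \<omega>) = I hp \<omega>" "(\<integral>\<^sup>+v. ennreal (- J \<omega> v) \<partial>\<kappa> \<omega>) = I hn \<omega>"
    "(\<integral>\<^sup>+v. ennreal \<bar>J \<omega> v\<bar> \<partial>\<kappa> \<omega>) = I ha \<omega>" for \<omega>
  proof -
    have d: "ennreal (max 0 x / W v \<omega>) = ennreal (x / W v \<omega>)" "\<bar>x / W v \<omega>\<bar> = \<bar>x\<bar> / W v \<omega>" for x v
      using W_nonneg[of v \<omega>] by (auto simp: max_def ennreal_neg divide_nonpos_nonneg)
    show "(\<integral>\<^sup>+v. ennreal (J \<omega> v) \<partial>\<kappa> \<omega>) = I hp \<omega>" "(\<integral>\<^sup>+v. ennreal (- J \<omega> v) \<partial>\<kappa> \<omega>) = I hn \<omega>"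
      "(\<integral>\<^sup>+v. ennreal \<bar>J \<omega> v\<bar> \<partial>\<kappa> \<omega>) = I ha \<omega>"
      unfolding J_def I_def by (auto intro!: nn_integral_cong simp: hp_def hn_def ha_def d abs_of_nonneg[OF W_nonneg])
  qed
  have Jint: "integrable (\<kappa> \<omega>) (J \<omega>)" if "\<omega> \<in> space M" "I ha \<omega> \<noteq> \<infinity>" for \<omega>
    using Jm[OF that(1)] that(2) Jn(3)[of \<omega>] by (intro integrableI_bounded) (auto simp: less_top)
  show "AE \<omega> in M. integrable (\<kappa> \<omega>) (J \<omega>)"
    using ae(3) AE_space by eventually_elim (rule Jint)
  \<comment> \<open>The formula covers every \<open>\<omega>\<close> and not only almost every one:
    where \<open>J \<omega>\<close> is not integrable, its integral is \<open>0\<close> by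
    convention. This makes the integral a measurable function of \<open>\<omega>\<close>.\<close>
  have e1: "(\<integral>v. J \<omega> v \<partial>\<kappa> \<omega>) = (if I ha \<omega> = \<infinity> then 0 else enn2real (I hp \<omega>) - enn2real (I hn \<omega>))" 
    and e2: "(\<integral>v. \<bar>J \<omega> v\<bar> \<partial>\<kappa> \<omega>) = enn2real (I ha \<omega>)" if \<omega>: "\<omega> \<in> space M" for \<omega>
  proof -
    show "(\<integral>v. J \<omega> v \<partial>\<kappa> \<omega>) = (if I ha \<omega> = \<infinity> then 0 else enn2real (I hp \<omega>) - enn2real (I hn \<omega>))"
    proof (cases "I ha \<omega> = \<infinity>")
      case True
      have "\<not> integrable (\<kappa> \<omega>) (J \<omega>)"
        using True Jn(3)[of \<omega>] by (auto simp: integrable_iff_bounded)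
      then show ?thesis using True by (simp add: not_integrable_integral_eq)
    next
      case False
      then show ?thesis
        using real_lebesgue_integral_def[OF Jint[OF \<omega> False]] by (simp add: Jn)
    qed
    show "(\<integral>v. \<bar>J \<omega> v\<bar> \<partial>\<kappa> \<omega>) = enn2real (I ha \<omega>)"
      using Jm[OF \<omega>] by (subst integral_eq_nn_integral) (auto simp: Jn)
  qed
  have Ha: "has_bochner_integral M (\<lambda>\<omega>. enn2real (I ha \<omega>)) (\<integral>\<omega>. ha (\<gamma> \<omega>) \<omega> \<partial>M)"
    using ae(3) fin(3) ipos by (intro en) (auto intro!: integral_nonneg_AE)
  then show "integrable M (\<lambda>\<omega>. \<integral>v. \<bar>J \<omega> v\<bar> \<partial>\<kappa> \<omega>)"
    by (subst Bochner_Integration.integrable_cong[OF refl e2]) (auto simp: has_bochner_integral_iff)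
  have Hp: "has_bochner_integral M (\<lambda>\<omega>. enn2real (I hp \<omega>)) (\<integral>\<omega>. hp (\<gamma> \<omega>) \<omega> \<partial>M)"
    using ae(1) fin(1) ipos by (intro en) (auto intro!: integral_nonneg_AE)
  have Hn: "has_bochner_integral M (\<lambda>\<omega>. enn2real (I hn \<omega>)) (\<integral>\<omega>. hn (\<gamma> \<omega>) \<omega> \<partial>M)"
    using ae(2) fin(2) ipos by (intro en) (auto intro!: integral_nonneg_AE)
  have D: "has_bochner_integral M (\<lambda>\<omega>. enn2real (I hp \<omega>) - enn2real (I hn \<omega>))
      ((\<integral>\<omega>. hp (\<gamma> \<omega>) \<omega> \<partial>M) - (\<integral>\<omega>. hn (\<gamma> \<omega>) \<omega> \<partial>M))"
    by (rule has_bochner_integral_diff[OF Hp Hn])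
  have "(\<integral>\<omega>. hp (\<gamma> \<omega>) \<omega> \<partial>M) - (\<integral>\<omega>. hn (\<gamma> \<omega>) \<omega> \<partial>M) = (\<integral>\<omega>. h (\<gamma> \<omega>) \<omega> \<partial>M)"
  proof -
    have "h (\<gamma> \<omega>) \<omega> = hp (\<gamma> \<omega>) \<omega> - hn (\<gamma> \<omega>) \<omega>" for \<omega>
      by (simp add: hp_def hn_def max_def)
    then show ?thesis using Bochner_Integration.integral_diff[OF int'(1,2)] by simp
  qed
  moreover have "has_bochner_integral M (\<lambda>\<omega>. \<integral>v. J \<omega> v \<partial>\<kappa> \<omega>)
      ((\<integral>\<omega>. hp (\<gamma> \<omega>) \<omega> \<partial>M) - (\<integral>\<omega>. hn (\<gamma> \<omega>) \<omega> \<partial>M))"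
  proof -
    have m: "(\<lambda>\<omega>. \<integral>v. J \<omega> v \<partial>\<kappa> \<omega>) \<in> borel_measurable M"
      by (subst measurable_cong[OF e1]) auto
    have "AE \<omega> in M. (\<integral>v. J \<omega> v \<partial>\<kappa> \<omega>) = enn2real (I hp \<omega>) - enn2real (I hn \<omega>)"
      using ae(3) AE_space by eventually_elim (simp add: e1)
    then show ?thesis
      using D m by (subst has_bochner_integral_cong_AE[where g = "\<lambda>\<omega>. enn2real (I hp \<omega>) - enn2real (I hn \<omega>)"]) auto
  qed
  ultimately show "integrable M (\<lambda>\<omega>. \<integral>v. J \<omega> v \<partial>\<kappa> \<omega>)"
    "(\<integral>\<omega>. (\<integral>v. J \<omega> v \<partial>\<kappa> \<omega>) \<partial>M) = (\<integral>\<omega>. h (\<gamma> \<omega>) \<omega> \<partial>M)"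
    by (auto simp: has_bochner_integral_iff)
qed

end

text \<open>Signed integrands are pulled back along \<open>Q\<close> to \<open>unif01\<close>, a
  measure that does not depend on the parameter; there it is the measurability of a parameter
  integral.\<close>

lemma (in single_jump_df) integral_\<kappa>_measurable:
  fixes f :: "'b \<Rightarrow> ennreal \<Rightarrow> real"
  assumes f: "(\<lambda>(x, v). f x v) \<in> borel_measurable (N \<Otimes>\<^sub>M borel)" and k: "k \<in> measurable N Hs"
  shows "(\<lambda>x. \<integral>v. f x v \<partial>\<kappa> (k x)) \<in> borel_measurable N"
proof -
  have snd_unif01: "snd \<in> measurable (N \<Otimes>\<^sub>M unif01) borel"
    using measurable_snd[of N unif01] by (simp add: measurable_cong_sets[OF refl sets_unif01])
  have "(\<lambda>z. (k (fst z), snd z)) \<in> measurable (N \<Otimes>\<^sub>M unif01) (Hs \<Otimes>\<^sub>M borel)"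
    by (rule measurable_Pair[OF measurable_compose[OF measurable_fst k] snd_unif01])
  from measurable_compose[OF this Q_measurable]
  have "(\<lambda>z. Q (k (fst z)) (snd z)) \<in> borel_measurable (N \<Otimes>\<^sub>M unif01)"
    by (simp only: prod.case)
  then have "(\<lambda>z. (fst z, Q (k (fst z)) (snd z))) \<in> measurable (N \<Otimes>\<^sub>M unif01) (N \<Otimes>\<^sub>M borel)"
    by (rule measurable_Pair[OF measurable_fst])
  from measurable_compose[OF this f]
  have "(\<lambda>(x, u). f x (Q (k x) u)) \<in> borel_measurable (N \<Otimes>\<^sub>M unif01)" by (simp add: case_prod_beta')
  then have m: "(\<lambda>x. \<integral>u. f x (Q (k x) u) \<partial>unif01) \<in> borel_measurable N"
    by (rule unif01.borel_measurable_lebesgue_integral)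
  have eq: "(\<integral>u. f x (Q (k x) u) \<partial>unif01) = (\<integral>v. f x v \<partial>\<kappa> (k x))" if x: "x \<in> space N" for x
  proof -
    have kx: "k x \<in> space M" using measurable_space[OF k x] by simp
    have "f x \<in> borel_measurable borel"
      using measurable_compose[OF measurable_Pair1'[OF x] f] by simp
    moreover have "Q (k x) \<in> measurable unif01 borel"
      using Q_section[OF kx] by (simp only: measurable_cong_sets[OF sets_unif01 refl])
    ultimately show ?thesis unfolding \<kappa>_def by (intro integral_distr[symmetric])
  qed
  show ?thesis by (rule measurable_cong[THEN iffD1, OF _ m]) (rule eq)
qed

section \<open>One path: the kernel against the Stieltjes measure\<close>

locale single_jump_path = single_jump_df +
  fixes \<omega>
  assumes \<omega>: "\<omega> \<in> space M" and G_0: "G 0 \<omega> = 0"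
begin

sublocale D: df_path "\<lambda>s. G s \<omega>"
  using G_mono[OF \<omega>] G_rc[OF \<omega>] G_bounds[OF \<omega>] G_0 by unfold_locales auto

sublocale k: prob_space "\<kappa> \<omega>"
  by (rule prob_space_\<kappa>[OF \<omega>])

lemma measure_\<kappa>_atMost: "measure (\<kappa> \<omega>) {..ennreal t} = D.g0 t"
proof -
  have "ennreal t = ennreal (max 0 t)" by (simp add: max_def ennreal_neg)
  then show ?thesis
    using emeasure_\<kappa>_atMost[OF \<omega>, of "max 0 t"] G_bounds[OF \<omega>, of "max 0 t"]
    by (simp add: D.g0_def measure_def)
qed

lemma measure_\<kappa>_greaterThan: "measure (\<kappa> \<omega>) {ennreal t<..} = 1 - D.g0 t"
  using k.prob_compl[of "{..ennreal t}"] measure_\<kappa>_atMost[of t]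
  by (simp add: Compl_eq_Diff_UNIV[symmetric])

lemma emeasure_\<kappa>_Ioc: "x \<le> y \<Longrightarrow> emeasure (\<kappa> \<omega>) {ennreal x<..ennreal y} = ennreal (D.g0 y - D.g0 x)"
proof -
  assume xy: "x \<le> y"
  then have "{ennreal x<..ennreal y} = {..ennreal y} - {..ennreal x}" by auto
  then have "measure (\<kappa> \<omega>) {ennreal x<..ennreal y} = D.g0 y - D.g0 x"
    using k.finite_measure_Diff[of "{..ennreal y}" "{..ennreal x}"] xy
    by (auto simp: measure_\<kappa>_atMost ennreal_leI)
  then show ?thesis by (simp add: k.emeasure_eq_measure)
qed

text \<open>The left limit of \<open>g0\<close> is the mass of \<open>{..<t}\<close>, which is
  exhausted by the sets up to \<open>u n\<close>. Negative arguments of \<open>ennreal\<close>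
  collapse to \<open>0\<close>, in agreement with the constant extension \<open>g0\<close>.\<close>

lemma w_eq_W: "0 < t \<Longrightarrow> D.w t = W (ennreal t) \<omega>"
proof -
  assume t: "0 < t"
  define u where "u n = t - inverse (real (Suc n))" for n
  have unif01: "(\<Union>n. {..ennreal (u n)}) = {..<ennreal t}"
  proof (intro equalityI subsetI)
    fix v assume "v \<in> (\<Union>n. {..ennreal (u n)})"
    then obtain n where "v \<le> ennreal (u n)" by auto
    also have "ennreal (u n) < ennreal t" using t by (intro ennreal_lessI) (auto simp: u_def)
    finally show "v \<in> {..<ennreal t}" by simp
  next
    fix v assume v: "v \<in> {..<ennreal t}"
    then obtain r where r: "v = ennreal r" "0 \<le> r" by (cases v) auto
    then have "r < t" using v by (simp add: ennreal_less_iff)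
    then obtain n where "inverse (real (Suc n)) < t - r" using reals_Archimedean[of "t - r"] by auto
    then have "v \<le> ennreal (u n)" unfolding r u_def by (intro ennreal_leI) simp
    then show "v \<in> (\<Union>n. {..ennreal (u n)})" by auto
  qed
  have "incseq (\<lambda>n. {..ennreal (u n)})"
  proof (rule incseq_SucI)
    have "u n \<le> u (Suc n)" for n
      unfolding u_def by (intro diff_left_mono le_imp_inverse_le) auto
    then show "{..ennreal (u n)} \<subseteq> {..ennreal (u (Suc n))}" for n by (auto intro: order_trans ennreal_leI)
  qed
  then have "(\<lambda>n. measure (\<kappa> \<omega>) {..ennreal (u n)}) \<longlonglongrightarrow> measure (\<kappa> \<omega>) {..<ennreal t}"
    using k.finite_Lim_measure_incseq[of "\<lambda>n. {..ennreal (u n)}"] unif01 by (simp add: image_subset_iff)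
  moreover have "(\<lambda>n. D.g0 (u n)) \<longlonglongrightarrow> Lim (at_left t) D.g0"
    unfolding u_def
    by (rule filterlim_compose[OF mono_tendsto_at_left_Lim[OF D.mono_g0] filterlim_minus_inverse_at_left])
  ultimately have "measure (\<kappa> \<omega>) {..<ennreal t} = Lim (at_left t) D.g0"
    by (simp add: measure_\<kappa>_atMost LIMSEQ_unique)
  moreover have "measure (\<kappa> \<omega>) {ennreal t..} = 1 - measure (\<kappa> \<omega>) {..<ennreal t}"
    using k.prob_compl[of "{..<ennreal t}"] by (simp add: Compl_eq_Diff_UNIV[symmetric])
  ultimately show ?thesis by (simp add: W_def D.w_def)
qed

lemma W_antimono: "u \<le> v \<Longrightarrow> W v \<omega> \<le> W u \<omega>"
  unfolding W_def by (intro k.finite_measure_mono) auto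

lemma W_0: "W 0 \<omega> = 1"
proof -
  have "{0::ennreal..} = space (\<kappa> \<omega>)" by auto
  then show ?thesis using k.prob_space by (simp add: W_def)
qed

lemma w_0: "D.w 0 = 1"
proof -
  have "((\<lambda>_. 0) \<longlongrightarrow> 0) (at_left (0::real))" by simp
  moreover have "eventually (\<lambda>y. y \<in> {-1<..<0}) (at_left (0::real))" by (rule eventually_at_left_real) simp
  then have "eventually (\<lambda>y. 0 = D.g0 y) (at_left (0::real))"
    by eventually_elim (auto simp: D.g0_def G_0)
  ultimately have "(D.g0 \<longlongrightarrow> 0) (at_left 0)" by (rule Lim_transform_eventually)
  then have "Lim (at_left 0) D.g0 = 0" by (intro tendsto_Lim) auto
  then show ?thesis by (simp add: D.w_def)
qed

lemma w_pos: "0 \<le> t \<Longrightarrow> 0 < W (ennreal t) \<omega> \<Longrightarrow> 0 < D.w t"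
  using w_eq_W[of t] w_0 by (cases "t = 0") auto

text \<open>\<open>enn2real\<close> sends the possible mass at \<open>\<infinity>\<close> to
  \<open>0\<close>, outside \<open>{0<..t}\<close>; inside, the kernel and the Stieltjes measure of
  \<open>G\<close> agree on half-open intervals.\<close>

lemma restrict_K: "restrict_space D.K {0<..t} = restrict_space (distr (\<kappa> \<omega>) borel enn2real) {0<..t}"
proof (rule measure_eqI)
  define B where "B = distr (\<kappa> \<omega>) borel enn2real"
  have sB: "sets B = sets borel" by (simp add: B_def)
  interpret B: prob_space B unfolding B_def by (rule k.prob_space_distr) simp
  have eq: "emeasure D.K {x<..y} = emeasure B {x<..y}" if xy: "0 \<le> x" "x \<le> y" for x y
  proof -
    have "enn2real v \<in> {x<..y} \<longleftrightarrow> v \<in> {ennreal x<..ennreal y}" for v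
      using xy by (cases v) (auto simp: ennreal_less_iff ennreal_le_iff top_unique)
    then have "enn2real -` {x<..y} \<inter> space (\<kappa> \<omega>) = {ennreal x<..ennreal y}"
      by (intro set_eqI) (simp only: Int_iff vimage_eq space_\<kappa> UNIV_I simp_thms)
    then have "emeasure B {x<..y} = emeasure (\<kappa> \<omega>) {ennreal x<..ennreal y}"
      unfolding B_def by (subst emeasure_distr) auto
    then show ?thesis using xy by (simp add: emeasure_\<kappa>_Ioc D.emeasure_K_Ioc)
  qed
  show "sets (restrict_space D.K {0<..t}) = sets (restrict_space (distr (\<kappa> \<omega>) borel enn2real) {0<..t})"
    by (intro sets_restrict_space_cong) simp
  fix A assume "A \<in> sets (restrict_space D.K {0<..t})"
  then obtain S where S: "S \<in> sets borel" "A = S \<inter> {0<..t}" by (auto simp: sets_restrict_space)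
  have "emeasure D.K (S \<inter> {0<..t}) = emeasure B (S \<inter> {0<..t}) + emeasure (null_measure borel) (S \<inter> {0<..t})"
    by (rule emeasure_add_on_Ioc) (use S sB in \<open>auto simp: eq\<close>)
  then show "emeasure (restrict_space D.K {0<..t}) A = emeasure (restrict_space (distr (\<kappa> \<omega>) borel enn2real) {0<..t}) A"
    using S by (simp add: emeasure_restrict_space B_def)
qed

lemma set_integral_K:
  fixes f :: "real \<Rightarrow> real" and t :: real
  assumes f: "f \<in> borel_measurable borel"
  defines "fk \<equiv> \<lambda>v. f (enn2real v) * (if 0 < v \<and> v \<le> ennreal t then 1 else 0)"
  shows "set_integrable D.K {0<..t} f \<longleftrightarrow> integrable (\<kappa> \<omega>) fk"
    and "(LINT s:{0<..t}|D.K. f s) = (\<integral>v. fk v \<partial>\<kappa> \<omega>)"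
proof -
  have fk: "indicator {0<..t} (enn2real v) *\<^sub>R f (enn2real v) = fk v" for v
    by (cases v) (auto simp: fk_def indicator_def ennreal_le_iff2 top_unique)
  have m: "(\<lambda>x. indicator {0<..t} x *\<^sub>R f x) \<in> borel_measurable borel" using f by measurable
  have "set_integrable D.K {0<..t} f \<longleftrightarrow> integrable (restrict_space D.K {0<..t}) f"
    unfolding set_integrable_def by (subst integrable_restrict_space) auto
  also have "\<dots> \<longleftrightarrow> integrable (distr (\<kappa> \<omega>) borel enn2real) (\<lambda>x. indicator {0<..t} x *\<^sub>R f x)"
    unfolding restrict_K by (subst integrable_restrict_space) auto
  also have "\<dots> \<longleftrightarrow> integrable (\<kappa> \<omega>) (\<lambda>v. indicator {0<..t} (enn2real v) *\<^sub>R f (enn2real v))"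
    by (rule integrable_distr_eq) (use m in auto)
  also have "\<dots> \<longleftrightarrow> integrable (\<kappa> \<omega>) fk" by (simp only: fk)
  finally show "set_integrable D.K {0<..t} f \<longleftrightarrow> integrable (\<kappa> \<omega>) fk" .
  have "(LINT s:{0<..t}|D.K. f s) = (\<integral>x. f x \<partial>restrict_space D.K {0<..t})"
    unfolding set_lebesgue_integral_def by (subst integral_restrict_space) auto
  also have "\<dots> = (\<integral>x. indicator {0<..t} x *\<^sub>R f x \<partial>distr (\<kappa> \<omega>) borel enn2real)"
    unfolding restrict_K by (subst integral_restrict_space) auto
  also have "\<dots> = (\<integral>v. fk v \<partial>\<kappa> \<omega>)"
    unfolding fk[symmetric] by (rule integral_distr) (use m in auto)
  finally show "(LINT s:{0<..t}|D.K. f s) = (\<integral>v. fk v \<partial>\<kappa> \<omega>)" .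
qed

text \<open>No mass sits at or after \<open>Q \<omega> 1\<close>, so \<open>G\<close> tends to
  \<open>1\<close> there without a final jump, possibly only at \<open>\<infinity>\<close>, and the
  quantiles at levels tending to \<open>1\<close> overtake every \<open>v\<close> that still has
  mass from it onwards.\<close>

lemma Q_0_lt:
  assumes "W (Q \<omega> 1) \<omega> = 0" and v: "0 < W v \<omega>"
  shows "\<exists>n0. \<forall>n\<ge>n0. v < Q \<omega> (1 - 1 / (real n + 2))"
proof -
  have vQ: "v < Q \<omega> 1" using W_antimono[of "Q \<omega> 1" v] assms by (metis leD not_le)
  then obtain t where t: "v = ennreal t" "0 \<le> t" by (cases v) auto
  then have "G t \<omega> < 1" using vQ Q_le_iff[OF \<omega> t(2), of 1] by (metis leD not_le)
  then obtain n0 where n0: "1 / (1 - G t \<omega>) < real n0" using reals_Archimedean2 by blast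
  have "v < Q \<omega> (1 - 1 / (real n + 2))" if "n0 \<le> n" for n
  proof -
    have "1 / (1 - G t \<omega>) < real n + 2" using n0 that by linarith
    then have "1 / (real n + 2) < 1 - G t \<omega>"
      using \<open>G t \<omega> < 1\<close> by (simp add: field_simps)
    then show ?thesis unfolding t using Q_le_iff[OF \<omega> t(2)] by (simp add: not_le[symmetric])
  qed
  then show ?thesis by blast
qed

end

section \<open>The compensator\<close>

locale compensator_setup = single_jump_df +
  fixes F X :: "real \<Rightarrow> 'a \<Rightarrow> real" and L :: "'a \<Rightarrow> real" and H :: "ennreal \<Rightarrow> 'a \<Rightarrow> real"
  assumes X_adapted: "adapted_process Fi X"
    and X_fv: "rc_finite_variation M X"
    and F_measurable: "(\<lambda>(t, \<omega>). F t \<omega>) \<in> borel_measurable (restrict_space borel {0..} \<Otimes>\<^sub>M Hs)"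
    and X_eq: "AE \<omega> in M. \<forall>t\<ge>0. X t \<omega> =
           F t \<omega> * of_bool (ennreal t < \<gamma> \<omega>) + L \<omega> * of_bool (\<gamma> \<omega> \<le> ennreal t)"
    and L_int: "integrable M L"
    and F_sup: "(\<integral>\<^sup>+ \<omega>. (SUP t\<in>{t. 0 \<le> t \<and> ennreal t < t_G M \<gamma>}. ennreal \<bar>F t \<omega>\<bar>) \<partial>M) < \<infinity>"
    and H_cond: "is_cond_exp_given_time M Hs \<gamma> L H"
begin

abbreviation tG :: ennreal where "tG \<equiv> t_G M \<gamma>"

text \<open>Where nothing survives \<open>v\<close>, the jump has happened by time \<open>v\<close>
  and \<open>X\<close> does not constrain \<open>F\<close> there; the value \<open>0\<close> keeps
  \<open>Fz\<close> integrable at the jump time.\<close>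

definition Fz :: "ennreal \<Rightarrow> 'a \<Rightarrow> real" where
  "Fz v \<omega> = (if v < \<infinity> \<and> emeasure (\<kappa> \<omega>) {v<..} \<noteq> 0 then F (enn2real v) \<omega> else 0)"

definition \<phi> :: "ennreal \<Rightarrow> 'a \<Rightarrow> real" where "\<phi> v \<omega> = H v \<omega> - Fz v \<omega>"

definition \<Lambda> :: "ennreal \<Rightarrow> 'a \<Rightarrow> real" where
  "\<Lambda> v \<omega> = (\<integral>y. \<phi> y \<omega> / W y \<omega> * (if 0 < y \<and> y \<le> v then 1 else 0) \<partial>\<kappa> \<omega>)"

definition Ct :: "ennreal \<Rightarrow> 'a \<Rightarrow> real" where
  "Ct v \<omega> = Fz v \<omega> - F 0 \<omega> + \<Lambda> v \<omega>"

text \<open>Here \<open>Q \<omega> 1\<close> is the first time at which \<open>G\<close> reaches \<open>1\<close>. If it is reached continuously, the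
  integral need not exist up to that time, and is replaced by a limit along quantiles.\<close>

definition C0 :: "ennreal \<Rightarrow> 'a \<Rightarrow> real" where
  "C0 v \<omega> = (if 0 < W (Q \<omega> 1) \<omega> then Ct v \<omega> else lim (\<lambda>n. Ct (min v (Q \<omega> (1 - 1 / (real n + 2)))) \<omega>))"

text \<open>One fixed sequence turns left limits at \<open>tG\<close> into sequential limits, which
  are measurable in \<open>\<omega>\<close>. It lies strictly below \<open>tG\<close> but need not
  be monotone.\<close>

definition sq :: "nat \<Rightarrow> ennreal" where "sq = (SOME s. (\<forall>n. s n < tG) \<and> s \<longlonglongrightarrow> tG)"

text \<open>At \<open>tG\<close> the jump rule for an atom at the endpoint is the definition. Values
  beyond \<open>tG\<close> are immaterial, since \<open>\<gamma> \<le> tG\<close> almost surely. As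
  \<open>lim\<close> is total, measurability needs no case distinction on convergence.\<close>

definition C :: "ennreal \<Rightarrow> 'a \<Rightarrow> real" where
  "C v \<omega> = (if v < tG then C0 v \<omega>
    else if v = tG then lim (\<lambda>n. C0 (sq n) \<omega>) + (H tG \<omega> - lim (\<lambda>n. F (enn2real (sq n)) \<omega>)) else 0)"

section \<open>Joint measurability of the compensator function\<close>

lemma H_measurable: "(\<lambda>(t, \<omega>). H t \<omega>) \<in> borel_measurable (borel \<Otimes>\<^sub>M Hs)"
  and H_ae: "AE \<omega> in M. H (\<gamma> \<omega>) \<omega> = real_cond_exp M (join_time M Hs \<gamma>) L \<omega>"
  using H_cond by (simp_all add: is_cond_exp_given_time_def)

lemma F_measurable_ennreal: "(\<lambda>(v, \<omega>). F (enn2real v) \<omega>) \<in> borel_measurable (borel \<Otimes>\<^sub>M Hs)"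
proof -
  have "(\<lambda>z. enn2real (fst z)) \<in> measurable (borel \<Otimes>\<^sub>M Hs) (restrict_space borel {0..})"
    by (rule measurable_restrict_space2) auto
  then have "(\<lambda>z. (enn2real (fst z), snd z)) \<in> measurable (borel \<Otimes>\<^sub>M Hs) (restrict_space borel {0..} \<Otimes>\<^sub>M Hs)"
    by (rule measurable_Pair[OF _ measurable_snd])
  from measurable_compose[OF this F_measurable] show ?thesis
    by (simp add: case_prod_beta')
qed

lemma F_section: "0 \<le> t \<Longrightarrow> F t \<in> borel_measurable Hs"
  using measurable_compose[OF measurable_Pair1'[of "ennreal t" borel Hs] F_measurable_ennreal] by simp

lemma Fz_measurable: "(\<lambda>(v, \<omega>). Fz v \<omega>) \<in> borel_measurable (borel \<Otimes>\<^sub>M Hs)"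
proof -
  have "(\<lambda>x. emeasure (\<kappa> (snd x)) {y. fst x < y}) \<in> borel_measurable (borel \<Otimes>\<^sub>M Hs)"
    by (rule emeasure_\<kappa>_measurable) (auto simp: case_prod_beta')
  then have [measurable]: "(\<lambda>x. emeasure (\<kappa> (snd x)) {fst x<..}) \<in> borel_measurable (borel \<Otimes>\<^sub>M Hs)"
    by (simp add: greaterThan_def)
  have [measurable]: "(\<lambda>x. F (enn2real (fst x)) (snd x)) \<in> borel_measurable (borel \<Otimes>\<^sub>M Hs)"
    using F_measurable_ennreal by (simp only: case_prod_beta')
  show ?thesis unfolding Fz_def case_prod_beta' by measurable
qed

lemma \<phi>_measurable: "(\<lambda>(v, \<omega>). \<phi> v \<omega>) \<in> borel_measurable (borel \<Otimes>\<^sub>M Hs)"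
  using borel_measurable_diff[OF H_measurable Fz_measurable] by (simp add: \<phi>_def case_prod_beta')

lemma \<Lambda>_measurable: "(\<lambda>(v, \<omega>). \<Lambda> v \<omega>) \<in> borel_measurable (borel \<Otimes>\<^sub>M Hs)"
proof -
  have m: "(\<lambda>z. (snd z, snd (fst z))) \<in> measurable ((borel \<Otimes>\<^sub>M Hs) \<Otimes>\<^sub>M borel) (borel \<Otimes>\<^sub>M Hs)"
    by (rule measurable_Pair[OF measurable_snd measurable_compose[OF measurable_fst measurable_snd]])
  have m1: "(\<lambda>z. \<phi> (snd z) (snd (fst z))) \<in> borel_measurable ((borel \<Otimes>\<^sub>M Hs) \<Otimes>\<^sub>M borel)"
    using measurable_compose[OF m \<phi>_measurable] by (simp only: prod.case)
  have m2: "(\<lambda>z. W (snd z) (snd (fst z))) \<in> borel_measurable ((borel \<Otimes>\<^sub>M Hs) \<Otimes>\<^sub>M borel)"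
    using measurable_compose[OF m W_measurable] by (simp only: prod.case)
  have m3: "(\<lambda>z. if 0 < snd z \<and> snd z \<le> fst (fst z) then 1 else 0 :: real) \<in>
      borel_measurable (((borel :: ennreal measure) \<Otimes>\<^sub>M Hs) \<Otimes>\<^sub>M borel)"
    by measurable
  show ?thesis
    unfolding \<Lambda>_def case_prod_beta'
    by (rule integral_\<kappa>_measurable[OF _ measurable_snd])
       (unfold case_prod_beta', intro borel_measurable_times borel_measurable_divide m1 m2 m3)
qed

lemma Ct_measurable: "(\<lambda>(v, \<omega>). Ct v \<omega>) \<in> borel_measurable (borel \<Otimes>\<^sub>M Hs)"
proof -
  have "(\<lambda>z. F 0 (snd z)) \<in> borel_measurable ((borel :: ennreal measure) \<Otimes>\<^sub>M Hs)"
    by (rule measurable_compose[OF measurable_snd F_section]) simp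
  then show ?thesis
    unfolding Ct_def using Fz_measurable \<Lambda>_measurable
    unfolding case_prod_beta' by (intro borel_measurable_add borel_measurable_diff)
qed

lemma C0_measurable: "(\<lambda>(v, \<omega>). C0 v \<omega>) \<in> borel_measurable (borel \<Otimes>\<^sub>M Hs)"
proof -
  have Qu: "(\<lambda>z. Q (snd z) u) \<in> borel_measurable ((borel :: ennreal measure) \<Otimes>\<^sub>M Hs)" for u
    using measurable_compose[OF measurable_Pair[OF measurable_snd[of "borel :: ennreal measure" Hs] measurable_const[of u borel]] Q_measurable]
    by (simp only: prod.case space_borel UNIV_I simp_thms)
  have 1: "(\<lambda>z. W (Q (snd z) 1) (snd z)) \<in> borel_measurable ((borel :: ennreal measure) \<Otimes>\<^sub>M Hs)"
    using measurable_compose[OF measurable_Pair[OF Qu measurable_snd] W_measurable] by (simp only: prod.case)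
  have 2: "(\<lambda>z. Ct (min (fst z) (Q (snd z) u)) (snd z)) \<in> borel_measurable (borel \<Otimes>\<^sub>M Hs)" for u
  proof -
    have "(\<lambda>z. min (fst z) (Q (snd z) u)) \<in> borel_measurable ((borel :: ennreal measure) \<Otimes>\<^sub>M Hs)"
      using Qu[of u] by (intro borel_measurable_min measurable_fst)
    from measurable_compose[OF measurable_Pair[OF this measurable_snd] Ct_measurable]
    show ?thesis by (simp only: prod.case)
  qed
  have 3: "(\<lambda>z. lim (\<lambda>n. Ct (min (fst z) (Q (snd z) (1 - 1 / (real n + 2)))) (snd z))) \<in> borel_measurable (borel \<Otimes>\<^sub>M Hs)"
    by (rule borel_measurable_lim_metric) (rule 2)
  show ?thesis
    unfolding C0_def case_prod_beta'
  proof (rule measurable_If[OF _ 3])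
    show "(\<lambda>x. Ct (fst x) (snd x)) \<in> borel_measurable (borel \<Otimes>\<^sub>M Hs)"
      using Ct_measurable by (simp only: case_prod_beta')
    show "{x \<in> space (borel \<Otimes>\<^sub>M Hs). 0 < W (Q (snd x) 1) (snd x)} \<in> sets (borel \<Otimes>\<^sub>M Hs)"
      using borel_measurable_less[OF borel_measurable_const 1] by simp
  qed
qed

lemma C_measurable: "(\<lambda>(v, \<omega>). C v \<omega>) \<in> borel_measurable (borel \<Otimes>\<^sub>M Hs)"
proof -
  have s: "(\<lambda>z. f v (snd z)) \<in> borel_measurable ((borel :: ennreal measure) \<Otimes>\<^sub>M Hs)"
    if "(\<lambda>(v, \<omega>). f v \<omega>) \<in> borel_measurable (borel \<Otimes>\<^sub>M Hs)" for f :: "ennreal \<Rightarrow> 'a \<Rightarrow> real" and v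
  proof -
    have "f v \<in> borel_measurable Hs"
      using measurable_compose[OF measurable_Pair1'[of v borel Hs] that] by simp
    then show ?thesis by (rule measurable_compose[OF measurable_snd])
  qed
  have a: "(\<lambda>z. lim (\<lambda>n. C0 (sq n) (snd z)) + (H tG (snd z) - lim (\<lambda>n. F (enn2real (sq n)) (snd z))))
      \<in> borel_measurable ((borel :: ennreal measure) \<Otimes>\<^sub>M Hs)"
    by (intro borel_measurable_add borel_measurable_diff borel_measurable_lim_metric
        s[OF C0_measurable] s[OF H_measurable] s[OF F_measurable_ennreal])
  have b: "(\<lambda>z. C0 (fst z) (snd z)) \<in> borel_measurable (borel \<Otimes>\<^sub>M Hs)"
    using C0_measurable by (simp only: case_prod_beta')
  show ?thesis
    unfolding C_def case_prod_beta'
    by (intro measurable_If a b) measurable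
qed

section \<open>The endpoint of the support and integrability up to the jump\<close>

lemma AE_G_0: "AE \<omega> in M. G 0 \<omega> = 0"
proof -
  have "AE \<omega> in M. AE v in \<kappa> \<omega>. 0 < v"
    using \<gamma>_pos by (subst AE_disintegration[symmetric]) (auto simp: case_prod_beta')
  then show ?thesis
    using AE_space
  proof eventually_elim
    case (elim \<omega>)
    interpret k: prob_space "\<kappa> \<omega>" by (rule prob_space_\<kappa>[OF elim(2)])
    have "emeasure (\<kappa> \<omega>) {..0} = 0"
    proof -
      have "AE v in \<kappa> \<omega>. v \<notin> {..0}" using elim(1) by eventually_elim auto
      then show ?thesis by (subst (asm) AE_iff_null_sets[symmetric]) (auto simp: null_sets_def)
    qed
    then show ?case using emeasure_\<kappa>_atMost[OF elim(2), of 0] G_bounds[OF elim(2), of 0] by simp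
  qed
qed

text \<open>Since \<open>\<gamma> > 0\<close> almost surely, the probability of
  \<open>\<gamma> \<le> 1 / (n + 1)\<close> tends to \<open>0\<close> and is below \<open>1\<close>
  for some \<open>n\<close>.\<close>

lemma tG_pos: "0 < tG"
proof -
  have "(\<lambda>n. measure M {\<omega> \<in> space M. \<gamma> \<omega> \<le> ennreal (1 / (real n + 1))}) \<longlonglongrightarrow> measure M (\<Inter>n. {\<omega> \<in> space M. \<gamma> \<omega> \<le> ennreal (1 / (real n + 1))})"
  proof (rule finite_Lim_measure_decseq)
    show "decseq (\<lambda>n. {\<omega> \<in> space M. \<gamma> \<omega> \<le> ennreal (1 / (real n + 1))})"
    proof (rule antimonoI)
      fix m n :: nat assume "m \<le> n"
      then have "ennreal (1 / (real n + 1)) \<le> ennreal (1 / (real m + 1))"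
        by (intro ennreal_leI divide_left_mono) auto
      then show "{\<omega> \<in> space M. \<gamma> \<omega> \<le> ennreal (1 / (real n + 1))} \<le> {\<omega> \<in> space M. \<gamma> \<omega> \<le> ennreal (1 / (real m + 1))}"
        by (auto intro: order_trans)
    qed
  qed auto
  moreover have "measure M (\<Inter>n. {\<omega> \<in> space M. \<gamma> \<omega> \<le> ennreal (1 / (real n + 1))}) = 0"
  proof -
    have "\<gamma> \<omega> \<le> 0" if "\<And>n::nat. \<gamma> \<omega> \<le> ennreal (1 / (real n + 1))" for \<omega>
    proof (rule ennreal_le_epsilon)
      fix e :: real assume "0 < e"
      then obtain n where "inverse (real (Suc n)) < e" using reals_Archimedean by blast
      then have "ennreal (1 / (real n + 1)) \<le> ennreal e" by (intro ennreal_leI) (simp add: inverse_eq_divide add.commute)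
      then show "\<gamma> \<omega> \<le> 0 + ennreal e" using that[of n] by simp
    qed
    then have "(\<Inter>n::nat. {\<omega> \<in> space M. \<gamma> \<omega> \<le> ennreal (1 / (real n + 1))}) \<subseteq> {\<omega> \<in> space M. \<not> 0 < \<gamma> \<omega>}"
      by auto
    moreover have "{\<omega> \<in> space M. \<not> 0 < \<gamma> \<omega>} \<in> null_sets M"
      using \<gamma>_pos by (subst AE_iff_null[symmetric]) auto
    ultimately have "(\<Inter>n::nat. {\<omega> \<in> space M. \<gamma> \<omega> \<le> ennreal (1 / (real n + 1))}) \<in> null_sets M"
      by (rule null_sets_subset[rotated 2]) auto
    then show ?thesis by (simp add: measure_def null_sets_def)
  qed
  ultimately have "(\<lambda>n. measure M {\<omega> \<in> space M. \<gamma> \<omega> \<le> ennreal (1 / (real n + 1))}) \<longlonglongrightarrow> 0"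
    by simp
  then have "eventually (\<lambda>n. measure M {\<omega> \<in> space M. \<gamma> \<omega> \<le> ennreal (1 / (real n + 1))} < 1) sequentially"
    by (rule order_tendstoD(2)) simp
  then obtain n :: nat where n: "measure M {\<omega> \<in> space M. \<gamma> \<omega> \<le> ennreal (1 / (real n + 1))} < 1"
    by (auto simp: eventually_sequentially)
  have "0 < ennreal (1 / (real n + 1))" by simp
  also have "\<dots> \<le> tG"
    unfolding t_G_def using n by (intro SUP_upper) auto
  finally show ?thesis .
qed

lemma AE_\<gamma>_le_tG: "AE \<omega> in M. \<gamma> \<omega> \<le> tG"
proof (cases tG)
  case top
  then show ?thesis by simp
next
  case (real g)
  have "AE \<omega> in M. \<gamma> \<omega> \<le> ennreal (g + 1 / (real n + 1))" for n :: nat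
  proof -
    define t where "t = g + 1 / (real n + 1)"
    have t: "0 \<le> t" "g < t" using real by (auto simp: t_def)
    have "measure M {\<omega> \<in> space M. \<gamma> \<omega> \<le> ennreal t} = 1"
    proof (rule ccontr)
      assume "measure M {\<omega> \<in> space M. \<gamma> \<omega> \<le> ennreal t} \<noteq> 1"
      then have "measure M {\<omega> \<in> space M. \<gamma> \<omega> \<le> ennreal t} < 1" using prob_le_1 by (simp add: order.strict_iff_order)
      then have "ennreal t \<le> tG" unfolding t_G_def using t by (intro SUP_upper) auto
      then show False using real t by (simp add: ennreal_le_iff2)
    qed
    then have "AE \<omega> in M. \<omega> \<in> {\<omega> \<in> space M. \<gamma> \<omega> \<le> ennreal t}" by (intro AE_prob_1) auto
    then show ?thesis by (auto simp: t_def)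
  qed
  then have "AE \<omega> in M. \<forall>n::nat. \<gamma> \<omega> \<le> ennreal (g + 1 / (real n + 1))" unfolding AE_all_countable ..
  then show ?thesis
  proof eventually_elim
    case (elim \<omega>)
    show ?case
    proof (rule ennreal_le_epsilon)
      fix e :: real assume "0 < e"
      then obtain n where "inverse (real (Suc n)) < e" using reals_Archimedean by blast
      then have "ennreal (g + 1 / (real n + 1)) \<le> ennreal (g + e)" by (intro ennreal_leI) (simp add: inverse_eq_divide add.commute)
      also have "\<dots> = tG + ennreal e" using real \<open>0 < e\<close> by (simp add: ennreal_plus)
      finally show "\<gamma> \<omega> \<le> tG + ennreal e" using elim order_trans by blast
    qed
  qed
qed

lemma AE_\<kappa>_tG: "AE \<omega> in M. emeasure (\<kappa> \<omega>) {tG<..} = 0"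
proof -
  have "AE \<omega> in M. AE v in \<kappa> \<omega>. v \<le> tG"
    using AE_\<gamma>_le_tG by (subst AE_disintegration[symmetric]) (auto simp: case_prod_beta')
  then show ?thesis
  proof eventually_elim
    case (elim \<omega>)
    then have "AE v in \<kappa> \<omega>. v \<notin> {tG<..}" by eventually_elim auto
    then show ?case by (subst (asm) AE_iff_null_sets[symmetric]) (auto simp: null_sets_def)
  qed
qed

lemma sq: "sq n < tG" "sq \<longlonglongrightarrow> tG" "filterlim sq (at_left tG) sequentially"
proof -
  have "\<exists>s. (\<forall>n::nat. s n < tG) \<and> s \<longlonglongrightarrow> tG"
  proof -
    show ?thesis using approx_from_below_dense_linorder[OF tG_pos] .
  qed
  from someI_ex[OF this] show 1: "sq n < tG" and 2: "sq \<longlonglongrightarrow> tG" for n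
    unfolding sq_def[symmetric] by auto
  show "filterlim sq (at_left tG) sequentially"
    unfolding filterlim_at using 1 2 by (auto simp: less_imp_neq)
qed

text \<open>The supremum over all times need not be measurable; over rational times it is, and it is
  dominated by the one whose integral is assumed finite.\<close>

definition S :: "'a \<Rightarrow> ennreal" where
  "S \<omega> = (SUP q\<in>{q. q \<in> \<rat> \<and> 0 \<le> q \<and> ennreal q < tG}. ennreal \<bar>F q \<omega>\<bar>)"

lemma S_measurable: "S \<in> borel_measurable Hs"
proof -
  have "(\<lambda>\<omega>. SUP q\<in>{q. q \<in> \<rat> \<and> 0 \<le> q \<and> ennreal q < tG}. ennreal \<bar>F q \<omega>\<bar>) \<in> borel_measurable Hs"
  proof (rule borel_measurable_SUP)
    show "countable {q. q \<in> \<rat> \<and> 0 \<le> q \<and> ennreal q < tG}"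
      by (rule countable_subset[OF _ countable_rat]) auto
    fix q assume "q \<in> {q. q \<in> \<rat> \<and> 0 \<le> q \<and> ennreal q < tG}"
    then have "F q \<in> borel_measurable Hs" by (intro F_section) auto
    then show "(\<lambda>\<omega>. ennreal \<bar>F q \<omega>\<bar>) \<in> borel_measurable Hs" by measurable
  qed
  then show ?thesis by (simp add: S_def[abs_def])
qed

lemma S_finite: "(\<integral>\<^sup>+\<omega>. S \<omega> \<partial>M) < \<infinity>"
proof -
  have "(\<integral>\<^sup>+\<omega>. S \<omega> \<partial>M) \<le> (\<integral>\<^sup>+ \<omega>. (SUP t\<in>{t. 0 \<le> t \<and> ennreal t < t_G M \<gamma>}. ennreal \<bar>F t \<omega>\<bar>) \<partial>M)"
    unfolding S_def by (intro nn_integral_mono SUP_subset_mono) auto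
  then show ?thesis using F_sup by (rule le_less_trans)
qed

lemma AE_F_eq_X: "AE \<omega> in M. \<forall>t\<ge>0. ennreal t < \<gamma> \<omega> \<longrightarrow> F t \<omega> = X t \<omega>"
  using X_eq by eventually_elim auto

lemma AE_X_after: "AE \<omega> in M. \<forall>t\<ge>0. \<gamma> \<omega> \<le> ennreal t \<longrightarrow> X t \<omega> = L \<omega>"
  using X_eq by eventually_elim auto

text \<open>\<open>F\<close> itself is not assumed right-continuous, but before
  \<open>\<gamma>\<close> it equals \<open>X\<close>, which is. A value above the rational supremum
  would persist at rational times slightly later, still before \<open>\<gamma>\<close> and hence
  before \<open>tG\<close>.\<close>

lemma AE_F_le_S: "AE \<omega> in M. \<forall>t\<ge>0. ennreal t < \<gamma> \<omega> \<longrightarrow> ennreal \<bar>F t \<omega>\<bar> \<le> S \<omega>"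
  using AE_F_eq_X X_fv[unfolded rc_finite_variation_def] AE_\<gamma>_le_tG
proof eventually_elim
  case (elim \<omega>)
  show ?case
  proof (intro allI impI)
    fix t :: real assume t: "0 \<le> t" "ennreal t < \<gamma> \<omega>"
    show "ennreal \<bar>F t \<omega>\<bar> \<le> S \<omega>"
    proof (rule ccontr)
      assume "\<not> ennreal \<bar>F t \<omega>\<bar> \<le> S \<omega>"
      then have less: "S \<omega> < ennreal \<bar>X t \<omega>\<bar>" using elim(1) t by (simp add: not_le)
      have "((\<lambda>s. X s \<omega>) \<longlongrightarrow> X t \<omega>) (at_right t)"
        using elim(2) t by (simp add: continuous_within)
      then have "((\<lambda>s. ennreal \<bar>X s \<omega>\<bar>) \<longlongrightarrow> ennreal \<bar>X t \<omega>\<bar>) (at_right t)"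
        by (intro tendsto_intros)
      then have "eventually (\<lambda>s. S \<omega> < ennreal \<bar>X s \<omega>\<bar>) (at_right t)"
        using less by (rule order_tendstoD(1))
      then obtain b where b: "t < b" "\<And>y. t < y \<Longrightarrow> y < b \<Longrightarrow> S \<omega> < ennreal \<bar>X y \<omega>\<bar>"
        by (auto simp: eventually_at_right_field)
      obtain c where c: "t < c" "ennreal c \<le> \<gamma> \<omega>"
      proof (cases "\<gamma> \<omega>")
        case (real r)
        then show ?thesis using t that[of r] by (auto simp: ennreal_less_iff)
      next
        case top
        then show ?thesis using that[of "t + 1"] by auto
      qed
      obtain q where q: "q \<in> \<rat>" "t < q" "q < min b c"
        using Rats_dense_in_real[of t "min b c"] b(1) c(1) by auto
      then have qc: "ennreal q < ennreal c" using t by (intro ennreal_lessI) auto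
      then have "ennreal q < \<gamma> \<omega>" "ennreal q < tG" using c elim(3) by (auto intro: less_le_trans order_trans)
      then have "ennreal \<bar>F q \<omega>\<bar> \<le> S \<omega>"
        unfolding S_def using q t by (intro SUP_upper) auto
      moreover have "F q \<omega> = X q \<omega>" using elim(1) q t \<open>ennreal q < \<gamma> \<omega>\<close> by auto
      ultimately show False using b(2)[of q] q by (simp add: leD)
    qed
  qed
qed

text \<open>The bound strictly before \<open>\<gamma>\<close> is carried over to
  \<open>\<gamma>\<close> by the independent copy; in the exceptional case that nothing survives
  \<open>\<gamma>\<close>, \<open>Fz\<close> is \<open>0\<close>.\<close>

lemma AE_Fz_\<gamma>_le_S: "AE \<omega> in M. ennreal \<bar>Fz (\<gamma> \<omega>) \<omega>\<bar> \<le> S \<omega>"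
proof -
  have m: "Measurable.pred (borel \<Otimes>\<^sub>M Hs) (\<lambda>(v, \<omega>). v < \<infinity> \<longrightarrow> ennreal \<bar>F (enn2real v) \<omega>\<bar> \<le> S \<omega>)"
  proof -
    have [measurable]: "(\<lambda>z. F (enn2real (fst z)) (snd z)) \<in> borel_measurable (borel \<Otimes>\<^sub>M Hs)"
      using F_measurable_ennreal by (simp only: case_prod_beta')
    have [measurable]: "(\<lambda>z. S (snd z)) \<in> borel_measurable ((borel :: ennreal measure) \<Otimes>\<^sub>M Hs)"
      by (rule measurable_compose[OF measurable_snd S_measurable])
    show ?thesis unfolding case_prod_beta' by measurable
  qed
  have "AE \<omega> in M. \<forall>v<\<gamma> \<omega>. v < \<infinity> \<longrightarrow> ennreal \<bar>F (enn2real v) \<omega>\<bar> \<le> S \<omega>"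
    using AE_F_le_S
  proof eventually_elim
    case (elim \<omega>)
    show ?case
    proof (intro allI impI)
      fix v assume "v < \<gamma> \<omega>" "v < \<infinity>"
      then show "ennreal \<bar>F (enn2real v) \<omega>\<bar> \<le> S \<omega>" using elim by (cases v) auto
    qed
  qed
  from AE_independent_copy[OF m this] show ?thesis
    by eventually_elim (auto simp: Fz_def)
qed

lemma Hs_M: "f \<in> borel_measurable Hs \<Longrightarrow> f \<in> borel_measurable M"
  by (rule measurable_from_subalg[OF sub])

lemma integrable_bounded_S:
  fixes f :: "'a \<Rightarrow> real"
  assumes "f \<in> borel_measurable M" "AE \<omega> in M. ennreal \<bar>f \<omega>\<bar> \<le> S \<omega>"
  shows "integrable M f"
proof (rule integrableI_bounded)
  have "(\<integral>\<^sup>+\<omega>. ennreal (norm (f \<omega>)) \<partial>M) \<le> (\<integral>\<^sup>+\<omega>. S \<omega> \<partial>M)"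
    using assms(2) by (intro nn_integral_mono_AE) auto
  then show "(\<integral>\<^sup>+\<omega>. ennreal (norm (f \<omega>)) \<partial>M) < \<infinity>" using S_finite by (rule le_less_trans)
qed fact

lemma integrable_Fz_\<gamma>: "integrable M (\<lambda>\<omega>. Fz (\<gamma> \<omega>) \<omega>)"
  by (rule integrable_bounded_S[OF graph_measurable[OF Fz_measurable] AE_Fz_\<gamma>_le_S])

lemma integrable_F_0: "integrable M (F 0)"
proof (rule integrable_bounded_S[OF Hs_M[OF F_section]])
  show "AE \<omega> in M. ennreal \<bar>F 0 \<omega>\<bar> \<le> S \<omega>"
    using AE_F_le_S \<gamma>_pos by eventually_elim auto
qed simp

lemma L_M: "L \<in> borel_measurable M" using L_int by auto

lemma join_time: "subalgebra M (join_time M Hs \<gamma>)"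
  "\<gamma> \<in> borel_measurable (join_time M Hs \<gamma>)" "(\<lambda>\<omega>. \<omega>) \<in> measurable (join_time M Hs \<gamma>) Hs"
proof -
  have g: "sets Hs \<union> sets (vimage_algebra (space M) \<gamma> borel) \<subseteq> sets M"
    using sets_Hs \<gamma>_measurable sets_vimage_algebra2[of \<gamma> "space M" borel] by (auto simp: measurable_sets)
  then have pow: "sets Hs \<union> sets (vimage_algebra (space M) \<gamma> borel) \<subseteq> Pow (space M)"
    using sets.sets_into_space by blast
  have s: "sets (join_time M Hs \<gamma>) = sigma_sets (space M) (sets Hs \<union> sets (vimage_algebra (space M) \<gamma> borel))"
    and sp: "space (join_time M Hs \<gamma>) = space M"
    unfolding join_time_def using pow by (auto simp: sets_measure_of space_measure_of)
  show "subalgebra M (join_time M Hs \<gamma>)"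
    unfolding subalgebra_def s sp using g by (auto intro!: sets.sigma_sets_subset)
  show "\<gamma> \<in> borel_measurable (join_time M Hs \<gamma>)"
  proof (rule measurableI)
    fix A :: "ennreal set" assume "A \<in> sets borel"
    then have "\<gamma> -` A \<inter> space M \<in> sets (vimage_algebra (space M) \<gamma> borel)"
      by (intro in_vimage_algebra) auto
    then show "\<gamma> -` A \<inter> space (join_time M Hs \<gamma>) \<in> sets (join_time M Hs \<gamma>)"
      unfolding s sp by (intro sigma_sets.Basic) auto
  qed auto
  show "(\<lambda>\<omega>. \<omega>) \<in> measurable (join_time M Hs \<gamma>) Hs"
  proof (rule measurableI)
    fix A assume A: "A \<in> sets Hs"
    then have "A \<subseteq> space M" using sets.sets_into_space[of A Hs] by simp
    then have "(\<lambda>\<omega>. \<omega>) -` A \<inter> space M = A" by auto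
    then show "(\<lambda>\<omega>. \<omega>) -` A \<inter> space (join_time M Hs \<gamma>) \<in> sets (join_time M Hs \<gamma>)"
      unfolding s sp using A by (auto intro: sigma_sets.Basic)
  qed (simp add: sp)
qed

text \<open>The weight \<open>p\<close> at \<open>\<gamma>\<close> is measurable for the
  \<open>\<sigma>\<close>-algebra that joins \<open>Hs\<close> and \<open>\<gamma>\<close>, so under
  it \<open>L\<close> may be exchanged for its conditional expectation.\<close>

lemma H_\<gamma>:
  assumes p: "(\<lambda>(v, \<omega>). p v \<omega>) \<in> borel_measurable (borel \<Otimes>\<^sub>M Hs)" and b: "\<And>v \<omega>. \<bar>p v \<omega> :: real\<bar> \<le> 1"
  shows "integrable M (\<lambda>\<omega>. p (\<gamma> \<omega>) \<omega> * H (\<gamma> \<omega>) \<omega>)"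
    and "integrable M (\<lambda>\<omega>. p (\<gamma> \<omega>) \<omega> * L \<omega>)"
    and "(\<integral>\<omega>. p (\<gamma> \<omega>) \<omega> * H (\<gamma> \<omega>) \<omega> \<partial>M) = (\<integral>\<omega>. p (\<gamma> \<omega>) \<omega> * L \<omega> \<partial>M)"
proof -
  interpret j: finite_measure_subalgebra M "join_time M Hs \<gamma>"
    by unfold_locales (rule join_time)
  have pj: "(\<lambda>\<omega>. p (\<gamma> \<omega>) \<omega>) \<in> borel_measurable (join_time M Hs \<gamma>)"
    using measurable_compose[OF measurable_Pair[OF join_time(2,3)] p] by (simp only: prod.case)
  have pM: "(\<lambda>\<omega>. p (\<gamma> \<omega>) \<omega>) \<in> borel_measurable M" by (rule graph_measurable[OF p])
  show iL: "integrable M (\<lambda>\<omega>. p (\<gamma> \<omega>) \<omega> * L \<omega>)"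
    using L_int pM L_M b by (intro Bochner_Integration.integrable_bound[OF L_int] borel_measurable_times)
      (auto intro!: AE_I2 mult_left_le_one_le simp: abs_mult)
  note R = j.real_cond_exp_intg[OF iL pj L_M]
  have HM: "(\<lambda>\<omega>. p (\<gamma> \<omega>) \<omega> * H (\<gamma> \<omega>) \<omega>) \<in> borel_measurable M"
    by (intro borel_measurable_times pM graph_measurable[OF H_measurable])
  have ae: "AE \<omega> in M. p (\<gamma> \<omega>) \<omega> * real_cond_exp M (join_time M Hs \<gamma>) L \<omega> = p (\<gamma> \<omega>) \<omega> * H (\<gamma> \<omega>) \<omega>"
    using H_ae by eventually_elim simp
  show "integrable M (\<lambda>\<omega>. p (\<gamma> \<omega>) \<omega> * H (\<gamma> \<omega>) \<omega>)"
    by (rule integrable_cong_AE_imp[OF R(1) HM ae])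
  have "(\<integral>\<omega>. p (\<gamma> \<omega>) \<omega> * H (\<gamma> \<omega>) \<omega> \<partial>M) = (\<integral>\<omega>. p (\<gamma> \<omega>) \<omega> * real_cond_exp M (join_time M Hs \<gamma>) L \<omega> \<partial>M)"
    using ae HM R(1) by (intro integral_cong_AE) auto
  then show "(\<integral>\<omega>. p (\<gamma> \<omega>) \<omega> * H (\<gamma> \<omega>) \<omega> \<partial>M) = (\<integral>\<omega>. p (\<gamma> \<omega>) \<omega> * L \<omega> \<partial>M)"
    using R(2) by simp
qed

definition Y :: "'a \<Rightarrow> real" where "Y \<omega> = L \<omega> - Fz (\<gamma> \<omega>) \<omega>"

text \<open>The martingale property in weak form: \<open>H_\<gamma>\<close> replaces
  \<open>L\<close> by \<open>H\<close> inside \<open>Y\<close>, and \<open>compensation\<close> is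
  applied to \<open>p v \<omega> * \<phi> v \<omega>\<close>. The weight \<open>p\<close> later
  encodes the time window, the conditioning event and a stopping time.\<close>

lemma compensated_jump:
  assumes p: "(\<lambda>(v, \<omega>). p v \<omega>) \<in> borel_measurable (borel \<Otimes>\<^sub>M Hs)" and b: "\<And>v \<omega>. \<bar>p v \<omega> :: real\<bar> \<le> 1"
  defines "J \<equiv> \<lambda>\<omega> v. p v \<omega> * \<phi> v \<omega> / W v \<omega> * (if v \<le> \<gamma> \<omega> then 1 else 0)"
  shows "AE \<omega> in M. integrable (\<kappa> \<omega>) (J \<omega>)"
    and "integrable M (\<lambda>\<omega>. p (\<gamma> \<omega>) \<omega> * Y \<omega>)"
    and "integrable M (\<lambda>\<omega>. \<integral>v. J \<omega> v \<partial>\<kappa> \<omega>)"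
    and "(\<integral>\<omega>. p (\<gamma> \<omega>) \<omega> * Y \<omega> - (\<integral>v. J \<omega> v \<partial>\<kappa> \<omega>) \<partial>M) = 0"
proof -
  have pM: "(\<lambda>\<omega>. p (\<gamma> \<omega>) \<omega>) \<in> borel_measurable M" by (rule graph_measurable[OF p])
  have h: "(\<lambda>(v, \<omega>). p v \<omega> * \<phi> v \<omega>) \<in> borel_measurable (borel \<Otimes>\<^sub>M Hs)"
    using borel_measurable_times[OF p \<phi>_measurable] by (simp only: case_prod_beta')
  have iF: "integrable M (\<lambda>\<omega>. p (\<gamma> \<omega>) \<omega> * Fz (\<gamma> \<omega>) \<omega>)"
    using integrable_Fz_\<gamma> pM b by (intro Bochner_Integration.integrable_bound[OF integrable_Fz_\<gamma>] borel_measurable_times)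
      (auto intro!: AE_I2 mult_left_le_one_le simp: abs_mult)
  note HL = H_\<gamma>[OF p b]
  have i: "integrable M (\<lambda>\<omega>. p (\<gamma> \<omega>) \<omega> * \<phi> (\<gamma> \<omega>) \<omega>)"
    using Bochner_Integration.integrable_diff[OF HL(1) iF] by (simp add: \<phi>_def algebra_simps)
  show iY: "integrable M (\<lambda>\<omega>. p (\<gamma> \<omega>) \<omega> * Y \<omega>)"
    using Bochner_Integration.integrable_diff[OF HL(2) iF] by (simp add: Y_def algebra_simps)
  note c = compensation[OF h i]
  show "AE \<omega> in M. integrable (\<kappa> \<omega>) (J \<omega>)" using c(1) by (simp add: J_def)
  show iJ: "integrable M (\<lambda>\<omega>. \<integral>v. J \<omega> v \<partial>\<kappa> \<omega>)" using c(2) by (simp add: J_def)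
  have "(\<integral>\<omega>. p (\<gamma> \<omega>) \<omega> * Y \<omega> \<partial>M) = (\<integral>\<omega>. p (\<gamma> \<omega>) \<omega> * \<phi> (\<gamma> \<omega>) \<omega> \<partial>M)"
    using Bochner_Integration.integral_diff[OF HL(2) iF] Bochner_Integration.integral_diff[OF HL(1) iF] HL(3)
    by (simp add: \<phi>_def Y_def algebra_simps)
  then show "(\<integral>\<omega>. p (\<gamma> \<omega>) \<omega> * Y \<omega> - (\<integral>v. J \<omega> v \<partial>\<kappa> \<omega>) \<partial>M) = 0"
    using Bochner_Integration.integral_diff[OF iY iJ] c(4) by (simp add: J_def)
qed

end

text \<open>An indefinite integral is right-continuous by dominated convergence, because the
  truncation includes its endpoint, and of finite variation as the difference of the integrals of
  the two parts of \<open>\<psi>\<close>.\<close>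

lemma truncated_integral_path:
  fixes N :: "ennreal measure" and \<psi> :: "ennreal \<Rightarrow> real"
  assumes sets: "sets N = sets borel" and \<psi>: "integrable N \<psi>"
  defines "l \<equiv> \<lambda>t::real. \<integral>v. \<psi> v * (if v \<le> ennreal t then 1 else 0) \<partial>N"
  shows "continuous (at_right t) l" and "finite_variation_on l 0 b"
proof -
  note [measurable_cong] = sets
  have i: "integrable N (\<lambda>v. f v * (if v \<le> u then 1 else 0))" if "integrable N f" for f :: "ennreal \<Rightarrow> real" and u
  proof -
    have [measurable]: "f \<in> borel_measurable borel" using borel_measurable_integrable[OF that] by simp
    show ?thesis
      by (rule Bochner_Integration.integrable_bound[OF that]) (auto intro!: AE_I2)
  qed
  have "(l \<longlongrightarrow> l t) (at_right t)"
  proof (rule tendsto_at_right_sequentially[of t "t + 1"])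
    fix S :: "nat \<Rightarrow> real" assume S: "\<And>n. t < S n" "S \<longlonglongrightarrow> t"
    show "(\<lambda>n. l (S n)) \<longlonglongrightarrow> l t"
      unfolding l_def
    proof (rule integral_dominated_convergence[where w = "\<lambda>v. norm (\<psi> v)"])
      show "AE v in N. (\<lambda>n. \<psi> v * (if v \<le> ennreal (S n) then 1 else 0)) \<longlonglongrightarrow> \<psi> v * (if v \<le> ennreal t then 1 else 0)"
      proof (rule AE_I2)
        fix v
        have "eventually (\<lambda>n. (v \<le> ennreal (S n)) = (v \<le> ennreal t)) sequentially"
        proof (cases "v \<le> ennreal t")
          case True
          have "v \<le> ennreal (S n)" for n using True S(1)[of n] by (meson ennreal_leI less_imp_le order_trans)
          then show ?thesis using True by simp
        next
          case False
          have "(\<lambda>n. ennreal (S n)) \<longlonglongrightarrow> ennreal t" using S(2) by (intro tendsto_intros)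
          then have "eventually (\<lambda>n. ennreal (S n) < v) sequentially" using False by (intro order_tendstoD(2)) auto
          then show ?thesis by eventually_elim (use False in auto)
        qed
        then show "(\<lambda>n. \<psi> v * (if v \<le> ennreal (S n) then 1 else 0)) \<longlonglongrightarrow> \<psi> v * (if v \<le> ennreal t then 1 else 0)"
          by (intro tendsto_eventually) (auto elim!: eventually_mono)
      qed
    qed (use \<psi> borel_measurable_integrable[OF i[OF \<psi>]] in \<open>auto intro!: AE_I2\<close>)
  qed simp
  then show "continuous (at_right t) l" by (simp add: continuous_within)
  define lp ln where "lp t = (\<integral>v. max 0 (\<psi> v) * (if v \<le> ennreal t then 1 else 0) \<partial>N)"
    and "ln t = (\<integral>v. max 0 (- \<psi> v) * (if v \<le> ennreal t then 1 else 0) \<partial>N)" for t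
  have i2: "integrable N (\<lambda>v. max 0 (\<psi> v))" "integrable N (\<lambda>v. max 0 (- \<psi> v))" using \<psi> by auto
  have l_eq: "l = (\<lambda>t. lp t - ln t)"
  proof
    fix t
    have "\<psi> v * (if v \<le> ennreal t then 1 else 0) =
        max 0 (\<psi> v) * (if v \<le> ennreal t then 1 else 0) - max 0 (- \<psi> v) * (if v \<le> ennreal t then 1 else 0)" for v
      by (simp add: max_def)
    then show "l t = lp t - ln t"
      unfolding l_def lp_def ln_def using Bochner_Integration.integral_diff[OF i[OF i2(1)] i[OF i2(2)], of "ennreal t" "ennreal t"] by simp
  qed
  have m: "mono_on {0..b} (\<lambda>t. \<integral>v. f v * (if v \<le> ennreal t then 1 else 0) \<partial>N)"
    if "integrable N f" "\<And>v. 0 \<le> f v" for f :: "ennreal \<Rightarrow> real"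
  proof (rule mono_onI)
    fix r s :: real assume "r \<le> s"
    then have "v \<le> ennreal r \<Longrightarrow> v \<le> ennreal s" for v by (meson ennreal_leI order_trans)
    then have "f v * (if v \<le> ennreal r then 1 else 0) \<le> f v * (if v \<le> ennreal s then 1 else 0)" for v
      using that(2)[of v] by auto
    then show "(\<integral>v. f v * (if v \<le> ennreal r then 1 else 0) \<partial>N) \<le> (\<integral>v. f v * (if v \<le> ennreal s then 1 else 0) \<partial>N)"
      by (rule Bochner_Integration.integral_mono[OF i[OF that(1)] i[OF that(1)]])
  qed
  show "finite_variation_on l 0 b"
    unfolding l_eq lp_def ln_def
    by (intro finite_variation_on_diff finite_variation_on_mono m i2) auto
qed

section \<open>The closed form along one path\<close>

locale compensator_path =
  compensator_setup M Hs \<gamma> G F X L H + single_jump_path M Hs \<gamma> G \<omega>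
  for M Hs :: "'a measure" and \<gamma> G F X L H \<omega>
begin

lemma Fz_eq: "0 \<le> t \<Longrightarrow> Fz (ennreal t) \<omega> = D.Fz (\<lambda>s. F s \<omega>) t"
  using measure_\<kappa>_greaterThan[of t] G_bounds[OF \<omega>, of t]
  by (auto simp: Fz_def D.Fz_def k.emeasure_eq_measure D.g0_def)

lemma \<phi>_section: "(\<lambda>v. \<phi> v \<omega>) \<in> borel_measurable borel"
  and W_section: "(\<lambda>v. W v \<omega>) \<in> borel_measurable borel"
  and H_section: "(\<lambda>v. H v \<omega>) \<in> borel_measurable borel"
  by (rule \<kappa>_section[OF _ \<omega>], rule \<phi>_measurable W_measurable H_measurable)+

lemma set_integral_K':
  assumes f: "f \<in> borel_measurable borel"
  shows "set_integrable D.K {0<..t} (\<lambda>s. f (ennreal s) / D.w s) \<longleftrightarrow>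
      integrable (\<kappa> \<omega>) (\<lambda>v. f v / W v \<omega> * (if 0 < v \<and> v \<le> ennreal t then 1 else 0))"
    and "(LINT s:{0<..t}|D.K. f (ennreal s) / D.w s) =
      (\<integral>v. f v / W v \<omega> * (if 0 < v \<and> v \<le> ennreal t then 1 else 0) \<partial>\<kappa> \<omega>)"
proof -
  have m: "(\<lambda>s. f (ennreal s) / D.w s) \<in> borel_measurable borel" using f by measurable
  have eq: "f (ennreal (enn2real v)) / D.w (enn2real v) * (if 0 < v \<and> v \<le> ennreal t then 1 else 0) =
      f v / W v \<omega> * (if 0 < v \<and> v \<le> ennreal t then 1 else 0)" for v
  proof (cases "0 < v \<and> v \<le> ennreal t")
    case True
    then obtain s where "v = ennreal s" "0 < s" by (cases v) (auto simp: top_unique)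
    then show ?thesis by (simp add: w_eq_W)
  next
    case False
    then show ?thesis by (simp only: if_False mult_zero_right)
  qed
  show "set_integrable D.K {0<..t} (\<lambda>s. f (ennreal s) / D.w s) \<longleftrightarrow>
      integrable (\<kappa> \<omega>) (\<lambda>v. f v / W v \<omega> * (if 0 < v \<and> v \<le> ennreal t then 1 else 0))"
    using set_integral_K(1)[OF m, of t] unfolding eq .
  show "(LINT s:{0<..t}|D.K. f (ennreal s) / D.w s) =
      (\<integral>v. f v / W v \<omega> * (if 0 < v \<and> v \<le> ennreal t then 1 else 0) \<partial>\<kappa> \<omega>)"
    using set_integral_K(2)[OF m, of t] unfolding eq .
qed

lemma Ct_eq: "0 \<le> t \<Longrightarrow> Ct (ennreal t) \<omega> = D.ct (\<lambda>s. F s \<omega>) (\<lambda>s. H (ennreal s) \<omega>) t"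
proof -
  assume t: "0 \<le> t"
  have "(LINT s:{0<..t}|D.K. (H (ennreal s) \<omega> - D.Fz (\<lambda>s. F s \<omega>) s) / D.w s) = (LINT s:{0<..t}|D.K. \<phi> (ennreal s) \<omega> / D.w s)"
    by (intro set_lebesgue_integral_cong) (auto simp: \<phi>_def Fz_eq)
  also have "\<dots> = \<Lambda> (ennreal t) \<omega>"
    unfolding \<Lambda>_def by (rule set_integral_K'(2)[OF \<phi>_section])
  finally show ?thesis using t by (simp add: Ct_def D.ct_def Fz_eq)
qed

text \<open>As long as mass remains from \<open>v\<close> onwards, the truncating quantiles
  eventually exceed \<open>v\<close>, so the limit in \<open>C0\<close> is that of an eventually
  constant sequence.\<close>

lemma C0_eq: "0 < W v \<omega> \<Longrightarrow> C0 v \<omega> = Ct v \<omega>"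
proof (cases "0 < W (Q \<omega> 1) \<omega>")
  case False
  assume v: "0 < W v \<omega>"
  have 0: "W (Q \<omega> 1) \<omega> = 0" using False W_nonneg[of "Q \<omega> 1" \<omega>] by simp
  obtain n0 where "\<forall>n\<ge>n0. v < Q \<omega> (1 - 1 / (real n + 2))" using Q_0_lt[OF 0 v] by blast
  then have "eventually (\<lambda>n. Ct v \<omega> = Ct (min v (Q \<omega> (1 - 1 / (real n + 2)))) \<omega>) sequentially"
    unfolding eventually_sequentially by (intro exI[of _ n0]) (auto simp: min_def dest: less_imp_le)
  then have "(\<lambda>n. Ct (min v (Q \<omega> (1 - 1 / (real n + 2)))) \<omega>) \<longlonglongrightarrow> Ct v \<omega>"
    by (rule Lim_transform_eventually[OF tendsto_const])
  then show ?thesis using False by (simp add: C0_def limI)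
qed (simp add: C0_def)

lemma comp_value:
  assumes "has_compensator_integral G F H \<omega> t c" "0 \<le> t" "0 < W (ennreal t) \<omega>"
  shows "c = Ct (ennreal t) \<omega>"
  using D.has_compensator_integral_value[OF refl assms(2) w_pos[OF assms(2,3)] assms(1)] Ct_eq[OF assms(2)] by simp

lemma w_0_after:
  assumes "\<tau> < x" "0 \<le> \<tau>" "G \<tau> \<omega> = 1"
  shows "D.w x = 0"
  using D.w_le[OF assms(1)] D.w_nonneg[of x] assms by (simp add: D.g0_def)

text \<open>Any value of the integral is met, also past the time \<open>\<tau>\<close> at which
  \<open>G\<close> reaches \<open>1\<close>. With an atom at \<open>\<tau>\<close> neither the
  integral nor \<open>Ct\<close> changes after \<open>\<tau>\<close>. Without one the integral is
  the limit of integrals up to times before \<open>\<tau>\<close>; this is the case for which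
  \<open>C0\<close> is defined by a limit along quantiles.\<close>

lemma C0_value:
  assumes c: "has_compensator_integral G F H \<omega> t c" and t: "0 \<le> t"
  shows "C0 (ennreal t) \<omega> = c"
proof (cases "0 < W (ennreal t) \<omega>")
  case True
  then show ?thesis using comp_value[OF c t] C0_eq by simp
next
  case False
  have tW: "W (ennreal t) \<omega> = 0" using False W_nonneg[of "ennreal t" \<omega>] by simp
  have "1 - G t \<omega> \<le> D.w t" using D.w_ge[of t] t by (simp add: D.g0_def)
  moreover have "D.w t = 0" using tW w_eq_W[of t] t W_0 by (cases "t = 0") auto
  ultimately have "G t \<omega> = 1" using G_bounds[OF \<omega> t] by simp
  then have Qt: "Q \<omega> 1 \<le> ennreal t" using Q_le_iff[OF \<omega> t] by simp
  then obtain \<tau> where \<tau>: "Q \<omega> 1 = ennreal \<tau>" "0 \<le> \<tau>" by (cases "Q \<omega> 1") (auto simp: top_unique)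
  have \<tau>t: "\<tau> \<le> t" using Qt \<tau> t by (simp add: ennreal_le_iff)
  have G\<tau>: "G \<tau> \<omega> = 1" using Q_le_iff[OF \<omega> \<tau>(2), of 1] G_bounds[OF \<omega> \<tau>(2)] \<tau>(1) by simp
  show ?thesis
  proof (cases "0 < W (Q \<omega> 1) \<omega>")
    case True
    have "has_compensator_integral G F H \<omega> \<tau> c"
      by (rule D.has_compensator_integral_cut[OF refl c \<tau>(2) \<tau>t]) (rule w_0_after[OF _ \<tau>(2) G\<tau>])
    then have "c = Ct (ennreal \<tau>) \<omega>" using comp_value \<tau> True by simp
    \<comment> \<open>Beyond \<open>\<tau>\<close> there is no mass that \<open>\<Lambda>\<close>
      could collect, and \<open>Fz\<close> is \<open>0\<close> at both times.\<close>
    also have "\<dots> = Ct (ennreal t) \<omega>"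
    proof -
      have Gt: "\<not> G t \<omega> < 1" "\<not> G \<tau> \<omega> < 1" using \<open>G t \<omega> = 1\<close> G\<tau> by simp_all
      have "emeasure (\<kappa> \<omega>) {ennreal \<tau><..} = 0"
        using measure_\<kappa>_greaterThan[of \<tau>] \<tau>(2) G\<tau> by (simp add: k.emeasure_eq_measure D.g0_def)
      then have "AE y in \<kappa> \<omega>. y \<notin> {ennreal \<tau><..}" by (intro AE_not_in) (auto simp: null_sets_def)
      then have ae: "AE y in \<kappa> \<omega>. \<phi> y \<omega> / W y \<omega> * (if 0 < y \<and> y \<le> ennreal \<tau> then 1 else 0) = \<phi> y \<omega> / W y \<omega> * (if 0 < y \<and> y \<le> ennreal t then 1 else 0)"
      proof eventually_elim
        case (elim y)
        then have "y \<le> ennreal \<tau>" by simp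
        moreover from this have "y \<le> ennreal t" using ennreal_leI[OF \<tau>t] by (rule order_trans)
        ultimately show ?case by simp
      qed
      have m: "(\<lambda>y. \<phi> y \<omega> / W y \<omega> * (if 0 < y \<and> y \<le> u then 1 else 0)) \<in> borel_measurable (\<kappa> \<omega>)" for u :: ennreal
        by (simp only: measurable_cong_sets[OF sets_\<kappa> refl])
           (intro borel_measurable_times borel_measurable_divide \<phi>_section W_section, measurable)
      have "\<Lambda> (ennreal \<tau>) \<omega> = \<Lambda> (ennreal t) \<omega>"
        unfolding \<Lambda>_def by (rule integral_cong_AE[OF m m ae])
      then show ?thesis using Gt t \<tau>(2) by (simp add: Ct_def Fz_eq D.Fz_def)
    qed
    finally show ?thesis using True by (simp add: C0_def)
  next
    case False
    have W0: "W (ennreal \<tau>) \<omega> = 0" using False W_nonneg[of "Q \<omega> 1" \<omega>] \<tau> by simp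
    then have \<tau>0: "0 < \<tau>" using W_0 \<tau>(2) by (cases "\<tau> = 0") auto
    have w\<tau>: "D.w \<tau> = 0" using w_eq_W[OF \<tau>0] W0 by simp
    define u where "u n = 1 - 1 / (real n + 2)" for n
    define s where "s n = enn2real (Q \<omega> (u n))" for n
    have lim_g: "(D.g0 \<longlongrightarrow> 1) (at_left \<tau>)"
      using mono_tendsto_at_left_Lim[OF D.mono_g0, of \<tau>] w\<tau> by (simp add: D.w_def)
    \<comment> \<open>\<open>G\<close> tends to \<open>1\<close> from the left at
      \<open>\<tau>\<close>, so every level below \<open>1\<close> is already reached strictly
      before \<open>\<tau>\<close>.\<close>
    have Qlt: "Q \<omega> (u n) < ennreal \<tau>" for n
    proof -
      have "u n < 1" by (simp add: u_def)
      then have "eventually (\<lambda>x. u n < D.g0 x) (at_left \<tau>)" using lim_g by (intro order_tendstoD(1))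
      moreover have "eventually (\<lambda>x. x \<in> {0<..<\<tau>}) (at_left \<tau>)" using \<tau>0 by (rule eventually_at_left_real)
      ultimately have "eventually (\<lambda>x. u n < D.g0 x \<and> 0 < x \<and> x < \<tau>) (at_left \<tau>)"
        by eventually_elim auto
      then obtain x where x: "u n < D.g0 x" "0 < x" "x < \<tau>"
        using eventually_happens'[OF trivial_limit_at_left_real] by blast
      then have "Q \<omega> (u n) \<le> ennreal x" using Q_le_iff[OF \<omega>, of x "u n"] by (simp add: D.g0_def)
      also have "\<dots> < ennreal \<tau>" using x by (intro ennreal_lessI) auto
      finally show ?thesis .
    qed
    then have s: "ennreal (s n) = Q \<omega> (u n)" "0 \<le> s n" "s n < \<tau>" for n
    proof -
      obtain r where r: "Q \<omega> (u n) = ennreal r" "0 \<le> r" using Qlt[of n] by (cases "Q \<omega> (u n)") auto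
      then show "ennreal (s n) = Q \<omega> (u n)" "0 \<le> s n" "s n < \<tau>"
        using Qlt[of n] by (auto simp: s_def ennreal_less_iff)
    qed
    have s_lim: "s \<longlonglongrightarrow> \<tau>"
    proof (rule order_tendstoI)
      fix a assume a: "a < \<tau>"
      define b where "b = max 0 a"
      have b: "0 \<le> b" "b < \<tau>" using a \<tau>0 by (auto simp: b_def)
      have "G b \<omega> < 1"
      proof (rule ccontr)
        assume "\<not> G b \<omega> < 1"
        then have "Q \<omega> 1 \<le> ennreal b" using Q_le_iff[OF \<omega> b(1), of 1] by simp
        then show False using b \<tau> by (simp add: ennreal_le_iff)
      qed
      then obtain n0 where n0: "1 / (1 - G b \<omega>) < real n0" using reals_Archimedean2 by blast
      have "a < s n" if "n0 \<le> n" for n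
      proof -
        have "1 / (1 - G b \<omega>) < real n + 2" using n0 that by linarith
        then have "1 / (real n + 2) < 1 - G b \<omega>"
          using \<open>G b \<omega> < 1\<close> by (simp add: field_simps)
        then have "\<not> Q \<omega> (u n) \<le> ennreal b" using Q_le_iff[OF \<omega> b(1)] by (simp add: u_def)
        then have "ennreal b < ennreal (s n)" unfolding s(1) by (simp only: not_le)
        then have "b < s n" using b(1) by (simp add: ennreal_less_iff)
        then show ?thesis by (simp add: b_def)
      qed
      then show "eventually (\<lambda>n. a < s n) sequentially" by (auto simp: eventually_sequentially)
    next
      fix a assume "\<tau> < a"
      then have "s n < a" for n using s(3)[of n] by linarith
      then show "eventually (\<lambda>n. s n < a) sequentially" by simp
    qed
    have z: "D.w x = 0" if "\<tau> \<le> x" for x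
      using D.w_antimono[OF that] w\<tau> D.w_nonneg[of x] by simp
    obtain cs where cs: "\<And>n. has_compensator_integral G F H \<omega> (s n) (cs n)" "cs \<longlonglongrightarrow> c"
      using D.has_compensator_integral_lim[OF refl c z s(2,3) s_lim \<tau>t] by blast
    have "cs n = Ct (Q \<omega> (u n)) \<omega>" for n
    proof -
      have "G (s n) \<omega> < 1"
      proof (rule ccontr)
        assume "\<not> G (s n) \<omega> < 1"
        then have "Q \<omega> 1 \<le> ennreal (s n)" using Q_le_iff[OF \<omega> s(2), of 1 n] by simp
        then show False using s(2,3)[of n] \<tau> by (simp add: ennreal_le_iff)
      qed
      then have "0 < D.w (s n)" using D.w_ge[of "s n"] s(2)[of n] by (simp add: D.g0_def)
      then have "0 < W (ennreal (s n)) \<omega>" using w_eq_W[of "s n"] s(2)[of n] W_0 by (cases "s n = 0") auto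
      then show ?thesis using comp_value[OF cs(1) s(2)] s(1) by simp
    qed
    moreover have "min (ennreal t) (Q \<omega> (u n)) = Q \<omega> (u n)" for n
    proof -
      have "Q \<omega> (u n) \<le> ennreal t" using Qlt[of n] \<tau>t by (meson ennreal_leI less_imp_le order_trans)
      then show ?thesis by (simp add: min_def)
    qed
    ultimately have "(\<lambda>n. Ct (min (ennreal t) (Q \<omega> (u n))) \<omega>) = cs" by (simp add: fun_eq_iff)
    then show ?thesis using False limI[OF cs(2)] by (simp add: C0_def u_def)
  qed
qed

end

section \<open>Regularity and value of the compensator on almost every path\<close>

lemma finite_variation_on_const: "finite_variation_on (\<lambda>_. c) a b"
  by (rule finite_variation_on_mono) (simp add: mono_on_def)

lemma (in compensator_setup) H_\<gamma>_integrable: "integrable M (\<lambda>\<omega>. H (\<gamma> \<omega>) \<omega>)"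
  using H_\<gamma>(1)[of "\<lambda>_ _. 1"] by simp

definition (in compensator_setup) N :: "real \<Rightarrow> 'a \<Rightarrow> real" where
  "N t \<omega> = F 0 \<omega> + Y \<omega> * (if \<gamma> \<omega> \<le> ennreal t then 1 else 0) - \<Lambda> (min (ennreal t) (\<gamma> \<omega>)) \<omega>"

text \<open>All almost sure properties that are used pathwise, bundled so that a single null set is
  discarded. Integrability reaches only up to \<open>\<gamma> \<omega>\<close>; positivity of
  \<open>W\<close> at \<open>\<gamma>\<close> keeps the denominators up to there away from
  \<open>0\<close>.\<close>

locale good_path = compensator_path +
  assumes W_\<gamma>: "0 < W (\<gamma> \<omega>) \<omega>" and \<gamma>0: "0 < \<gamma> \<omega>" and \<gamma>_le_tG: "\<gamma> \<omega> \<le> tG"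
    and \<kappa>_tG: "emeasure (\<kappa> \<omega>) {tG<..} = 0"
    and X_rc: "\<And>t. 0 \<le> t \<Longrightarrow> continuous (at_right t) (\<lambda>s. X s \<omega>)"
    and X_bv: "\<And>b. 0 \<le> b \<Longrightarrow> finite_variation_on (\<lambda>s. X s \<omega>) 0 b"
    and F_eq: "\<And>t. 0 \<le> t \<Longrightarrow> ennreal t < \<gamma> \<omega> \<Longrightarrow> F t \<omega> = X t \<omega>"
    and X_after: "\<And>t. 0 \<le> t \<Longrightarrow> \<gamma> \<omega> \<le> ennreal t \<Longrightarrow> X t \<omega> = L \<omega>"
    and \<phi>_int: "integrable (\<kappa> \<omega>) (\<lambda>v. \<phi> v \<omega> / W v \<omega> * (if v \<le> \<gamma> \<omega> then 1 else 0))"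
    and H_int: "integrable (\<kappa> \<omega>) (\<lambda>v. H v \<omega> / W v \<omega> * (if v \<le> \<gamma> \<omega> then 1 else 0))"
begin

definition \<psi> :: "ennreal \<Rightarrow> real" where
  "\<psi> v = \<phi> v \<omega> / W v \<omega> * (if 0 < v \<and> v \<le> \<gamma> \<omega> then 1 else 0)"

lemma \<psi>_measurable: "\<psi> \<in> borel_measurable borel"
  unfolding \<psi>_def by (intro borel_measurable_times borel_measurable_divide \<phi>_section W_section) measurable

lemma \<psi>_int: "integrable (\<kappa> \<omega>) \<psi>"
  by (rule Bochner_Integration.integrable_bound[OF \<phi>_int])
     (use \<psi>_measurable in \<open>auto intro!: AE_I2 simp: \<psi>_def\<close>)

lemma \<Lambda>_min: "\<Lambda> (min v (\<gamma> \<omega>)) \<omega> = (\<integral>y. \<psi> y * (if y \<le> v then 1 else 0) \<partial>\<kappa> \<omega>)"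
  unfolding \<Lambda>_def by (intro Bochner_Integration.integral_cong) (auto simp: \<psi>_def)

lemma step_fv: "0 \<le> c \<Longrightarrow> mono_on {0..b} (\<lambda>t. c * (if \<gamma> \<omega> \<le> ennreal t then 1 else 0 :: real))"
  by (rule mono_onI) (auto intro: order_trans ennreal_leI)

lemma N_fv: "finite_variation_on (\<lambda>t. N t \<omega>) 0 b"
proof -
  \<comment> \<open>\<open>Y\<close> has no sign, so the jump is split into its positive and
    negative part to obtain monotone terms.\<close>
  have e: "N t \<omega> = ((F 0 \<omega> - max 0 (- Y \<omega>) * (if \<gamma> \<omega> \<le> ennreal t then 1 else 0)) -
      (0 - max 0 (Y \<omega>) * (if \<gamma> \<omega> \<le> ennreal t then 1 else 0))) - (\<integral>y. \<psi> y * (if y \<le> ennreal t then 1 else 0) \<partial>\<kappa> \<omega>)" for t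
    unfolding N_def \<Lambda>_min by (simp add: max_def)
  show ?thesis
    unfolding e
    by (intro finite_variation_on_diff finite_variation_on_const finite_variation_on_mono step_fv
        truncated_integral_path(2) \<psi>_int) auto
qed

lemma N_rc: "continuous (at_right t) (\<lambda>t. N t \<omega>)" if "0 \<le> t"
proof -
  have "((\<lambda>s. if \<gamma> \<omega> \<le> ennreal s then 1 else 0 :: real) \<longlongrightarrow> (if \<gamma> \<omega> \<le> ennreal t then 1 else 0)) (at_right t)"
  proof (rule tendsto_eventually)
    show "eventually (\<lambda>s. (if \<gamma> \<omega> \<le> ennreal s then 1 else 0 :: real) = (if \<gamma> \<omega> \<le> ennreal t then 1 else 0)) (at_right t)"
    proof (cases "\<gamma> \<omega> \<le> ennreal t")
      case True
      have "eventually (\<lambda>s. s \<in> {t<..<t+1}) (at_right t)" by (rule eventually_at_right_real) simp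
      then show ?thesis
      proof eventually_elim
        case (elim s)
        then have "ennreal t \<le> ennreal s" by (intro ennreal_leI) auto
        with True have "\<gamma> \<omega> \<le> ennreal s" by (rule order_trans)
        then show ?case using True by simp
      qed
    next
      case False
      have "((\<lambda>s. ennreal s) \<longlongrightarrow> ennreal t) (at_right t)" by (intro tendsto_intros)
      then have "eventually (\<lambda>s. ennreal s < \<gamma> \<omega>) (at_right t)" using False by (intro order_tendstoD(2)) auto
      then show ?thesis by eventually_elim (use False in auto)
    qed
  qed
  then have "continuous (at_right t) (\<lambda>s. if \<gamma> \<omega> \<le> ennreal s then 1 else 0 :: real)"
    by (simp add: continuous_within)
  then show ?thesis
    unfolding N_def \<Lambda>_min
    by (intro continuous_diff continuous_add continuous_mult continuous_const truncated_integral_path(1) \<psi>_int) auto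
qed

lemma W_before: "v \<le> \<gamma> \<omega> \<Longrightarrow> 0 < W v \<omega>"
  using W_antimono[of v "\<gamma> \<omega>"] W_\<gamma> by linarith

lemma Fz_before: "0 \<le> t \<Longrightarrow> ennreal t < \<gamma> \<omega> \<Longrightarrow> Fz (ennreal t) \<omega> = X t \<omega>"
proof -
  assume t: "0 \<le> t" "ennreal t < \<gamma> \<omega>"
  have "W (\<gamma> \<omega>) \<omega> \<le> measure (\<kappa> \<omega>) {ennreal t<..}"
    unfolding W_def using t by (intro k.finite_measure_mono) auto
  then have "emeasure (\<kappa> \<omega>) {ennreal t<..} \<noteq> 0" using W_\<gamma> by (simp add: k.emeasure_eq_measure)
  then show ?thesis using t F_eq[OF t] by (simp add: Fz_def)
qed

lemma Ct_before: "0 \<le> t \<Longrightarrow> ennreal t < \<gamma> \<omega> \<Longrightarrow> Ct (ennreal t) \<omega> = X t \<omega> - N t \<omega>"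
  using Fz_before[of t] by (simp add: Ct_def N_def)

lemma C_before: "0 \<le> t \<Longrightarrow> ennreal t < \<gamma> \<omega> \<Longrightarrow> C (ennreal t) \<omega> = X t \<omega> - N t \<omega>"
  using Ct_before[of t] C0_eq[OF W_before, of "ennreal t"] less_le_trans[OF _ \<gamma>_le_tG, of "ennreal t"]
  by (simp add: C_def)

lemma X_left_limit: "0 < t \<Longrightarrow> \<exists>l. ((\<lambda>s. X s \<omega>) \<longlongrightarrow> l) (at_left t)"
  by (rule finite_variation_on_left_limit[OF X_bv[of t]]) auto

text \<open>One-sided limits that exist are attained along \<open>sq\<close>, so the definition by
  sequential limits gives the value, wherever \<open>\<gamma>\<close> lies.\<close>

lemma C_tG_formula:
  assumes "((\<lambda>s. C s \<omega>) \<longlongrightarrow> c) (at_left tG)" "((\<lambda>s. F (enn2real s) \<omega>) \<longlongrightarrow> f) (at_left tG)"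
  shows "C tG \<omega> = c + (H tG \<omega> - f)"
proof -
  have "(\<lambda>n. C (sq n) \<omega>) \<longlonglongrightarrow> c" by (rule filterlim_compose[OF assms(1) sq(3)])
  then have "(\<lambda>n. C0 (sq n) \<omega>) \<longlonglongrightarrow> c" using sq(1) by (simp add: C_def)
  moreover have "(\<lambda>n. F (enn2real (sq n)) \<omega>) \<longlonglongrightarrow> f" by (rule filterlim_compose[OF assms(2) sq(3)])
  ultimately show ?thesis by (simp add: C_def limI)
qed

lemma filterlim_enn2real_at_left:
  assumes "0 < g"
  shows "filterlim enn2real (at_left g) (at_left (ennreal g))"
proof -
  have "eventually (\<lambda>s. s \<in> {..<ennreal g}) (at_left (ennreal g))"
    by (auto simp: eventually_at_filter)
  then have 1: "eventually (\<lambda>s. enn2real s < g) (at_left (ennreal g))"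
  proof eventually_elim
    case (elim s)
    then show ?case by (cases s) (auto simp: ennreal_less_iff)
  qed
  have "((\<lambda>s. s) \<longlongrightarrow> ennreal g) (at_left (ennreal g))" by (rule tendsto_ident_at)
  then have "(enn2real \<longlongrightarrow> g) (at_left (ennreal g))"
    using assms by (intro tendsto_enn2real) auto
  then show ?thesis using 1 unfolding filterlim_at by (auto elim!: eventually_mono)
qed

context
  fixes g assumes g: "\<gamma> \<omega> = tG" "tG = ennreal g" "0 < g"
begin

lemma eventually_before: "eventually (\<lambda>s. s = ennreal (enn2real s) \<and> s < \<gamma> \<omega>) (at_left tG)"
proof -
  have "eventually (\<lambda>s. s \<in> {..<tG}) (at_left tG)"
    by (auto simp: eventually_at_filter)
  then show ?thesis
  proof eventually_elim
    case (elim s)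
    then have "s < top" by (metis lessThan_iff top_greatest order_less_le_trans)
    then show ?case using elim g by simp
  qed
qed

lemma F_left_limit_tG: "\<exists>f. ((\<lambda>s. F (enn2real s) \<omega>) \<longlongrightarrow> f) (at_left tG)"
proof -
  obtain l where l: "((\<lambda>s. X s \<omega>) \<longlongrightarrow> l) (at_left g)" using X_left_limit[OF g(3)] by blast
  have "((\<lambda>s. X (enn2real s) \<omega>) \<longlongrightarrow> l) (at_left tG)"
    unfolding g(2) by (rule filterlim_compose[OF l filterlim_enn2real_at_left[OF g(3)]])
  moreover have "eventually (\<lambda>s. X (enn2real s) \<omega> = F (enn2real s) \<omega>) (at_left tG)"
    using eventually_before by eventually_elim (metis F_eq enn2real_nonneg)
  ultimately have "((\<lambda>s. F (enn2real s) \<omega>) \<longlongrightarrow> l) (at_left tG)" by (rule Lim_transform_eventually)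
  then show ?thesis ..
qed

lemma C_left_limit_tG: "\<exists>c. ((\<lambda>s. C s \<omega>) \<longlongrightarrow> c) (at_left tG)"
proof -
  have "finite_variation_on (\<lambda>t. X t \<omega> - N t \<omega>) 0 g"
    using g by (intro finite_variation_on_diff X_bv N_fv) auto
  from finite_variation_on_left_limit[OF this g(3)]
  obtain l where l: "((\<lambda>s. X s \<omega> - N s \<omega>) \<longlongrightarrow> l) (at_left g)" by auto
  have "((\<lambda>s. X (enn2real s) \<omega> - N (enn2real s) \<omega>) \<longlongrightarrow> l) (at_left tG)"
    unfolding g(2) by (rule filterlim_compose[OF l filterlim_enn2real_at_left[OF g(3)]])
  moreover have "eventually (\<lambda>s. X (enn2real s) \<omega> - N (enn2real s) \<omega> = C s \<omega>) (at_left tG)"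
    using eventually_before by eventually_elim (metis C_before enn2real_nonneg)
  ultimately have "((\<lambda>s. C s \<omega>) \<longlongrightarrow> l) (at_left tG)" by (rule Lim_transform_eventually)
  then show ?thesis ..
qed

text \<open>The jump rule agrees with the closed form. No mass lies beyond \<open>tG\<close>, so the
  atom at \<open>tG\<close> carries all of \<open>W tG\<close> and contributes exactly
  \<open>H tG\<close> to \<open>\<Lambda>\<close>, while \<open>Fz tG = 0\<close>; the left limit of
  \<open>F\<close> enters through the left limit of \<open>C\<close> and is subtracted
  again.\<close>

lemma C_tG: "C tG \<omega> = Ct tG \<omega>"
proof -
  obtain f where f: "((\<lambda>s. F (enn2real s) \<omega>) \<longlongrightarrow> f) (at_left tG)" using F_left_limit_tG by blast
  have fs: "(\<lambda>n. F (enn2real (sq n)) \<omega>) \<longlonglongrightarrow> f" by (rule filterlim_compose[OF f sq(3)])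
  define l where "l = (\<integral>y. \<psi> y * (if y < tG then 1 else 0) \<partial>\<kappa> \<omega>)"
  have sqr: "sq n = ennreal (enn2real (sq n))" for n
  proof -
    have "sq n < top" using sq(1)[of n] by (metis top_greatest order_less_le_trans)
    then show ?thesis by simp
  qed
  have C0n: "C0 (sq n) \<omega> = F (enn2real (sq n)) \<omega> - F 0 \<omega> + (\<integral>y. \<psi> y * (if y \<le> sq n then 1 else 0) \<partial>\<kappa> \<omega>)" for n
  proof -
    have lt: "ennreal (enn2real (sq n)) < \<gamma> \<omega>" using sq(1)[of n] sqr[of n] g by simp
    have "C0 (sq n) \<omega> = Ct (sq n) \<omega>" using W_before[of "sq n"] sq(1)[of n] g by (intro C0_eq) auto
    moreover have "Fz (sq n) \<omega> = F (enn2real (sq n)) \<omega>"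
      using Fz_before[OF enn2real_nonneg lt] F_eq[OF enn2real_nonneg lt] sqr[of n] by simp
    moreover have "\<Lambda> (sq n) \<omega> = (\<integral>y. \<psi> y * (if y \<le> sq n then 1 else 0) \<partial>\<kappa> \<omega>)"
      using \<Lambda>_min[of "sq n"] sq(1)[of n] g by (simp add: min_def less_imp_le)
    ultimately show ?thesis by (simp add: Ct_def)
  qed
  have m: "(\<lambda>y. \<psi> y * (if P y then 1 else 0)) \<in> borel_measurable (\<kappa> \<omega>)" if "Measurable.pred borel P" for P
    unfolding measurable_cong_sets[OF sets_\<kappa> refl]
    by (intro borel_measurable_times \<psi>_measurable measurable_If measurable_const) (use that in \<open>auto simp: pred_def\<close>)
  have "(\<lambda>n. \<integral>y. \<psi> y * (if y \<le> sq n then 1 else 0) \<partial>\<kappa> \<omega>) \<longlonglongrightarrow> l"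
    unfolding l_def
  proof (rule integral_dominated_convergence[where w = "\<lambda>v. norm (\<psi> v)"])
    show "AE v in \<kappa> \<omega>. (\<lambda>n. \<psi> v * (if v \<le> sq n then 1 else 0)) \<longlonglongrightarrow> \<psi> v * (if v < tG then 1 else 0)"
    proof (rule AE_I2)
      fix v
      have "eventually (\<lambda>n. (v \<le> sq n) = (v < tG)) sequentially"
      proof (cases "v < tG")
        case True
        then have "eventually (\<lambda>n. v < sq n) sequentially" using order_tendstoD(1)[OF sq(2)] by blast
        then show ?thesis by eventually_elim (use True in auto)
      next
        case False
        then have "\<not> v \<le> sq n" for n using sq(1)[of n] by auto
        then show ?thesis using False by simp
      qed
      then show "(\<lambda>n. \<psi> v * (if v \<le> sq n then 1 else 0)) \<longlonglongrightarrow> \<psi> v * (if v < tG then 1 else 0)"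
        by (intro tendsto_eventually) (auto elim!: eventually_mono)
    qed
  qed (use \<psi>_int m in \<open>auto intro!: AE_I2\<close>)
  then have "(\<lambda>n. C0 (sq n) \<omega>) \<longlonglongrightarrow> f - F 0 \<omega> + l"
    unfolding C0n by (intro tendsto_intros fs)
  then have CtG: "C tG \<omega> = l - F 0 \<omega> + H tG \<omega>"
    using fs by (simp add: C_def limI)
  have Fz0: "Fz tG \<omega> = 0" using \<kappa>_tG by (simp add: Fz_def)
  have "\<Lambda> tG \<omega> = (\<integral>y. \<psi> y * (if y < tG then 1 else 0) + indicator {tG} y * H tG \<omega> / W tG \<omega> \<partial>\<kappa> \<omega>)"
    unfolding \<Lambda>_def using g tG_pos Fz0
    by (intro Bochner_Integration.integral_cong) (auto simp: \<psi>_def \<phi>_def indicator_def)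
  also have "\<dots> = l + (\<integral>y. indicator {tG} y * H tG \<omega> / W tG \<omega> \<partial>\<kappa> \<omega>)"
    unfolding l_def
  proof (rule Bochner_Integration.integral_add)
    show "integrable (\<kappa> \<omega>) (\<lambda>y. \<psi> y * (if y < tG then 1 else 0))"
      by (rule Bochner_Integration.integrable_bound[OF \<psi>_int m]) (auto intro!: AE_I2)
    show "integrable (\<kappa> \<omega>) (\<lambda>y. indicator {tG} y * H tG \<omega> / W tG \<omega>)"
      by (intro integrable_divide integrable_mult_left integrable_real_indicator)
         (auto simp: k.emeasure_eq_measure)
  qed
  also have "(\<integral>y. indicator {tG} y * H tG \<omega> / W tG \<omega> \<partial>\<kappa> \<omega>) = measure (\<kappa> \<omega>) {tG} * H tG \<omega> / W tG \<omega>"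
    by simp
  also have "measure (\<kappa> \<omega>) {tG} = W tG \<omega>"
  proof -
    have "{tG..} = {tG} \<union> {tG<..}" by auto
    moreover have "measure (\<kappa> \<omega>) ({tG} \<union> {tG<..}) = measure (\<kappa> \<omega>) {tG} + measure (\<kappa> \<omega>) {tG<..}"
      by (rule k.finite_measure_Union) auto
    ultimately have "W tG \<omega> = measure (\<kappa> \<omega>) {tG} + measure (\<kappa> \<omega>) {tG<..}"
      by (simp only: W_def)
    then show ?thesis using \<kappa>_tG by (simp add: measure_def)
  qed
  finally have "\<Lambda> tG \<omega> = l + H tG \<omega>" using W_\<gamma> g by simp
  then show ?thesis using CtG Fz0 by (simp add: Ct_def)
qed

end

text \<open>After the jump \<open>X = L\<close>, and subtracting \<open>Ct\<close> at
  \<open>\<gamma>\<close> gives \<open>N\<close> term by term, as \<open>Y = L - Fz\<close>. Thus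
  the regularity of \<open>C\<close> stopped at \<open>\<gamma>\<close> follows from that of
  \<open>X\<close> and \<open>N\<close>.\<close>

lemma C_eq: "0 \<le> t \<Longrightarrow> C (min (ennreal t) (\<gamma> \<omega>)) \<omega> = X t \<omega> - N t \<omega>"
proof (cases "ennreal t < \<gamma> \<omega>")
  case True
  assume "0 \<le> t"
  with True C_before[of t] show ?thesis by (simp add: min_def less_imp_le)
next
  case False
  assume t: "0 \<le> t"
  have le: "\<gamma> \<omega> \<le> ennreal t" using False by simp
  obtain g where g: "\<gamma> \<omega> = ennreal g" "0 < g"
  proof (cases "\<gamma> \<omega>")
    case (real r)
    then show ?thesis using \<gamma>0 by (intro that) auto
  next
    case top
    then show ?thesis using le by (simp add: top_unique)
  qed
  have "C (\<gamma> \<omega>) \<omega> = Ct (\<gamma> \<omega>) \<omega>"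
  proof (cases "\<gamma> \<omega> = tG")
    case True
    then have "tG = ennreal g" using g(1) by (rule trans[OF sym])
    from C_tG[OF True this g(2)] show ?thesis unfolding True .
  next
    case False
    then have "\<gamma> \<omega> < tG" using \<gamma>_le_tG by simp
    then show ?thesis using C0_eq[OF W_\<gamma>] by (simp add: C_def)
  qed
  then show ?thesis using le X_after[OF t le] by (simp add: min_absorb2 Ct_def N_def Y_def)
qed

lemma compensator_integral_exists:
  assumes t: "0 \<le> t" "ennreal t \<le> \<gamma> \<omega>"
  shows "\<exists>c. has_compensator_integral G F H \<omega> t c"
proof -
  have w: "0 < D.w t" by (rule w_pos[OF t(1) W_before[OF t(2)]])
  have "integrable (\<kappa> \<omega>) (\<lambda>v. H v \<omega> / W v \<omega> * (if 0 < v \<and> v \<le> ennreal t then 1 else 0))"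
  proof (rule Bochner_Integration.integrable_bound[OF H_int])
    show "(\<lambda>v. H v \<omega> / W v \<omega> * (if 0 < v \<and> v \<le> ennreal t then 1 else 0)) \<in> borel_measurable (\<kappa> \<omega>)"
      by (simp only: measurable_cong_sets[OF sets_\<kappa> refl])
         (intro borel_measurable_times borel_measurable_divide H_section W_section, measurable)
    show "AE v in \<kappa> \<omega>. norm (H v \<omega> / W v \<omega> * (if 0 < v \<and> v \<le> ennreal t then 1 else 0))
        \<le> norm (H v \<omega> / W v \<omega> * (if v \<le> \<gamma> \<omega> then 1 else 0))"
      using order_trans[OF _ t(2)] by (intro AE_I2) auto
  qed
  then have H: "set_integrable D.K {0<..t} (\<lambda>s. H (ennreal s) \<omega> / D.w s)"
    using set_integral_K'(1)[OF H_section] by simp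
  show ?thesis
  proof (cases "t = 0")
    \<comment> \<open>The decomposition of the survival product needs a positive \<open>t\<close>;
      at \<open>t = 0\<close> a constant integrator does.\<close>
    case True
    show ?thesis
    proof (rule D.has_compensator_integral_exists[where G = G and F = F and H = H and \<omega> = \<omega>
          and p = "\<lambda>_. F 0 \<omega>" and q = "\<lambda>_. 0", OF refl t(1) w])
      show "F x \<omega> * (1 - G x \<omega>) = F 0 \<omega> - 0" if "x \<in> {0..t}" for x
        using that True by (simp add: G_0)
    qed (use H in \<open>auto simp: mono_def\<close>)
  next
    case False
    then have t0: "0 < t" using t by simp
    have FX: "F s \<omega> = X s \<omega>" if "0 \<le> s" "s < t" for s
    proof (rule F_eq[OF that(1)])
      have "ennreal s < ennreal t" using that by (intro ennreal_lessI) auto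
      then show "ennreal s < \<gamma> \<omega>" using t(2) by (rule less_le_trans)
    qed
    show ?thesis
    proof (rule D.survival_product_decomp[where F = F and G = G and \<omega> = \<omega> and X = "\<lambda>s. X s \<omega>", OF refl t0 X_bv[OF t(1)] X_rc FX])
      fix p q assume pq: "mono p" "\<And>x. continuous (at_right x) p" "mono q" "\<And>x. continuous (at_right x) q"
        "\<And>x. x \<in> {0..t} \<Longrightarrow> F x \<omega> * (1 - G x \<omega>) = p x - q x"
      show ?thesis
        by (rule D.has_compensator_integral_exists[where G = G and F = F and H = H and \<omega> = \<omega> and p = p and q = q,
              OF refl t(1) w pq(1,2,3,4) pq(5) H])
    qed
  qed
qed

end

lemma (in compensator_setup) AE_good_path: "AE \<omega> in M. good_path M Hs \<gamma> G F X L H \<omega>"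
proof -
  have "AE \<omega> in M. integrable (\<kappa> \<omega>) (\<lambda>v. \<phi> v \<omega> / W v \<omega> * (if v \<le> \<gamma> \<omega> then 1 else 0))"
    using compensated_jump(1)[of "\<lambda>_ _. 1"] by simp
  moreover have "AE \<omega> in M. integrable (\<kappa> \<omega>) (\<lambda>v. H v \<omega> / W v \<omega> * (if v \<le> \<gamma> \<omega> then 1 else 0))"
    by (rule compensation(1)[OF H_measurable H_\<gamma>_integrable])
  ultimately show ?thesis
    using AE_space AE_G_0 AE_W_\<gamma>_pos \<gamma>_pos AE_\<gamma>_le_tG AE_\<kappa>_tG X_fv[unfolded rc_finite_variation_def]
      AE_F_eq_X AE_X_after
  proof eventually_elim
    case (elim \<omega>)
    show ?case
      by (intro good_path.intro compensator_path.intro compensator_setup_axioms single_jump_path.intro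
          single_jump_df_axioms single_jump_path_axioms.intro good_path_axioms.intro)
         (use elim in auto)
  qed
qed

section \<open>The martingale property\<close>

context good_path
begin

lemma N_diff:
  assumes st: "0 \<le> s" "s \<le> t"
  shows "N t \<omega> - N s \<omega> = Y \<omega> * (if ennreal s < \<gamma> \<omega> \<and> \<gamma> \<omega> \<le> ennreal t then 1 else 0) -
    (\<integral>v. \<phi> v \<omega> / W v \<omega> * (if ennreal s < v \<and> v \<le> ennreal t then 1 else 0) * (if v \<le> \<gamma> \<omega> then 1 else 0) \<partial>\<kappa> \<omega>)"
proof -
  have le: "v \<le> ennreal s \<Longrightarrow> v \<le> ennreal t" for v using ennreal_leI[OF st(2)] by (rule order_trans[rotated])
  have i: "integrable (\<kappa> \<omega>) (\<lambda>y. \<psi> y * (if y \<le> u then 1 else 0))" for u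
  proof (rule Bochner_Integration.integrable_bound[OF \<psi>_int])
    show "(\<lambda>y. \<psi> y * (if y \<le> u then 1 else 0)) \<in> borel_measurable (\<kappa> \<omega>)"
      unfolding measurable_cong_sets[OF sets_\<kappa> refl]
      by (intro borel_measurable_times \<psi>_measurable measurable_If measurable_const) auto
  qed (auto intro!: AE_I2)
  have "(\<integral>v. \<phi> v \<omega> / W v \<omega> * (if ennreal s < v \<and> v \<le> ennreal t then 1 else 0) * (if v \<le> \<gamma> \<omega> then 1 else 0) \<partial>\<kappa> \<omega>) =
      (\<integral>v. \<psi> v * (if v \<le> ennreal t then 1 else 0) - \<psi> v * (if v \<le> ennreal s then 1 else 0) \<partial>\<kappa> \<omega>)"
    using le by (intro Bochner_Integration.integral_cong refl) (auto simp: \<psi>_def not_le intro: le_less_trans)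
  also have "\<dots> = \<Lambda> (min (ennreal t) (\<gamma> \<omega>)) \<omega> - \<Lambda> (min (ennreal s) (\<gamma> \<omega>)) \<omega>"
    unfolding \<Lambda>_min by (rule Bochner_Integration.integral_diff[OF i i])
  finally show ?thesis using le[of "\<gamma> \<omega>"] by (auto simp: N_def not_le not_less algebra_simps)
qed

lemma N_0: "N 0 \<omega> = F 0 \<omega>"
proof -
  have "\<Lambda> (min 0 (\<gamma> \<omega>)) \<omega> = (\<integral>y. 0 \<partial>\<kappa> \<omega>)"
    unfolding \<Lambda>_def by (intro Bochner_Integration.integral_cong refl) auto
  then show ?thesis using \<gamma>0 by (simp add: N_def)
qed

lemma X_0: "X 0 \<omega> = F 0 \<omega>"
  using F_eq[of 0] \<gamma>0 by simp

end

context compensator_setup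
begin

definition A :: "real \<Rightarrow> 'a \<Rightarrow> real" where "A t \<omega> = C (min (ennreal t) (\<gamma> \<omega>)) \<omega>"

text \<open>\<open>C\<close> is composed with \<open>min t \<gamma>\<close> and with
  \<open>\<omega>\<close> seen through \<open>Hs\<close>; both coordinates are predictable, so joint
  measurability of \<open>C\<close> suffices.\<close>

lemma A_predictable: "predictable_process Fi A"
proof -
  have "(\<lambda>z. min (ennreal (fst z)) (\<gamma> (snd z))) \<in> borel_measurable Pred"
    by (rule Pred_min) (auto intro: \<gamma>_Fi)
  from measurable_compose[OF measurable_Pair[OF this Pred_snd] C_measurable]
  show ?thesis by (simp add: predictable_process_def A_def case_prod_beta')
qed

lemma A_adapted: "0 \<le> t \<Longrightarrow> A t \<in> borel_measurable (Fi (ennreal t))"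
proof -
  have 1: "(\<lambda>\<omega>. min (ennreal t) (\<gamma> \<omega>)) \<in> borel_measurable (Fi (ennreal t))"
  proof (rule borel_measurableI_greater)
    fix y
    have "{\<omega> \<in> space (Fi (ennreal t)). y < min (ennreal t) (\<gamma> \<omega>)} = (if y < ennreal t then {\<omega> \<in> space M. y < \<gamma> \<omega>} else {})"
      by auto
    moreover have "{\<omega> \<in> space M. y < \<gamma> \<omega>} \<in> sets (Fi (ennreal t))" if "y < ennreal t"
      by (rule Fi_I[where C = "space Hs"]) (use that in \<open>auto simp del: space_Hs\<close>, auto)
    ultimately show "{\<omega> \<in> space (Fi (ennreal t)). y < min (ennreal t) (\<gamma> \<omega>)} \<in> sets (Fi (ennreal t))"
      by simp
  qed
  have 2: "(\<lambda>\<omega>. \<omega>) \<in> measurable (Fi (ennreal t)) Hs"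
  proof (rule measurableI)
    fix B assume B: "B \<in> sets Hs"
    then have "B \<subseteq> space M" using sets.sets_into_space[of B Hs] by simp
    then have "(\<lambda>\<omega>. \<omega>) -` B \<inter> space (Fi (ennreal t)) = B" by auto
    then show "(\<lambda>\<omega>. \<omega>) -` B \<inter> space (Fi (ennreal t)) \<in> sets (Fi (ennreal t))"
      using Hs_Fi[OF _ B, of "ennreal t"] by simp
  qed simp
  from measurable_compose[OF measurable_Pair[OF 1 2] C_measurable]
  show ?thesis by (simp add: A_def[abs_def])
qed

lemma Fi_M: "f \<in> borel_measurable (Fi t) \<Longrightarrow> f \<in> borel_measurable M"
  by (rule measurable_from_subalg[OF subalgebra_Fi])

lemma X_M: "0 \<le> t \<Longrightarrow> X t \<in> borel_measurable (Fi (ennreal t))"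
  using X_adapted by (simp add: adapted_process_def)

abbreviation R :: "real \<Rightarrow> 'a \<Rightarrow> real" where "R t \<omega> \<equiv> X t \<omega> - A t \<omega>"

lemma R_Fi: "0 \<le> t \<Longrightarrow> R t \<in> borel_measurable (Fi (ennreal t))"
  by (intro borel_measurable_diff X_M A_adapted)

lemma AE_R_eq_N: "AE \<omega> in M. \<forall>t\<ge>0. R t \<omega> = N t \<omega>"
  using AE_good_path
proof eventually_elim
  case (elim \<omega>)
  interpret good_path M Hs \<gamma> G F X L H \<omega> by (rule elim)
  show ?case using C_eq by (simp add: A_def)
qed

lemma A_path:
  "AE \<omega> in M. (\<forall>t\<ge>0. continuous (at_right t) (\<lambda>s. A s \<omega>)) \<and> (\<forall>b\<ge>0. finite_variation_on (\<lambda>s. A s \<omega>) 0 b) \<and> A 0 \<omega> = 0"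
  using AE_good_path
proof eventually_elim
  case (elim \<omega>)
  interpret good_path M Hs \<gamma> G F X L H \<omega> by (rule elim)
  have eq: "A t \<omega> = X t \<omega> - N t \<omega>" if "0 \<le> t" for t using C_eq[OF that] by (simp add: A_def)
  show ?case
  proof (intro conjI allI impI)
    fix t :: real assume t: "0 \<le> t"
    have "((\<lambda>s. X s \<omega> - N s \<omega>) \<longlongrightarrow> X t \<omega> - N t \<omega>) (at_right t)"
      using X_rc[OF t] N_rc[OF t] by (intro tendsto_diff) (auto simp: continuous_within)
    moreover have "eventually (\<lambda>s. s \<in> {t<..<t+1}) (at_right t)" by (rule eventually_at_right_real) simp
    then have "eventually (\<lambda>s. X s \<omega> - N s \<omega> = A s \<omega>) (at_right t)"
      by eventually_elim (use t in \<open>simp add: eq\<close>)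
    ultimately have "((\<lambda>s. A s \<omega>) \<longlongrightarrow> X t \<omega> - N t \<omega>) (at_right t)" by (rule Lim_transform_eventually)
    then show "continuous (at_right t) (\<lambda>s. A s \<omega>)" using eq[OF t] by (simp add: continuous_within)
  next
    fix b :: real assume b: "0 \<le> b"
    have "finite_variation_on (\<lambda>s. X s \<omega> - N s \<omega>) 0 b"
      by (intro finite_variation_on_diff X_bv N_fv b)
    then show "finite_variation_on (\<lambda>s. A s \<omega>) 0 b"
      by (subst finite_variation_on_cong[of 0 b _ "\<lambda>s. X s \<omega> - N s \<omega>"]) (auto simp: eq)
  next
    show "A 0 \<omega> = 0" using eq[of 0] X_0 N_0 by simp
  qed
qed

lemma R_cadlag: "cadlag M R"
  unfolding cadlag_def using AE_good_path
proof eventually_elim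
  case (elim \<omega>)
  interpret good_path M Hs \<gamma> G F X L H \<omega> by (rule elim)
  have eq: "R t \<omega> = N t \<omega>" if "0 \<le> t" for t using C_eq[OF that] by (simp add: A_def)
  show ?case
  proof (intro conjI allI impI)
    fix t :: real assume t: "0 \<le> t"
    have "((\<lambda>s. N s \<omega>) \<longlongrightarrow> N t \<omega>) (at_right t)" using N_rc[OF t] by (auto simp: continuous_within)
    moreover have "eventually (\<lambda>s. s \<in> {t<..<t+1}) (at_right t)" by (rule eventually_at_right_real) simp
    then have "eventually (\<lambda>s. N s \<omega> = R s \<omega>) (at_right t)"
      by eventually_elim (use t eq in auto)
    ultimately have "((\<lambda>s. R s \<omega>) \<longlongrightarrow> N t \<omega>) (at_right t)" by (rule Lim_transform_eventually)
    then show "continuous (at_right t) (\<lambda>s. R s \<omega>)" using eq[OF t] by (simp add: continuous_within)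
  next
    fix t :: real assume t: "0 < t"
    obtain l where l: "((\<lambda>s. N s \<omega>) \<longlongrightarrow> l) (at_left t)"
      using finite_variation_on_left_limit[OF N_fv[of t] t] by auto
    have "eventually (\<lambda>s. s \<in> {0<..<t}) (at_left t)" using t by (rule eventually_at_left_real)
    then have "eventually (\<lambda>s. N s \<omega> = R s \<omega>) (at_left t)"
      by eventually_elim (use eq in auto)
    with l have "((\<lambda>s. R s \<omega>) \<longlongrightarrow> l) (at_left t)" by (rule Lim_transform_eventually)
    then show "\<exists>l. ((\<lambda>s. R s \<omega>) \<longlongrightarrow> l) (at_left t)" ..
  qed
qed

text \<open>The same compensation identity yields the martingale property (with \<open>q = 1\<close>) and optional
  stopping (with \<open>q\<close> the trace of the predictable set \<open>{(v, \<omega>). v \<le> T \<omega>}\<close> before \<open>\<gamma>\<close>).\<close>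

lemma compensated_increment:
  fixes s :: real and t :: "'a \<Rightarrow> real"
  assumes s: "0 \<le> s" and st: "\<And>\<omega>. \<omega> \<in> space M \<Longrightarrow> s \<le> t \<omega>" and C': "C' \<in> sets Hs"
    and q: "(\<lambda>(v, \<omega>). q v \<omega>) \<in> borel_measurable (borel \<Otimes>\<^sub>M Hs)" "\<And>v \<omega>. \<bar>q v \<omega> :: real\<bar> \<le> 1"
    and qt: "AE \<omega> in M. \<forall>v\<le>\<gamma> \<omega>. (if ennreal s < v then q v \<omega> else 0) = (if ennreal s < v \<and> v \<le> ennreal (t \<omega>) then 1 else 0)"
    and B: "AE \<omega> in M. ennreal s < \<gamma> \<omega> \<longrightarrow> (\<omega> \<in> B \<longleftrightarrow> \<omega> \<in> C')"
  obtains f where "integrable M f" "(\<integral>\<omega>. f \<omega> \<partial>M) = 0"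
    "AE \<omega> in M. f \<omega> = indicator B \<omega> * (N (t \<omega>) \<omega> - N s \<omega>)"
proof -
  \<comment> \<open>\<open>B\<close> is only known through its trace \<open>C'\<close> before the
    jump, so the weight uses \<open>C'\<close>; the restriction to \<open>v > s\<close> selects the
    increment after \<open>s\<close>.\<close>
  define p where "p v \<omega> = indicator C' \<omega> * (if ennreal s < v then q v \<omega> else 0)" for v \<omega>
  have p: "(\<lambda>(v, \<omega>). p v \<omega>) \<in> borel_measurable (borel \<Otimes>\<^sub>M Hs)"
  proof -
    have "(\<lambda>z. indicator C' (snd z)) \<in> borel_measurable ((borel :: ennreal measure) \<Otimes>\<^sub>M Hs)"
      by (rule measurable_compose[OF measurable_snd borel_measurable_indicator[OF C']])
    moreover have "(\<lambda>z. if ennreal s < fst z then q (fst z) (snd z) else 0) \<in> borel_measurable (borel \<Otimes>\<^sub>M Hs)"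
      using q(1) by (intro measurable_If) (auto simp: case_prod_beta')
    ultimately show ?thesis unfolding p_def case_prod_beta' by (rule borel_measurable_times)
  qed
  have pb: "\<bar>p v \<omega>\<bar> \<le> 1" for v \<omega> using q(2)[of v \<omega>] by (auto simp: p_def indicator_def)
  note cj = compensated_jump[OF p pb]
  show ?thesis
  proof (rule that)
    show "integrable M (\<lambda>\<omega>. p (\<gamma> \<omega>) \<omega> * Y \<omega> - (\<integral>v. p v \<omega> * \<phi> v \<omega> / W v \<omega> * (if v \<le> \<gamma> \<omega> then 1 else 0) \<partial>\<kappa> \<omega>))"
      by (rule Bochner_Integration.integrable_diff[OF cj(2,3)])
    show "(\<integral>\<omega>. p (\<gamma> \<omega>) \<omega> * Y \<omega> - (\<integral>v. p v \<omega> * \<phi> v \<omega> / W v \<omega> * (if v \<le> \<gamma> \<omega> then 1 else 0) \<partial>\<kappa> \<omega>) \<partial>M) = 0"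
      by (rule cj(4))
    show "AE \<omega> in M. p (\<gamma> \<omega>) \<omega> * Y \<omega> - (\<integral>v. p v \<omega> * \<phi> v \<omega> / W v \<omega> * (if v \<le> \<gamma> \<omega> then 1 else 0) \<partial>\<kappa> \<omega>) =
        indicator B \<omega> * (N (t \<omega>) \<omega> - N s \<omega>)"
      using AE_good_path qt B AE_space
    proof eventually_elim
      case (elim \<omega>)
      interpret good_path M Hs \<gamma> G F X L H \<omega> by (rule elim(1))
      note d = N_diff[OF s st[OF elim(4)]]
      have pe: "p v \<omega> = indicator C' \<omega> * (if ennreal s < v \<and> v \<le> ennreal (t \<omega>) then 1 else 0)" if "v \<le> \<gamma> \<omega>" for v
        using elim(2) that by (simp add: p_def)
      have "(\<integral>v. p v \<omega> * \<phi> v \<omega> / W v \<omega> * (if v \<le> \<gamma> \<omega> then 1 else 0) \<partial>\<kappa> \<omega>) =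
        (\<integral>v. indicator C' \<omega> * (\<phi> v \<omega> / W v \<omega> * (if ennreal s < v \<and> v \<le> ennreal (t \<omega>) then 1 else 0) * (if v \<le> \<gamma> \<omega> then 1 else 0)) \<partial>\<kappa> \<omega>)"
        by (intro Bochner_Integration.integral_cong refl) (auto simp: pe)
      also have "\<dots> = indicator C' \<omega> * (\<integral>v. \<phi> v \<omega> / W v \<omega> * (if ennreal s < v \<and> v \<le> ennreal (t \<omega>) then 1 else 0) * (if v \<le> \<gamma> \<omega> then 1 else 0) \<partial>\<kappa> \<omega>)"
        by (rule integral_mult_right_zero)
      finally have e: "p (\<gamma> \<omega>) \<omega> * Y \<omega> - (\<integral>v. p v \<omega> * \<phi> v \<omega> / W v \<omega> * (if v \<le> \<gamma> \<omega> then 1 else 0) \<partial>\<kappa> \<omega>) =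
          indicator C' \<omega> * (N (t \<omega>) \<omega> - N s \<omega>)"
        unfolding d pe[OF order_refl] by (simp add: algebra_simps)
      show ?case
      proof (cases "ennreal s < \<gamma> \<omega>")
        case True
        then have "indicator B \<omega> = (indicator C' \<omega> :: real)" using elim(3) by (auto simp: indicator_def)
        then show ?thesis using e by simp
      next
        \<comment> \<open>If the jump has occurred by time \<open>s\<close>, the increment is
          \<open>0\<close>, and it does not matter that \<open>B\<close> and \<open>C'\<close> may
          differ.\<close>
        case False
        have "(\<integral>v. \<phi> v \<omega> / W v \<omega> * (if ennreal s < v \<and> v \<le> ennreal (t \<omega>) then 1 else 0) * (if v \<le> \<gamma> \<omega> then 1 else 0) \<partial>\<kappa> \<omega>) = (\<integral>v. 0 \<partial>\<kappa> \<omega>)"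
          using False by (intro Bochner_Integration.integral_cong refl) (auto simp: not_less dest: order_trans)
        then have "N (t \<omega>) \<omega> - N s \<omega> = 0" unfolding d using False by simp
        then show ?thesis using e by simp
      qed
    qed
  qed
qed

lemma compensated_increment_const:
  assumes s: "0 \<le> s" "s \<le> t" and B: "B \<in> sets (Fi (ennreal s))"
  obtains f where "integrable M f" "(\<integral>\<omega>. f \<omega> \<partial>M) = 0"
    "AE \<omega> in M. f \<omega> = indicator B \<omega> * (N t \<omega> - N s \<omega>)"
proof -
  obtain C' where C': "C' \<in> sets Hs" "AE \<omega> in M. ennreal s < \<gamma> \<omega> \<longrightarrow> (\<omega> \<in> B \<longleftrightarrow> \<omega> \<in> C')"
    using Fi_trace[OF _ B] by auto
  have q: "(\<lambda>(v, \<omega>). if v \<le> ennreal t then 1 else 0 :: real) \<in> borel_measurable (borel \<Otimes>\<^sub>M Hs)"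
    unfolding case_prod_beta' by measurable
  show ?thesis
  proof (rule compensated_increment[OF s(1) _ C'(1) q _ _ C'(2), where t = "\<lambda>_. t"])
    fix f assume "integrable M f" "expectation f = 0" "AE \<omega> in M. f \<omega> = indicator B \<omega> * (N t \<omega> - N s \<omega>)"
    then show ?thesis by (rule that)
  qed (use s in auto)
qed

lemma R_integrable: "0 \<le> t \<Longrightarrow> integrable M (R t)"
proof -
  assume t: "0 \<le> t"
  have "space M \<in> sets (Fi (ennreal 0))" using sets.top[of "Fi (ennreal 0)"] by simp
  then obtain f where f: "integrable M f" "AE \<omega> in M. f \<omega> = indicator (space M) \<omega> * (N t \<omega> - N 0 \<omega>)"
    using compensated_increment_const[OF order_refl t] by metis
  show ?thesis
  proof (rule integrable_cong_AE_imp[OF Bochner_Integration.integrable_add[OF f(1) integrable_F_0]])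
    show "R t \<in> borel_measurable M" by (rule Fi_M[OF R_Fi[OF t]])
    show "AE \<omega> in M. f \<omega> + F 0 \<omega> = R t \<omega>"
      using f(2) AE_R_eq_N AE_good_path AE_space
    proof eventually_elim
      case (elim \<omega>)
      interpret good_path M Hs \<gamma> G F X L H \<omega> by (rule elim(3))
      show ?case using elim(1,2,4) N_0 t by simp
    qed
  qed
qed

lemma R_martingale_increment:
  assumes s: "0 \<le> s" "s \<le> t" and B: "B \<in> sets (Fi (ennreal s))"
  shows "(\<integral>\<omega>\<in>B. R t \<omega> \<partial>M) = (\<integral>\<omega>\<in>B. R s \<omega> \<partial>M)"
proof -
  have BM: "B \<in> sets M" using B sets_Fi_subset by auto
  have si: "set_integrable M B (R u)" if "0 \<le> u" for u
    unfolding set_integrable_def by (rule integrable_mult_indicator[OF BM R_integrable[OF that]])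
  obtain f where f: "integrable M f" "(\<integral>\<omega>. f \<omega> \<partial>M) = 0"
    "AE \<omega> in M. f \<omega> = indicator B \<omega> * (N t \<omega> - N s \<omega>)"
    using compensated_increment_const[OF s B] by blast
  have t: "0 \<le> t" using s by simp
  have "(\<integral>\<omega>\<in>B. R t \<omega> \<partial>M) - (\<integral>\<omega>\<in>B. R s \<omega> \<partial>M) = (\<integral>\<omega>\<in>B. (R t \<omega> - R s \<omega>) \<partial>M)"
    by (rule set_integral_diff(2)[OF si[OF t] si[OF s(1)], symmetric])
  also have "\<dots> = (\<integral>\<omega>. f \<omega> \<partial>M)"
    unfolding set_lebesgue_integral_def
  proof (rule integral_cong_AE)
    show "(\<lambda>\<omega>. indicator B \<omega> *\<^sub>R (R t \<omega> - R s \<omega>)) \<in> borel_measurable M"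
      using BM Fi_M[OF R_Fi[OF t]] Fi_M[OF R_Fi[OF s(1)]] by measurable
    show "AE \<omega> in M. indicator B \<omega> *\<^sub>R (R t \<omega> - R s \<omega>) = f \<omega>"
      using f(3) AE_R_eq_N by eventually_elim (use s t in simp)
  qed (use f in auto)
  finally show ?thesis using f(2) by simp
qed

lemma martingale_R: "martingale_process M Fi R"
  unfolding martingale_process_def
proof (intro conjI allI impI)
  show "adapted_process Fi R" unfolding adapted_process_def using R_Fi by blast
  show "0 \<le> t \<Longrightarrow> integrable M (R t)" for t by (rule R_integrable)
  fix s t :: real assume s: "0 \<le> s" "s \<le> t"
  interpret c: finite_measure_subalgebra M "Fi (ennreal s)" by unfold_locales (rule subalgebra_Fi)
  show "AE \<omega> in M. real_cond_exp M (Fi (ennreal s)) (R t) \<omega> = R s \<omega>"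
    using s by (intro c.real_cond_exp_charact R_martingale_increment R_integrable R_Fi) auto
qed

text \<open>\<open>R\<close> is a true martingale, so the constant sequence
  \<open>\<infinity>\<close> localises it; stopping at \<open>\<infinity>\<close> changes nothing at
  finite times.\<close>

lemma local_martingale_R: "local_martingale M Fi R"
  unfolding local_martingale_def
proof (intro conjI exI[of _ "\<lambda>_ _. \<infinity>"] allI)
  show "adapted_process Fi R" unfolding adapted_process_def using R_Fi by blast
  show "cadlag M R" by (rule R_cadlag)
  show "stopping_time Fi (\<lambda>_. \<infinity>)" unfolding stopping_time_def by simp
  show "AE \<omega> in M. incseq (\<lambda>n::nat. \<infinity>::ennreal) \<and> (\<lambda>n::nat. \<infinity>::ennreal) \<longlonglongrightarrow> \<infinity>"
    by (simp add: incseq_def)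
  have e: "stopped_process (\<lambda>_. \<infinity>) R t = R t" if "0 \<le> t" for t
    using that by (auto simp: stopped_process_def fun_eq_iff)
  show "martingale_process M Fi (stopped_process (\<lambda>_. \<infinity>) R)"
    unfolding martingale_process_def adapted_process_def
  proof (intro conjI allI impI)
    fix t :: real assume t: "0 \<le> t"
    show "stopped_process (\<lambda>_. \<infinity>) R t \<in> borel_measurable (Fi (ennreal t))"
      unfolding e[OF t] by (rule R_Fi[OF t])
    show "integrable M (stopped_process (\<lambda>_. \<infinity>) R t)"
      unfolding e[OF t] by (rule R_integrable[OF t])
  next
    fix s t :: real assume st: "0 \<le> s" "s \<le> t"
    then have t: "0 \<le> t" by simp
    show "AE \<omega> in M. real_cond_exp M (Fi (ennreal s)) (stopped_process (\<lambda>_. \<infinity>) R t) \<omega> = stopped_process (\<lambda>_. \<infinity>) R s \<omega>"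
      unfolding e[OF t] e[OF st(1)] using martingale_R st unfolding martingale_process_def by blast
  qed
qed

lemma predictable_compensator_A: "is_predictable_compensator M Fi X A"
  unfolding is_predictable_compensator_def rc_finite_variation_def
proof (intro conjI A_predictable local_martingale_R)
  show "AE \<omega> in M. (\<forall>t\<ge>0. continuous (at_right t) (\<lambda>s. A s \<omega>)) \<and> (\<forall>b\<ge>0. finite_variation_on (\<lambda>s. A s \<omega>) 0 b)"
    using A_path by eventually_elim auto
  show "AE \<omega> in M. A 0 \<omega> = 0" using A_path by eventually_elim auto
qed

end

section \<open>Uniqueness\<close>

text \<open>Transfers identities known at countably many times, hence outside a single null set, to
  all times.\<close>

lemma rc_determined_by_rationals:
  fixes f :: "real \<Rightarrow> real"
  assumes f: "continuous (at_right t) f" and b: "t < b"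
    and c: "\<And>s. s \<in> \<rat> \<Longrightarrow> t < s \<Longrightarrow> s < b \<Longrightarrow> f s = c"
  shows "f t = c"
proof (rule ccontr)
  assume "f t \<noteq> c"
  then have "f t \<in> - {c}" by simp
  moreover have "(f \<longlongrightarrow> f t) (at_right t)" using f by (simp add: continuous_within)
  ultimately have "eventually (\<lambda>s. f s \<in> - {c}) (at_right t)"
    by (rule topological_tendstoD[rotated, rotated]) (simp add: open_Compl)
  then obtain d where d: "t < d" "\<And>s. t < s \<Longrightarrow> s < d \<Longrightarrow> f s \<noteq> c"
    by (auto simp: eventually_at_right_field)
  obtain q where "q \<in> \<rat>" "t < q" "q < min b d"
    using Rats_dense_in_real[of t "min b d"] b d(1) by auto
  then show False using c[of q] d(2)[of q] by auto
qed

text \<open>Since the mass from \<open>t\<close> onwards is bounded below, an atom at \<open>t\<close> can be moved to the left hand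
  side, which leaves a contraction on short intervals; so the set where \<open>e\<close> vanishes can be extended
  step by step.\<close>

lemma volterra_zero:
  fixes N :: "ennreal measure" and e :: "real \<Rightarrow> real"
  assumes "prob_space N" and sets: "sets N = sets borel"
    and \<delta>: "0 < \<delta>" "\<And>t. 0 \<le> t \<Longrightarrow> t \<le> t0 \<Longrightarrow> \<delta> \<le> measure N {ennreal t..}"
    and B: "\<And>t. 0 \<le> t \<Longrightarrow> t \<le> t0 \<Longrightarrow> \<bar>e t\<bar> \<le> B"
    and int: "\<And>t. 0 \<le> t \<Longrightarrow> t \<le> t0 \<Longrightarrow> integrable N (\<lambda>v. e (enn2real v) * (if v \<le> ennreal t then 1 else 0))"
    and eq: "\<And>t. 0 \<le> t \<Longrightarrow> t \<le> t0 \<Longrightarrow>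
      (\<integral>v. e (enn2real v) * (if v \<le> ennreal t then 1 else 0) \<partial>N) + e t * measure N {ennreal t<..} = 0"
    and t: "0 \<le> t" "t \<le> t0"
  shows "e t = 0"
proof -
  interpret prob_space N by fact
  note [measurable_cong] = sets
  have space: "space N = UNIV" using sets_eq_imp_space_eq[OF sets] by simp
  \<comment> \<open>The atom at \<open>u\<close> is moved to the other side: the coefficient of
    \<open>e u\<close> becomes the mass from \<open>u\<close> onwards, which is at least
    \<open>\<delta>\<close>, and the integral only involves times strictly before
    \<open>u\<close>.\<close>
  have strict: "integrable N (\<lambda>v. e (enn2real v) * (if v < ennreal u then 1 else 0))"
    "e u * measure N {ennreal u..} = - (\<integral>v. e (enn2real v) * (if v < ennreal u then 1 else 0) \<partial>N)"
    if u: "0 \<le> u" "u \<le> t0" for u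
  proof -
    have split: "e (enn2real v) * (if v < ennreal u then 1 else 0) =
        e (enn2real v) * (if v \<le> ennreal u then 1 else 0) - e u * indicator {ennreal u} v" for v
      using u by (auto simp: indicator_def)
    have i: "integrable N (\<lambda>v. e u * indicator {ennreal u} v)"
      by (intro integrable_mult_right integrable_real_indicator) (auto simp: emeasure_eq_measure)
    show "integrable N (\<lambda>v. e (enn2real v) * (if v < ennreal u then 1 else 0))"
      unfolding split by (rule Bochner_Integration.integrable_diff[OF int[OF u] i])
    have "(\<integral>v. e (enn2real v) * (if v < ennreal u then 1 else 0) \<partial>N) =
        (\<integral>v. e (enn2real v) * (if v \<le> ennreal u then 1 else 0) \<partial>N) - e u * measure N {ennreal u}"
      unfolding split Bochner_Integration.integral_diff[OF int[OF u] i] by (simp add: space)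
    moreover have "measure N ({ennreal u} \<union> {ennreal u<..}) = measure N {ennreal u} + measure N {ennreal u<..}"
      by (rule finite_measure_Union) auto
    moreover have "{ennreal u} \<union> {ennreal u<..} = {ennreal u..}" by auto
    ultimately show "e u * measure N {ennreal u..} = - (\<integral>v. e (enn2real v) * (if v < ennreal u then 1 else 0) \<partial>N)"
      using eq[OF u] by (simp add: algebra_simps)
  qed
  \<comment> \<open>\<open>Sup Z\<close> is the end of the interval on which \<open>e\<close>
    vanishes. The equation gives \<open>e = 0\<close> there as well, and an end before
    \<open>t0\<close> could be moved further.\<close>
  define Z where "Z = {s. 0 \<le> s \<and> s \<le> t0 \<and> (\<forall>u. 0 \<le> u \<and> u < s \<longrightarrow> e u = 0)}"
  have Z0: "0 \<in> Z" using t by (auto simp: Z_def)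
  have Zb: "bdd_above Z" by (auto simp: Z_def bdd_above_def)
  define s where "s = Sup Z"
  have s: "0 \<le> s" "s \<le> t0"
  proof -
    show "0 \<le> s" unfolding s_def by (rule cSup_upper[OF Z0 Zb])
    have "Z \<noteq> {}" using Z0 by blast
    then show "s \<le> t0" unfolding s_def by (rule cSup_least) (simp add: Z_def)
  qed
  have before: "e u = 0" if u: "0 \<le> u" "u < s" for u
  proof -
    have "Z \<noteq> {}" using Z0 by blast
    then obtain z where "z \<in> Z" "u < z" using u(2) unfolding s_def by (auto simp: less_cSup_iff[OF _ Zb])
    then show ?thesis using u by (auto simp: Z_def)
  qed
  have at: "e s = 0"
  proof -
    have "(\<lambda>v. e (enn2real v) * (if v < ennreal s then 1 else 0)) = (\<lambda>_. 0)"
    proof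
      fix v
      show "e (enn2real v) * (if v < ennreal s then 1 else 0) = 0"
        by (cases v) (auto simp: before ennreal_less_iff)
    qed
    then have "e s * measure N {ennreal s..} = 0" using strict(2)[OF s] by simp
    then show ?thesis using \<delta>(1) \<delta>(2)[OF s] by auto
  qed
  have "\<not> s < t0"
  proof
    assume st0: "s < t0"
    \<comment> \<open>\<open>l\<close> is the distribution function of \<open>N\<close>; its
      right-continuity gives an interval \<open>(s, r]\<close> of mass
      \<open>\<theta> < \<delta>\<close>, on which the equation is a contraction with factor
      \<open>\<theta> / \<delta>\<close>.\<close>
    define l where "l u = (\<integral>v. (1 :: real) * (if v \<le> ennreal u then 1 else 0) \<partial>N)" for u :: real
    have l: "l u = measure N {..ennreal u}" for u
    proof -
      have "l u = (\<integral>v. indicator {..ennreal u} v \<partial>N)"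
        unfolding l_def by (intro Bochner_Integration.integral_cong) (auto simp: indicator_def)
      then show ?thesis by (simp add: space)
    qed
    have "continuous (at_right s) l"
      unfolding l_def by (rule truncated_integral_path(1)[OF sets]) simp
    then have "(l \<longlongrightarrow> l s) (at_right s)" by (simp add: continuous_within)
    then have "eventually (\<lambda>u. l u < l s + \<delta>) (at_right s)"
      using \<delta>(1) by (intro order_tendstoD(2)) auto
    then obtain d where d: "s < d" "\<And>u. s < u \<Longrightarrow> u < d \<Longrightarrow> l u < l s + \<delta>"
      by (auto simp: eventually_at_right_field)
    define r where "r = (s + min d t0) / 2"
    have r: "s < r" "r < d" "r \<le> t0" using d(1) st0 by (auto simp: r_def)
    define \<theta> where "\<theta> = measure N {ennreal s<..ennreal r}"
    have \<theta>: "\<theta> < \<delta>" "0 \<le> \<theta>"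
    proof -
      have "{ennreal s<..ennreal r} = {..ennreal r} - {..ennreal s}" by auto
      moreover have "{..ennreal s} \<subseteq> {..ennreal r}" using r by (auto intro: order_trans ennreal_leI less_imp_le)
      ultimately have "\<theta> = l r - l s" unfolding \<theta>_def l by (simp add: finite_measure_Diff)
      then show "\<theta> < \<delta>" using d(2)[of r] r by simp
    qed (simp add: \<theta>_def)
    define m where "m = (SUP u\<in>{s<..r}. \<bar>e u\<bar>)"
    have bdd: "bdd_above ((\<lambda>u. \<bar>e u\<bar>) ` {s<..r})"
      using B s r by (auto simp: bdd_above_def intro!: exI[of _ B])
    have em: "\<bar>e u\<bar> \<le> m" if "u \<in> {s<..r}" for u
      unfolding m_def by (rule cSUP_upper[OF that bdd])
    have m0: "0 \<le> m" using em[of r] r by auto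
    have "m \<le> m * \<theta> / \<delta>"
      unfolding m_def
    proof (rule cSUP_least)
      fix u assume u: "u \<in> {s<..r}"
      then have u': "0 \<le> u" "u \<le> t0" using s r by auto
      have "\<bar>e u\<bar> * \<delta> \<le> \<bar>e u * measure N {ennreal u..}\<bar>"
        using \<delta>(2)[OF u'] \<delta>(1) by (auto simp: abs_mult intro: mult_left_mono)
      also have "\<dots> = \<bar>\<integral>v. e (enn2real v) * (if v < ennreal u then 1 else 0) \<partial>N\<bar>"
        using strict(2)[OF u'] by simp
      also have "\<dots> \<le> (\<integral>v. \<bar>e (enn2real v) * (if v < ennreal u then 1 else 0)\<bar> \<partial>N)"
        by (rule integral_abs_bound)
      also have "\<dots> \<le> (\<integral>v. m * indicator {ennreal s<..ennreal r} v \<partial>N)"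
      proof (rule Bochner_Integration.integral_mono)
        show "integrable N (\<lambda>v. \<bar>e (enn2real v) * (if v < ennreal u then 1 else 0)\<bar>)"
          using strict(1)[OF u'] by (rule integrable_abs)
        show "integrable N (\<lambda>v. m * indicator {ennreal s<..ennreal r} v)"
          by (intro integrable_mult_right integrable_real_indicator) (auto simp: emeasure_eq_measure)
        fix v
        show "\<bar>e (enn2real v) * (if v < ennreal u then 1 else 0)\<bar> \<le> m * indicator {ennreal s<..ennreal r} v"
        proof (cases "v < ennreal u")
          case True
          then obtain x where x: "v = ennreal x" "0 \<le> x" by (cases v) auto
          then have xu: "x < u" using True by (simp add: ennreal_less_iff)
          show ?thesis
          proof (cases "x \<le> s")
            case True
            then have "e x = 0" using before[of x] at x by (cases "x = s") auto
            then show ?thesis using x m0 by simp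
          next
            case False
            then have "\<bar>e x\<bar> \<le> m" using xu u by (intro em) auto
            moreover have "v \<in> {ennreal s<..ennreal r}"
              using False xu u s x by (auto simp: ennreal_less_iff intro: ennreal_leI)
            ultimately show ?thesis using x m0 by simp
          qed
        qed (use m0 in simp)
      qed
      also have "\<dots> = m * \<theta>" by (simp add: \<theta>_def space)
      finally show "\<bar>e u\<bar> \<le> (SUP u\<in>{s<..r}. \<bar>e u\<bar>) * \<theta> / \<delta>"
        using \<delta>(1) by (simp add: m_def field_simps)
    qed (use r in auto)
    then have "m * \<delta> \<le> m * \<theta>" using \<delta>(1) by (simp add: field_simps)
    then have "m = 0" using m0 \<theta> by (smt (verit) mult_strict_left_mono)
    then have "e u = 0" if "u \<in> {s<..r}" for u using em[OF that] by simp
    then have "r \<in> Z" using before at r s unfolding Z_def by (auto, metis linorder_cases greaterThanAtMost_iff less_imp_le)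
    then have "r \<le> s" unfolding s_def by (rule cSup_upper[OF _ Zb])
    then show False using r by simp
  qed
  then show ?thesis using before[of t] at t s by (cases "t = s") auto
qed

lemma stopped_path_rc:
  fixes D :: "real \<Rightarrow> real" and T :: ennreal
  assumes D: "\<And>t. 0 \<le> t \<Longrightarrow> continuous (at_right t) D" and t: "0 \<le> t"
  shows "continuous (at_right t) (\<lambda>s. D (enn2real (min (ennreal s) T)))"
proof -
  have ev: "eventually (\<lambda>s. s \<in> {t<..<b}) (at_right t)" if "t < b" for b
    using that by (rule eventually_at_right_real)
  show ?thesis
  proof (cases "ennreal t < T")
    case True
    obtain b where b: "t < b" "ennreal b \<le> T"
    proof (cases T)
      case (real r)
      then show ?thesis using True t that[of r] by (auto simp: ennreal_less_iff)
    next
      case top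
      then show ?thesis using that[of "t + 1"] by auto
    qed
    have e: "enn2real (min (ennreal s) T) = s" if "t \<le> s" "s < b" for s
    proof -
      have "ennreal s \<le> T" using b(2) that by (meson ennreal_leI less_imp_le order_trans)
      then show ?thesis using that t by (simp add: min_absorb1)
    qed
    have "(D \<longlongrightarrow> D t) (at_right t)" using D[OF t] by (simp add: continuous_within)
    moreover have "eventually (\<lambda>s. D s = D (enn2real (min (ennreal s) T))) (at_right t)"
      using ev[OF b(1)] by eventually_elim (use e in auto)
    ultimately have "((\<lambda>s. D (enn2real (min (ennreal s) T))) \<longlongrightarrow> D t) (at_right t)"
      by (rule Lim_transform_eventually)
    then show ?thesis using e[of t] b(1) by (simp add: continuous_within)
  next
    case False
    then have le: "T \<le> ennreal t" by simp
    have e: "min (ennreal s) T = T" if "t \<le> s" for s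
      using le ennreal_leI[OF that] by (auto simp: min_absorb2 intro: order_trans)
    have "((\<lambda>_. D (enn2real T)) \<longlongrightarrow> D (enn2real T)) (at_right t)" by simp
    moreover have "eventually (\<lambda>s. D (enn2real T) = D (enn2real (min (ennreal s) T))) (at_right t)"
      using ev[of "t + 1"] by (simp add: eventually_mono e)
    ultimately have "((\<lambda>s. D (enn2real (min (ennreal s) T))) \<longlongrightarrow> D (enn2real T)) (at_right t)"
      by (rule Lim_transform_eventually)
    then show ?thesis using e[of t] by (simp add: continuous_within)
  qed
qed

section \<open>Signed disintegration and vanishing conditional means\<close>

context single_jump_df
begin

lemma integral_disintegration:
  fixes h :: "ennreal \<Rightarrow> 'a \<Rightarrow> real"
  assumes h: "(\<lambda>(v, \<omega>). h v \<omega>) \<in> borel_measurable (borel \<Otimes>\<^sub>M Hs)"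
    and int: "integrable M (\<lambda>\<omega>. h (\<gamma> \<omega>) \<omega>)"
  shows "AE \<omega> in M. integrable (\<kappa> \<omega>) (\<lambda>v. h v \<omega>)"
    and "integrable M (\<lambda>\<omega>. \<integral>v. h v \<omega> \<partial>\<kappa> \<omega>)"
    and "(\<integral>\<omega>. (\<integral>v. h v \<omega> \<partial>\<kappa> \<omega>) \<partial>M) = (\<integral>\<omega>. h (\<gamma> \<omega>) \<omega> \<partial>M)"
proof -
  interpret MU: pair_prob_space M unif01 ..
  have "(\<lambda>x. (fst x, snd x)) \<in> measurable (M \<Otimes>\<^sub>M unif01) (Hs \<Otimes>\<^sub>M borel)"
    by (rule measurable_Pair[OF measurable_compose[OF measurable_fst Hs_id]])
       (use measurable_snd[of M unif01] in \<open>simp only: measurable_cong_sets[OF refl sets_unif01]\<close>)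
  from measurable_compose[OF this Q_measurable]
  have "(\<lambda>x. Q (fst x) (snd x)) \<in> borel_measurable (M \<Otimes>\<^sub>M unif01)" by (simp only: prod.case)
  then have m2: "(\<lambda>(\<omega>, u). (Q \<omega> u, \<omega>)) \<in> measurable (M \<Otimes>\<^sub>M unif01) (borel \<Otimes>\<^sub>M Hs)"
    unfolding case_prod_beta' by (rule measurable_Pair[OF _ measurable_compose[OF measurable_fst Hs_id]])
  have "integrable (distr M (borel \<Otimes>\<^sub>M Hs) (\<lambda>\<omega>. (\<gamma> \<omega>, \<omega>))) (\<lambda>(v, \<omega>). h v \<omega>)"
    using int by (subst integrable_distr_eq[OF \<gamma>_pair_measurable h]) simp
  then have i: "integrable (M \<Otimes>\<^sub>M unif01) (\<lambda>(\<omega>, u). h (Q \<omega> u) \<omega>)"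
    unfolding disintegration_distr by (subst (asm) integrable_distr_eq[OF m2 h]) (simp add: case_prod_beta')
  have k: "integrable unif01 (\<lambda>u. h (Q \<omega> u) \<omega>) \<longleftrightarrow> integrable (\<kappa> \<omega>) (\<lambda>v. h v \<omega>)"
    "(\<integral>u. h (Q \<omega> u) \<omega> \<partial>unif01) = (\<integral>v. h v \<omega> \<partial>\<kappa> \<omega>)" if \<omega>: "\<omega> \<in> space M" for \<omega>
  proof -
    have q: "Q \<omega> \<in> measurable unif01 borel"
      using Q_section[OF \<omega>] by (simp only: measurable_cong_sets[OF sets_unif01 refl])
    show "integrable unif01 (\<lambda>u. h (Q \<omega> u) \<omega>) \<longleftrightarrow> integrable (\<kappa> \<omega>) (\<lambda>v. h v \<omega>)"
      "(\<integral>u. h (Q \<omega> u) \<omega> \<partial>unif01) = (\<integral>v. h v \<omega> \<partial>\<kappa> \<omega>)"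
      unfolding \<kappa>_def using integrable_distr_eq[OF q \<kappa>_section[OF h \<omega>]] integral_distr[OF q \<kappa>_section[OF h \<omega>]] by simp_all
  qed
  show "AE \<omega> in M. integrable (\<kappa> \<omega>) (\<lambda>v. h v \<omega>)"
    using MU.AE_integrable_fst'[OF i] AE_space by eventually_elim (simp add: k)
  have kc: "integrable M (\<lambda>\<omega>. \<integral>u. h (Q \<omega> u) \<omega> \<partial>unif01) \<longleftrightarrow> integrable M (\<lambda>\<omega>. \<integral>v. h v \<omega> \<partial>\<kappa> \<omega>)"
    "(\<integral>\<omega>. (\<integral>u. h (Q \<omega> u) \<omega> \<partial>unif01) \<partial>M) = (\<integral>\<omega>. (\<integral>v. h v \<omega> \<partial>\<kappa> \<omega>) \<partial>M)"
    by (rule Bochner_Integration.integrable_cong[OF refl k(2)] Bochner_Integration.integral_cong[OF refl k(2)]; assumption)+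
  show "integrable M (\<lambda>\<omega>. \<integral>v. h v \<omega> \<partial>\<kappa> \<omega>)"
    using MU.integrable_fst'[OF i] kc(1) by simp
  have "(\<integral>\<omega>. (\<integral>v. h v \<omega> \<partial>\<kappa> \<omega>) \<partial>M) = (\<integral>x. (case x of (\<omega>, u) \<Rightarrow> h (Q \<omega> u) \<omega>) \<partial>(M \<Otimes>\<^sub>M unif01))"
    using MU.integral_fst'[OF i] kc(2) by simp
  also have "\<dots> = (\<integral>x. (case x of (v, \<omega>) \<Rightarrow> h v \<omega>) \<partial>distr M (borel \<Otimes>\<^sub>M Hs) (\<lambda>\<omega>. (\<gamma> \<omega>, \<omega>)))"
    unfolding disintegration_distr by (subst integral_distr[OF m2 h]) (simp add: case_prod_beta')
  also have "\<dots> = (\<integral>\<omega>. h (\<gamma> \<omega>) \<omega> \<partial>M)"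
    by (subst integral_distr[OF \<gamma>_pair_measurable h]) simp
  finally show "(\<integral>\<omega>. (\<integral>v. h v \<omega> \<partial>\<kappa> \<omega>) \<partial>M) = (\<integral>\<omega>. h (\<gamma> \<omega>) \<omega> \<partial>M)" .
qed

text \<open>The \<open>\<kappa>\<close>-mean is \<open>Hs\<close>-measurable and, by disintegration,
  has integral \<open>0\<close> over every set of \<open>Hs\<close>; it is therefore its own
  conditional expectation, and that is \<open>0\<close>.\<close>

lemma conditional_mean_zero:
  fixes h :: "ennreal \<Rightarrow> 'a \<Rightarrow> real"
  assumes h: "(\<lambda>(v, \<omega>). h v \<omega>) \<in> borel_measurable (borel \<Otimes>\<^sub>M Hs)"
    and int: "integrable M (\<lambda>\<omega>. h (\<gamma> \<omega>) \<omega>)"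
    and zero: "\<And>B. B \<in> sets Hs \<Longrightarrow> (\<integral>\<omega>\<in>B. h (\<gamma> \<omega>) \<omega> \<partial>M) = 0"
  shows "AE \<omega> in M. (\<integral>v. h v \<omega> \<partial>\<kappa> \<omega>) = 0"
proof -
  interpret c: finite_measure_subalgebra M Hs by unfold_locales (rule sub)
  define m where "m \<omega> = (\<integral>v. h v \<omega> \<partial>\<kappa> \<omega>)" for \<omega>
  have h': "(\<lambda>(\<omega>, v). h v \<omega>) \<in> borel_measurable (Hs \<Otimes>\<^sub>M borel)"
    using measurable_compose[OF measurable_pair_swap' h] by (simp add: case_prod_beta')
  have mH: "m \<in> borel_measurable Hs"
    unfolding m_def[abs_def] by (rule integral_\<kappa>_measurable[OF h' measurable_ident_sets[OF refl], simplified])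
  have mi: "integrable M m" unfolding m_def[abs_def] by (rule integral_disintegration(2)[OF h int])
  have "(\<integral>\<omega>\<in>B. m \<omega> \<partial>M) = 0" if B: "B \<in> sets Hs" for B
  proof -
    have hB: "(\<lambda>(v, \<omega>). indicator B \<omega> * h v \<omega>) \<in> borel_measurable (borel \<Otimes>\<^sub>M Hs)"
    proof -
      have "(\<lambda>z. indicator B (snd z) :: real) \<in> borel_measurable ((borel :: ennreal measure) \<Otimes>\<^sub>M Hs)"
        by (rule measurable_compose[OF measurable_snd borel_measurable_indicator[OF B]])
      then show ?thesis using h unfolding case_prod_beta' by (rule borel_measurable_times)
    qed
    have BM: "B \<in> sets M" using B sets_Hs by auto
    have iB: "integrable M (\<lambda>\<omega>. indicator B \<omega> * h (\<gamma> \<omega>) \<omega>)"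
      using integrable_mult_indicator[OF BM int] by simp
    have "(\<integral>\<omega>\<in>B. m \<omega> \<partial>M) = (\<integral>\<omega>. (\<integral>v. indicator B \<omega> * h v \<omega> \<partial>\<kappa> \<omega>) \<partial>M)"
      by (simp add: set_lebesgue_integral_def m_def)
    also have "\<dots> = (\<integral>\<omega>. indicator B \<omega> * h (\<gamma> \<omega>) \<omega> \<partial>M)"
      by (rule integral_disintegration(3)[OF hB iB])
    also have "\<dots> = 0" using zero[OF B] by (simp add: set_lebesgue_integral_def)
    finally show ?thesis .
  qed
  then have "AE \<omega> in M. real_cond_exp M Hs m \<omega> = 0"
    by (intro c.real_cond_exp_charact mi) auto
  moreover have "AE \<omega> in M. real_cond_exp M Hs m \<omega> = m \<omega>"
    by (rule c.real_cond_exp_F_meas[OF mi mH])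
  ultimately show ?thesis by eventually_elim (simp add: m_def)
qed

end

lemma (in single_jump) predictable_process_measurable:
  assumes "predictable_process Fi P" "0 \<le> t"
  shows "P t \<in> borel_measurable M"
proof -
  have "(\<lambda>\<omega>. (t, \<omega>)) \<in> measurable M (sigma ({0..} \<times> space M) ({{0} \<times> B |B. B \<in> sets (Fi 0)} \<union>
        {{s<..t} \<times> B |s t B. 0 \<le> s \<and> s \<le> t \<and> B \<in> sets (Fi (ennreal s))}))"
  proof (rule measurable_measure_of)
    show "{{0} \<times> B |B. B \<in> sets (Fi 0)} \<union> {{s<..t} \<times> B |s t B. 0 \<le> s \<and> s \<le> t \<and> B \<in> sets (Fi (ennreal s))}
        \<subseteq> Pow ({0::real..} \<times> space M)"
      using Pred_generators by simp
    show "(\<lambda>\<omega>. (t, \<omega>)) \<in> space M \<rightarrow> {0..} \<times> space M" using assms(2) by auto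
    fix Y assume "Y \<in> {{0} \<times> B |B. B \<in> sets (Fi 0)} \<union> {{s<..t} \<times> B |s t B. 0 \<le> s \<and> s \<le> t \<and> B \<in> sets (Fi (ennreal s))}"
    then obtain S B where Y: "Y = S \<times> B" "B \<in> sets M" using sets_Fi_subset by blast
    then have "B \<subseteq> space M" using sets.sets_into_space by blast
    then have "(\<lambda>\<omega>. (t, \<omega>)) -` Y \<inter> space M = (if t \<in> S then B else {})" using Y by auto
    then show "(\<lambda>\<omega>. (t, \<omega>)) -` Y \<inter> space M \<in> sets M" using Y by simp
  qed
  then have "(\<lambda>\<omega>. (t, \<omega>)) \<in> measurable M Pred" by (simp add: predictable_sigma_def)
  from measurable_compose[OF this assms(1)[unfolded predictable_process_def]] show ?thesis by simp
qed

section \<open>The stopped difference of two compensators\<close>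

context compensator_setup
begin

text \<open>The indicator of \<open>s \<le> T\<close> is a predictable process, hence known from
  \<open>Hs\<close> up to \<open>\<gamma>\<close>. So before the jump a stopping time is represented
  by a jointly measurable weight, which is the form that \<open>compensated_increment\<close>
  accepts.\<close>

lemma stopping_time_trace:
  assumes T: "stopping_time Fi T" and t: "0 \<le> t"
  obtains q where "(\<lambda>(v, \<omega>). q v \<omega>) \<in> borel_measurable (borel \<Otimes>\<^sub>M Hs)" "\<And>v \<omega>. \<bar>q v \<omega> :: real\<bar> \<le> 1"
    "AE \<omega> in M. \<forall>v\<le>\<gamma> \<omega>. (if 0 < v then q v \<omega> else 0) =
       (if 0 < v \<and> v \<le> ennreal (enn2real (min (ennreal t) (T \<omega>))) then 1 else 0)"
proof -
  have "(\<lambda>x. min (ennreal (fst x)) top) \<in> borel_measurable Pred"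
    by (rule Pred_min) (use sets.top[of "Fi _"] in auto)
  then have f: "(\<lambda>x. ennreal (fst x)) \<in> borel_measurable Pred" by (simp add: min_def)
  have m: "(\<lambda>x. min (ennreal (fst x)) (T (snd x))) \<in> borel_measurable Pred"
    by (rule Pred_min) (rule stopping_time_greater[OF T])
  have "{x \<in> space Pred. min (ennreal (fst x)) (T (snd x)) = ennreal (fst x)} \<in> sets Pred"
    using f m by measurable
  then have "(\<lambda>x. if min (ennreal (fst x)) (T (snd x)) = ennreal (fst x) then 1 else 0 :: real) \<in> borel_measurable Pred"
    by (intro measurable_If) auto
  then have "predictable_process Fi (\<lambda>s \<omega>. if min (ennreal s) (T \<omega>) = ennreal s then 1 else 0)"
    by (simp add: predictable_process_def case_prod_beta')
  from predictable_trace[OF this] obtain p where p: "p \<in> borel_measurable (borel \<Otimes>\<^sub>M Hs)"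
    "AE \<omega> in M. \<forall>s\<ge>0. ennreal s \<le> \<gamma> \<omega> \<longrightarrow> (if min (ennreal s) (T \<omega>) = ennreal s then 1 else 0) = (p (s, \<omega>) :: real)"
    by blast
  \<comment> \<open>Clipping to \<open>[-1, 1]\<close> is harmless where \<open>p\<close> is an
    indicator and gives the bound everywhere else; cutting at \<open>t\<close> makes
    \<open>v\<close> finite, so that \<open>enn2real\<close> loses nothing.\<close>
  define q where "q v \<omega> = (if v \<le> ennreal t then max (- 1) (min 1 (p (enn2real v, \<omega>))) else 0)" for v \<omega>
  show ?thesis
  proof (rule that)
    have "(\<lambda>z. (enn2real (fst z), snd z)) \<in> measurable (borel \<Otimes>\<^sub>M Hs) (borel \<Otimes>\<^sub>M Hs)"
      by (rule measurable_Pair[OF borel_measurable_enn2real[OF measurable_fst] measurable_snd])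
    from measurable_compose[OF this p(1)]
    have "(\<lambda>z. p (enn2real (fst z), snd z)) \<in> borel_measurable (borel \<Otimes>\<^sub>M Hs)" .
    then have "(\<lambda>z. if fst z \<le> ennreal t then max (- 1) (min 1 (p (enn2real (fst z), snd z))) else 0) \<in> borel_measurable (borel \<Otimes>\<^sub>M Hs)"
      by (intro measurable_If borel_measurable_max borel_measurable_min borel_measurable_const) auto
    then show "(\<lambda>(v, \<omega>). q v \<omega>) \<in> borel_measurable (borel \<Otimes>\<^sub>M Hs)"
      by (simp add: q_def case_prod_beta')
    show "\<bar>q v \<omega>\<bar> \<le> 1" for v \<omega> by (auto simp: q_def)
    show "AE \<omega> in M. \<forall>v\<le>\<gamma> \<omega>. (if 0 < v then q v \<omega> else 0) =
       (if 0 < v \<and> v \<le> ennreal (enn2real (min (ennreal t) (T \<omega>))) then 1 else 0)"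
      using p(2)
    proof eventually_elim
      case (elim \<omega>)
      have "min (ennreal t) (T \<omega>) < top" by (simp add: min_less_iff_disj)
      then have e: "ennreal (enn2real (min (ennreal t) (T \<omega>))) = min (ennreal t) (T \<omega>)" by simp
      have "q v \<omega> = (if v \<le> min (ennreal t) (T \<omega>) then 1 else 0)" if v: "v \<le> \<gamma> \<omega>" for v
      proof (cases "v \<le> ennreal t")
        case True
        then have r: "ennreal (enn2real v) = v" by (simp add: le_less_trans[OF _ ennreal_less_top])
        have "p (enn2real v, \<omega>) = (if min v (T \<omega>) = v then 1 else 0)"
          using elim[rule_format, of "enn2real v"] v unfolding r by simp
        then show ?thesis using True by (auto simp: q_def min_def)
      qed (simp add: q_def)
      then show ?case unfolding e by auto
    qed
  qed
qed

text \<open>Optional stopping, tested on sets of \<open>Hs\<close> only. Measurability of the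
  stopped process is a premise; in the application the process is the sum of a predictable process
  and a martingale, both measurable at each time.\<close>

lemma stopped_R_mean:
  assumes T: "stopping_time Fi T" and t: "0 \<le> t"
    and m: "stopped_process T R t \<in> borel_measurable M"
  shows "integrable M (stopped_process T R t)"
    and "B \<in> sets Hs \<Longrightarrow> (\<integral>\<omega>\<in>B. stopped_process T R t \<omega> \<partial>M) = (\<integral>\<omega>\<in>B. F 0 \<omega> \<partial>M)"
proof -
  obtain q where q: "(\<lambda>(v, \<omega>). q v \<omega>) \<in> borel_measurable (borel \<Otimes>\<^sub>M Hs)" "\<And>v \<omega>. \<bar>q v \<omega> :: real\<bar> \<le> 1"
    "AE \<omega> in M. \<forall>v\<le>\<gamma> \<omega>. (if 0 < v then q v \<omega> else 0) =
       (if 0 < v \<and> v \<le> ennreal (enn2real (min (ennreal t) (T \<omega>))) then 1 else 0)"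
    using stopping_time_trace[OF T t] by blast
  have key: "\<exists>f. integrable M f \<and> (\<integral>\<omega>. f \<omega> \<partial>M) = 0 \<and>
      (AE \<omega> in M. f \<omega> = indicator B \<omega> * (N (enn2real (min (ennreal t) (T \<omega>))) \<omega> - N 0 \<omega>))" if B: "B \<in> sets Hs" for B
    by (rule compensated_increment[OF order_refl _ B q(1,2), where t = "\<lambda>\<omega>. enn2real (min (ennreal t) (T \<omega>))" and B = B])
       (use q(3) in auto)
  have eq: "AE \<omega> in M. stopped_process T R t \<omega> = (N (enn2real (min (ennreal t) (T \<omega>))) \<omega> - N 0 \<omega>) + F 0 \<omega>"
    using AE_R_eq_N AE_good_path
  proof eventually_elim
    case (elim \<omega>)
    interpret good_path M Hs \<gamma> G F X L H \<omega> by (rule elim(2))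
    show ?case using elim(1) N_0 by (simp add: stopped_process_def)
  qed
  have BM: "B \<in> sets M" if "B \<in> sets Hs" for B using that sets_Hs by auto
  have "space M \<in> sets Hs" using sets.top[of Hs] by simp
  from key[OF this] obtain f where f: "integrable M f"
    "AE \<omega> in M. f \<omega> = indicator (space M) \<omega> * (N (enn2real (min (ennreal t) (T \<omega>))) \<omega> - N 0 \<omega>)" by blast
  show i: "integrable M (stopped_process T R t)"
  proof (rule integrable_cong_AE_imp[OF Bochner_Integration.integrable_add[OF f(1) integrable_F_0] m])
    show "AE \<omega> in M. f \<omega> + F 0 \<omega> = stopped_process T R t \<omega>"
      using f(2) eq AE_space by eventually_elim simp
  qed
  assume B: "B \<in> sets Hs"
  from key[OF B] obtain f where f: "integrable M f" "(\<integral>\<omega>. f \<omega> \<partial>M) = 0"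
    "AE \<omega> in M. f \<omega> = indicator B \<omega> * (N (enn2real (min (ennreal t) (T \<omega>))) \<omega> - N 0 \<omega>)" by blast
  have iF: "integrable M (\<lambda>\<omega>. indicator B \<omega> *\<^sub>R F 0 \<omega>)"
    by (rule integrable_mult_indicator[OF BM[OF B] integrable_F_0])
  have "(\<integral>\<omega>\<in>B. stopped_process T R t \<omega> \<partial>M) = (\<integral>\<omega>. f \<omega> + indicator B \<omega> *\<^sub>R F 0 \<omega> \<partial>M)"
    unfolding set_lebesgue_integral_def
  proof (rule integral_cong_AE)
    show "(\<lambda>\<omega>. indicator B \<omega> *\<^sub>R stopped_process T R t \<omega>) \<in> borel_measurable M"
      by (rule borel_measurable_integrable[OF integrable_mult_indicator[OF BM[OF B] i]])
    show "(\<lambda>\<omega>. f \<omega> + indicator B \<omega> *\<^sub>R F 0 \<omega>) \<in> borel_measurable M"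
      by (rule borel_measurable_integrable[OF Bochner_Integration.integrable_add[OF f(1) iF]])
    show "AE \<omega> in M. indicator B \<omega> *\<^sub>R stopped_process T R t \<omega> = f \<omega> + indicator B \<omega> *\<^sub>R F 0 \<omega>"
      using f(3) eq by eventually_elim (auto simp: indicator_def)
  qed
  also have "\<dots> = (\<integral>\<omega>\<in>B. F 0 \<omega> \<partial>M)"
    unfolding Bochner_Integration.integral_add[OF f(1) iF] f(2) by (simp add: set_lebesgue_integral_def)
  finally show "(\<integral>\<omega>\<in>B. stopped_process T R t \<omega> \<partial>M) = (\<integral>\<omega>\<in>B. F 0 \<omega> \<partial>M)" .
qed

text \<open>Every event contained in \<open>{\<gamma> \<le> s}\<close> already belongs to the
  filtration at \<open>s\<close>, so on this set conditioning changes nothing and no martingale can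
  move after the jump.\<close>

lemma martingale_const_after:
  assumes m: "martingale_process M Fi P" and s: "0 \<le> s" "s \<le> t"
  shows "AE \<omega> in M. \<gamma> \<omega> \<le> ennreal s \<longrightarrow> P t \<omega> = P s \<omega>"
proof -
  interpret c: finite_measure_subalgebra M "Fi (ennreal s)" by unfold_locales (rule subalgebra_Fi)
  have i: "integrable M (P u)" if "0 \<le> u" for u using m that by (simp add: martingale_process_def)
  have t: "0 \<le> t" using s by simp
  have ce: "AE \<omega> in M. real_cond_exp M (Fi (ennreal s)) (P t) \<omega> = P s \<omega>"
    using m s by (simp add: martingale_process_def)
  define Z where "Z = {\<omega> \<in> space M. \<gamma> \<omega> \<le> ennreal s}"
  have Z: "Z \<in> sets M" unfolding Z_def by measurable
  have iZ: "integrable M (\<lambda>\<omega>. indicator Z \<omega> *\<^sub>R P u \<omega>)" if "0 \<le> u" for u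
    by (rule integrable_mult_indicator[OF Z i[OF that]])
  have "AE \<omega> in M. indicator Z \<omega> *\<^sub>R P t \<omega> = indicator Z \<omega> *\<^sub>R P s \<omega>"
  proof (rule density_unique_real[OF iZ[OF t] iZ[OF s(1)]])
    fix B assume B: "B \<in> sets M"
    have BZ: "B \<inter> Z \<in> sets (Fi (ennreal s))"
      by (rule Fi_after) (use B Z in \<open>auto simp: Z_def\<close>)
    have e: "(\<integral>\<omega>\<in>B. indicator Z \<omega> *\<^sub>R P u \<omega> \<partial>M) = (\<integral>\<omega>\<in>B \<inter> Z. P u \<omega> \<partial>M)" for u
      unfolding set_lebesgue_integral_def by (intro Bochner_Integration.integral_cong) (auto simp: indicator_def)
    have "(\<integral>\<omega>\<in>B \<inter> Z. P t \<omega> \<partial>M) = (\<integral>\<omega>\<in>B \<inter> Z. real_cond_exp M (Fi (ennreal s)) (P t) \<omega> \<partial>M)"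
      by (rule c.real_cond_exp_intA[OF i[OF t] BZ])
    also have "\<dots> = (\<integral>\<omega>\<in>B \<inter> Z. P s \<omega> \<partial>M)"
    proof (rule set_lebesgue_integral_cong_AE)
      show "real_cond_exp M (Fi (ennreal s)) (P t) \<in> borel_measurable M"
        by (rule borel_measurable_integrable[OF c.real_cond_exp_int(1)[OF i[OF t]]])
      show "P s \<in> borel_measurable M" by (rule borel_measurable_integrable[OF i[OF s(1)]])
      show "B \<inter> Z \<in> sets M" using B Z by simp
      show "AE \<omega>\<in>B \<inter> Z in M. real_cond_exp M (Fi (ennreal s)) (P t) \<omega> = P s \<omega>"
        using ce by eventually_elim simp
    qed
    finally show "(\<integral>\<omega>\<in>B. indicator Z \<omega> *\<^sub>R P t \<omega> \<partial>M) = (\<integral>\<omega>\<in>B. indicator Z \<omega> *\<^sub>R P s \<omega> \<partial>M)"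
      unfolding e .
  qed
  then show ?thesis using AE_space by eventually_elim (auto simp: Z_def)
qed

text \<open>The Volterra equation is known at rational times and extended by right-continuity, which
  needs room to the right; it is therefore used strictly before \<open>\<gamma>\<close> only. At
  \<open>\<gamma>\<close> two cases remain: if mass survives, the independent copy applies;
  otherwise the remaining mass is an atom at \<open>\<gamma>\<close>, and the mean-zero equation
  reads \<open>p * W = 0\<close> there.\<close>

lemma stopped_difference_zero:
  assumes A'_pred: "predictable_process Fi A'" and A'_path: "rc_finite_variation M A'" and A'_0: "AE \<omega> in M. A' 0 \<omega> = 0"
    and T: "stopping_time Fi T"
    and mart: "martingale_process M Fi (stopped_process T (\<lambda>t \<omega>. X t \<omega> - A' t \<omega>))"
  shows "AE \<omega> in M. \<forall>t\<ge>0. stopped_process T (\<lambda>t \<omega>. A' t \<omega> - A t \<omega>) t \<omega> = 0"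
proof -
  define E where "E = stopped_process T (\<lambda>t \<omega>. A' t \<omega> - A t \<omega>)"
  define R' where "R' = stopped_process T (\<lambda>t \<omega>. X t \<omega> - A' t \<omega>)"
  define RT where "RT = stopped_process T R"
  have E_eq: "E t \<omega> = RT t \<omega> - R' t \<omega>" for t \<omega>
    by (simp add: E_def RT_def R'_def stopped_process_def)
  have "predictable_process Fi (\<lambda>t \<omega>. A' t \<omega> - A t \<omega>)"
    using borel_measurable_diff[OF A'_pred[unfolded predictable_process_def] A_predictable[unfolded predictable_process_def]]
    by (simp add: predictable_process_def case_prod_beta')
  then have E_pred: "predictable_process Fi E"
    unfolding E_def using T by (rule predictable_process_stopped)
  obtain p where p: "p \<in> borel_measurable (borel \<Otimes>\<^sub>M Hs)"
    and Ep: "AE \<omega> in M. \<forall>t\<ge>0. ennreal t \<le> \<gamma> \<omega> \<longrightarrow> E t \<omega> = p (t, \<omega>)"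
    using predictable_trace[OF E_pred] by blast
  have EM: "E t \<in> borel_measurable M" if "0 \<le> t" for t by (rule predictable_process_measurable[OF E_pred that])
  have R'i: "integrable M (R' t)" if "0 \<le> t" for t using mart that by (simp add: martingale_process_def R'_def)
  have RTm: "RT t \<in> borel_measurable M" if t: "0 \<le> t" for t
  proof -
    have "RT t = (\<lambda>\<omega>. E t \<omega> + R' t \<omega>)" by (simp add: E_eq fun_eq_iff)
    then show ?thesis using EM[OF t] borel_measurable_integrable[OF R'i[OF t]] by simp
  qed
  note RTmean = stopped_R_mean[OF T _ RTm[unfolded RT_def], folded RT_def]
  have Ei: "integrable M (E t)" if t: "0 \<le> t" for t
    unfolding E_eq[abs_def] by (rule Bochner_Integration.integrable_diff[OF RTmean(1)[OF t t] R'i[OF t]])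
  \<comment> \<open>\<open>RT\<close> and \<open>R'\<close> have the same integral over
    \<open>B\<close>, that of \<open>F 0\<close>: the first by optional stopping, the second as a
    martingale that starts at \<open>X 0 = F 0\<close>.\<close>
  have Emean: "(\<integral>\<omega>\<in>B. E t \<omega> \<partial>M) = 0" if B: "B \<in> sets Hs" and t: "0 \<le> t" for B t
  proof -
    interpret c: finite_measure_subalgebra M "Fi (ennreal 0)" by unfold_locales (rule subalgebra_Fi)
    have BM: "B \<in> sets M" using B sets_Hs by auto
    have BF: "B \<in> sets (Fi (ennreal 0))" using Hs_Fi[OF _ B, of 0] by simp
    have si: "set_integrable M B f" if "integrable M f" for f :: "'a \<Rightarrow> real"
      unfolding set_integrable_def by (rule integrable_mult_indicator[OF BM that])
    have "(\<integral>\<omega>\<in>B. R' t \<omega> \<partial>M) = (\<integral>\<omega>\<in>B. real_cond_exp M (Fi (ennreal 0)) (R' t) \<omega> \<partial>M)"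
      by (rule c.real_cond_exp_intA[OF R'i[OF t] BF])
    also have "\<dots> = (\<integral>\<omega>\<in>B. F 0 \<omega> \<partial>M)"
    proof (rule set_lebesgue_integral_cong_AE)
      show "real_cond_exp M (Fi (ennreal 0)) (R' t) \<in> borel_measurable M"
        by (rule borel_measurable_integrable[OF c.real_cond_exp_int(1)[OF R'i[OF t]]])
      show "F 0 \<in> borel_measurable M" by (rule borel_measurable_integrable[OF integrable_F_0])
      have "AE \<omega> in M. real_cond_exp M (Fi (ennreal 0)) (R' t) \<omega> = R' 0 \<omega>"
        using mart t unfolding martingale_process_def R'_def by blast
      then show "AE \<omega>\<in>B in M. real_cond_exp M (Fi (ennreal 0)) (R' t) \<omega> = F 0 \<omega>"
        using A'_0 AE_good_path
      proof eventually_elim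
        case (elim \<omega>)
        interpret good_path M Hs \<gamma> G F X L H \<omega> by (rule elim(3))
        show ?case using elim(1,2) X_0 by (simp add: R'_def stopped_process_def)
      qed
    qed (rule BM)
    finally have "(\<integral>\<omega>\<in>B. R' t \<omega> \<partial>M) = (\<integral>\<omega>\<in>B. F 0 \<omega> \<partial>M)" .
    then show ?thesis
      unfolding E_eq[abs_def] set_integral_diff(2)[OF si[OF RTmean(1)[OF t t]] si[OF R'i[OF t]]]
      using RTmean(2)[OF t t B] by simp
  qed
  \<comment> \<open>Constancy after the jump is almost sure for each pair of times; rational pairs
    are countable, and right-continuity of \<open>E\<close> covers the other times later.\<close>
  have R'_after: "AE \<omega> in M. \<forall>s\<in>\<rat> \<inter> {0..}. \<forall>t\<in>\<rat> \<inter> {0..}. s \<le> t \<longrightarrow> \<gamma> \<omega> \<le> ennreal s \<longrightarrow> R' t \<omega> = R' s \<omega>"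
  proof -
    have c: "countable (\<rat> \<inter> {0::real..})" by (intro countable_Int1 countable_rat)
    have "AE \<omega> in M. s \<le> t \<longrightarrow> \<gamma> \<omega> \<le> ennreal s \<longrightarrow> R' t \<omega> = R' s \<omega>"
      if "s \<in> \<rat> \<inter> {0..}" "t \<in> \<rat> \<inter> {0..}" for s t :: real
    proof (cases "s \<le> t")
      case True
      then show ?thesis using martingale_const_after[OF mart, of s t] that by (simp add: R'_def)
    qed simp
    then show ?thesis by (simp add: AE_ball_countable[OF c])
  qed
  have E_path: "AE \<omega> in M. (\<forall>t\<ge>0. continuous (at_right t) (\<lambda>s. E s \<omega>)) \<and> (\<forall>b\<ge>0. \<exists>K. \<forall>t\<in>{0..b}. \<bar>E t \<omega>\<bar> \<le> K)"
    using A'_path[unfolded rc_finite_variation_def] A_path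
  proof eventually_elim
    case (elim \<omega>)
    show ?case
    proof (intro conjI allI impI)
      fix t :: real assume t: "0 \<le> t"
      have "continuous (at_right u) (\<lambda>s. A' s \<omega> - A s \<omega>)" if "0 \<le> u" for u
        using elim that by (intro continuous_diff) auto
      from stopped_path_rc[OF this t, of "T \<omega>"] show "continuous (at_right t) (\<lambda>s. E s \<omega>)"
        by (simp add: E_def stopped_process_def)
    next
      fix b :: real assume b: "0 \<le> b"
      have "finite_variation_on (\<lambda>s. A' s \<omega> - A s \<omega>) 0 b"
        using elim b by (intro finite_variation_on_diff) auto
      then obtain K where K: "\<And>x. x \<in> {0..b} \<Longrightarrow> \<bar>A' x \<omega> - A x \<omega>\<bar> \<le> K"
        using finite_variation_on_bounded by blast
      have "enn2real (min (ennreal t) (T \<omega>)) \<in> {0..b}" if "t \<in> {0..b}" for t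
      proof -
        have "enn2real (min (ennreal t) (T \<omega>)) \<le> enn2real (ennreal t)" by (intro enn2real_mono) auto
        then show ?thesis using that by auto
      qed
      then show "\<exists>K. \<forall>t\<in>{0..b}. \<bar>E t \<omega>\<bar> \<le> K"
        using K by (intro exI[of _ K]) (auto simp: E_def stopped_process_def)
    qed
  qed
  have E_after: "AE \<omega> in M. \<forall>t\<ge>0. E t \<omega> = E (enn2real (min (ennreal t) (\<gamma> \<omega>))) \<omega>"
    using R'_after E_path AE_R_eq_N
  proof eventually_elim
    case (elim \<omega>)
    show ?case
    proof (intro allI impI)
      fix t :: real assume t: "0 \<le> t"
      show "E t \<omega> = E (enn2real (min (ennreal t) (\<gamma> \<omega>))) \<omega>"
      proof (cases "\<gamma> \<omega> \<le> ennreal t")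
        case False
        then show ?thesis using t by (simp add: min_absorb1)
      next
        case True
        then obtain g where g: "\<gamma> \<omega> = ennreal g" "0 \<le> g" by (cases "\<gamma> \<omega>") (auto simp: top_unique)
        have gt: "g \<le> t" using True g t by (simp add: ennreal_le_iff)
        \<comment> \<open>\<open>R\<close> equals \<open>N\<close>, which is constant from
          \<open>\<gamma>\<close> on, so its stopped version is constant there whether or not
          \<open>T\<close> has occurred.\<close>
        have RTc: "RT u \<omega> = RT s \<omega>" if "g \<le> s" "s \<le> u" for s u
        proof -
          have Nc: "N x \<omega> = N y \<omega>" if "g \<le> x" "g \<le> y" for x y
            using ennreal_leI[OF that(1)] ennreal_leI[OF that(2)] g by (simp add: N_def min_absorb2)
          have su: "ennreal s \<le> ennreal u" using that by (intro ennreal_leI) auto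
          show ?thesis
          proof (cases "T \<omega> \<le> ennreal s")
            case True
            then have "min (ennreal u) (T \<omega>) = min (ennreal s) (T \<omega>)" using su by (simp add: min_absorb2 order_trans[OF True su])
            then show ?thesis by (simp add: RT_def stopped_process_def)
          next
            case False
            then have sT: "ennreal s \<le> T \<omega>" by simp
            have fin: "min (ennreal u) (T \<omega>) < top" by (simp add: min_less_iff_disj)
            have "ennreal s \<le> min (ennreal u) (T \<omega>)" using su sT by simp
            then have "enn2real (ennreal s) \<le> enn2real (min (ennreal u) (T \<omega>))"
              using fin by (intro enn2real_mono) auto
            then have 1: "g \<le> enn2real (min (ennreal u) (T \<omega>))" using that g by simp
            have 2: "enn2real (min (ennreal s) (T \<omega>)) = s" using sT that g by (simp add: min_absorb1)
            show ?thesis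
              unfolding RT_def stopped_process_def
              using elim(3)[rule_format, OF enn2real_nonneg] Nc[OF 1, of s] that 2
                elim(3)[rule_format, of s] g(2) by simp
          qed
        qed
        obtain q0 where q0: "q0 \<in> \<rat>" "t < q0" using Rats_dense_in_real[of t "t + 1"] by auto
        have Eq: "E s \<omega> = E q0 \<omega>" if "s \<in> \<rat>" "g < s" "s < q0" for s
        proof -
          have "\<gamma> \<omega> \<le> ennreal s" using g that by (simp add: ennreal_leI)
          then have "R' q0 \<omega> = R' s \<omega>" using elim(1) that q0 g by auto
          then show ?thesis using RTc[of s q0] that by (simp add: E_eq)
        qed
        have Eall: "E u \<omega> = E q0 \<omega>" if u: "g \<le> u" "u \<le> t" for u
        proof (rule rc_determined_by_rationals[where f = "\<lambda>u. E u \<omega>"])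
          show "continuous (at_right u) (\<lambda>u. E u \<omega>)" using elim(2) u g by auto
          show "u < q0" using u q0 by simp
          show "E s \<omega> = E q0 \<omega>" if "s \<in> \<rat>" "u < s" "s < q0" for s
            using Eq[of s] that u by simp
        qed
        have "min (ennreal t) (\<gamma> \<omega>) = ennreal g" using True g by (simp add: min_absorb2)
        then show ?thesis using Eall[of t] Eall[of g] gt g by simp
      qed
    qed
  qed
  \<comment> \<open>\<open>E\<close> is frozen after the jump, so for a jump at \<open>v\<close> its
    value at \<open>t\<close> is that of \<open>p\<close> at the earlier of \<open>t\<close> and
    \<open>v\<close>.\<close>
  define h where "h t v \<omega> = p (enn2real (min (ennreal t) v), \<omega>)" for t :: real and v \<omega>
  have hm: "(\<lambda>(v, \<omega>). h t v \<omega>) \<in> borel_measurable (borel \<Otimes>\<^sub>M Hs)" for t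
  proof -
    have "(\<lambda>z. enn2real (min (ennreal t) (fst z))) \<in> borel_measurable ((borel :: ennreal measure) \<Otimes>\<^sub>M Hs)"
      by (intro borel_measurable_enn2real borel_measurable_min borel_measurable_const measurable_fst)
    from measurable_compose[OF measurable_Pair[OF this measurable_snd] p] show ?thesis
      by (simp add: h_def case_prod_beta')
  qed
  have hE: "AE \<omega> in M. h t (\<gamma> \<omega>) \<omega> = E t \<omega>" if t: "0 \<le> t" for t
    using E_after Ep
  proof eventually_elim
    case (elim \<omega>)
    have "min (ennreal t) (\<gamma> \<omega>) < top" by (simp add: min_less_iff_disj)
    then have "ennreal (enn2real (min (ennreal t) (\<gamma> \<omega>))) \<le> \<gamma> \<omega>" by simp
    from elim(2)[rule_format, OF enn2real_nonneg this] elim(1)[rule_format, OF t]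
    show ?case by (simp only: h_def)
  qed
  have h_props: "AE \<omega> in M. integrable (\<kappa> \<omega>) (\<lambda>v. h t v \<omega>) \<and> (\<integral>v. h t v \<omega> \<partial>\<kappa> \<omega>) = 0" if t: "0 \<le> t" for t
  proof -
    have gm: "(\<lambda>\<omega>. h t (\<gamma> \<omega>) \<omega>) \<in> borel_measurable M" by (rule graph_measurable[OF hm])
    have hi: "integrable M (\<lambda>\<omega>. h t (\<gamma> \<omega>) \<omega>)"
    proof (rule integrable_cong_AE_imp[OF Ei[OF t] gm])
      show "AE \<omega> in M. E t \<omega> = h t (\<gamma> \<omega>) \<omega>" using hE[OF t] by eventually_elim simp
    qed
    have hz: "(\<integral>\<omega>\<in>B. h t (\<gamma> \<omega>) \<omega> \<partial>M) = 0" if B: "B \<in> sets Hs" for B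
    proof -
      have "(\<integral>\<omega>\<in>B. h t (\<gamma> \<omega>) \<omega> \<partial>M) = (\<integral>\<omega>\<in>B. E t \<omega> \<partial>M)"
      proof (rule set_lebesgue_integral_cong_AE[OF _ gm EM[OF t]])
        show "B \<in> sets M" using B sets_Hs by auto
        show "AE \<omega>\<in>B in M. h t (\<gamma> \<omega>) \<omega> = E t \<omega>" using hE[OF t] by eventually_elim simp
      qed
      then show ?thesis using Emean[OF B t] by simp
    qed
    have "AE \<omega> in M. (\<integral>v. h t v \<omega> \<partial>\<kappa> \<omega>) = 0"
      by (rule conditional_mean_zero[OF hm hi]) (rule hz)
    with integral_disintegration(1)[OF hm hi] show ?thesis by eventually_elim simp
  qed
  have h_rat: "AE \<omega> in M. \<forall>t\<in>\<rat> \<inter> {0..}. integrable (\<kappa> \<omega>) (\<lambda>v. h t v \<omega>) \<and> (\<integral>v. h t v \<omega> \<partial>\<kappa> \<omega>) = 0"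
  proof -
    have c: "countable (\<rat> \<inter> {0::real..})" by (intro countable_Int1 countable_rat)
    show ?thesis unfolding AE_ball_countable[OF c] using h_props by auto
  qed
  have before: "AE \<omega> in M. \<forall>t\<ge>0. ennreal t < \<gamma> \<omega> \<longrightarrow> p (t, \<omega>) = 0"
    using AE_good_path h_rat Ep E_path
  proof eventually_elim
    case (elim \<omega>)
    interpret good_path M Hs \<gamma> G F X L H \<omega> by (rule elim(1))
    show ?case
    proof (intro allI impI)
      fix t0 :: real assume t0: "0 \<le> t0" "ennreal t0 < \<gamma> \<omega>"
      obtain b where b: "t0 < b" "ennreal b \<le> \<gamma> \<omega>"
      proof (cases "\<gamma> \<omega>")
        case (real r)
        then show ?thesis using t0 that[of r] by (auto simp: ennreal_less_iff)
      next
        case top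
        then show ?thesis using that[of "t0 + 1"] by auto
      qed
      obtain q0 where q0: "q0 \<in> \<rat>" "t0 < q0" "q0 < b" using Rats_dense_in_real[OF b(1)] by auto
      have before\<gamma>: "ennreal u \<le> \<gamma> \<omega>" if "u \<le> q0" for u
        using b(2) q0(3) that by (meson ennreal_leI less_imp_le order_trans)
      define e where "e u = p (u, \<omega>)" for u
      have eE: "E u \<omega> = e u" if "0 \<le> u" "u \<le> q0" for u
        using elim(3) that before\<gamma>[OF that(2)] by (simp add: e_def)
      define \<psi>' where "\<psi>' v = e (enn2real v) * (if v \<le> ennreal q0 then 1 else 0)" for v
      have hq: "integrable (\<kappa> \<omega>) (\<lambda>v. h q v \<omega>)" "(\<integral>v. h q v \<omega> \<partial>\<kappa> \<omega>) = 0" if "q \<in> \<rat>" "0 \<le> q" for q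
        using elim(2) that by auto
      have h_split: "h q v \<omega> = e (enn2real v) * (if v \<le> ennreal q then 1 else 0) + e q * indicator {ennreal q<..} v" if "0 \<le> q" for q v
        using that by (auto simp: h_def e_def indicator_def min_def)
      have em: "(\<lambda>v. e (enn2real v)) \<in> borel_measurable borel"
      proof -
        have "(\<lambda>v. (enn2real v, \<omega>)) \<in> measurable borel (borel \<Otimes>\<^sub>M Hs)"
          using \<omega> by (intro measurable_Pair borel_measurable_enn2real measurable_ident_sets[OF refl] measurable_const) simp
        from measurable_compose[OF this p] show ?thesis unfolding e_def .
      qed
      have ii: "integrable (\<kappa> \<omega>) (\<lambda>v. c * indicator {ennreal q<..} v)" for c :: real and q
        by (intro integrable_mult_right integrable_real_indicator) (auto simp: k.emeasure_eq_measure)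
      have ie: "integrable (\<kappa> \<omega>) (\<lambda>v. e (enn2real v) * (if v \<le> ennreal q then 1 else 0))" if q: "q \<in> \<rat>" "0 \<le> q" for q
      proof -
        have "integrable (\<kappa> \<omega>) (\<lambda>v. h q v \<omega> - e q * indicator {ennreal q<..} v)"
          by (rule Bochner_Integration.integrable_diff[OF hq(1)[OF q] ii])
        then show ?thesis using h_split[OF q(2)] by simp
      qed
      have i\<psi>: "integrable (\<kappa> \<omega>) \<psi>'" unfolding \<psi>'_def using ie[OF q0(1)] q0(2) t0(1) by simp
      \<comment> \<open>\<open>\<Phi> u = 0\<close> is the Volterra equation. It is written with
        \<open>E\<close> in place of \<open>e\<close> because right-continuity is known for the
        process; it holds at rational times up to \<open>q0\<close>, and \<open>q0 > t0\<close>
        leaves room to reach every \<open>u \<le> t0\<close> from the right.\<close>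
      define \<Phi> where "\<Phi> u = (\<integral>v. \<psi>' v * (if v \<le> ennreal u then 1 else 0) \<partial>\<kappa> \<omega>) + E u \<omega> * (1 - D.g0 u)" for u
      have \<psi>u: "\<psi>' v * (if v \<le> ennreal u then 1 else 0) = e (enn2real v) * (if v \<le> ennreal u then 1 else 0)" if "u \<le> q0" for u v
        using order_trans[OF _ ennreal_leI[OF that], of v] by (auto simp: \<psi>'_def)
      have \<Phi>rat: "\<Phi> q = 0" if "q \<in> \<rat>" "0 \<le> q" "q \<le> q0" for q
      proof -
        have "0 = (\<integral>v. e (enn2real v) * (if v \<le> ennreal q then 1 else 0) + e q * indicator {ennreal q<..} v \<partial>\<kappa> \<omega>)"
          using hq(2)[OF that(1,2)] h_split[OF that(2)] by simp
        also have "\<dots> = (\<integral>v. e (enn2real v) * (if v \<le> ennreal q then 1 else 0) \<partial>\<kappa> \<omega>) + e q * measure (\<kappa> \<omega>) {ennreal q<..}"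
          unfolding Bochner_Integration.integral_add[OF ie[OF that(1,2)] ii] by simp
        finally show ?thesis
          unfolding \<Phi>_def \<psi>u[OF that(3)] eE[OF that(2,3)] by (simp add: measure_\<kappa>_greaterThan)
      qed
      have \<Phi>: "\<Phi> u = 0" if u: "0 \<le> u" "u \<le> t0" for u
      proof (rule rc_determined_by_rationals[where f = \<Phi> and b = q0])
        show "continuous (at_right u) \<Phi>"
          unfolding \<Phi>_def using elim(4) u
          by (intro continuous_add continuous_mult continuous_diff continuous_const D.g0_rc
              truncated_integral_path(1)[OF sets_\<kappa> i\<psi>]) auto
        show "u < q0" using u q0 by simp
        show "\<Phi> s = 0" if "s \<in> \<rat>" "u < s" "s < q0" for s using that u by (intro \<Phi>rat) auto
      qed
      obtain B where B: "\<And>t. t \<in> {0..t0} \<Longrightarrow> \<bar>E t \<omega>\<bar> \<le> B" using elim(4) t0(1) by blast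
      have "e t0 = 0"
      proof (rule volterra_zero[OF prob_space_\<kappa>[OF \<omega>] sets_\<kappa> W_\<gamma>, where e = e and B = B and ?t0.0 = t0])
        fix t assume t: "0 \<le> t" "t \<le> t0"
        then have tq: "t \<le> q0" using q0 by simp
        show "W (\<gamma> \<omega>) \<omega> \<le> measure (\<kappa> \<omega>) {ennreal t..}"
          using W_antimono[OF before\<gamma>[OF tq]] by (simp add: W_def)
        show "\<bar>e t\<bar> \<le> B" using B[of t] eE[OF t(1) tq] t by simp
        show "integrable (\<kappa> \<omega>) (\<lambda>v. e (enn2real v) * (if v \<le> ennreal t then 1 else 0))"
        proof (rule Bochner_Integration.integrable_bound[OF i\<psi>])
          show "(\<lambda>v. e (enn2real v) * (if v \<le> ennreal t then 1 else 0)) \<in> borel_measurable (\<kappa> \<omega>)"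
            unfolding measurable_cong_sets[OF sets_\<kappa> refl]
            by (intro borel_measurable_times em measurable_If measurable_const) auto
          show "AE v in \<kappa> \<omega>. norm (e (enn2real v) * (if v \<le> ennreal t then 1 else 0)) \<le> norm (\<psi>' v)"
            using order_trans[OF _ ennreal_leI[OF tq]] by (intro AE_I2) (auto simp: \<psi>'_def)
        qed
        show "(\<integral>v. e (enn2real v) * (if v \<le> ennreal t then 1 else 0) \<partial>\<kappa> \<omega>) + e t * measure (\<kappa> \<omega>) {ennreal t<..} = 0"
          using \<Phi>[OF t] unfolding \<Phi>_def \<psi>u[OF tq] eE[OF t(1) tq] by (simp add: measure_\<kappa>_greaterThan)
      qed (use t0 in auto)
      then show "p (t0, \<omega>) = 0" by (simp add: e_def)
    qed
  qed
  have "AE \<omega> in M. (\<gamma> \<omega> < \<infinity> \<longrightarrow> p (enn2real (\<gamma> \<omega>), \<omega>) = 0) \<or> emeasure (\<kappa> \<omega>) {\<gamma> \<omega><..} = 0"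
  proof (rule AE_independent_copy)
    have "(\<lambda>z. enn2real (fst z)) \<in> borel_measurable ((borel :: ennreal measure) \<Otimes>\<^sub>M Hs)"
      by (intro borel_measurable_enn2real measurable_fst)
    from measurable_compose[OF measurable_Pair[OF this measurable_snd] p]
    have [measurable]: "(\<lambda>z. p (enn2real (fst z), snd z)) \<in> borel_measurable (borel \<Otimes>\<^sub>M Hs)" .
    show "Measurable.pred (borel \<Otimes>\<^sub>M Hs) (\<lambda>(v, \<omega>). v < \<infinity> \<longrightarrow> p (enn2real v, \<omega>) = 0)"
      unfolding case_prod_beta' by measurable
    show "AE \<omega> in M. \<forall>v<\<gamma> \<omega>. v < \<infinity> \<longrightarrow> p (enn2real v, \<omega>) = 0"
      using before
    proof eventually_elim
      case (elim \<omega>)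
      show ?case
      proof (intro allI impI)
        fix v assume v: "v < \<gamma> \<omega>" "v < \<infinity>"
        then show "p (enn2real v, \<omega>) = 0" using elim by (cases v) auto
      qed
    qed
  qed
  then have at: "AE \<omega> in M. \<gamma> \<omega> < \<infinity> \<longrightarrow> p (enn2real (\<gamma> \<omega>), \<omega>) = 0"
    using AE_good_path h_rat before
  proof eventually_elim
    case (elim \<omega>)
    interpret good_path M Hs \<gamma> G F X L H \<omega> by (rule elim(2))
    show ?case
    proof
      assume fin: "\<gamma> \<omega> < \<infinity>"
      then obtain g where g: "\<gamma> \<omega> = ennreal g" "0 \<le> g" by (cases "\<gamma> \<omega>") auto
      show "p (enn2real (\<gamma> \<omega>), \<omega>) = 0"
      proof (cases "emeasure (\<kappa> \<omega>) {\<gamma> \<omega><..} = 0")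
        case False
        then show ?thesis using elim(1) fin by simp
      next
        case True
        \<comment> \<open>Before \<open>\<gamma>\<close> the function \<open>p\<close> vanishes and
          after \<open>\<gamma>\<close> there is no mass, so for \<open>q\<close> beyond
          \<open>\<gamma>\<close> only the value at \<open>\<gamma>\<close> is left in
          \<open>h q\<close>. \<open>q\<close> is rational because the mean-zero equations are
          available at rational times.\<close>
        obtain q where q: "q \<in> \<rat>" "g < q" using Rats_dense_in_real[of g "g + 1"] by auto
        have "AE v in \<kappa> \<omega>. v \<notin> {\<gamma> \<omega><..}" using True by (intro AE_not_in) (auto simp: null_sets_def)
        then have "AE v in \<kappa> \<omega>. h q v \<omega> = p (g, \<omega>) * indicator {\<gamma> \<omega>} v"
        proof eventually_elim
          case (elim v)
          then have v: "v \<le> ennreal g" using g by simp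
          have "v \<le> ennreal q" using v q by (meson ennreal_leI less_imp_le order_trans)
          then have "h q v \<omega> = p (enn2real v, \<omega>)" by (simp add: h_def min_absorb2)
          moreover have "p (enn2real v, \<omega>) = p (g, \<omega>) * indicator {\<gamma> \<omega>} v"
          proof (cases "v = \<gamma> \<omega>")
            case True
            then show ?thesis using g by simp
          next
            case False
            then have lt: "v < \<gamma> \<omega>" using v g by simp
            then obtain x where x: "v = ennreal x" "0 \<le> x" by (cases v) auto
            then have "p (x, \<omega>) = 0" using \<open>\<forall>t\<ge>0. ennreal t < \<gamma> \<omega> \<longrightarrow> p (t, \<omega>) = 0\<close> lt by simp
            then show ?thesis using x False by simp
          qed
          ultimately show ?case by simp
        qed
        then have "(\<integral>v. h q v \<omega> \<partial>\<kappa> \<omega>) = (\<integral>v. p (g, \<omega>) * indicator {\<gamma> \<omega>} v \<partial>\<kappa> \<omega>)"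
          using elim(3) q g by (intro integral_cong_AE) auto
        then have "p (g, \<omega>) * measure (\<kappa> \<omega>) {\<gamma> \<omega>} = 0"
          using elim(3) q g by simp
        moreover have "measure (\<kappa> \<omega>) {\<gamma> \<omega>} = W (\<gamma> \<omega>) \<omega>"
        proof -
          have "{\<gamma> \<omega>..} = {\<gamma> \<omega>} \<union> {\<gamma> \<omega><..}" by auto
          moreover have "measure (\<kappa> \<omega>) ({\<gamma> \<omega>} \<union> {\<gamma> \<omega><..}) = measure (\<kappa> \<omega>) {\<gamma> \<omega>} + measure (\<kappa> \<omega>) {\<gamma> \<omega><..}"
            by (rule k.finite_measure_Union) auto
          ultimately show ?thesis using True by (simp only: W_def measure_def) simp
        qed
        ultimately show ?thesis using W_\<gamma> g by simp
      qed
    qed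
  qed
  show ?thesis
    unfolding E_def[symmetric]
    using E_after Ep before at
  proof eventually_elim
    case (elim \<omega>)
    show ?case
    proof (intro allI impI)
      fix t :: real assume t: "0 \<le> t"
      define r where "r = enn2real (min (ennreal t) (\<gamma> \<omega>))"
      have "min (ennreal t) (\<gamma> \<omega>) < top" by (simp add: min_less_iff_disj)
      then have r: "ennreal r = min (ennreal t) (\<gamma> \<omega>)" by (simp add: r_def)
      then have "ennreal r \<le> \<gamma> \<omega>" by simp
      moreover have "0 \<le> r" by (simp add: r_def)
      ultimately have "E r \<omega> = p (r, \<omega>)" using elim(2) by blast
      moreover have "E t \<omega> = E r \<omega>" unfolding r_def by (rule elim(1)[rule_format, OF t])
      ultimately have "E t \<omega> = p (r, \<omega>)" by simp
      also have "p (r, \<omega>) = 0"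
      proof (cases "ennreal r < \<gamma> \<omega>")
        case True
        then show ?thesis using elim(3) by (simp add: r_def)
      next
        case False
        then have "\<gamma> \<omega> = ennreal r" using r by (simp add: min_def split: if_splits)
        moreover have "0 \<le> r" by (simp add: r_def)
        ultimately show ?thesis using elim(4) by simp
      qed
      finally show "E t \<omega> = 0" .
    qed
  qed
qed

text \<open>On a fixed path the localising times eventually exceed \<open>t\<close>, and then
  stopping is invisible at \<open>t\<close>; countably many of them cost one null set.\<close>

lemma compensator_unique:
  assumes "is_predictable_compensator M Fi X A'"
  shows "AE \<omega> in M. \<forall>t\<ge>0. A' t \<omega> = A t \<omega>"
proof -
  obtain T :: "nat \<Rightarrow> 'a \<Rightarrow> ennreal" where T: "\<And>n. stopping_time Fi (T n)"
    "AE \<omega> in M. incseq (\<lambda>n. T n \<omega>) \<and> (\<lambda>n. T n \<omega>) \<longlonglongrightarrow> \<infinity>"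
    "\<And>n. martingale_process M Fi (stopped_process (T n) (\<lambda>t \<omega>. X t \<omega> - A' t \<omega>))"
    using assms unfolding is_predictable_compensator_def local_martingale_def by blast
  have "AE \<omega> in M. \<forall>t\<ge>0. stopped_process (T n) (\<lambda>t \<omega>. A' t \<omega> - A t \<omega>) t \<omega> = 0" for n
    using assms T unfolding is_predictable_compensator_def by (intro stopped_difference_zero) auto
  then have "AE \<omega> in M. \<forall>n. \<forall>t\<ge>0. stopped_process (T n) (\<lambda>t \<omega>. A' t \<omega> - A t \<omega>) t \<omega> = 0"
    unfolding AE_all_countable by blast
  then show ?thesis
    using T(2)
  proof eventually_elim
    case (elim \<omega>)
    show ?case
    proof (intro allI impI)
      fix t :: real assume t: "0 \<le> t"
      have "eventually (\<lambda>n. ennreal t < T n \<omega>) sequentially"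
        using elim(2) by (intro order_tendstoD(1)[of _ \<infinity>]) auto
      then obtain n where "ennreal t < T n \<omega>" by (auto simp: eventually_sequentially)
      then have "enn2real (min (ennreal t) (T n \<omega>)) = t" using t by (simp add: min_absorb1)
      moreover have "stopped_process (T n) (\<lambda>t \<omega>. A' t \<omega> - A t \<omega>) t \<omega> = 0" using elim(1) t by blast
      ultimately show "A' t \<omega> = A t \<omega>" by (simp add: stopped_process_def)
    qed
  qed
qed

end

theorem theorem3p1:
  fixes M Hs :: "'a measure"
    and \<gamma> :: "'a \<Rightarrow> ennreal"
    and G F X :: "real \<Rightarrow> 'a \<Rightarrow> real"
    and L :: "'a \<Rightarrow> real"
    and H :: "ennreal \<Rightarrow> 'a \<Rightarrow> real"
  assumes "prob_space M"
    and "subalgebra M Hs"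
    and "\<gamma> \<in> borel_measurable M"
    and "AE \<omega> in M. 0 < \<gamma> \<omega>"
    and "regular_cond_df M Hs \<gamma> G"
    and "adapted_process (single_jump_filtration M Hs \<gamma>) X"
    and "rc_finite_variation M X"
    and "(\<lambda>(t, \<omega>). F t \<omega>) \<in> borel_measurable (restrict_space borel {0..} \<Otimes>\<^sub>M Hs)"
    and "L \<in> borel_measurable (single_jump_filtration M Hs \<gamma> \<infinity>)"
    and "AE \<omega> in M. \<forall>t\<ge>0. X t \<omega> =
           F t \<omega> * of_bool (ennreal t < \<gamma> \<omega>) + L \<omega> * of_bool (\<gamma> \<omega> \<le> ennreal t)"
    and "integrable M L"
    and "(\<integral>\<^sup>+ \<omega>. (SUP t\<in>{t. 0 \<le> t \<and> ennreal t < t_G M \<gamma>}. ennreal \<bar>F t \<omega>\<bar>) \<partial>M) < \<infinity>"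
    and "is_cond_exp_given_time M Hs \<gamma> L H"
  shows "\<exists>C :: ennreal \<Rightarrow> 'a \<Rightarrow> real.
      (\<lambda>(t, \<omega>). C t \<omega>) \<in> borel_measurable (borel \<Otimes>\<^sub>M Hs) \<and>
      (AE \<omega> in M. \<forall>t. 0 \<le> t \<and> ennreal t < t_G M \<gamma> \<longrightarrow>
         (\<forall>c. has_compensator_integral G F H \<omega> t c \<longrightarrow> C (ennreal t) \<omega> = c) \<and>
         (ennreal t \<le> \<gamma> \<omega> \<longrightarrow> (\<exists>c. has_compensator_integral G F H \<omega> t c))) \<and>
      (measure M {\<omega> \<in> space M. \<gamma> \<omega> = t_G M \<gamma>} > 0 \<longrightarrow>
         (AE \<omega> in M.
            (\<forall>c f. ((\<lambda>s. C s \<omega>) \<longlongrightarrow> c) (at_left (t_G M \<gamma>)) \<longrightarrow>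
                   ((\<lambda>s. F (enn2real s) \<omega>) \<longlongrightarrow> f) (at_left (t_G M \<gamma>)) \<longrightarrow>
                   C (t_G M \<gamma>) \<omega> = c + (H (t_G M \<gamma>) \<omega> - f)) \<and>
            (\<gamma> \<omega> = t_G M \<gamma> \<and> t_G M \<gamma> < \<infinity> \<longrightarrow>
                   (\<exists>c. ((\<lambda>s. C s \<omega>) \<longlongrightarrow> c) (at_left (t_G M \<gamma>))) \<and>
                   (\<exists>f. ((\<lambda>s. F (enn2real s) \<omega>) \<longlongrightarrow> f) (at_left (t_G M \<gamma>)))))) \<and>
      is_predictable_compensator M (single_jump_filtration M Hs \<gamma>) X
         (\<lambda>t \<omega>. C (min (ennreal t) (\<gamma> \<omega>)) \<omega>) \<and>
      (\<forall>A. is_predictable_compensator M (single_jump_filtration M Hs \<gamma>) X A \<longrightarrow>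
         (AE \<omega> in M. \<forall>t\<ge>0. A t \<omega> = C (min (ennreal t) (\<gamma> \<omega>)) \<omega>))"
proof -
  interpret prob_space M by fact
  interpret compensator_setup M Hs \<gamma> G F X L H
    using assms by unfold_locales auto
  have clause1: "AE \<omega> in M. \<forall>t. 0 \<le> t \<and> ennreal t < t_G M \<gamma> \<longrightarrow>
         (\<forall>c. has_compensator_integral G F H \<omega> t c \<longrightarrow> C (ennreal t) \<omega> = c) \<and>
         (ennreal t \<le> \<gamma> \<omega> \<longrightarrow> (\<exists>c. has_compensator_integral G F H \<omega> t c))"
    using AE_good_path
  proof eventually_elim
    case (elim \<omega>)
    interpret good_path M Hs \<gamma> G F X L H \<omega> by (rule elim)
    show ?case using C0_value compensator_integral_exists by (auto simp: C_def)
  qed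
  have clause2: "AE \<omega> in M.
            (\<forall>c f. ((\<lambda>s. C s \<omega>) \<longlongrightarrow> c) (at_left (t_G M \<gamma>)) \<longrightarrow>
                   ((\<lambda>s. F (enn2real s) \<omega>) \<longlongrightarrow> f) (at_left (t_G M \<gamma>)) \<longrightarrow>
                   C (t_G M \<gamma>) \<omega> = c + (H (t_G M \<gamma>) \<omega> - f)) \<and>
            (\<gamma> \<omega> = t_G M \<gamma> \<and> t_G M \<gamma> < \<infinity> \<longrightarrow>
                   (\<exists>c. ((\<lambda>s. C s \<omega>) \<longlongrightarrow> c) (at_left (t_G M \<gamma>))) \<and>
                   (\<exists>f. ((\<lambda>s. F (enn2real s) \<omega>) \<longlongrightarrow> f) (at_left (t_G M \<gamma>))))"
    using AE_good_path
  proof eventually_elim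
    case (elim \<omega>)
    interpret good_path M Hs \<gamma> G F X L H \<omega> by (rule elim)
    show ?case
    proof (intro conjI allI impI)
      fix c f assume "((\<lambda>s. C s \<omega>) \<longlongrightarrow> c) (at_left tG)" "((\<lambda>s. F (enn2real s) \<omega>) \<longlongrightarrow> f) (at_left tG)"
      then show "C tG \<omega> = c + (H tG \<omega> - f)" by (rule C_tG_formula)
    next
      assume g: "\<gamma> \<omega> = tG \<and> tG < \<infinity>"
      then obtain g where "tG = ennreal g" "0 < g" using tG_pos by (cases tG) auto
      with g show "\<exists>c. ((\<lambda>s. C s \<omega>) \<longlongrightarrow> c) (at_left tG)" "\<exists>f. ((\<lambda>s. F (enn2real s) \<omega>) \<longlongrightarrow> f) (at_left tG)"
        using C_left_limit_tG F_left_limit_tG by blast+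
    qed
  qed
  show ?thesis
    using C_measurable clause1 clause2 predictable_compensator_A compensator_unique
    unfolding A_def[abs_def] by (intro exI[of _ C]) auto
qed

end
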